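(* For any $\rho\in[0,\infty)$, there is at least one minimiser $(m,\psi)$ for the variational problem $$\chi(\rho)=\min\Big\{\varphi(m,\psi)\colon m\in[0,\infty)^{\mathbb N},\ \psi\in\mathcal M_1(\mathbb N_0),\ \rho=\sum_{k\in\mathbb N}km_k+\sum_{a\in\mathbb N_0}a\psi(a)\Big\},$$ i.e. at least one minimiser $(m,\psi)$ of $\varphi$ under the constraint $\sum_{k\in\mathbb N}km_k+\sum_{a\in\mathbb N_0}a\psi(a)=\rho$. Furthermore, there is at least one minimiser $(m,\psi)$ such that $\psi$ has no more than two atoms. Additionally, for any $(m,\psi)\in[0,\infty)^{\mathbb N}\times\mathcal M_1(\mathbb N_0)$, there is at least one minimiser $(P_a)_{a\in\mathbb N_0}$ for the variational formula that defines $\varphi(m,\psi)$.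
   Context: Setting. $\mathbb N=\{1,2,\dots\}$, $\mathbb N_0=\mathbb N\cup\{0\}$, $d\in\mathbb N$. For every $k\in\mathbb N$ a deterministic mark $G_k\subset\mathbb Z^d$ is fixed with $|G_k|=k$ and $([-L_k,L_k]^d\cap\mathbb Z^d)\subset G_k\subset([-L_k-1,L_k+1]^d\cap\mathbb Z^d)$ for some $L_k\in\mathbb N_0$. $\Omega$ is the set of configurations $\omega=\sum_{k\in\mathbb N}\sum_{x\in\mathbb Z^d}\xi^{(k)}(x)\delta_{(x,G_k)}$ with $\xi^{(k)}(x)\in\mathbb N_0$ (the number of points at $x$ carrying the mark $G_k$), with the $\sigma$-algebra generated by the evaluations $\xi^{(k)}(x)$. Counting: $N_\Lambda^{(\delta_k)}(\omega)=\sum_{x\in\Lambda}\xi^{(k)}(x)$, $N_\Lambda^{(\ell)}=\sum_{k}k N_\Lambda^{(\delta_k)}$; for $\Lambda=\{0\}$ write $N_0^{(\cdot)}$. Interaction: $v\colon\mathbb Z^d\to[0,\infty)$ with $v(x)=v(-x)$ and finite support; $\bar v=\sum_{i\in\mathbb Z^d}v(i)$; $T_{x,y}(G,G')=\sum_{i\in G}\sum_{j\in G'}v(x+i-y-j)$; $\Phi_{\Lambda,\Lambda'}(\omega)=\sum_{x\in\Lambda,y\in\Lambda'}\sum_{k,l\in\mathbb N}\xi^{(k)}(x)\xi^{(l)}(y)T_{x,y}(G_k,G_l)$, and $\Phi_{0,\mathbb Z^d}=\Phi_{\{0\},\mathbb Z^d}$. Reference measure: $q=(q_k)_{k\in\mathbb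 N}$ is a summable sequence of positive numbers with $q_k=\mathrm e^{o(k)}$ as $k\to\infty$ (standing assumption); under $\mathbb P$ the variables $\xi^{(k)}(x)$ are independent and $\xi^{(k)}(x)$ is Poisson distributed with parameter $q_k$. For $Q\subset\mathbb Z^d$, $P_Q$ is the law under $P$ of the restriction of $\omega$ to points in $Q$ (with their full marks). $\mathcal M_1(\mathbb N_0)$ is the set of probability measures on $\mathbb N_0$ and $\mathcal M_1^{(\mathrm s)}(\Omega)$ the set of shift-invariant probability measures on $\Omega$; $P(f)=\int f\,\mathrm dP$. The entropy density is $I(P)=\lim_{Q\uparrow\mathbb Z^d}\frac1{|Q|}H(P_Q|\mathbb P_Q)\in[0,\infty]$, the limit along centred boxes with diverging radius ($H$ relative entropy). For $m\in[0,\infty)^{\mathbb N}$, $\psi\in\mathcal M_1(\mathbb N_0)$, $$\varphi(m,\psi)=\inf\Big\{\sum_{a\in\mathbb N_0}\psi(a)\big[I(P_a)+P_a(\Phi_{0,\mathbb Z^d})+2\bar v aP_a(N_0^{(\ell)})+\bar v a^2\big]\colon P_0,P_1,\dots\in\mathcal M_1^{(\mathrm s)}(\Omega),\ \sum_{a}\psi(a)P_a(N_0^{(\delta_k)})=m_k\ \forall k\in\mathbb N\Big\}$$ (summands with $\psi(a)=0$ are $0$). The free energy at density $\rho$ is $\chi(\rho)=\chi(\rho,0)$, where $\chi(\rho_{\rm mi},\rho_{\rm ma})=\inf\{\varphi(m,\psi)\colon\sum_k km_k=\rho_{\rm mi},\ \sum_a a\psi(a)=\rho_{\rm ma}\}$;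 equivalently $\chi(\rho)=\inf\{\varphi(m,\delta_0)\colon\sum_kkm_k=\rho\}$. *)

theory Defs
  imports "HOL-Probability.Probability" "HOL-Library.Landau_Symbols"
begin

text \<open>
  The lattice is \<open>int ^ 'd\<close>, and \<open>\<omega> (k, x)\<close> is the number of points at \<open>x\<close> that carry the mark
  \<open>G k\<close>, for \<open>k \<ge> 1\<close>. All sums and expectations of nonnegative quantities, and hence all
  infima, are taken in \<open>[0, \<infinity>]\<close>.
\<close>

type_synonym 'd config = "nat \<times> (int ^ 'd) \<Rightarrow> nat"

definition box_Z :: "nat \<Rightarrow> (int ^ 'd::finite) set" where
  "box_Z n = {x. \<forall>i. \<bar>x $ i\<bar> \<le> int n}"

text \<open>Configurations with points in \<open>Q\<close> only, with the sigma-algebra of the evaluations; as elements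
  of a product space they are extensional, so there is no coordinate with \<open>k = 0\<close>.\<close>

definition config_space :: "(int ^ 'd::finite) set \<Rightarrow> 'd config measure" where
  "config_space Q = PiM ({1..} \<times> Q) (\<lambda>_. count_space UNIV)"

definition translate :: "int ^ 'd::finite \<Rightarrow> 'd config \<Rightarrow> 'd config" where
  "translate z \<omega> = (\<lambda>(k, x)\<in>{1..} \<times> UNIV. \<omega> (k, x + z))"

definition shift_invariant_probs :: "'d::finite config measure set" where
  "shift_invariant_probs =
    {P. sets P = sets (config_space UNIV) \<and> prob_space P \<and>
        (\<forall>z. distr P (config_space UNIV) (translate z) = P)}"

definition law_on :: "(int ^ 'd::finite) set \<Rightarrow> 'd config measure \<Rightarrow> 'd config measure" where
  "law_on Q P = distr P (config_space Q) (\<lambda>\<omega>. restrict \<omega> ({1..} \<times> Q))"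

definition reference :: "(nat \<Rightarrow> real) \<Rightarrow> 'd::finite config measure" where
  "reference q = PiM ({1..} \<times> UNIV) (\<lambda>(k, x). measure_pmf (poisson_pmf (q k)))"

text \<open>Relative entropy of the probability measure \<open>P\<close> with respect to the probability measure \<open>R\<close>.
  The library's \<^const>\<open>KL_divergence\<close> (reference measure first) is a real-valued integral. The negative
  part of the logarithm of \<open>dP/dR\<close> is always \<open>P\<close>-integrable, so the integral
  fails to exist exactly when the relative entropy is infinite.\<close>

definition rel_entropy :: "'a measure \<Rightarrow> 'a measure \<Rightarrow> ennreal" where
  "rel_entropy P R =
    (if absolutely_continuous R P \<and> integrable P (entropy_density (exp 1) R P)
     then ennreal (KL_divergence (exp 1) R P) else \<infinity>)"

definition entropy_dens :: "(nat \<Rightarrow> real) \<Rightarrow> 'd::finite config measure \<Rightarrow> ennreal" where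
  "entropy_dens q P =
    lim (\<lambda>n. rel_entropy (law_on (box_Z n) P) (law_on (box_Z n) (reference q))
             / of_nat (card (box_Z n :: (int ^ 'd) set)))"

definition N_mark :: "(int ^ 'd::finite) set \<Rightarrow> nat \<Rightarrow> 'd config \<Rightarrow> ennreal" where
  "N_mark \<Lambda> k \<omega> = (\<Sum>\<^sub>\<infinity>x\<in>\<Lambda>. of_nat (\<omega> (k, x)))"

definition N_len :: "(int ^ 'd::finite) set \<Rightarrow> 'd config \<Rightarrow> ennreal" where
  "N_len \<Lambda> \<omega> = (\<Sum>\<^sub>\<infinity>k\<in>{1..}. of_nat k * N_mark \<Lambda> k \<omega>)"

definition T_int :: "(int ^ 'd::finite \<Rightarrow> real) \<Rightarrow> int ^ 'd \<Rightarrow> int ^ 'd \<Rightarrow>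
    (int ^ 'd) set \<Rightarrow> (int ^ 'd) set \<Rightarrow> real" where
  "T_int v x y A B = (\<Sum>i\<in>A. \<Sum>j\<in>B. v (x + i - y - j))"

text \<open>As in the double sum over all points, the pairing of a point with itself is included.\<close>

definition Phi :: "(nat \<Rightarrow> (int ^ 'd::finite) set) \<Rightarrow> (int ^ 'd \<Rightarrow> real) \<Rightarrow>
    (int ^ 'd) set \<Rightarrow> (int ^ 'd) set \<Rightarrow> 'd config \<Rightarrow> ennreal" where
  "Phi G v \<Lambda> \<Lambda>' \<omega> =
    (\<Sum>\<^sub>\<infinity>(x, y)\<in>\<Lambda> \<times> \<Lambda>'. \<Sum>\<^sub>\<infinity>(k, l)\<in>{1..} \<times> {1..}.
       of_nat (\<omega> (k, x)) * of_nat (\<omega> (l, y)) * ennreal (T_int v x y (G k) (G l)))"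

definition v_bar :: "(int ^ 'd::finite \<Rightarrow> real) \<Rightarrow> real" where
  "v_bar v = (\<Sum>\<^sub>\<infinity>i. v i)"

definition cost :: "(nat \<Rightarrow> real) \<Rightarrow> (nat \<Rightarrow> (int ^ 'd::finite) set) \<Rightarrow> (int ^ 'd \<Rightarrow> real) \<Rightarrow>
    nat pmf \<Rightarrow> (nat \<Rightarrow> 'd config measure) \<Rightarrow> ennreal" where
  "cost q G v \<psi> P =
    (\<Sum>\<^sub>\<infinity>a. ennreal (pmf \<psi> a) *
       (entropy_dens q (P a)
        + (\<integral>\<^sup>+\<omega>. Phi G v {0} UNIV \<omega> \<partial>P a)
        + 2 * ennreal (v_bar v) * of_nat a * (\<integral>\<^sup>+\<omega>. N_len {0} \<omega> \<partial>P a)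
        + ennreal (v_bar v) * (of_nat a)\<^sup>2))"

definition competitors :: "(nat \<Rightarrow> real) \<Rightarrow> nat pmf \<Rightarrow> (nat \<Rightarrow> 'd::finite config measure) set" where
  "competitors m \<psi> =
    {P. (\<forall>a. P a \<in> shift_invariant_probs) \<and>
        (\<forall>k\<ge>1. (\<Sum>\<^sub>\<infinity>a. ennreal (pmf \<psi> a) * (\<integral>\<^sup>+\<omega>. N_mark {0} k \<omega> \<partial>P a)) = ennreal (m k))}"

definition phi :: "(nat \<Rightarrow> real) \<Rightarrow> (nat \<Rightarrow> (int ^ 'd::finite) set) \<Rightarrow> (int ^ 'd \<Rightarrow> real) \<Rightarrow>
    (nat \<Rightarrow> real) \<Rightarrow> nat pmf \<Rightarrow> ennreal" where
  "phi q G v m \<psi> = (INF P\<in>competitors m \<psi>. cost q G v \<psi> P)"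

definition density_mi :: "(nat \<Rightarrow> real) \<Rightarrow> ennreal" where
  "density_mi m = (\<Sum>\<^sub>\<infinity>k\<in>{1..}. of_nat k * ennreal (m k))"

definition density_ma :: "nat pmf \<Rightarrow> ennreal" where
  "density_ma \<psi> = (\<Sum>\<^sub>\<infinity>a. of_nat a * ennreal (pmf \<psi> a))"

definition chi_mi_ma :: "(nat \<Rightarrow> real) \<Rightarrow> (nat \<Rightarrow> (int ^ 'd::finite) set) \<Rightarrow>
    (int ^ 'd \<Rightarrow> real) \<Rightarrow> real \<Rightarrow> real \<Rightarrow> ennreal" where
  "chi_mi_ma q G v \<rho>mi \<rho>ma =
    (INF (m, \<psi>)\<in>{(m, \<psi>). m \<in> {1..} \<rightarrow> {0..} \<and> density_mi m = ennreal \<rho>mi \<and> density_ma \<psi> = ennreal \<rho>ma}.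
       phi q G v m \<psi>)"

definition chi :: "(nat \<Rightarrow> real) \<Rightarrow> (nat \<Rightarrow> (int ^ 'd::finite) set) \<Rightarrow>
    (int ^ 'd \<Rightarrow> real) \<Rightarrow> real \<Rightarrow> ennreal" where
  "chi q G v \<rho> = chi_mi_ma q G v \<rho> 0"

text \<open>\<open>(m, \<psi>)\<close> with total (micro plus macro) density \<open>\<rho>\<close>. The value \<open>m 0\<close> plays no role.\<close>

definition with_density :: "real \<Rightarrow> (nat \<Rightarrow> real) \<times> nat pmf \<Rightarrow> bool" where
  "with_density \<rho> = (\<lambda>(m, \<psi>). m \<in> {1..} \<rightarrow> {0..} \<and> density_mi m + density_ma \<psi> = ennreal \<rho>)"

end

theory Submission
  imports Defs
begin

text \<open>Sequences of competitors are compact because a bounded entropy density forces tightness and uniform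
  integrability of every \<open>\<xi>\<^sup>(\<^sup>k\<^sup>)\<close>. The entropy density is lower semicontinuous and, being affine
  in the limit of large boxes, additive under mixing and conditioning. Carrying the macroscopic level \<open>a\<close> as a
  spatially constant field next to the configuration turns the family \<open>(P a)\<close> into one measure,
  so that a minimiser for fixed \<open>(m, \<psi>)\<close> is a limit of a minimising sequence.
  Summing over the pairs of covered sites, the interaction becomes a quadratic form in the occupation field.

  For \<open>\<chi>\<close>, a macroscopic level \<open>a\<close> costs no less than \<open>a\<close> cubes on every site of a randomly shifted
  coarse lattice, up to a vanishing entropy, so \<open>\<chi> \<le> \<phi>(m, \<psi>)\<close>. Conversely, in a minimising sequence
  for \<open>\<chi>\<close> the mass that is lost in the limit sits in larger and larger marks. A large mark has a relatively
  small boundary, so the number of large marks covering a site becomes a constant field; no mass of this field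
  is lost since the interaction bounds its second moment (and if \<open>v = 0\<close> the lost mass may be put back for free).
  Finally \<open>\<psi>\<close> enters only through the means of a density and of a cost, so by planar convexity
  two of its atoms do.\<close>

section \<open>Relative entropy as a supremum over bounded local functions\<close>

text \<open>Entropies are handled in dual form: the supremum of the integral of f under P over
  bounded local f whose exponential has reference integral at most 1. Adding, shifting, bumping or
  log-summing test functions then gives superadditivity, translation monotonicity, the price of
  extra points, semicontinuity and concavity, without touching densities. The obstacle is that local
  convergence keeps each mean m_k but not the sum of k m_k: density may escape to ever larger marks.
  The spare coordinates \<open>(0, x)\<close> store that part, and tests depend on marks only, so
  adding or forgetting these coordinates does not change the entropy. Escaping marks are copied into
  the field while they also remain in the configuration, hence along the sequence the cost is
  controlled only for marks up to a fixed size K plus the field, and K grows after the limit.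
  Subexponentiality of q enters in one place: a cube mark of size k costs about |ln q_k| once per k
  sites, which vanishes per site.\<close>

lemma ln_young:
  fixes a c :: real
  assumes "0 \<le> a"
  shows "a * c \<le> a * ln a - a + exp c"
proof (cases "a = 0")
  case False
  with assms have a: "a > 0" by simp
  have "1 + (c - ln a) \<le> exp (c - ln a)" by (rule exp_ge_add_one_self)
  also have "\<dots> = exp c / a" using a by (simp add: exp_diff)
  finally have "a * (1 + (c - ln a)) \<le> exp c"
    using a by (simp add: pos_le_divide_eq mult.commute)
  then show ?thesis by (simp add: algebra_simps)
qed simp

lemma prob_integrable_bounded:
  fixes f :: "'a \<Rightarrow> real"
  assumes "prob_space P" "f \<in> borel_measurable P" "\<And>x. \<bar>f x\<bar> \<le> B"
  shows "integrable P f"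
proof -
  interpret prob_space P by fact
  show ?thesis using assms(2,3) by (intro integrable_const_bound[where B=B]) auto
qed

text \<open>The Radon-Nikodym derivative is finite almost everywhere, so its real part defines the
  same density measure. The entropy density is built from this real part, hence its formula holds at
  every point.\<close>

lemma KL_real_density:
  assumes P: "prob_space P" and R: "prob_space R" and sets: "sets P = sets R"
    and ac: "absolutely_continuous R P"
  obtains h where "h \<in> borel_measurable R" "\<And>x. 0 \<le> h x" "P = density R (\<lambda>x. ennreal (h x))"
    "\<And>x. entropy_density (exp 1) R P x = ln (h x)" "integral\<^sup>L R h = 1" "integrable R h"
proof -
  interpret P: prob_space P by fact
  interpret R: prob_space R by fact
  define h where "h = (\<lambda>x. enn2real (RN_deriv R P x))"
  have m[measurable]: "h \<in> borel_measurable R" unfolding h_def by simp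
  have fin: "AE x in R. RN_deriv R P x \<noteq> \<infinity>"
    using R.RN_deriv_finite[OF P.sigma_finite_measure_axioms ac sets] .
  have d: "density R (RN_deriv R P) = P"
    using R.density_RN_deriv[OF ac sets] .
  have "density R (\<lambda>x. ennreal (h x)) = density R (RN_deriv R P)"
    using fin by (intro density_cong) (auto simp: h_def top.not_eq_extremum)
  with d have P_eq: "P = density R (\<lambda>x. ennreal (h x))" by simp
  have nn: "h x \<ge> 0" for x by (simp add: h_def)
  have "(\<integral>\<^sup>+x. ennreal (h x) \<partial>R) = emeasure P (space R)"
    by (subst P_eq) (auto simp: emeasure_density intro!: nn_integral_cong)
  also have "\<dots> = 1" using P.emeasure_space_1 sets_eq_imp_space_eq[OF sets] by simp
  finally have 1: "(\<integral>\<^sup>+x. ennreal (h x) \<partial>R) = 1" .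
  have i: "integrable R h" using 1 nn by (intro integrableI_nonneg) auto
  have "integral\<^sup>L R h = 1"
    by (subst integral_eq_nn_integral) (use nn 1 in auto)
  then show ?thesis
    using that[OF m nn P_eq _ _ i] by (auto simp: h_def entropy_density_def log_def)
qed

text \<open>Integrates \<open>ln_young\<close> at \<open>a = h x\<close>, \<open>c = f x\<close>:
  the terms \<open>- h\<close> and \<open>exp f\<close> contribute -1 and at most 1. This is the
  easy half of the Donsker-Varadhan formula, with the logarithm of the exponential moment absorbed
  into the normalisation of the tests.\<close>

lemma rel_entropy_ge:
  fixes f :: "'a \<Rightarrow> real"
  assumes P: "prob_space P" and R: "prob_space R" and sets: "sets P = sets R"
    and f[measurable]: "f \<in> borel_measurable R" and B: "\<And>x. \<bar>f x\<bar> \<le> B"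
    and le1: "(\<integral>x. exp (f x) \<partial>R) \<le> 1"
  shows "ennreal (\<integral>x. f x \<partial>P) \<le> rel_entropy P R"
proof (cases "absolutely_continuous R P \<and> integrable P (entropy_density (exp 1) R P)")
  case True
  then have ac: "absolutely_continuous R P" by simp
  from KL_real_density[OF P R sets ac] obtain h where h[measurable]: "h \<in> borel_measurable R"
    and nn: "\<And>x. 0 \<le> h x" and P_eq: "P = density R (\<lambda>x. ennreal (h x))"
    and ent: "\<And>x. entropy_density (exp 1) R P x = ln (h x)" and h1: "integral\<^sup>L R h = 1"
    and ih: "integrable R h" by blast
  have ent': "entropy_density (exp 1) R P = (\<lambda>x. ln (h x))" using ent by (rule ext)
  have int: "integrable R (\<lambda>x. h x * ln (h x))"
  proof -
    have "integrable (density R (\<lambda>x. ennreal (h x))) (\<lambda>x. ln (h x))"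
      using True ent' unfolding P_eq[symmetric] by simp
    then show ?thesis by (subst (asm) integrable_density) (auto simp: nn)
  qed
  have KL: "KL_divergence (exp 1) R P = (\<integral>x. h x * ln (h x) \<partial>R)"
  proof -
    have "KL_divergence (exp 1) R P = (\<integral>x. ln (h x) \<partial>P)"
      unfolding KL_divergence_def by (intro Bochner_Integration.integral_cong) (auto simp: ent)
    also have "\<dots> = (\<integral>x. h x * ln (h x) \<partial>R)"
      by (subst P_eq, subst integral_density) (auto simp: nn)
    finally show ?thesis .
  qed
  have fP: "(\<integral>x. f x \<partial>P) = (\<integral>x. h x * f x \<partial>R)"
    by (subst P_eq, subst integral_density) (auto simp: nn)
  have if1: "integrable R (\<lambda>x. h x * f x)"
  proof (rule Bochner_Integration.integrable_bound)
    show "integrable R (\<lambda>x. B * h x)" using ih by simp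
    show "AE x in R. norm (h x * f x) \<le> norm (B * h x)"
      using nn by (auto simp: abs_mult mult.commute[of "h _"] intro!: always_eventually mult_right_mono order.trans[OF B abs_ge_self])
  qed simp
  have ie: "integrable R (\<lambda>x. exp (f x))"
  proof (rule prob_integrable_bounded[OF R, where B="exp B"])
    show "\<bar>exp (f x)\<bar> \<le> exp B" for x using B[of x] by simp
  qed simp
  have "(\<integral>x. h x * f x \<partial>R) \<le> (\<integral>x. h x * ln (h x) - h x + exp (f x) \<partial>R)"
    by (intro integral_mono if1 Bochner_Integration.integrable_add Bochner_Integration.integrable_diff int ih ie ln_young nn)
  also have "\<dots> = KL_divergence (exp 1) R P - 1 + (\<integral>x. exp (f x) \<partial>R)"
    using int ih ie h1 KL by simp
  also have "\<dots> \<le> KL_divergence (exp 1) R P" using le1 by simp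
  finally show ?thesis using True fP by (auto simp: rel_entropy_def intro: ennreal_leI)
next
  case False
  then show ?thesis by (simp only: rel_entropy_def if_False) simp
qed

lemma xlnx_ge: "x * ln x \<ge> - 1" if "x \<ge> 0" for x :: real
  using ln_young[OF that, of 0] ln_young[of x 0] that
proof (cases "x \<le> 1")
  case True
  then show ?thesis using ln_young[OF that, of 0] that by simp
next
  case False
  then show ?thesis by (smt (verit) ln_ge_zero mult_nonneg_nonneg)
qed

text \<open>The clamped logarithm of the density is a bounded test that nearly attains the supremum.
  The value \<open>- real n\<close> where the density vanishes keeps the exponential below
  \<open>h + exp (- real n)\<close>; the lower bound -1 prepares Fatou's lemma.\<close>

lemma ln_clamp:
  fixes h :: real and n :: nat
  defines "c \<equiv> max (- real n) (min (real n) (if h = 0 then - real n else ln h))"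
  assumes "h \<ge> 0"
  shows "\<bar>c\<bar> \<le> real n" "exp c \<le> h + exp (- real n)"
    "h * c \<ge> - 1"
proof -
  show "\<bar>c\<bar> \<le> real n" by (auto simp: c_def)
  show "exp c \<le> h + exp (- real n)"
  proof (cases "h = 0")
    case False
    then have h: "h > 0" using assms by simp
    have "c \<le> max (- real n) (ln h)" using False by (auto simp: c_def)
    then have "exp c \<le> exp (- real n) \<or> exp c \<le> exp (ln h)"
      by (auto simp: le_max_iff_disj)
    then show ?thesis
    proof
      assume "exp c \<le> exp (ln h)"
      then have "exp c \<le> h" using h by simp
      then show ?thesis using exp_gt_zero[of "- real n"] by linarith
    qed (use h in linarith)
  qed (auto simp: c_def)
  show "h * c \<ge> - 1"
  proof (cases "h = 0 \<or> c \<ge> 0")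
    case True
    then have "h * c \<ge> 0" using assms(2) by (auto intro: mult_nonneg_nonneg)
    then show ?thesis by simp
  next
    case False
    then have "c \<ge> ln h" by (auto simp: c_def)
    then have "h * c \<ge> h * ln h" using assms by (intro mult_left_mono) auto
    then show ?thesis using xlnx_ge[OF assms(2)] by simp
  qed
qed

lemma ln_clamp_tendsto:
  fixes h :: real
  assumes "h \<ge> 0"
  shows "(\<lambda>n. h * max (- real n) (min (real n) (if h = 0 then - real n else ln h))) \<longlonglongrightarrow> h * ln h"
proof (cases "h = 0")
  case False
  have "eventually (\<lambda>n. h * max (- real n) (min (real n) (if h = 0 then - real n else ln h)) = h * ln h) sequentially"
    using eventually_ge_at_top[of "nat \<lceil>\<bar>ln h\<bar>\<rceil>"]
  proof eventually_elim
    case (elim n)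
    then have "\<bar>ln h\<bar> \<le> real n" by linarith
    then show ?case using False by (auto simp: max_def min_def)
  qed
  then show ?thesis by (rule tendsto_eventually)
qed simp

text \<open>Multiples of indicators of null sets force absolute continuity; clamped logarithms of
  the density, renormalised, then converge to the entropy. Fatou's lemma also supplies the
  integrability that \<open>rel_entropy\<close> asks for.\<close>

lemma rel_entropy_le:
  fixes S :: ennreal
  assumes P: "prob_space P" and R: "prob_space R" and sets: "sets P = sets R"
    and S: "\<And>f B. f \<in> borel_measurable R \<Longrightarrow> (\<And>x. \<bar>f x\<bar> \<le> B) \<Longrightarrow> (\<integral>x. exp (f x) \<partial>R) \<le> 1
      \<Longrightarrow> ennreal (\<integral>x. f x \<partial>P) \<le> S"
  shows "rel_entropy P R \<le> S"
proof (cases "S = \<infinity>")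
  case False
  then obtain s where s: "S = ennreal s" "s \<ge> 0" by (cases S) auto
  interpret P: prob_space P by fact
  interpret R: prob_space R by fact
  have S': "(\<integral>x. f x \<partial>P) \<le> s" if "f \<in> borel_measurable R" "\<And>x. \<bar>f x\<bar> \<le> B" "(\<integral>x. exp (f x) \<partial>R) \<le> 1" for f B
    using S[OF that] s by simp
  have ac: "absolutely_continuous R P"
    unfolding absolutely_continuous_def
  proof safe
    fix A assume A: "A \<in> null_sets R"
    then have A'[measurable]: "A \<in> sets R" by auto
    then have A''[measurable]: "A \<in> sets P" using sets by simp
    \<comment> \<open>On a null set of R the test \<open>t * indicator A\<close> has exponential
      moment 1 for every t, so its integral under P must stay bounded as t grows.\<close>
    have "t * measure P A \<le> s" if "t \<ge> 0" for t
    proof -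
      have ae: "AE x in R. exp (t * indicator A x) = 1"
        using AE_not_in[OF A] by eventually_elim simp
      have "(\<integral>x. exp (t * indicator A x) \<partial>R) = (\<integral>x. 1 \<partial>R)"
        by (intro integral_cong_AE ae; measurable)
      also have "\<dots> = 1" using R.prob_space by simp
      finally have "(\<integral>x. t * indicator A x \<partial>P) \<le> s"
        using that by (intro S'[of "\<lambda>x. t * indicator A x" t]) (auto simp: indicator_def)
      then show ?thesis by simp
    qed
    from this[of "(s + 1) / measure P A"] s have "measure P A = 0"
      by (cases "measure P A = 0") (auto simp: zero_less_measure_iff)
    then show "A \<in> null_sets P" by (auto simp: P.emeasure_eq_measure)
  qed
  from KL_real_density[OF P R sets ac] obtain h where h[measurable]: "h \<in> borel_measurable R"
    and nn: "\<And>x. 0 \<le> h x" and P_eq: "P = density R (\<lambda>x. ennreal (h x))"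
    and ent: "\<And>x. entropy_density (exp 1) R P x = ln (h x)" and h1: "integral\<^sup>L R h = 1"
    and ih: "integrable R h" by blast
  have ent': "entropy_density (exp 1) R P = (\<lambda>x. ln (h x))" using ent by (rule ext)
  define c where "c n x = max (- real n) (min (real n) (if h x = 0 then - real n else ln (h x)))" for n x
  have cm[measurable]: "c n \<in> borel_measurable R" for n unfolding c_def by measurable
  have cb: "\<bar>c n x\<bar> \<le> real n" for n x unfolding c_def by (rule ln_clamp(1)[OF nn])
  have ic: "integrable R (\<lambda>x. h x * c n x)" for n
  proof (rule Bochner_Integration.integrable_bound)
    show "integrable R (\<lambda>x. real n * h x)" using ih by simp
    show "AE x in R. norm (h x * c n x) \<le> norm (real n * h x)"
      using cb nn by (auto simp: abs_mult mult.commute[of "h _"] intro!: always_eventually mult_right_mono)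
  qed simp
  have cP: "(\<integral>x. c n x \<partial>P) = (\<integral>x. h x * c n x \<partial>R)" for n
    by (subst P_eq, subst integral_density) (auto simp: nn)
  have bound: "(\<integral>x. h x * c n x \<partial>R) \<le> s + ln (1 + exp (- real n))" for n
  proof -
    have ie: "integrable R (\<lambda>x. exp (c n x))"
    proof (rule prob_integrable_bounded[OF R, where B="exp (real n)"])
      show "\<bar>exp (c n x)\<bar> \<le> exp (real n)" for x using cb[of n x] by simp
    qed simp
    have "(\<integral>x. exp (c n x) \<partial>R) \<le> (\<integral>x. h x + exp (- real n) \<partial>R)"
      using ln_clamp(2)[OF nn] ih ie by (intro integral_mono) (auto simp: c_def)
    also have "\<dots> = 1 + exp (- real n)" using ih h1 R.prob_space by simp
    finally have e: "(\<integral>x. exp (c n x) \<partial>R) \<le> 1 + exp (- real n)" .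
    \<comment> \<open>Lowering the test by l turns the moment bound
      \<open>1 + exp (- real n)\<close> into the admissible 1; l tends to 0 with n.\<close>
    define l where "l = ln (1 + exp (- real n))"
    have pos: "1 + exp (- real n) > 0" by (simp add: add_pos_pos)
    have "(\<integral>x. c n x - l \<partial>P) \<le> s"
    proof (rule S'[of "\<lambda>x. c n x - l" "real n + \<bar>l\<bar>"])
      show "\<bar>c n x - l\<bar> \<le> real n + \<bar>l\<bar>" for x using cb[of n x] by linarith
      have "(\<integral>x. exp (c n x - l) \<partial>R) = (\<integral>x. exp (c n x) \<partial>R) / (1 + exp (- real n))"
        using pos by (simp add: exp_diff l_def)
      then show "(\<integral>x. exp (c n x - l) \<partial>R) \<le> 1" using e pos by simp
    qed simp
    moreover have "(\<integral>x. c n x - l \<partial>P) = (\<integral>x. c n x \<partial>P) - l"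
      using sets prob_integrable_bounded[OF P, of "c n" "real n"] cb P.prob_space measurable_cong_sets[OF sets refl, of borel]
      by (subst Bochner_Integration.integral_diff) auto
    ultimately show ?thesis using cP l_def by simp
  qed
  have nnb: "(\<integral>\<^sup>+x. ennreal (h x * c n x + 1) \<partial>R) \<le> ennreal (s + ln (1 + exp (- real n)) + 1)" for n
  proof -
    have "h x * c n x + 1 \<ge> 0" for x using ln_clamp(3)[OF nn, of x n] by (simp add: c_def)
    then have "(\<integral>\<^sup>+x. ennreal (h x * c n x + 1) \<partial>R) = ennreal (\<integral>x. h x * c n x + 1 \<partial>R)"
      using ic by (intro nn_integral_eq_integral) auto
    also have "\<dots> \<le> ennreal (s + ln (1 + exp (- real n)) + 1)"
      using bound[of n] ic R.prob_space by (intro ennreal_leI) simp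
    finally show ?thesis .
  qed
  have lim: "(\<integral>\<^sup>+x. ennreal (h x * ln (h x) + 1) \<partial>R) \<le> ennreal (s + 1)"
  proof -
    have "(\<integral>\<^sup>+x. ennreal (h x * ln (h x) + 1) \<partial>R) = (\<integral>\<^sup>+x. liminf (\<lambda>n. ennreal (h x * c n x + 1)) \<partial>R)"
    proof (intro nn_integral_cong)
      fix x
      have "(\<lambda>n. ennreal (h x * c n x + 1)) \<longlonglongrightarrow> ennreal (h x * ln (h x) + 1)"
        unfolding c_def by (intro tendsto_ennrealI tendsto_add ln_clamp_tendsto nn tendsto_const)
      then show "ennreal (h x * ln (h x) + 1) = liminf (\<lambda>n. ennreal (h x * c n x + 1))"
        by (simp add: lim_imp_Liminf)
    qed
    also have "\<dots> \<le> liminf (\<lambda>n. \<integral>\<^sup>+x. ennreal (h x * c n x + 1) \<partial>R)"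
      by (intro nn_integral_liminf) simp
    also have "\<dots> \<le> liminf (\<lambda>n. ennreal (s + ln (1 + exp (- real n)) + 1))"
      by (intro Liminf_mono always_eventually allI nnb)
    also have "\<dots> = ennreal (s + 1)"
    proof (intro lim_imp_Liminf)
      have "(\<lambda>n. s + ln (1 + exp (- real n)) + 1) \<longlonglongrightarrow> s + ln (1 + 0) + 1"
        by (intro tendsto_intros filterlim_compose[OF exp_at_bot]
            filterlim_compose[OF filterlim_uminus_at_bot_at_top] filterlim_real_sequentially) auto
      then show "(\<lambda>n. ennreal (s + ln (1 + exp (- real n)) + 1)) \<longlonglongrightarrow> ennreal (s + 1)"
        by (intro tendsto_ennrealI) simp
    qed simp
    finally show ?thesis .
  qed
  have nn': "h x * ln (h x) + 1 \<ge> 0" for x using xlnx_ge[OF nn[of x]] by simp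
  have i1: "integrable R (\<lambda>x. h x * ln (h x) + 1)"
    using lim nn' by (intro integrableI_nonneg) (auto intro: le_less_trans)
  have i2: "integrable R (\<lambda>x. h x * ln (h x))"
    using Bochner_Integration.integrable_diff[OF i1, of "\<lambda>_. 1"] by simp
  have "ennreal (\<integral>x. h x * ln (h x) + 1 \<partial>R) \<le> ennreal (s + 1)"
    using lim nn' by (subst (asm) nn_integral_eq_integral[OF i1]) auto
  then have "(\<integral>x. h x * ln (h x) + 1 \<partial>R) \<le> s + 1" using s by (subst (asm) ennreal_le_iff) auto
  then have KLb: "(\<integral>x. h x * ln (h x) \<partial>R) \<le> s" using i2 R.prob_space by simp
  have iP: "integrable P (entropy_density (exp 1) R P)"
  proof -
    have "integrable (density R (\<lambda>x. ennreal (h x))) (\<lambda>x. ln (h x))"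
      using i2 by (subst integrable_density) (auto simp: nn)
    then show ?thesis unfolding ent' P_eq[symmetric] .
  qed
  have "KL_divergence (exp 1) R P = (\<integral>x. ln (h x) \<partial>P)"
    unfolding KL_divergence_def by (intro Bochner_Integration.integral_cong) (auto simp: ent)
  also have "\<dots> = (\<integral>x. h x * ln (h x) \<partial>R)"
    by (subst P_eq, subst integral_density) (auto simp: nn)
  finally show ?thesis using ac iP KLb s by (auto simp: rel_entropy_def intro: ennreal_leI)
qed simp

section \<open>Local functions\<close>

lemma nn_integral_count_space_eq_SUP:
  fixes f :: "'a \<Rightarrow> ennreal"
  assumes "countable A"
  shows "(\<integral>\<^sup>+x. f x \<partial>count_space A) = (SUP F\<in>{F. finite F \<and> F \<subseteq> A}. sum f F)"
proof (rule antisym)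
  show "(SUP F\<in>{F. finite F \<and> F \<subseteq> A}. sum f F) \<le> (\<integral>\<^sup>+x. f x \<partial>count_space A)"
  proof (intro SUP_least)
    fix F assume "F \<in> {F. finite F \<and> F \<subseteq> A}"
    then have F: "finite F" "F \<subseteq> A" by auto
    have "sum f F = (\<integral>\<^sup>+x. f x * indicator F x \<partial>count_space A)"
      using F by (subst nn_integral_count_space'[of F]) (auto intro!: sum.cong)
    also have "\<dots> \<le> (\<integral>\<^sup>+x. f x \<partial>count_space A)"
      by (intro nn_integral_mono) (auto simp: indicator_def)
    finally show "sum f F \<le> (\<integral>\<^sup>+x. f x \<partial>count_space A)" .
  qed
  show "(\<integral>\<^sup>+x. f x \<partial>count_space A) \<le> (SUP F\<in>{F. finite F \<and> F \<subseteq> A}. sum f F)"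
  proof (cases "finite A")
    case True
    then show ?thesis by (auto simp: nn_integral_count_space_finite intro!: SUP_upper)
  next
    case False
    then have bij: "bij_betw (from_nat_into A) UNIV A" using assms by (intro bij_betw_from_nat_into)
    then have inj: "inj (from_nat_into A)" and ran: "range (from_nat_into A) = A" by (auto simp: bij_betw_def)
    have "(\<integral>\<^sup>+x. f x \<partial>count_space A) = (\<Sum>n. f (from_nat_into A n))"
      using nn_integral_bij_count_space[OF bij, of f] by (simp add: nn_integral_count_space_nat)
    also have "\<dots> = (SUP n. \<Sum>i<n. f (from_nat_into A i))" by (rule suminf_eq_SUP)
    also have "\<dots> \<le> (SUP F\<in>{F. finite F \<and> F \<subseteq> A}. sum f F)"
    proof (intro SUP_least)
      fix n
      have "(\<Sum>i<n. f (from_nat_into A i)) = sum f (from_nat_into A ` {..<n})"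
        by (subst sum.reindex) (auto intro: inj_on_subset[OF inj])
      also have "\<dots> \<le> (SUP F\<in>{F. finite F \<and> F \<subseteq> A}. sum f F)"
        using ran by (intro SUP_upper) auto
      finally show "(\<Sum>i<n. f (from_nat_into A i)) \<le> (SUP F\<in>{F. finite F \<and> F \<subseteq> A}. sum f F)" .
    qed
    finally show ?thesis .
  qed
qed

text \<open>Bridge from the unconditional sums of the definitions to integrals, where Tonelli's
  theorem and monotone convergence apply.\<close>

lemma infsum_ennreal_eq_nn_integral:
  fixes f :: "'a \<Rightarrow> ennreal"
  assumes "countable A"
  shows "infsum f A = (\<integral>\<^sup>+x. f x \<partial>count_space A)"
  unfolding nn_integral_count_space_eq_SUP[OF assms] by (rule nonneg_infsum_complete) simp

abbreviation conf :: "'i set \<Rightarrow> ('i \<Rightarrow> nat) measure" where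
  "conf I \<equiv> PiM I (\<lambda>_. count_space UNIV)"

definition depends_on :: "'i set \<Rightarrow> (('i \<Rightarrow> 'b) \<Rightarrow> 'c) \<Rightarrow> bool" where
  "depends_on F f \<longleftrightarrow> (\<forall>\<omega> \<omega>'. (\<forall>i\<in>F. \<omega> i = \<omega>' i) \<longrightarrow> f \<omega> = f \<omega>')"

text \<open>Local functions live on all of \<open>'i \<Rightarrow> nat\<close>, not on an
  extensional function space, so one and the same test can be integrated over laws on different
  index sets.\<close>

definition cyl :: "'i set \<Rightarrow> (('i \<Rightarrow> nat) \<Rightarrow> real) \<Rightarrow> bool" where
  "cyl J f \<longleftrightarrow> (\<exists>F\<subseteq>J. finite F \<and> depends_on F f) \<and> (\<exists>B. \<forall>\<omega>. \<bar>f \<omega>\<bar> \<le> B)"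

lemma depends_onI: "(\<And>\<omega> \<omega>'. (\<And>i. i \<in> F \<Longrightarrow> \<omega> i = \<omega>' i) \<Longrightarrow> f \<omega> = f \<omega>') \<Longrightarrow> depends_on F f"
  unfolding depends_on_def by blast

lemma depends_onD: "depends_on F f \<Longrightarrow> (\<And>i. i \<in> F \<Longrightarrow> \<omega> i = \<omega>' i) \<Longrightarrow> f \<omega> = f \<omega>'"
  unfolding depends_on_def by blast

lemma depends_on_mono: "depends_on F f \<Longrightarrow> F \<subseteq> F' \<Longrightarrow> depends_on F' f"
  unfolding depends_on_def by blast

lemma depends_on_comp: "depends_on F f \<Longrightarrow> depends_on F (\<lambda>\<omega>. h (f \<omega>))"
  unfolding depends_on_def by metis

lemma depends_on_comp2: "depends_on F f \<Longrightarrow> depends_on F' g \<Longrightarrow> depends_on (F \<union> F') (\<lambda>\<omega>. h (f \<omega>) (g \<omega>))"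
  unfolding depends_on_def by (metis UnI1 UnI2)

text \<open>A finite product of countable discrete spaces is discrete, so measurability of a local
  function is automatic.\<close>

lemma measurable_depends_on:
  assumes "finite F" "F \<subseteq> I" "depends_on F f" "\<And>\<omega>. f \<omega> \<in> space N"
  shows "f \<in> measurable (conf I) N"
proof -
  have "(\<lambda>\<omega>. restrict \<omega> F) \<in> measurable (conf I) (conf F)"
    using assms(2) by (rule measurable_restrict_subset)
  moreover have "conf F = count_space (PiE F (\<lambda>_. UNIV))"
    using assms(1) by (intro count_space_PiM_finite) auto
  then have "f \<in> measurable (conf F) N"
    using assms(4) by auto
  ultimately have "(\<lambda>\<omega>. f (restrict \<omega> F)) \<in> measurable (conf I) N"
    by (rule measurable_compose)
  moreover have "f (restrict \<omega> F) = f \<omega>" for \<omega>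
    using assms(3) by (rule depends_onD) simp
  ultimately show ?thesis by simp
qed

lemma cylI: "finite F \<Longrightarrow> F \<subseteq> J \<Longrightarrow> depends_on F f \<Longrightarrow> (\<And>\<omega>. \<bar>f \<omega>\<bar> \<le> B) \<Longrightarrow> cyl J f"
  unfolding cyl_def by blast

lemma cylE:
  assumes "cyl J f"
  obtains F B where "finite F" "F \<subseteq> J" "depends_on F f" "\<And>\<omega>. \<bar>f \<omega>\<bar> \<le> B" "B > 0"
proof -
  from assms obtain F B where "finite F" "F \<subseteq> J" "depends_on F f" and B: "\<And>\<omega>. \<bar>f \<omega>\<bar> \<le> B"
    unfolding cyl_def by blast
  moreover have "\<bar>f \<omega>\<bar> \<le> \<bar>B\<bar> + 1" for \<omega> using B[of \<omega>] by auto
  ultimately show ?thesis by (intro that[of F "\<bar>B\<bar> + 1"]) auto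
qed

lemma cyl_mono: "cyl J f \<Longrightarrow> J \<subseteq> J' \<Longrightarrow> cyl J' f"
  unfolding cyl_def by blast

lemma cyl_measurable:
  assumes "cyl J f" "J \<subseteq> I" "sets M = sets (conf I)"
  shows "f \<in> borel_measurable M"
proof -
  from assms(1) obtain F where "finite F" "F \<subseteq> J" "depends_on F f"
    unfolding cyl_def by blast
  then have "f \<in> borel_measurable (conf I)"
    using assms(2) by (intro measurable_depends_on) auto
  then show ?thesis using assms(3) by (simp cong: measurable_cong_sets)
qed

lemma cyl_integrable:
  assumes "cyl J f" "J \<subseteq> I" "sets M = sets (conf I)" "prob_space M"
  shows "integrable M f"
  using assms cyl_measurable[OF assms(1-3)] unfolding cyl_def
  by (auto intro: prob_integrable_bounded)

lemma cyl_const: "cyl J (\<lambda>_. c)"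
  by (rule cylI[of "{}" _ _ "\<bar>c\<bar>"]) (auto intro: depends_onI)

lemma cyl_add:
  assumes "cyl J f" "cyl J g" shows "cyl J (\<lambda>\<omega>. f \<omega> + g \<omega>)"
proof -
  from cylE[OF assms(1)] obtain F B where 1: "finite F" "F \<subseteq> J" "depends_on F f" "\<And>\<omega>. \<bar>f \<omega>\<bar> \<le> B" by metis
  from cylE[OF assms(2)] obtain F' B' where 2: "finite F'" "F' \<subseteq> J" "depends_on F' g" "\<And>\<omega>. \<bar>g \<omega>\<bar> \<le> B'" by metis
  have "\<bar>f \<omega> + g \<omega>\<bar> \<le> B + B'" for \<omega> using 1(4)[of \<omega>] 2(4)[of \<omega>] by linarith
  then show ?thesis using 1 2
    by (intro cylI[of "F \<union> F'"] depends_on_comp2) auto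
qed

lemma cyl_exp: "cyl J f \<Longrightarrow> cyl J (\<lambda>\<omega>. exp (f \<omega>))"
proof -
  assume "cyl J f"
  from cylE[OF this] obtain F B where 1: "finite F" "F \<subseteq> J" "depends_on F f" "\<And>\<omega>. \<bar>f \<omega>\<bar> \<le> B" by metis
  have "f \<omega> \<le> B" for \<omega> using 1(4)[of \<omega>] by linarith
  then show ?thesis using 1 by (intro cylI[of F _ _ "exp B"] depends_on_comp[of F f exp]) auto
qed

text \<open>Induction over the generated sigma-algebra. The two measures share the induction because
  the same local event has to approximate A under both.\<close>

lemma approx_set:
  assumes P: "prob_space P" and R: "prob_space R"
    and sP: "sets P = sets (conf J)" and sR: "sets R = sets (conf J)"
    and A: "A \<in> sets (conf J)" and e: "0 < (\<epsilon>::real)"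
  shows "\<exists>F C. finite F \<and> F \<subseteq> J \<and> depends_on F C
    \<and> measure P {\<omega> \<in> space (conf J). (\<omega> \<in> A) \<noteq> C \<omega>} < \<epsilon>
    \<and> measure R {\<omega> \<in> space (conf J). (\<omega> \<in> A) \<noteq> C \<omega>} < \<epsilon>"
proof -
  interpret P: prob_space P by fact
  interpret R: prob_space R by fact
  let ?\<Omega> = "PiE J (\<lambda>_. UNIV :: nat set)"
  have sp: "space (conf J) = ?\<Omega>" by (simp add: space_PiM)
  have spP: "space P = ?\<Omega>" and spR: "space R = ?\<Omega>"
    using sets_eq_imp_space_eq[OF sP] sets_eq_imp_space_eq[OF sR] sp by auto
  let ?G = "{{f \<in> ?\<Omega>. f i \<in> B} | i B. i \<in> J \<and> B \<in> sets (count_space (UNIV :: nat set))}"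
  have gen: "sets (conf J) = sigma_sets ?\<Omega> ?G"
    by (subst sets_PiM_single) simp
  define d where "d A C = {\<omega> \<in> ?\<Omega>. (\<omega> \<in> A) \<noteq> C \<omega>}" for A :: "('a \<Rightarrow> nat) set" and C
  have dm: "d A C \<in> sets (conf J)" if "A \<in> sets (conf J)" "finite F" "F \<subseteq> J" "depends_on F C" for A F C
  proof -
    have [measurable]: "Measurable.pred (conf J) C"
      using that by (intro measurable_depends_on) auto
    have [measurable]: "A \<in> sets (conf J)" by fact
    have "{\<omega> \<in> space (conf J). (\<omega> \<in> A) \<noteq> C \<omega>} \<in> sets (conf J)" by measurable
    then show ?thesis by (simp add: d_def sp)
  qed
  have "\<forall>\<epsilon>>0. \<exists>F C. finite F \<and> F \<subseteq> J \<and> depends_on F C \<and> measure P (d A C) < \<epsilon> \<and> measure R (d A C) < \<epsilon>"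
    using A unfolding gen
  proof (induction rule: sigma_sets.induct)
    case (Basic a)
    then obtain i B where a: "a = {f \<in> ?\<Omega>. f i \<in> B}" "i \<in> J" by blast
    have "d a (\<lambda>\<omega>. \<omega> i \<in> B) = {}" by (auto simp: d_def a)
    moreover have "depends_on {i} (\<lambda>\<omega>. \<omega> i \<in> B)" by (intro depends_onI) auto
    ultimately show ?case using a(2) by (intro allI impI exI[of _ "{i}"] exI[of _ "\<lambda>\<omega>. \<omega> i \<in> B"]) auto
  next
    case Empty
    have "d {} (\<lambda>\<omega>. False) = {}" by (auto simp: d_def)
    then show ?case by (intro allI impI exI[of _ "{}"] exI[of _ "\<lambda>\<omega>. False"]) (auto intro: depends_onI)
  next
    case (Compl a)
    have eq: "d (?\<Omega> - a) (\<lambda>\<omega>. \<not> C \<omega>) = d a C" for C by (auto simp: d_def)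
    show ?case
    proof (intro allI impI)
      fix \<epsilon> :: real assume "\<epsilon> > 0"
      with Compl.IH obtain F C where "finite F" "F \<subseteq> J" "depends_on F C" "measure P (d a C) < \<epsilon>" "measure R (d a C) < \<epsilon>"
        by blast
      then show "\<exists>F C. finite F \<and> F \<subseteq> J \<and> depends_on F C \<and> measure P (d (?\<Omega> - a) C) < \<epsilon> \<and> measure R (d (?\<Omega> - a) C) < \<epsilon>"
        using eq depends_on_comp[of F C Not] by (intro exI[of _ F] exI[of _ "\<lambda>\<omega>. \<not> C \<omega>"]) auto
    qed
  next
    case (Union a)
    have am: "a i \<in> sets (conf J)" for i using Union.hyps gen by simp
    show ?case
    proof (intro allI impI)
      fix \<epsilon> :: real assume e: "\<epsilon> > 0"
      \<comment> \<open>Partial unions exhaust the countable union up to \<open>\<epsilon>/2\<close>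
        under both measures; the other \<open>\<epsilon>/2\<close> is shared by the events
        approximating the first N sets.\<close>
      define u where "u n = (\<Union>i<n. a i)" for n
      have um: "u n \<in> sets (conf J)" for n unfolding u_def using am by auto
      have inc: "incseq u" unfolding u_def incseq_def by (intro allI impI UN_mono) auto
      have uU: "(\<Union>n. u n) = (\<Union>i. a i)" unfolding u_def by auto
      have "(\<lambda>n. measure P (u n)) \<longlonglongrightarrow> measure P (\<Union>n. u n)"
        using um sP inc by (intro P.finite_Lim_measure_incseq) auto
      then have "\<forall>\<^sub>F n in sequentially. measure P (\<Union>n. u n) - \<epsilon>/2 < measure P (u n)"
        using e by (intro order_tendstoD) auto
      moreover have "(\<lambda>n. measure R (u n)) \<longlonglongrightarrow> measure R (\<Union>n. u n)"
        using um sR inc by (intro R.finite_Lim_measure_incseq) auto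
      then have "\<forall>\<^sub>F n in sequentially. measure R (\<Union>n. u n) - \<epsilon>/2 < measure R (u n)"
        using e by (intro order_tendstoD) auto
      ultimately have "\<forall>\<^sub>F n in sequentially. measure P (\<Union>n. u n) - \<epsilon>/2 < measure P (u n) \<and>
          measure R (\<Union>n. u n) - \<epsilon>/2 < measure R (u n)" by eventually_elim simp
      then obtain N where N: "measure P (\<Union>n. u n) - \<epsilon>/2 < measure P (u N)"
          "measure R (\<Union>n. u n) - \<epsilon>/2 < measure R (u N)"
        using eventually_happens'[OF sequentially_bot] by blast
      define \<delta> where "\<delta> = \<epsilon> / (2 * (real N + 1))"
      have "\<delta> > 0" using e by (simp add: \<delta>_def)
      then have "\<forall>i. \<exists>F C. finite F \<and> F \<subseteq> J \<and> depends_on F C \<and> measure P (d (a i) C) < \<delta> \<and> measure R (d (a i) C) < \<delta>"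
        using Union.IH by blast
      then obtain F C where FC: "\<And>i. finite (F i)" "\<And>i. F i \<subseteq> J" "\<And>i. depends_on (F i) (C i)"
        "\<And>i. measure P (d (a i) (C i)) < \<delta>" "\<And>i. measure R (d (a i) (C i)) < \<delta>"
        by metis
      let ?F = "\<Union>i<N. F i" and ?C = "\<lambda>\<omega>. \<exists>i<N. C i \<omega>"
      have dF: "depends_on ?F ?C"
      proof (rule depends_onI)
        fix \<omega> \<omega>' :: "'a \<Rightarrow> nat" assume h: "\<And>i. i \<in> ?F \<Longrightarrow> \<omega> i = \<omega>' i"
        have "C i \<omega> = C i \<omega>'" if "i < N" for i
          using FC(3)[of i] by (rule depends_onD) (use h that in auto)
        then show "?C \<omega> = ?C \<omega>'" by auto
      qed
      have F: "finite ?F" "?F \<subseteq> J" using FC(1,2) by auto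
      have sub: "d (\<Union>i. a i) ?C \<subseteq> ((\<Union>n. u n) - u N) \<union> (\<Union>i<N. d (a i) (C i))"
        unfolding d_def uU u_def by auto
      have bound: "measure M (d (\<Union>i. a i) ?C) < \<epsilon>"
        if M: "prob_space M" "sets M = sets (conf J)" "measure M (\<Union>n. u n) - \<epsilon>/2 < measure M (u N)"
          "\<And>i. measure M (d (a i) (C i)) < \<delta>" for M
      proof -
        interpret M: prob_space M by fact
        have m1: "(\<Union>n. u n) - u N \<in> sets M" using um that(2) by auto
        have m2: "d (a i) (C i) \<in> sets M" for i using dm[OF am FC(1,2,3)] that(2) by auto
        have "measure M (d (\<Union>i. a i) ?C) \<le> measure M (((\<Union>n. u n) - u N) \<union> (\<Union>i<N. d (a i) (C i)))"
          using m1 m2 by (intro M.finite_measure_mono sub) auto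
        also have "\<dots> \<le> measure M ((\<Union>n. u n) - u N) + measure M (\<Union>i<N. d (a i) (C i))"
          using m1 m2 by (intro measure_Un_le) auto
        also have "measure M ((\<Union>n. u n) - u N) = measure M (\<Union>n. u n) - measure M (u N)"
          using um that(2) by (intro M.finite_measure_Diff) auto
        also have "measure M (\<Union>i<N. d (a i) (C i)) \<le> (\<Sum>i<N. measure M (d (a i) (C i)))"
          using m2 by (intro M.finite_measure_subadditive_finite) auto
        also have "\<dots> \<le> (\<Sum>i<N. \<delta>)" using that(4) by (intro sum_mono less_imp_le)
        also have "\<dots> \<le> \<epsilon>/2" using e by (simp add: \<delta>_def field_simps)
        finally show ?thesis using that(3) by linarith
      qed
      show "\<exists>F C. finite F \<and> F \<subseteq> J \<and> depends_on F C \<and> measure P (d (\<Union>i. a i) C) < \<epsilon> \<and> measure R (d (\<Union>i. a i) C) < \<epsilon>"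
        using F dF bound[OF P sP N(1) FC(4)] bound[OF R sR N(2) FC(5)]
        by (intro exI[of _ ?F] exI[of _ ?C]) simp
    qed
  qed
  then show ?thesis using e unfolding d_def sp by blast
qed

text \<open>The number of thresholds passed is the floor of t. This makes a bounded function, up to
  one step height, a sum of indicators of level sets.\<close>

lemma layer_count:
  fixes t :: real
  assumes "0 \<le> t" "t \<le> real n"
  shows "\<bar>t - (\<Sum>i=1..n. of_bool (real i \<le> t))\<bar> \<le> 1"
proof -
  have "(\<Sum>i=1..n. of_bool (real i \<le> t) :: real) = real (card {i\<in>{1..n}. real i \<le> t})"
    by (simp add: of_bool_def sum.If_cases Int_def)
  also have "{i\<in>{1..n}. real i \<le> t} = {1..nat \<lfloor>t\<rfloor>}"
    using assms by (auto simp: le_nat_floor) linarith+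
  finally show ?thesis using assms by simp linarith
qed

text \<open>Layer decomposition: n level sets of height s approximate f uniformly up to s, and each
  level set is replaced by a local event. The resulting g obeys the same bound B as f.\<close>

lemma approx_fun:
  fixes f :: "('i \<Rightarrow> nat) \<Rightarrow> real"
  assumes P: "prob_space P" and R: "prob_space R"
    and sP: "sets P = sets (conf J)" and sR: "sets R = sets (conf J)"
    and f: "f \<in> borel_measurable (conf J)" "\<And>\<omega>. \<bar>f \<omega>\<bar> \<le> B" and B: "B > 0" and e: "0 < (\<epsilon>::real)"
  shows "\<exists>g. cyl J g \<and> (\<forall>\<omega>. \<bar>g \<omega>\<bar> \<le> B) \<and> (\<integral>\<omega>. \<bar>f \<omega> - g \<omega>\<bar> \<partial>P) < \<epsilon> \<and> (\<integral>\<omega>. \<bar>f \<omega> - g \<omega>\<bar> \<partial>R) < \<epsilon>"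
proof -
  note [measurable] = f(1)
  \<comment> \<open>This n brings the layer height s below \<open>\<epsilon>/2\<close>; the errors
    \<open>\<delta>\<close> of the n layers add up to
    \<open>s * n * \<delta> = \<epsilon>/2\<close>.\<close>
  obtain n :: nat where n: "4 * B / \<epsilon> < real n" using reals_Archimedean2 by blast
  then have n0: "n > 0" using B e by (smt (verit) divide_pos_pos of_nat_0_less_iff)
  define s where "s = 2 * B / real n"
  have s: "s > 0" "s < \<epsilon>/2" using n n0 B e by (auto simp: s_def field_simps)
  define A where "A i = {\<omega> \<in> space (conf J). s * real i \<le> f \<omega> + B}" for i :: nat
  have Am: "A i \<in> sets (conf J)" for i unfolding A_def by measurable
  define \<delta> where "\<delta> = \<epsilon> / (4 * B)"
  have d0: "\<delta> > 0" using B e by (simp add: \<delta>_def)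
  have ex: "\<forall>i. \<exists>F C. finite F \<and> F \<subseteq> J \<and> depends_on F C
    \<and> measure P {\<omega> \<in> space (conf J). (\<omega> \<in> A i) \<noteq> C \<omega>} < \<delta>
    \<and> measure R {\<omega> \<in> space (conf J). (\<omega> \<in> A i) \<noteq> C \<omega>} < \<delta>"
    by (intro allI approx_set[OF P R sP sR Am d0])
  obtain F where F: "\<forall>i. \<exists>C. finite (F i) \<and> F i \<subseteq> J \<and> depends_on (F i) C
    \<and> measure P {\<omega> \<in> space (conf J). (\<omega> \<in> A i) \<noteq> C \<omega>} < \<delta>
    \<and> measure R {\<omega> \<in> space (conf J). (\<omega> \<in> A i) \<noteq> C \<omega>} < \<delta>"
    using choice[OF ex] by blast
  obtain C where FC: "\<And>i. finite (F i)" "\<And>i. F i \<subseteq> J" "\<And>i. depends_on (F i) (C i)"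
    "\<And>i. measure P {\<omega> \<in> space (conf J). (\<omega> \<in> A i) \<noteq> C i \<omega>} < \<delta>"
    "\<And>i. measure R {\<omega> \<in> space (conf J). (\<omega> \<in> A i) \<noteq> C i \<omega>} < \<delta>"
    using choice[OF F] by blast
  define g where "g \<omega> = s * (\<Sum>i=1..n. of_bool (C i \<omega>)) - B" for \<omega>
  have gB: "\<bar>g \<omega>\<bar> \<le> B" for \<omega>
  proof -
    have "(\<Sum>i=1..n. of_bool (C i \<omega>) :: real) \<le> (\<Sum>i=1..n. 1)" by (intro sum_mono) auto
    then have "s * (\<Sum>i=1..n. of_bool (C i \<omega>)) \<le> s * real n" using s by simp
    also have "\<dots> = 2 * B" using n0 by (simp add: s_def)
    finally have "s * (\<Sum>i=1..n. of_bool (C i \<omega>)) \<le> 2 * B" .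
    moreover have "0 \<le> s * (\<Sum>i=1..n. of_bool (C i \<omega>))" using s by (intro mult_nonneg_nonneg sum_nonneg) auto
    ultimately show ?thesis unfolding g_def by linarith
  qed
  have dg: "depends_on (\<Union>i\<in>{1..n}. F i) g"
  proof (rule depends_onI)
    fix \<omega> \<omega>' :: "'i \<Rightarrow> nat" assume h: "\<And>i. i \<in> (\<Union>i\<in>{1..n}. F i) \<Longrightarrow> \<omega> i = \<omega>' i"
    have "C i \<omega> = C i \<omega>'" if "i \<in> {1..n}" for i
      using FC(3)[of i] by (rule depends_onD) (use h that in blast)
    then show "g \<omega> = g \<omega>'" unfolding g_def by (intro arg_cong2[where f="(-)"] arg_cong2[where f="(*)"] sum.cong) auto
  qed
  have cg: "cyl J g" using FC(1,2) gB by (intro cylI[OF _ _ dg]) auto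
  have gm[measurable]: "g \<in> borel_measurable (conf J)" by (rule cyl_measurable[OF cg]) auto
  have Cm[measurable]: "Measurable.pred (conf J) (C i)" for i
    by (rule measurable_depends_on[OF FC(1,2,3)]) simp
  note [measurable] = Am
  have bound: "\<bar>f \<omega> - g \<omega>\<bar> \<le> s + s * (\<Sum>i=1..n. indicator {\<omega> \<in> space (conf J). (\<omega> \<in> A i) \<noteq> C i \<omega>} \<omega>)"
    if "\<omega> \<in> space (conf J)" for \<omega>
  proof -
    let ?t = "(f \<omega> + B) / s"
    have "0 \<le> f \<omega> + B" "f \<omega> + B \<le> s * real n" using f(2)[of \<omega>] n0 by (auto simp: s_def abs_le_iff)
    then have "0 \<le> ?t" "?t \<le> real n" using s by (auto simp: pos_divide_le_eq mult.commute)
    then have "\<bar>?t - (\<Sum>i=1..n. of_bool (real i \<le> ?t))\<bar> \<le> 1" by (rule layer_count)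
    moreover have "(\<Sum>i=1..n. of_bool (real i \<le> ?t) :: real) = (\<Sum>i=1..n. of_bool (\<omega> \<in> A i))"
      using that s by (intro sum.cong) (auto simp: A_def pos_le_divide_eq mult.commute)
    ultimately have 1: "\<bar>?t - (\<Sum>i=1..n. of_bool (\<omega> \<in> A i))\<bar> \<le> 1" by simp
    have "\<bar>(\<Sum>i=1..n. of_bool (\<omega> \<in> A i)) - (\<Sum>i=1..n. of_bool (C i \<omega>)) :: real\<bar>
        = \<bar>\<Sum>i=1..n. of_bool (\<omega> \<in> A i) - of_bool (C i \<omega>) :: real\<bar>" by (simp only: sum_subtractf)
    also have "\<dots> \<le> (\<Sum>i=1..n. \<bar>of_bool (\<omega> \<in> A i) - of_bool (C i \<omega>) :: real\<bar>)" by (rule sum_abs)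
    also have "\<dots> = (\<Sum>i=1..n. indicator {\<omega> \<in> space (conf J). (\<omega> \<in> A i) \<noteq> C i \<omega>} \<omega>)"
      using that by (intro sum.cong) (auto simp: indicator_def)
    finally have 2: "\<bar>(\<Sum>i=1..n. of_bool (\<omega> \<in> A i)) - (\<Sum>i=1..n. of_bool (C i \<omega>)) :: real\<bar>
      \<le> (\<Sum>i=1..n. indicator {\<omega> \<in> space (conf J). (\<omega> \<in> A i) \<noteq> C i \<omega>} \<omega>)" .
    have "f \<omega> - g \<omega> = s * (?t - (\<Sum>i=1..n. of_bool (C i \<omega>)))" using s by (simp add: g_def field_simps)
    then have "\<bar>f \<omega> - g \<omega>\<bar> = s * \<bar>?t - (\<Sum>i=1..n. of_bool (C i \<omega>))\<bar>" using s by (simp add: abs_mult)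
    also have "\<dots> \<le> s * (1 + (\<Sum>i=1..n. indicator {\<omega> \<in> space (conf J). (\<omega> \<in> A i) \<noteq> C i \<omega>} \<omega>))"
      using 1 2 s by (intro mult_left_mono) linarith+
    finally show ?thesis by (simp add: algebra_simps)
  qed
  have int: "(\<integral>\<omega>. \<bar>f \<omega> - g \<omega>\<bar> \<partial>M) < \<epsilon>"
    if M: "prob_space M" and sM: "sets M = sets (conf J)"
      and me: "\<And>i. measure M {\<omega> \<in> space (conf J). (\<omega> \<in> A i) \<noteq> C i \<omega>} < \<delta>" for M
  proof -
    interpret M: prob_space M by fact
    have spM: "space M = space (conf J)" using sM by (rule sets_eq_imp_space_eq)
    have mm: "h \<in> borel_measurable M \<longleftrightarrow> h \<in> borel_measurable (conf J)" for h :: "_ \<Rightarrow> real"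
      using sM by (simp cong: measurable_cong_sets)
    have ms: "{\<omega> \<in> space (conf J). (\<omega> \<in> A i) \<noteq> C i \<omega>} \<in> sets M" for i unfolding sM by measurable
    have ii: "integrable M (indicator {\<omega> \<in> space (conf J). (\<omega> \<in> A i) \<noteq> C i \<omega>} :: _ \<Rightarrow> real)" for i
      using ms by (intro M.integrable_const_bound[where B=1]) (auto simp: indicator_def)
    have "(\<integral>\<omega>. \<bar>f \<omega> - g \<omega>\<bar> \<partial>M) \<le> (\<integral>\<omega>. s + s * (\<Sum>i=1..n. indicator {\<omega> \<in> space (conf J). (\<omega> \<in> A i) \<noteq> C i \<omega>} \<omega>) \<partial>M)"
    proof (intro integral_mono)
      show "integrable M (\<lambda>\<omega>. \<bar>f \<omega> - g \<omega>\<bar>)"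
      proof (rule prob_integrable_bounded[OF M, where B = "B + B"])
        show "\<bar>\<bar>f \<omega> - g \<omega>\<bar>\<bar> \<le> B + B" for \<omega> using f(2)[of \<omega>] gB[of \<omega>] by linarith
      qed (simp add: mm)
    qed (use ii bound spM in auto)
    also have "\<dots> = s + s * (\<Sum>i=1..n. measure M {\<omega> \<in> space (conf J). (\<omega> \<in> A i) \<noteq> C i \<omega>})"
      using ii ms M.prob_space by simp
    also have "\<dots> \<le> s + s * (\<Sum>i=1..n. \<delta>)"
      using s me by (intro add_left_mono mult_left_mono sum_mono less_imp_le) auto
    also have "s * (\<Sum>i=1..n. \<delta>) = \<epsilon>/2" using n0 B by (simp add: s_def \<delta>_def)
    finally show ?thesis using s by linarith
  qed
  show ?thesis using cg gB int[OF P sP FC(4)] int[OF R sR FC(5)] by blast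
qed

lemma exp_lipschitz:
  fixes x y B :: real
  assumes "\<bar>x\<bar> \<le> B" "\<bar>y\<bar> \<le> B"
  shows "exp y \<le> exp x + exp B * \<bar>x - y\<bar>"
proof (cases "y \<le> x")
  case False
  have "1 + (x - y) \<le> exp (x - y)" by (rule exp_ge_add_one_self)
  then have "exp y * (1 + (x - y)) \<le> exp x"
    using mult_left_mono[of "1 + (x - y)" "exp (x - y)" "exp y"] by (simp add: exp_diff)
  then have "exp y \<le> exp x + exp y * (y - x)" by (simp add: algebra_simps)
  also have "exp y * (y - x) \<le> exp B * (y - x)" using assms False by (intro mult_right_mono) auto
  finally show ?thesis using False by simp
qed (simp add: add_increasing2)

text \<open>A bounded test f is replaced by a local g that is close in mean under both measures. The
  constraint on the exponential moment may be violated slightly by g, so g is lowered by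
  \<open>ln (1 + exp B * \<epsilon>)\<close>, which vanishes with \<open>\<epsilon>\<close>.\<close>

theorem rel_entropy_cyl:
  fixes P R :: "('i \<Rightarrow> nat) measure"
  assumes P: "prob_space P" and R: "prob_space R"
    and sP: "sets P = sets (conf J)" and sR: "sets R = sets (conf J)"
  shows "rel_entropy P R = (SUP f\<in>{f. cyl J f \<and> (\<integral>\<omega>. exp (f \<omega>) \<partial>R) \<le> 1}. ennreal (\<integral>\<omega>. f \<omega> \<partial>P))"
    (is "_ = ?S")
proof (rule antisym)
  interpret P: prob_space P by fact
  interpret R: prob_space R by fact
  show "?S \<le> rel_entropy P R"
  proof (rule SUP_least)
    fix f :: "('i \<Rightarrow> nat) \<Rightarrow> real" assume "f \<in> {f. cyl J f \<and> (\<integral>\<omega>. exp (f \<omega>) \<partial>R) \<le> 1}"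
    then have f: "cyl J f" "(\<integral>\<omega>. exp (f \<omega>) \<partial>R) \<le> 1" by auto
    from f(1) obtain B where "\<And>\<omega>. \<bar>f \<omega>\<bar> \<le> B" unfolding cyl_def by blast
    then show "ennreal (\<integral>\<omega>. f \<omega> \<partial>P) \<le> rel_entropy P R"
      using cyl_measurable[OF f(1) subset_refl sR] f(2) sP sR by (intro rel_entropy_ge[OF P R]) auto
  qed
  show "rel_entropy P R \<le> ?S"
  proof (cases "?S = \<infinity>")
    case False
    then obtain S where S: "?S = ennreal S" "S \<ge> 0" by (cases ?S) auto
    have S': "(\<integral>\<omega>. g \<omega> \<partial>P) \<le> S" if "cyl J g" "(\<integral>\<omega>. exp (g \<omega>) \<partial>R) \<le> 1" for g
    proof -
      have "ennreal (\<integral>\<omega>. g \<omega> \<partial>P) \<le> ?S" using that by (intro SUP_upper) auto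
      then show ?thesis unfolding S(1) using S(2) by simp
    qed
    show ?thesis
    proof (rule rel_entropy_le[OF P R])
      show "sets P = sets R" using sP sR by simp
      fix f :: "('i \<Rightarrow> nat) \<Rightarrow> real" and B0 :: real
      assume f: "f \<in> borel_measurable R" and B0: "\<And>\<omega>. \<bar>f \<omega>\<bar> \<le> B0" and f1: "(\<integral>\<omega>. exp (f \<omega>) \<partial>R) \<le> 1"
      define B where "B = \<bar>B0\<bar> + 1"
      have B: "B > 0" "\<And>\<omega>. \<bar>f \<omega>\<bar> \<le> B" unfolding B_def using B0 by (auto intro: order.trans[OF B0])
      have fm: "f \<in> borel_measurable (conf J)" using f sR by (simp cong: measurable_cong_sets)
      then have fP: "f \<in> borel_measurable P" using sP by (simp cong: measurable_cong_sets)
      have "(\<integral>\<omega>. f \<omega> \<partial>P) \<le> S + ln (1 + exp B * \<epsilon>) + \<epsilon>" if e: "\<epsilon> > 0" for \<epsilon>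
      proof -
        from approx_fun[OF P R sP sR fm B(2,1) e] obtain g where g: "cyl J g" "\<And>\<omega>. \<bar>g \<omega>\<bar> \<le> B"
          "(\<integral>\<omega>. \<bar>f \<omega> - g \<omega>\<bar> \<partial>P) < \<epsilon>" "(\<integral>\<omega>. \<bar>f \<omega> - g \<omega>\<bar> \<partial>R) < \<epsilon>" by blast
        note gR[measurable] = cyl_measurable[OF g(1) subset_refl sR]
        note gP[measurable] = cyl_measurable[OF g(1) subset_refl sP]
        note [measurable] = f fP
        have abs: "integrable M (\<lambda>\<omega>. \<bar>f \<omega> - g \<omega>\<bar>)" if "prob_space M" "(\<lambda>\<omega>. \<bar>f \<omega> - g \<omega>\<bar>) \<in> borel_measurable M" for M
        proof (rule prob_integrable_bounded[OF that, where B = "B + B"])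
          show "\<bar>\<bar>f \<omega> - g \<omega>\<bar>\<bar> \<le> B + B" for \<omega> using B(2)[of \<omega>] g(2)[of \<omega>] by linarith
        qed
        have absR: "integrable R (\<lambda>\<omega>. \<bar>f \<omega> - g \<omega>\<bar>)" using R by (intro abs) simp_all
        have absP: "integrable P (\<lambda>\<omega>. \<bar>f \<omega> - g \<omega>\<bar>)" using P by (intro abs) simp_all
        have eb: "integrable R (\<lambda>\<omega>. exp (h \<omega>))" if "h \<in> borel_measurable R" "\<And>\<omega>. \<bar>h \<omega>\<bar> \<le> B" for h
        proof (rule prob_integrable_bounded[OF R, where B = "exp B"])
          show "\<bar>exp (h \<omega>)\<bar> \<le> exp B" for \<omega> using that(2)[of \<omega>] by simp
        qed (use that in simp)
        have "(\<integral>\<omega>. exp (g \<omega>) \<partial>R) \<le> (\<integral>\<omega>. exp (f \<omega>) + exp B * \<bar>f \<omega> - g \<omega>\<bar> \<partial>R)"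
          using eb[OF gR g(2)] eb[OF f B(2)] absR
          by (intro integral_mono exp_lipschitz B g) simp_all
        also have "\<dots> = (\<integral>\<omega>. exp (f \<omega>) \<partial>R) + exp B * (\<integral>\<omega>. \<bar>f \<omega> - g \<omega>\<bar> \<partial>R)"
          using eb[OF f B(2)] absR by simp
        also have "\<dots> \<le> 1 + exp B * \<epsilon>"
          using f1 g(4) by (intro add_mono mult_left_mono) auto
        finally have eg: "(\<integral>\<omega>. exp (g \<omega>) \<partial>R) \<le> 1 + exp B * \<epsilon>" .
        define l where "l = ln (1 + exp B * \<epsilon>)"
        have pos: "1 + exp B * \<epsilon> > 0" using e by (simp add: add_pos_pos)
        have ig: "integrable P g" by (rule cyl_integrable[OF g(1) subset_refl sP P])
        have "(\<integral>\<omega>. g \<omega> + (- l) \<partial>P) \<le> S"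
        proof (rule S')
          show "cyl J (\<lambda>\<omega>. g \<omega> + (- l))" by (intro cyl_add g cyl_const)
          have "(\<integral>\<omega>. exp (g \<omega> + - l) \<partial>R) = (\<integral>\<omega>. exp (g \<omega>) \<partial>R) / (1 + exp B * \<epsilon>)"
            using pos by (simp add: exp_diff l_def)
          then show "(\<integral>\<omega>. exp (g \<omega> + - l) \<partial>R) \<le> 1" using eg pos by simp
        qed
        then have "(\<integral>\<omega>. g \<omega> \<partial>P) - l \<le> S" using ig P.prob_space by simp
        moreover have "(\<integral>\<omega>. f \<omega> \<partial>P) \<le> (\<integral>\<omega>. g \<omega> + \<bar>f \<omega> - g \<omega>\<bar> \<partial>P)"
          using ig absP prob_integrable_bounded[OF P fP B(2)] by (intro integral_mono) auto
        ultimately show ?thesis using ig absP g(3) unfolding l_def by simp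
      qed
      moreover have "((\<lambda>\<epsilon>. S + ln (1 + exp B * \<epsilon>) + \<epsilon>) \<longlongrightarrow> S + ln (1 + exp B * 0) + 0) (at_right 0)"
        by (intro tendsto_intros) auto
      ultimately have "(\<integral>\<omega>. f \<omega> \<partial>P) \<le> S + ln (1 + exp B * 0) + 0"
        by (intro tendsto_lowerbound[where F="at_right 0"]) (auto simp: eventually_at_right_less eventually_at intro!: exI[of _ 1])
      then show "ennreal (\<integral>\<omega>. f \<omega> \<partial>P) \<le> ?S" unfolding S(1) by (intro ennreal_leI) simp
    qed
  next
    case True
    then show ?thesis unfolding True by simp
  qed
qed

section \<open>Local compactness of tight sequences\<close>

text \<open>The Kolmogorov extension theorem of the library requires Polish coordinate spaces.\<close>

instantiation nat :: metric_space
begin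

definition dist_nat :: "nat \<Rightarrow> nat \<Rightarrow> real" where
  "dist_nat m n = (if m = n then 0 else 1)"

definition uniformity_nat :: "(nat \<times> nat) filter" where
  "uniformity_nat = (INF e\<in>{0<..}. principal {(x, y). dist x y < e})"

instance
proof
  fix U :: "nat set"
  have "\<forall>x\<in>U. \<forall>\<^sub>F (x', y) in uniformity. x' = x \<longrightarrow> y \<in> U"
  proof
    fix x assume "x \<in> U"
    then have "\<forall>\<^sub>F z in principal {(x, y). dist x y < (1 :: real)}. case z of (x', y) \<Rightarrow> x' = x \<longrightarrow> y \<in> U"
      by (auto simp: eventually_principal dist_nat_def split: if_splits)
    moreover have "uniformity \<le> principal {(x, y :: nat). dist x y < (1 :: real)}"
      unfolding uniformity_nat_def by (intro INF_lower) auto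
    ultimately show "\<forall>\<^sub>F (x', y) in uniformity. x' = x \<longrightarrow> y \<in> U"
      by (rule filter_leD[rotated])
  qed
  then show "open U \<longleftrightarrow> (\<forall>x\<in>U. \<forall>\<^sub>F (x', y) in uniformity. x' = x \<longrightarrow> y \<in> U)"
    by (simp add: Topological_Spaces.open_discrete)
qed (auto simp: uniformity_nat_def dist_nat_def)

end

instance nat :: complete_space
proof
  fix X :: "nat \<Rightarrow> nat"
  assume "Cauchy X"
  then obtain N where N: "\<And>m n. m \<ge> N \<Longrightarrow> n \<ge> N \<Longrightarrow> dist (X m) (X n) < 1"
    unfolding Cauchy_def by (meson zero_less_one)
  have "X m = X N" if "m \<ge> N" for m
    using N[OF that order_refl] by (simp add: dist_nat_def split: if_splits)
  then show "convergent X"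
    by (intro convergentI[where L="X N"] tendsto_eventually eventually_sequentiallyI[of N])
qed

instance nat :: polish_space ..

text \<open>Diagonal extraction, obtained from compactness of a countable power of [0, 1], which is
  metrisable.\<close>

lemma convergent_subseq_countable:
  fixes a :: "nat \<Rightarrow> 'k::countable \<Rightarrow> real"
  assumes "\<And>n k. a n k \<in> {0..1}"
  obtains r l where "strict_mono (r :: nat \<Rightarrow> nat)" "\<And>k. (\<lambda>n. a (r n) k) \<longlonglongrightarrow> l k"
proof -
  have "compactin (product_topology (\<lambda>_::'k. euclidean :: real topology) UNIV) (PiE UNIV (\<lambda>_. {0..1}))"
    by (subst compactin_PiE) auto
  then have "compact (PiE UNIV (\<lambda>_. {0..1}) :: ('k \<Rightarrow> real) set)"
    by (simp add: euclidean_product_topology)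
  then have "seq_compact (PiE UNIV (\<lambda>_. {0..1}) :: ('k \<Rightarrow> real) set)"
    by (simp add: compact_eq_seq_compact_metric)
  moreover have "\<forall>n. a n \<in> PiE UNIV (\<lambda>_. {0..1})" using assms by auto
  ultimately obtain l r where r: "strict_mono (r :: nat \<Rightarrow> nat)" and l: "(a \<circ> r) \<longlonglongrightarrow> l"
    unfolding seq_compact_def by metis
  have "(\<lambda>n. (a \<circ> r) n k) \<longlonglongrightarrow> l k" for k
  proof -
    have "continuous_on UNIV (\<lambda>f :: 'k \<Rightarrow> real. f k)"
      by (rule continuous_on_product_then_coordinatewise) simp
    then have "isCont (\<lambda>f :: 'k \<Rightarrow> real. f k) l" by (metis UNIV_I continuous_on_eq_continuous_at open_UNIV)
    then show ?thesis by (rule isCont_tendsto_compose) (rule l)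
  qed
  then show ?thesis by (intro that[OF r, of l]) (simp add: o_def)
qed

text \<open>\<open>L\<close> collects the limits of the probabilities of point cylinders. Tightness
  makes these limits add up to 1 on every finite set of coordinates.\<close>

locale tight_sequence =
  fixes \<mu> :: "nat \<Rightarrow> ('i::countable \<Rightarrow> nat) measure" and L :: "'i set \<Rightarrow> ('i \<Rightarrow> nat) \<Rightarrow> real"
  assumes prob: "\<And>n. prob_space (\<mu> n)" and sets_mu: "\<And>n. sets (\<mu> n) = sets (conf UNIV)"
    and tight: "\<And>i e. e > 0 \<Longrightarrow> \<exists>M. \<forall>n. measure (\<mu> n) {\<omega>. \<omega> i > M} \<le> e"
    and L: "\<And>J x. finite J \<Longrightarrow> (\<lambda>n. measure (\<mu> n) {\<omega>. \<forall>i\<in>J. \<omega> i = x i}) \<longlonglongrightarrow> L J x"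
begin

definition E :: "'i set \<Rightarrow> ('i \<Rightarrow> nat) set" where "E J = PiE J (\<lambda>_. UNIV)"

definition PJ :: "'i set \<Rightarrow> ('i \<Rightarrow> nat) measure" where
  "PJ J = density (count_space (E J)) (\<lambda>x. ennreal (L J x))"

lemma space_mu: "space (\<mu> n) = UNIV"
  using sets_eq_imp_space_eq[OF sets_mu] by (simp add: space_PiM)

lemma local_set: "finite J \<Longrightarrow> {\<omega>. restrict \<omega> J \<in> B} \<in> sets (\<mu> n)"
proof -
  assume "finite J"
  have "depends_on J (\<lambda>\<omega> :: 'i \<Rightarrow> nat. restrict \<omega> J)"
    by (intro depends_onI restrict_ext)
  from depends_on_comp[OF this] have "depends_on J (\<lambda>\<omega>. restrict \<omega> J \<in> B)" .
  with \<open>finite J\<close> have "Measurable.pred (conf UNIV) (\<lambda>\<omega>. restrict \<omega> J \<in> B)"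
    by (intro measurable_depends_on[of J]) auto
  then show ?thesis unfolding sets_mu by (simp add: pred_def space_PiM)
qed

lemma count_E: "finite J \<Longrightarrow> conf J = count_space (E J)"
  unfolding E_def by (intro count_space_PiM_finite) auto

lemma countable_E: "finite J \<Longrightarrow> countable (E J)"
  unfolding E_def by (intro countable_PiE) auto

lemma L_nonneg: "finite J \<Longrightarrow> 0 \<le> L J x"
  using L[of J x] by (rule LIMSEQ_le_const) auto

lemma sum_L:
  assumes J: "finite J" and B: "finite B" "B \<subseteq> E J"
  shows "(\<lambda>n. measure (\<mu> n) {\<omega>. restrict \<omega> J \<in> B}) \<longlonglongrightarrow> (\<Sum>x\<in>B. L J x)"
proof -
  have "measure (\<mu> n) {\<omega>. restrict \<omega> J \<in> B} = (\<Sum>x\<in>B. measure (\<mu> n) {\<omega>. \<forall>i\<in>J. \<omega> i = x i})" for n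
  proof -
    interpret prob_space "\<mu> n" by (rule prob)
    have eq: "{\<omega>. \<forall>i\<in>J. \<omega> i = x i} = {\<omega>. restrict \<omega> J \<in> {x}}" if "x \<in> B" for x
      using that B(2) by (auto simp: E_def PiE_def extensional_def restrict_def fun_eq_iff)
    have "{\<omega>. restrict \<omega> J \<in> {x}} \<in> events" for x by (rule local_set[OF J])
    moreover have "{\<omega>. restrict \<omega> J \<in> B} = (\<Union>x\<in>B. {\<omega>. restrict \<omega> J \<in> {x}})" by auto
    ultimately have "measure (\<mu> n) {\<omega>. restrict \<omega> J \<in> B} = (\<Sum>x\<in>B. measure (\<mu> n) {\<omega>. restrict \<omega> J \<in> {x}})"
      using B by (simp only:, intro finite_measure_finite_Union) (auto simp: disjoint_family_on_def)
    then show ?thesis using eq by simp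
  qed
  then show ?thesis using L[OF J] by (simp add: tendsto_sum)
qed

lemma finite_box: "finite J \<Longrightarrow> finite (PiE J (\<lambda>i. {..M i::nat}))"
  by (intro finite_PiE) auto

lemma box_mass:
  assumes J: "finite J" and e: "e > 0"
  shows "\<exists>M. \<forall>n. measure (\<mu> n) {\<omega>. restrict \<omega> J \<in> PiE J (\<lambda>i. {..M i})} \<ge> 1 - e"
proof -
  define d where "d = e / (real (card J) + 1)"
  have d: "d > 0" using e by (simp add: d_def)
  have "\<forall>i. \<exists>M. \<forall>n. measure (\<mu> n) {\<omega>. \<omega> i > M} \<le> d" by (intro allI tight d)
  from choice[OF this] obtain M where M: "\<And>i n. measure (\<mu> n) {\<omega>. \<omega> i > M i} \<le> d" by blast
  show ?thesis
  proof (intro exI[of _ M] allI)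
    fix n
    interpret prob_space "\<mu> n" by (rule prob)
    let ?B = "{\<omega>. restrict \<omega> J \<in> PiE J (\<lambda>i. {..M i})}"
    have m: "{\<omega>. \<omega> i > M i} \<in> sets (\<mu> n)" for i
      using local_set[of "{i}" "{\<omega>. \<omega> i > M i}"] by simp
    have "1 - measure (\<mu> n) ?B = measure (\<mu> n) (space (\<mu> n) - ?B)"
      by (rule prob_compl[OF local_set[OF J], symmetric])
    also have "\<dots> \<le> measure (\<mu> n) (\<Union>i\<in>J. {\<omega>. \<omega> i > M i})"
      using J m by (intro finite_measure_mono) (auto simp: not_le)
    also have "\<dots> \<le> (\<Sum>i\<in>J. measure (\<mu> n) {\<omega>. \<omega> i > M i})"
      using J m by (intro finite_measure_subadditive_finite) auto
    also have "\<dots> \<le> (\<Sum>i\<in>J. d)" by (intro sum_mono M)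
    also have "\<dots> \<le> e" using e by (simp add: d_def field_simps)
    finally show "measure (\<mu> n) ?B \<ge> 1 - e" by simp
  qed
qed

lemma emeasure_PJ: "finite J \<Longrightarrow> B \<subseteq> E J \<Longrightarrow> emeasure (PJ J) B = (\<integral>\<^sup>+x. ennreal (L J x) \<partial>count_space B)"
proof -
  assume "B \<subseteq> E J"
  then have eq: "count_space B = restrict_space (count_space (E J)) B"
    by (simp add: restrict_count_space inf.absorb1 inf.absorb2)
  show ?thesis
    unfolding eq PJ_def using \<open>B \<subseteq> E J\<close> by (simp add: emeasure_density nn_integral_restrict_space)
qed

lemma emeasure_PJ_finite: "finite J \<Longrightarrow> finite B \<Longrightarrow> B \<subseteq> E J \<Longrightarrow> emeasure (PJ J) B = ennreal (\<Sum>x\<in>B. L J x)"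
  by (simp add: emeasure_PJ nn_integral_count_space_finite sum_ennreal L_nonneg)

lemma prob_PJ: assumes J: "finite J" shows "prob_space (PJ J)"
proof
  have "(\<Sum>x\<in>B. L J x) \<le> 1" if "finite B" "B \<subseteq> E J" for B
    using sum_L[OF J that] by (rule LIMSEQ_le_const2) (auto intro: prob_space.prob_le_1[OF prob])
  then have "(\<Sum>x\<in>B. ennreal (L J x)) \<le> 1" if "finite B" "B \<subseteq> E J" for B
    using that by (simp add: sum_ennreal L_nonneg[OF J])
  then have le: "emeasure (PJ J) (E J) \<le> 1"
    by (subst emeasure_PJ[OF J]) (auto simp: nn_integral_count_space_eq_SUP[OF countable_E[OF J]] intro!: SUP_least)
  have "ennreal (1 - e) \<le> emeasure (PJ J) (E J)" if e: "e > 0" for e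
  proof -
    from box_mass[OF J e] obtain M where M: "\<And>n. measure (\<mu> n) {\<omega>. restrict \<omega> J \<in> PiE J (\<lambda>i. {..M i})} \<ge> 1 - e" by blast
    have sub: "PiE J (\<lambda>i. {..M i}) \<subseteq> E J" unfolding E_def by (rule PiE_mono) auto
    have "1 - e \<le> (\<Sum>x\<in>PiE J (\<lambda>i. {..M i}). L J x)"
      using sum_L[OF J finite_box[OF J] sub] by (rule LIMSEQ_le_const) (use M in auto)
    then have "ennreal (1 - e) \<le> emeasure (PJ J) (PiE J (\<lambda>i. {..M i}))"
      unfolding emeasure_PJ_finite[OF J finite_box[OF J] sub] by (rule ennreal_leI)
    also have "\<dots> \<le> emeasure (PJ J) (E J)" using sub by (intro emeasure_mono) (auto simp: PJ_def)
    finally show ?thesis .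
  qed
  moreover from le obtain t where t: "emeasure (PJ J) (E J) = ennreal t" "t \<ge> 0"
    by (cases "emeasure (PJ J) (E J)") (auto simp: top_unique)
  ultimately have "1 - e \<le> t" if "e > 0" for e using that by (simp add: ennreal_le_iff)
  then have "1 \<le> t + e" if "e > 0" for e using that by (simp add: algebra_simps)
  then have "1 \<le> t" by (rule field_le_epsilon)
  then have "1 \<le> emeasure (PJ J) (E J)" using t by simp
  with le have "emeasure (PJ J) (E J) = 1" by (rule antisym)
  moreover have "space (PJ J) = E J" by (simp add: PJ_def)
  ultimately show "emeasure (PJ J) (space (PJ J)) = 1" by simp
qed

text \<open>Finite subsets give the lower bound for the limit, and the lower bound for the
  complement gives the upper bound, since no mass is lost. Infinite B must be allowed: preimages
  under projections to fewer coordinates are infinite.\<close>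

lemma setwise:
  assumes J: "finite J" and B: "B \<subseteq> E J"
  shows "(\<lambda>n. measure (\<mu> n) {\<omega>. restrict \<omega> J \<in> B}) \<longlonglongrightarrow> measure (PJ J) B"
proof -
  interpret PJ: prob_space "PJ J" by (rule prob_PJ[OF J])
  have low: "\<forall>\<^sub>F n in sequentially. measure (\<mu> n) {\<omega>. restrict \<omega> J \<in> C} > measure (PJ J) C - e"
    if C: "C \<subseteq> E J" and e: "e > 0" for C e
  proof -
    have fin: "emeasure (PJ J) C = ennreal (measure (PJ J) C)" by (rule PJ.emeasure_eq_measure)
    have "\<exists>D. finite D \<and> D \<subseteq> C \<and> measure (PJ J) C - e < (\<Sum>x\<in>D. L J x)"
    proof (cases "measure (PJ J) C - e < 0")
      case True
      then show ?thesis by (intro exI[of _ "{}"]) auto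
    next
      case False
      then have "ennreal (measure (PJ J) C - e) < emeasure (PJ J) C"
        unfolding fin using e by (intro ennreal_lessI) (auto simp: not_less)
      also have "emeasure (PJ J) C = (SUP D\<in>{D. finite D \<and> D \<subseteq> C}. \<Sum>x\<in>D. ennreal (L J x))"
        using C countable_subset[OF C countable_E[OF J]] by (subst emeasure_PJ[OF J]) (auto simp: nn_integral_count_space_eq_SUP)
      finally obtain D where D: "finite D" "D \<subseteq> C" "ennreal (measure (PJ J) C - e) < (\<Sum>x\<in>D. ennreal (L J x))"
        by (auto simp: less_SUP_iff)
      then have "measure (PJ J) C - e < (\<Sum>x\<in>D. L J x)"
        using False by (simp add: sum_ennreal L_nonneg[OF J] ennreal_less_iff)
      then show ?thesis using D by blast
    qed
    then obtain D where D: "finite D" "D \<subseteq> C" "measure (PJ J) C - e < (\<Sum>x\<in>D. L J x)" by blast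
    have "\<forall>\<^sub>F n in sequentially. measure (\<mu> n) {\<omega>. restrict \<omega> J \<in> D} > measure (PJ J) C - e"
      using sum_L[OF J D(1)] D C by (intro order_tendstoD) auto
    then show ?thesis
    proof eventually_elim
      case (elim n)
      interpret prob_space "\<mu> n" by (rule prob)
      have "measure (\<mu> n) {\<omega>. restrict \<omega> J \<in> D} \<le> measure (\<mu> n) {\<omega>. restrict \<omega> J \<in> C}"
        using D(2) local_set[OF J] by (intro finite_measure_mono) auto
      then show ?case using elim by linarith
    qed
  qed
  show ?thesis
  proof (rule order_tendstoI)
    fix a assume "a < measure (PJ J) B"
    then show "\<forall>\<^sub>F n in sequentially. a < measure (\<mu> n) {\<omega>. restrict \<omega> J \<in> B}"
      using low[OF B, of "measure (PJ J) B - a"] by simp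
  next
    fix a assume a: "measure (PJ J) B < a"
    have c: "measure (PJ J) (E J - B) = 1 - measure (PJ J) B"
      using PJ.prob_compl[of B] B by (simp add: PJ_def)
    have "\<forall>\<^sub>F n in sequentially. measure (\<mu> n) {\<omega>. restrict \<omega> J \<in> E J - B} > measure (PJ J) (E J - B) - (a - measure (PJ J) B)"
      using a by (intro low) auto
    then show "\<forall>\<^sub>F n in sequentially. measure (\<mu> n) {\<omega>. restrict \<omega> J \<in> B} < a"
    proof eventually_elim
      case (elim n)
      interpret prob_space "\<mu> n" by (rule prob)
      have "{\<omega>. restrict \<omega> J \<in> E J - B} = space (\<mu> n) - {\<omega>. restrict \<omega> J \<in> B}"
        by (auto simp: space_mu E_def)
      then have "measure (\<mu> n) {\<omega>. restrict \<omega> J \<in> E J - B} = 1 - measure (\<mu> n) {\<omega>. restrict \<omega> J \<in> B}"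
        using prob_compl[OF local_set[OF J, of B]] by simp
      then show ?case using elim c by simp
    qed
  qed
qed

text \<open>Consistency is inherited from the sequence: both sides are limits of the probabilities
  of one and the same event.\<close>

lemma projective: "polish_projective UNIV PJ"
  unfolding polish_projective_def
proof (rule projective_family.intro)
  fix J H :: "'i set" assume JH: "J \<subseteq> H" "finite H"
  then have J: "finite J" by (auto intro: finite_subset)
  have cb: "sets (PiM K (\<lambda>_. borel :: nat measure)) = sets (conf K)" for K :: "'i set"
    by (intro sets_PiM_cong) (auto simp: sets_borel_eq_count_space)
  have sets_eq: "sets (PJ J) = sets (PiM J (\<lambda>_. borel :: nat measure))"
    unfolding cb count_E[OF J] by (simp add: PJ_def)
  have sp: "space (PJ H) = E H" by (simp add: PJ_def)
  have rm: "(\<lambda>f. restrict f J) \<in> measurable (PJ H) (PiM J (\<lambda>_. borel))"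
  proof -
    have "(\<lambda>f. restrict f J) \<in> measurable (count_space (E H)) (count_space (E J))" by (auto simp: E_def)
    then show ?thesis
      using sets_eq by (subst measurable_cong_sets[of "PJ H" "count_space (E H)" _ "count_space (E J)"]) (auto simp: PJ_def)
  qed
  interpret PH: prob_space "PJ H" by (rule prob_PJ[OF JH(2)])
  interpret PJ': prob_space "PJ J" by (rule prob_PJ[OF J])
  show "PJ J = distr (PJ H) (PiM J (\<lambda>_. borel)) (\<lambda>f. restrict f J)"
  proof (rule measure_eqI)
    show "sets (PJ J) = sets (distr (PJ H) (PiM J (\<lambda>_. borel)) (\<lambda>f. restrict f J))" using sets_eq by simp
    fix A assume A: "A \<in> sets (PJ J)"
    then have AE: "A \<subseteq> E J" by (simp add: PJ_def)
    define B where "B = {y \<in> E H. restrict y J \<in> A}"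
    have BH: "B \<subseteq> E H" by (auto simp: B_def)
    have "{\<omega>. restrict \<omega> H \<in> B} = {\<omega>. restrict \<omega> J \<in> A}"
      using JH(1) by (auto simp: B_def E_def Int_absorb1)
    then have "measure (PJ J) A = measure (PJ H) B"
      using setwise[OF J AE] setwise[OF JH(2) BH] by (metis LIMSEQ_unique)
    moreover have "emeasure (distr (PJ H) (PiM J (\<lambda>_. borel)) (\<lambda>f. restrict f J)) A = emeasure (PJ H) B"
      using A sets_eq rm by (subst emeasure_distr) (auto simp: B_def sp Int_def vimage_def intro!: arg_cong2[where f=emeasure])
    ultimately show "emeasure (PJ J) A = emeasure (distr (PJ H) (PiM J (\<lambda>_. borel)) (\<lambda>f. restrict f J)) A"
      by (simp add: PH.emeasure_eq_measure PJ'.emeasure_eq_measure)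
  qed
next
  fix J :: "'i set" assume "finite J" "J \<subseteq> UNIV"
  from prob_PJ[OF this(1)] show "prob_space (PJ J)" .
qed

lemma limit_measure:
  obtains \<nu> where "prob_space \<nu>" "sets \<nu> = sets (conf UNIV)"
    "\<And>J B. finite J \<Longrightarrow> B \<subseteq> E J \<Longrightarrow> measure \<nu> {\<omega>. restrict \<omega> J \<in> B} = measure (PJ J) B"
proof -
  interpret P: polish_projective UNIV PJ by (rule projective)
  have cb: "sets (PiM K (\<lambda>_. borel :: nat measure)) = sets (conf K)" for K :: "'i set"
    by (intro sets_PiM_cong) (auto simp: sets_borel_eq_count_space)
  show ?thesis
  proof
    show "prob_space P.lim" by (rule P.P.prob_space_axioms)
    show "sets P.lim = sets (conf UNIV)" using cb by simp
    fix J :: "'i set" and B :: "('i \<Rightarrow> nat) set" assume J: "finite J" and B: "B \<subseteq> E J"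
    have "measure P.lim (prod_emb UNIV (\<lambda>_. borel) J B) = measure (PJ J) B"
      using J B cb by (intro P.measure_lim_emb) (auto simp: count_E)
    moreover have "prod_emb UNIV (\<lambda>_. borel :: nat measure) J B = {\<omega>. restrict \<omega> J \<in> B}"
      by (auto simp: prod_emb_def)
    ultimately show "measure P.lim {\<omega>. restrict \<omega> J \<in> B} = measure (PJ J) B" by simp
  qed
qed

end

text \<open>Layers approximate f uniformly, with an error independent of the measure, so convergence
  on finitely many local events is enough.\<close>

lemma tendsto_cyl_of_local_sets:
  fixes \<mu> :: "nat \<Rightarrow> ('i \<Rightarrow> nat) measure"
  assumes mu: "\<And>n. prob_space (\<mu> n)" "\<And>n. sets (\<mu> n) = sets (conf UNIV)"
    and nu: "prob_space \<nu>" "sets \<nu> = sets (conf UNIV)"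
    and conv: "\<And>J C. finite J \<Longrightarrow> depends_on J C \<Longrightarrow> (\<lambda>n. measure (\<mu> n) {\<omega>. C \<omega>}) \<longlonglongrightarrow> measure \<nu> {\<omega>. C \<omega>}"
    and f: "cyl UNIV f"
  shows "(\<lambda>n. \<integral>\<omega>. f \<omega> \<partial>\<mu> n) \<longlonglongrightarrow> (\<integral>\<omega>. f \<omega> \<partial>\<nu>)"
proof -
  from cylE[OF f] obtain F B where F: "finite F" "depends_on F f" and B: "\<And>\<omega>. \<bar>f \<omega>\<bar> \<le> B" "B > 0" by metis
  define s where "s n = 2 * B / real n" for n
  define A where "A n i \<omega> \<longleftrightarrow> s n * real i \<le> f \<omega> + B" for n i \<omega>
  define g where "g n \<omega> = s n * (\<Sum>i=1..n. of_bool (A n i \<omega>)) - B" for n \<omega>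
  have dA: "depends_on F (A n i)" for n i
    unfolding A_def by (rule depends_on_comp[OF F(2)])
  have bound: "\<bar>f \<omega> - g n \<omega>\<bar> \<le> s n" if n: "n > 0" for n \<omega>
  proof -
    have s: "s n > 0" using n B by (simp add: s_def)
    let ?t = "(f \<omega> + B) / s n"
    have "0 \<le> f \<omega> + B" "f \<omega> + B \<le> s n * real n" using B(1)[of \<omega>] n by (auto simp: s_def abs_le_iff)
    then have "0 \<le> ?t" "?t \<le> real n" using s by (auto simp: pos_divide_le_eq mult.commute)
    then have "\<bar>?t - (\<Sum>i=1..n. of_bool (real i \<le> ?t))\<bar> \<le> 1" by (rule layer_count)
    moreover have "(\<Sum>i=1..n. of_bool (real i \<le> ?t) :: real) = (\<Sum>i=1..n. of_bool (A n i \<omega>))"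
      using s by (intro sum.cong) (auto simp: A_def pos_le_divide_eq mult.commute)
    ultimately have "\<bar>?t - (\<Sum>i=1..n. of_bool (A n i \<omega>))\<bar> \<le> 1" by simp
    moreover have "f \<omega> - g n \<omega> = s n * (?t - (\<Sum>i=1..n. of_bool (A n i \<omega>)))" using s by (simp add: g_def field_simps)
    ultimately show ?thesis using s by (simp add: abs_mult)
  qed
  have int: "(\<integral>\<omega>. g n \<omega> \<partial>M) = s n * (\<Sum>i=1..n. measure M {\<omega>. A n i \<omega>}) - B \<and> integrable M (g n) \<and> integrable M f"
    if M: "prob_space M" "sets M = sets (conf UNIV)" for M n
  proof -
    interpret M: prob_space M by fact
    have sp: "space M = UNIV" using sets_eq_imp_space_eq[OF M(2)] by (simp add: space_PiM)
    have "Measurable.pred (conf UNIV) (A n i)" for i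
      by (rule measurable_depends_on[OF F(1) _ dA]) auto
    then have m: "{\<omega>. A n i \<omega>} \<in> sets M" for i unfolding M(2) by (simp add: pred_def space_PiM)
    have ind: "(\<lambda>\<omega>. of_bool (A n i \<omega>) :: real) = indicator {\<omega>. A n i \<omega>}" for i by (auto simp: indicator_def)
    have i: "integrable M (\<lambda>\<omega>. of_bool (A n i \<omega>) :: real)" for i
      unfolding ind using m by (intro M.integrable_const_bound[where B=1]) (auto simp: indicator_def)
    have "(\<integral>\<omega>. of_bool (A n i \<omega>) \<partial>M) = measure M {\<omega>. A n i \<omega>}" for i
      unfolding ind using m by (simp add: sp)
    moreover have "g n = (\<lambda>\<omega>. s n * (\<Sum>i=1..n. indicator {\<omega>. A n i \<omega>} \<omega>) - B)"
      unfolding g_def indicator_def by simp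
    ultimately show ?thesis
      using i M.prob_space cyl_integrable[OF f subset_refl M(2,1)] unfolding ind by simp
  qed
  have diff: "\<bar>(\<integral>\<omega>. f \<omega> \<partial>M) - (s n * (\<Sum>i=1..n. measure M {\<omega>. A n i \<omega>}) - B)\<bar> \<le> s n"
    if M: "prob_space M" "sets M = sets (conf UNIV)" and n: "n > 0" for M n
  proof -
    interpret M: prob_space M by fact
    note I = int[OF M, of n]
    have "\<bar>(\<integral>\<omega>. f \<omega> \<partial>M) - (\<integral>\<omega>. g n \<omega> \<partial>M)\<bar> = \<bar>\<integral>\<omega>. f \<omega> - g n \<omega> \<partial>M\<bar>" using I by simp
    also have "\<dots> \<le> (\<integral>\<omega>. \<bar>f \<omega> - g n \<omega>\<bar> \<partial>M)" by (rule integral_abs_bound)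
    also have "\<dots> \<le> (\<integral>\<omega>. s n \<partial>M)" using I bound[OF n] by (intro integral_mono) auto
    finally show ?thesis using I M.prob_space by simp
  qed
  show ?thesis
  proof (rule LIMSEQ_I)
    fix e :: real assume e: "e > 0"
    obtain n :: nat where n: "6 * B / e < real n" using reals_Archimedean2 by blast
    then have n0: "n > 0" using B(2) e by (smt (verit) divide_pos_pos of_nat_0_less_iff)
    have se: "s n < e/3" using n n0 e by (simp add: s_def field_simps)
    have "(\<lambda>k. s n * (\<Sum>i=1..n. measure (\<mu> k) {\<omega>. A n i \<omega>}) - B) \<longlonglongrightarrow> s n * (\<Sum>i=1..n. measure \<nu> {\<omega>. A n i \<omega>}) - B"
      by (intro tendsto_intros conv[OF F(1) dA])
    then obtain k0 where k0: "\<And>k. k \<ge> k0 \<Longrightarrow> \<bar>(s n * (\<Sum>i=1..n. measure (\<mu> k) {\<omega>. A n i \<omega>}) - B) - (s n * (\<Sum>i=1..n. measure \<nu> {\<omega>. A n i \<omega>}) - B)\<bar> < e/3"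
      using e unfolding LIMSEQ_def dist_real_def by (metis divide_pos_pos zero_less_numeral)
    show "\<exists>k0. \<forall>k\<ge>k0. norm ((\<integral>\<omega>. f \<omega> \<partial>\<mu> k) - (\<integral>\<omega>. f \<omega> \<partial>\<nu>)) < e"
    proof (intro exI[of _ k0] allI impI)
      fix k assume "k \<ge> k0"
      from k0[OF this] diff[OF mu(1) mu(2) n0, of k] diff[OF nu n0] se
      show "norm ((\<integral>\<omega>. f \<omega> \<partial>\<mu> k) - (\<integral>\<omega>. f \<omega> \<partial>\<nu>)) < e" unfolding real_norm_def by linarith
    qed
  qed
qed

theorem tight_subseq:
  fixes \<mu> :: "nat \<Rightarrow> ('i::countable \<Rightarrow> nat) measure"
  assumes prob: "\<And>n. prob_space (\<mu> n)" and sets_mu: "\<And>n. sets (\<mu> n) = sets (conf UNIV)"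
    and tight: "\<And>i e. e > 0 \<Longrightarrow> \<exists>M. \<forall>n. measure (\<mu> n) {\<omega>. \<omega> i > M} \<le> e"
  obtains r \<nu> where "strict_mono (r :: nat \<Rightarrow> nat)" "prob_space \<nu>" "sets \<nu> = sets (conf UNIV)"
    "\<And>f. cyl UNIV f \<Longrightarrow> (\<lambda>n. \<integral>\<omega>. f \<omega> \<partial>\<mu> (r n)) \<longlonglongrightarrow> (\<integral>\<omega>. f \<omega> \<partial>\<nu>)"
proof -
  \<comment> \<open>Point cylinders are coded by lists of pairs of a coordinate and a value. These
    form a countable type, so a single subsequence serves all cylinders.\<close>
  define a where "a n l = measure (\<mu> n) {\<omega>. \<forall>(i, c)\<in>set l. \<omega> i = c}" for n and l :: "('i \<times> nat) list"
  have "a n l \<in> {0..1}" for n l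
    unfolding a_def using prob_space.prob_le_1[OF prob] by simp
  then obtain r l where r: "strict_mono (r :: nat \<Rightarrow> nat)" and l: "\<And>k. (\<lambda>n. a (r n) k) \<longlonglongrightarrow> l k"
    using convergent_subseq_countable[of a] by metis
  have "\<exists>l. (\<lambda>n. measure (\<mu> (r n)) {\<omega>. \<forall>i\<in>J. \<omega> i = x i}) \<longlonglongrightarrow> l" if "finite J" for J x
  proof -
    obtain js where js: "set js = J" using finite_list[OF \<open>finite J\<close>] by blast
    have "{\<omega>. \<forall>(i, c)\<in>set (map (\<lambda>i. (i, x i)) js). \<omega> i = c} = {\<omega>. \<forall>i\<in>J. \<omega> i = x i}" by (auto simp: js)
    then show ?thesis using l[of "map (\<lambda>i. (i, x i)) js"] unfolding a_def by metis
  qed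
  then have L: "(\<lambda>n. measure (\<mu> (r n)) {\<omega>. \<forall>i\<in>J. \<omega> i = x i})
      \<longlonglongrightarrow> lim (\<lambda>n. measure (\<mu> (r n)) {\<omega>. \<forall>i\<in>J. \<omega> i = x i})" if "finite J" for J x
    using that unfolding convergent_LIMSEQ_iff[symmetric] by (blast intro: convergentI)
  interpret tight_sequence "\<lambda>n. \<mu> (r n)" "\<lambda>J x. lim (\<lambda>n. measure (\<mu> (r n)) {\<omega>. \<forall>i\<in>J. \<omega> i = x i})"
  proof (rule tight_sequence.intro)
    fix i and e :: real assume "e > 0"
    from tight[OF this, of i] show "\<exists>M. \<forall>n. measure (\<mu> (r n)) {\<omega>. \<omega> i > M} \<le> e" by blast
  qed (rule prob sets_mu L | assumption)+
  obtain \<nu> where nu: "prob_space \<nu>" "sets \<nu> = sets (conf UNIV)"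
    "\<And>J B. finite J \<Longrightarrow> B \<subseteq> E J \<Longrightarrow> measure \<nu> {\<omega>. restrict \<omega> J \<in> B} = measure (PJ J) B"
    using limit_measure by blast
  have "(\<lambda>n. measure (\<mu> (r n)) {\<omega>. C \<omega>}) \<longlonglongrightarrow> measure \<nu> {\<omega>. C \<omega>}" if J: "finite J" "depends_on J C" for J C
  proof -
    define B where "B = {x \<in> E J. C x}"
    have "C (restrict \<omega> J) = C \<omega>" for \<omega> using J(2) by (rule depends_onD) simp
    then have "{\<omega>. restrict \<omega> J \<in> B} = {\<omega>. C \<omega>}" by (auto simp: B_def E_def)
    moreover have "B \<subseteq> E J" by (auto simp: B_def)
    ultimately show ?thesis using setwise[OF J(1), of B] nu(3)[OF J(1), of B] by simp
  qed
  note conv = this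
  show ?thesis
  proof (rule that[OF r nu(1,2)])
    fix f :: "('i \<Rightarrow> nat) \<Rightarrow> real" assume f: "cyl UNIV f"
    show "(\<lambda>n. \<integral>\<omega>. f \<omega> \<partial>\<mu> (r n)) \<longlonglongrightarrow> (\<integral>\<omega>. f \<omega> \<partial>\<nu>)"
      by (rule tendsto_cyl_of_local_sets[OF prob sets_mu nu(1,2) conv f])
  qed
qed

section \<open>Entropy density\<close>

abbreviation marks :: "(int ^ 'd::finite) set \<Rightarrow> (nat \<times> (int ^ 'd)) set" where
  "marks Q \<equiv> {1..} \<times> Q"

text \<open>Unlike \<open>translate\<close> it does not cut down to the marks, so it also moves
  additional coordinates \<open>(0, x)\<close>.\<close>

definition tshift :: "int ^ 'd::finite \<Rightarrow> 'd config \<Rightarrow> 'd config" where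
  "tshift z \<omega> = (\<lambda>(k, x). \<omega> (k, x + z))"

text \<open>The relative entropy of the restrictions to J in dual form. It involves no pushforward
  and makes sense for laws on any index set that contains J.\<close>

definition hent :: "(nat \<Rightarrow> real) \<Rightarrow> 'd::finite config measure \<Rightarrow> (nat \<times> (int ^ 'd)) set \<Rightarrow> ennreal" where
  "hent q P J = (SUP f\<in>{f. cyl J f \<and> (\<integral>\<omega>. exp (f \<omega>) \<partial>(reference q)) \<le> 1}. ennreal (\<integral>\<omega>. f \<omega> \<partial>P))"

text \<open>By superadditivity of \<open>hent\<close> over disjoint boxes, the supremum is the limit along boxes.\<close>

definition dens :: "(nat \<Rightarrow> real) \<Rightarrow> 'd::finite config measure \<Rightarrow> ennreal" where
  "dens q P = (SUP n. hent q P (marks (box_Z n)) / of_nat (card (box_Z n :: (int ^ 'd) set)))"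

section \<open>Dual entropy with respect to the reference measure\<close>

lemma prob_reference: "prob_space (reference q)"
  unfolding reference_def by (intro prob_space_PiM) (auto split: prod.split simp: measure_pmf.prob_space_axioms)

lemma sets_reference: "sets (reference q) = sets (conf (marks UNIV))"
  unfolding reference_def by (intro sets_PiM_cong) auto

lemma restrict_cyl: "cyl J f \<Longrightarrow> J \<subseteq> I \<Longrightarrow> f (restrict \<omega> I) = f \<omega>"
proof -
  assume f: "cyl J f" and "J \<subseteq> I"
  from cylE[OF f] obtain F where "F \<subseteq> J" "depends_on F f" by metis
  with \<open>J \<subseteq> I\<close> show ?thesis by (intro depends_onD[of F f]) auto
qed

lemma cyl_integral_distr:
  assumes "cyl J f" "J \<subseteq> K" "K \<subseteq> I" "sets M = sets (conf I)"
  shows "(\<integral>\<omega>. f \<omega> \<partial>distr M (conf K) (\<lambda>\<omega>. restrict \<omega> K)) = (\<integral>\<omega>. f \<omega> \<partial>M)"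
proof -
  have "(\<lambda>\<omega>. restrict \<omega> K) \<in> measurable (conf I) (conf K)"
    using assms(3) by (rule measurable_restrict_subset)
  then have "(\<lambda>\<omega>. restrict \<omega> K) \<in> measurable M (conf K)"
    using assms(4) by (simp cong: measurable_cong_sets)
  then have "(\<integral>\<omega>. f \<omega> \<partial>distr M (conf K) (\<lambda>\<omega>. restrict \<omega> K)) = (\<integral>\<omega>. f (restrict \<omega> K) \<partial>M)"
    by (rule integral_distr) (rule cyl_measurable[OF assms(1,2) refl])
  then show ?thesis using assms(1,2) by (simp add: restrict_cyl)
qed

text \<open>Cylinder functions over Q do not notice the restriction to Q, so the tests for the
  restricted laws are exactly those of \<open>hent\<close>.\<close>

lemma rel_entropy_law_on:
  assumes P: "prob_space P" "sets P = sets (conf (marks UNIV))"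
  shows "rel_entropy (law_on Q P) (law_on Q (reference q)) = hent q P (marks Q)"
proof -
  have m: "(\<lambda>\<omega>. restrict \<omega> (marks Q)) \<in> measurable M (conf (marks Q))" if "sets M = sets (conf (marks UNIV))" for M :: "'a config measure"
  proof -
    have "(\<lambda>\<omega>. restrict \<omega> (marks Q)) \<in> measurable (conf (marks UNIV)) (conf (marks Q))"
      by (rule measurable_restrict_subset) auto
    then show ?thesis using that by (simp cong: measurable_cong_sets)
  qed
  have sub: "marks Q \<subseteq> marks UNIV" by auto
  have 1: "rel_entropy (law_on Q P) (law_on Q (reference q)) =
    (SUP f\<in>{f. cyl (marks Q) f \<and> (\<integral>\<omega>. exp (f \<omega>) \<partial>law_on Q (reference q)) \<le> 1}. ennreal (\<integral>\<omega>. f \<omega> \<partial>law_on Q P))"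
    using P sets_reference[of q] prob_reference[of q] m
    by (intro rel_entropy_cyl) (auto simp: law_on_def config_space_def intro!: prob_space.prob_space_distr)
  have 2: "(\<integral>\<omega>. f \<omega> \<partial>law_on Q M) = (\<integral>\<omega>. f \<omega> \<partial>M)"
    if "cyl (marks Q) f" "sets M = sets (conf (marks UNIV))" for f M
    unfolding law_on_def config_space_def by (rule cyl_integral_distr[OF that(1) subset_refl sub that(2)])
  have 3: "(\<integral>\<omega>. exp (f \<omega>) \<partial>law_on Q (reference q)) = (\<integral>\<omega>. exp (f \<omega>) \<partial>reference q)" if "cyl (marks Q) f" for f
    by (rule 2[OF cyl_exp[OF that] sets_reference])
  show ?thesis unfolding 1 hent_def by (rule SUP_cong) (auto simp: 2[OF _ P(2)] 3)
qed

lemma hent_upper: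
  "cyl J f \<Longrightarrow> (\<integral>\<omega>. exp (f \<omega>) \<partial>(reference q)) \<le> 1 \<Longrightarrow> ennreal (\<integral>\<omega>. f \<omega> \<partial>P) \<le> hent q P J"
  unfolding hent_def by (rule SUP_upper) auto

lemma hent_mono: "J \<subseteq> J' \<Longrightarrow> hent q P J \<le> hent q P J'"
  unfolding hent_def by (rule SUP_subset_mono) (auto intro: cyl_mono)

text \<open>Independence of disjoint blocks. Only the finitely many coordinates on which f and g
  depend enter, so Fubini's theorem on a finite product suffices.\<close>

lemma reference_integral_mult:
  assumes f: "cyl J f" and g: "cyl J' g" and disj: "J \<inter> J' = {}" and sub: "J \<subseteq> marks UNIV" "J' \<subseteq> marks UNIV"
  shows "(\<integral>\<omega>. f \<omega> * g \<omega> \<partial>(reference q)) = (\<integral>\<omega>. f \<omega> \<partial>(reference q)) * (\<integral>\<omega>. g \<omega> \<partial>(reference q))"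
proof -
  from cylE[OF f] obtain F B where F: "finite F" "F \<subseteq> J" "depends_on F f" "\<And>\<omega>. \<bar>f \<omega>\<bar> \<le> B" by metis
  from cylE[OF g] obtain F' B' where F': "finite F'" "F' \<subseteq> J'" "depends_on F' g" "\<And>\<omega>. \<bar>g \<omega>\<bar> \<le> B'" by metis
  let ?M = "\<lambda>(k, x). measure_pmf (poisson_pmf (q k)) :: nat measure"
  have "prob_space (?M i)" for i by (cases i) (simp add: measure_pmf.prob_space_axioms)
  then interpret product_prob_space ?M "marks UNIV" by (rule product_prob_spaceI)
  have FF: "F \<inter> F' = {}" "F \<union> F' \<subseteq> marks UNIV" using F(2) F'(2) disj sub by auto
  have setsM: "sets (PiM K ?M) = sets (conf K)" for K by (intro sets_PiM_cong) auto
  have int: "(\<integral>\<omega>. h \<omega> \<partial>(reference q)) = (\<integral>\<omega>. h \<omega> \<partial>(PiM K ?M))" if "cyl K h" "finite K" "K \<subseteq> marks UNIV" for h K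
  proof -
    have "PiM K ?M = distr (PiM (marks UNIV) ?M) (PiM K ?M) (\<lambda>\<omega>. restrict \<omega> K)"
      using that by (intro distr_PiM_restrict_finite[symmetric]) auto
    also have "\<dots> = distr (reference q) (conf K) (\<lambda>\<omega>. restrict \<omega> K)"
      unfolding reference_def by (rule distr_cong) (simp_all add: setsM)
    finally show ?thesis using cyl_integral_distr[OF that(1) subset_refl that(3) sets_reference] by simp
  qed
  have cf: "cyl F f" using F by (intro cylI[of F]) auto
  have cg: "cyl F' g" using F' by (intro cylI[of F']) auto
  have dfg: "depends_on (F \<union> F') (\<lambda>\<omega>. f \<omega> * g \<omega>)" using depends_on_comp2[OF F(3) F'(3), of "(*)"] by simp
  have "\<bar>f \<omega> * g \<omega>\<bar> \<le> B * B'" for \<omega>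
    unfolding abs_mult using F(4)[of \<omega>] F'(4)[of \<omega>] by (intro mult_mono) auto
  with dfg F(1) F'(1) have cfg: "cyl (F \<union> F') (\<lambda>\<omega>. f \<omega> * g \<omega>)" by (intro cylI[of "F \<union> F'"]) auto
  have ifg: "integrable (PiM (F \<union> F') ?M) (\<lambda>\<omega>. f \<omega> * g \<omega>)"
    by (rule cyl_integrable[OF cfg subset_refl setsM]) (intro prob_space_PiM, auto split: prod.split simp: measure_pmf.prob_space_axioms)
  have "(\<integral>\<omega>. f \<omega> * g \<omega> \<partial>(reference q)) = (\<integral>\<omega>. f \<omega> * g \<omega> \<partial>(PiM (F \<union> F') ?M))"
    using F(1) F'(1) FF(2) by (intro int cfg) auto
  also have "\<dots> = (\<integral>x. (\<integral>y. f (merge F F' (x, y)) * g (merge F F' (x, y)) \<partial>PiM F' ?M) \<partial>PiM F ?M)"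
    by (rule product_integral_fold[OF FF(1) F(1) F'(1) ifg])
  also have "\<dots> = (\<integral>x. (\<integral>y. f x * g y \<partial>PiM F' ?M) \<partial>PiM F ?M)"
  proof (intro Bochner_Integration.integral_cong refl)
    fix x y :: "nat \<times> (int ^ 'a) \<Rightarrow> nat"
    have "f (merge F F' (x, y)) = f x" using F(3) by (rule depends_onD) (simp add: merge_def)
    moreover have "g (merge F F' (x, y)) = g y" using F'(3) by (rule depends_onD) (use FF(1) in \<open>auto simp: merge_def\<close>)
    ultimately show "f (merge F F' (x, y)) * g (merge F F' (x, y)) = f x * g y" by simp
  qed
  also have "\<dots> = (\<integral>\<omega>. f \<omega> \<partial>PiM F ?M) * (\<integral>\<omega>. g \<omega> \<partial>PiM F' ?M)" by simp
  also have "\<dots> = (\<integral>\<omega>. f \<omega> \<partial>(reference q)) * (\<integral>\<omega>. g \<omega> \<partial>(reference q))"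
    using int[OF cf F(1)] int[OF cg F'(1)] FF(2) by auto
  finally show ?thesis .
qed

lemma hent_tests_nonempty: "{f. cyl J f \<and> (\<integral>\<omega>. exp (f \<omega>) \<partial>(reference q)) \<le> 1} \<noteq> {}"
proof -
  interpret prob_space "reference q" by (rule prob_reference)
  have "(\<lambda>_. 0) \<in> {f. cyl J f \<and> (\<integral>\<omega>. exp (f \<omega>) \<partial>(reference q)) \<le> 1}"
    using cyl_const prob_space by simp
  then show ?thesis by blast
qed

text \<open>The sum of two tests on disjoint blocks is again a test, because the reference
  factorises. A test with negative integral counts as 0 in \<open>ennreal\<close> and is covered by
  monotonicity.\<close>

lemma hent_superadd:
  assumes P: "prob_space P" "sets P = sets (conf I)" and I: "marks UNIV \<subseteq> I"
    and disj: "J \<inter> J' = {}" and sub: "J \<subseteq> marks UNIV" "J' \<subseteq> marks UNIV"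
  shows "hent q P J + hent q P J' \<le> hent q P (J \<union> J')"
proof -
  let ?T = "\<lambda>J. {f. cyl J f \<and> (\<integral>\<omega>. exp (f \<omega>) \<partial>(reference q)) \<le> 1}"
  have "ennreal (\<integral>\<omega>. f \<omega> \<partial>P) + ennreal (\<integral>\<omega>. g \<omega> \<partial>P) \<le> hent q P (J \<union> J')" if f: "f \<in> ?T J" and g: "g \<in> ?T J'" for f g
  proof (cases "(\<integral>\<omega>. f \<omega> \<partial>P) < 0 \<or> (\<integral>\<omega>. g \<omega> \<partial>P) < 0")
    case True
    have "ennreal (\<integral>\<omega>. f \<omega> \<partial>P) \<le> hent q P (J \<union> J')"
      using f by (intro order.trans[OF hent_upper hent_mono[of J]]) auto
    moreover have "ennreal (\<integral>\<omega>. g \<omega> \<partial>P) \<le> hent q P (J \<union> J')"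
      using g by (intro order.trans[OF hent_upper hent_mono[of J']]) auto
    ultimately show ?thesis using True by (auto simp: ennreal_neg)
  next
    case False
    have c: "cyl (J \<union> J') f" "cyl (J \<union> J') g" using f g by (auto intro: cyl_mono)
    have i: "integrable P f" "integrable P g"
      using c sub I by (auto intro!: cyl_integrable[OF _ _ P(2,1)])
    have "(\<integral>\<omega>. exp (f \<omega> + g \<omega>) \<partial>(reference q)) = (\<integral>\<omega>. exp (f \<omega>) \<partial>(reference q)) * (\<integral>\<omega>. exp (g \<omega>) \<partial>(reference q))"
      unfolding exp_add using f g disj sub by (intro reference_integral_mult[of J _ J']) (auto intro: cyl_exp)
    also have "\<dots> \<le> 1 * 1" using f g by (intro mult_mono) auto
    finally have "ennreal (\<integral>\<omega>. f \<omega> + g \<omega> \<partial>P) \<le> hent q P (J \<union> J')"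
      using c by (intro hent_upper cyl_add) auto
    then show ?thesis using i False by (simp add: ennreal_plus[symmetric] del: ennreal_plus)
  qed
  then show ?thesis
    unfolding hent_def[of q P J] hent_def[of q P J']
    unfolding ennreal_SUP_add_left[OF hent_tests_nonempty, symmetric]
    unfolding ennreal_SUP_add_right[OF hent_tests_nonempty]
    by (intro SUP_least) blast
qed

lemma hent_superadd_sum:
  assumes P: "prob_space P" "sets P = sets (conf I)" and I: "marks UNIV \<subseteq> I"
    and A: "finite A" and disj: "disjoint_family_on J A" and sub: "\<And>i. i \<in> A \<Longrightarrow> J i \<subseteq> marks UNIV"
  shows "(\<Sum>i\<in>A. hent q P (J i)) \<le> hent q P (\<Union>i\<in>A. J i)"
  using A disj sub
proof (induction A rule: finite_induct)
  case (insert a A)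
  have "(\<Sum>i\<in>insert a A. hent q P (J i)) \<le> hent q P (J a) + hent q P (\<Union>i\<in>A. J i)"
    using insert by (auto simp: disjoint_family_on_def)
  also have "\<dots> \<le> hent q P (J a \<union> (\<Union>i\<in>A. J i))"
    using insert by (intro hent_superadd[OF P I]) (auto simp: disjoint_family_on_def)
  finally show ?case by simp
qed simp

section \<open>Shift invariance\<close>

lemma depends_on_tshift: "depends_on F f \<Longrightarrow> depends_on ((\<lambda>(k, x). (k, x + z)) ` F) (\<lambda>\<omega>. f (tshift z \<omega>))"
  by (rule depends_onI, erule depends_onD) (force simp: tshift_def)

lemma cyl_tshift: "cyl J f \<Longrightarrow> cyl ((\<lambda>(k, x). (k, x + z)) ` J) (\<lambda>\<omega>. f (tshift z \<omega>))"
proof -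
  assume "cyl J f"
  from cylE[OF this] obtain F B where F: "finite F" "F \<subseteq> J" "depends_on F f" "\<And>\<omega>. \<bar>f \<omega>\<bar> \<le> B" by metis
  show ?thesis
    by (rule cylI[where B=B, OF _ _ depends_on_tshift[OF F(3)]]) (use F in auto)
qed

text \<open>Shift invariance tested on local functions. The index set \<open>I\<close> may contain the coordinates \<open>(0, x)\<close> in
  addition to the marks.\<close>

definition cinv :: "(nat \<times> (int ^ 'd::finite)) set \<Rightarrow> 'd config measure \<Rightarrow> bool" where
  "cinv I P \<longleftrightarrow> prob_space P \<and> sets P = sets (conf I) \<and> (\<exists>K. I = K \<times> UNIV \<and> {1..} \<subseteq> K) \<and>
    (\<forall>z f. cyl I f \<longrightarrow> (\<integral>\<omega>. f (tshift z \<omega>) \<partial>P) = (\<integral>\<omega>. f \<omega> \<partial>P))"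

lemma cinvD:
  assumes "cinv I P"
  shows "prob_space P" "sets P = sets (conf I)" "marks UNIV \<subseteq> I"
    "\<And>z f. cyl I f \<Longrightarrow> (\<integral>\<omega>. f (tshift z \<omega>) \<partial>P) = (\<integral>\<omega>. f \<omega> \<partial>P)"
  using assms unfolding cinv_def by auto

lemma cinv_shift_cyl:
  assumes "cinv I P" "cyl I f"
  shows "cyl I (\<lambda>\<omega>. f (tshift z \<omega>))"
proof -
  from assms(1) obtain K where "I = K \<times> UNIV" unfolding cinv_def by blast
  then have "(\<lambda>(k, x). (k, x + z)) ` I \<subseteq> I" by auto
  then show ?thesis using cyl_tshift[OF assms(2)] by (rule cyl_mono[rotated])
qed

lemma translate_measurable: "translate z \<in> measurable (conf (marks UNIV)) (conf (marks UNIV))"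
  unfolding translate_def by (rule measurable_restrict) (auto split: prod.split intro!: measurable_component_singleton)

lemma translate_eq_tshift: "translate z \<omega> = restrict (tshift z \<omega>) (marks UNIV)"
  by (auto simp: translate_def tshift_def fun_eq_iff restrict_def)

lemma shift_invariant_imp_cinv:
  assumes "P \<in> shift_invariant_probs" shows "cinv (marks UNIV) P"
  unfolding cinv_def
proof (intro conjI allI impI)
  have P: "sets P = sets (conf (marks UNIV))" "\<And>z. distr P (conf (marks UNIV)) (translate z) = P"
    using assms by (auto simp: shift_invariant_probs_def config_space_def)
  show "prob_space P" "sets P = sets (conf (marks UNIV))" using P(1) assms by (auto simp: shift_invariant_probs_def)
  fix z :: "int ^ 'a" and f :: "'a config \<Rightarrow> real" assume f: "cyl (marks UNIV) f"
  have m: "translate z \<in> measurable P (conf (marks UNIV))"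
    using translate_measurable P(1) by (simp cong: measurable_cong_sets)
  have "(\<integral>\<omega>. f \<omega> \<partial>P) = (\<integral>\<omega>. f (translate z \<omega>) \<partial>P)"
    by (subst P(2)[of z, symmetric]) (rule integral_distr[OF m cyl_measurable[OF f subset_refl refl]])
  then show "(\<integral>\<omega>. f (tshift z \<omega>) \<partial>P) = (\<integral>\<omega>. f \<omega> \<partial>P)"
    using restrict_cyl[OF f subset_refl] by (simp add: translate_eq_tshift)
qed (auto intro: exI[of _ "{1..}"])

text \<open>Covers the Poisson reference and, with other single-site laws, a competitor with
  prescribed means.\<close>

definition product_law :: "(nat \<Rightarrow> nat pmf) \<Rightarrow> 'd::finite config measure" where
  "product_law p = PiM (marks UNIV) (\<lambda>(k, x). measure_pmf (p k))"

lemma reference_eq_product_law: "reference q = product_law (\<lambda>k. poisson_pmf (q k))"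
  unfolding reference_def product_law_def ..

text \<open>Reindexing the sites leaves the factors unchanged, since they depend on the mark
  only.\<close>

lemma product_law_shift_invariant: "(product_law p :: 'd::finite config measure) \<in> shift_invariant_probs"
proof -
  let ?M = "\<lambda>(k, x). measure_pmf (p k) :: nat measure"
  have s: "sets (product_law p :: 'd config measure) = sets (conf (marks UNIV))"
    unfolding product_law_def by (intro sets_PiM_cong) auto
  have pr: "prob_space (product_law p :: 'd config measure)"
    unfolding product_law_def by (intro prob_space_PiM) (auto split: prod.split simp: measure_pmf.prob_space_axioms)
  have "distr (product_law p) (conf (marks UNIV)) (translate z) = product_law p" for z :: "int ^ 'd"
  proof -
    let ?f = "\<lambda>(k, x). (k, x + z) :: nat \<times> (int ^ 'd)"
    have "distr (PiM (marks UNIV) ?M) (PiM (marks UNIV) (\<lambda>i. ?M (?f i))) (\<lambda>\<omega>. \<lambda>n\<in>marks UNIV. \<omega> (?f n)) =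
        PiM (marks UNIV) (\<lambda>i. ?M (?f i))"
      by (rule distr_PiM_reindex) (auto simp: inj_on_def measure_pmf.prob_space_axioms)
    moreover have "(\<lambda>i. ?M (?f i)) = ?M" by (auto simp: fun_eq_iff)
    moreover have "(\<lambda>\<omega>. \<lambda>n\<in>marks UNIV. \<omega> (?f n)) = translate z"
      by (auto simp: translate_def fun_eq_iff restrict_def)
    ultimately have "distr (product_law p) (product_law p) (translate z) = product_law p"
      unfolding product_law_def by simp
    moreover have "distr (product_law p) (conf (marks UNIV)) (translate z) = distr (product_law p) (product_law p) (translate z)"
      by (rule distr_cong) (auto simp: s)
    ultimately show ?thesis by simp
  qed
  then show ?thesis using s pr by (simp add: shift_invariant_probs_def config_space_def)
qed

lemma reference_cinv: "cinv (marks UNIV) (reference q)"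
  unfolding reference_eq_product_law by (intro shift_invariant_imp_cinv product_law_shift_invariant)

text \<open>The shifted test stays admissible because the reference is shift invariant, and its
  integral under P is the same. This one inequality is what packing boxes requires.\<close>

lemma hent_shift:
  assumes P: "cinv I P" and J: "J \<subseteq> marks UNIV"
  shows "hent q P J \<le> hent q P ((\<lambda>(k, x). (k, x + z)) ` J)"
  unfolding hent_def[of q P J]
proof (rule SUP_least)
  fix f :: "'a config \<Rightarrow> real" assume "f \<in> {f. cyl J f \<and> (\<integral>\<omega>. exp (f \<omega>) \<partial>(reference q)) \<le> 1}"
  then have f: "cyl J f" "(\<integral>\<omega>. exp (f \<omega>) \<partial>(reference q)) \<le> 1" by auto
  have "(\<integral>\<omega>. exp (f (tshift z \<omega>)) \<partial>(reference q)) = (\<integral>\<omega>. exp (f \<omega>) \<partial>(reference q))"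
    using cinvD(4)[OF reference_cinv cyl_exp[OF cyl_mono[OF f(1) J]]] .
  then have "ennreal (\<integral>\<omega>. f (tshift z \<omega>) \<partial>P) \<le> hent q P ((\<lambda>(k, x). (k, x + z)) ` J)"
    using f by (intro hent_upper cyl_tshift) auto
  moreover have "cyl I f" using f(1) J cinvD(3)[OF P] by (auto intro: cyl_mono)
  ultimately show "ennreal (\<integral>\<omega>. f \<omega> \<partial>P) \<le> hent q P ((\<lambda>(k, x). (k, x + z)) ` J)"
    using cinvD(4)[OF P] by simp
qed

section \<open>Packing boxes and the existence of the limit\<close>

lemma card_cube:
  fixes a b :: int
  shows "finite {x :: int ^ 'd::finite. \<forall>i. a \<le> x $ i \<and> x $ i < b}"
    "card {x :: int ^ 'd::finite. \<forall>i. a \<le> x $ i \<and> x $ i < b} = nat (b - a) ^ CARD('d)"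
proof -
  have bij: "bij_betw vec_lambda (PiE (UNIV :: 'd set) (\<lambda>_. {a..<b})) {x :: int ^ 'd. \<forall>i. a \<le> x $ i \<and> x $ i < b}"
    by (rule bij_betwI[of _ _ _ vec_nth]) (auto simp: PiE_def Pi_def)
  have "finite (PiE (UNIV :: 'd set) (\<lambda>_. {a..<b}))" by (intro finite_PiE) auto
  then show "finite {x :: int ^ 'd. \<forall>i. a \<le> x $ i \<and> x $ i < b}" using bij bij_betw_finite by blast
  show "card {x :: int ^ 'd. \<forall>i. a \<le> x $ i \<and> x $ i < b} = nat (b - a) ^ CARD('d)"
    using bij_betw_same_card[OF bij] by (simp add: card_PiE)
qed

lemma box_Z_eq_cube: "box_Z n = {x :: int ^ 'd::finite. \<forall>i. - int n \<le> x $ i \<and> x $ i < int n + 1}"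
  by (auto simp: box_Z_def abs_le_iff minus_le_iff zle_add1_eq_le)

lemma finite_box_Z: "finite (box_Z n :: (int ^ 'd::finite) set)"
  unfolding box_Z_eq_cube by (rule card_cube)

lemma card_box_Z: "card (box_Z n :: (int ^ 'd::finite) set) = (2 * n + 1) ^ CARD('d)"
  unfolding box_Z_eq_cube card_cube(2) by (simp add: nat_add_distrib) (metis Suc_as_int mult_2 nat_int_add)

lemma card_box_pos: "(0 :: ennreal) < of_nat (card (box_Z n :: (int ^ 'd::finite) set))"
  unfolding card_box_Z of_nat_0_less_iff by simp

lemma ennreal_divide_mult_cancel:
  fixes x b :: ennreal
  assumes "0 < b" "b < top" shows "x / b * b = x"
proof -
  obtain r where r: "b = ennreal r" "r > 0" using assms by (cases b) auto
  then have "inverse b * b = 1" by (simp add: inverse_ennreal ennreal_mult[symmetric])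
  then show ?thesis by (simp add: divide_ennreal_def mult.assoc)
qed

lemma hent_box_packing:
  fixes P :: "'d::finite config measure"
  assumes P: "cinv I P" and m: "m * (2 * n + 1) \<le> 2 * N + 1"
  shows "of_nat (m ^ CARD('d)) * hent q P (marks (box_Z n)) \<le> hent q P (marks (box_Z N))"
proof -
  define A :: "(int ^ 'd) set" where "A = {j. \<forall>i. 0 \<le> j $ i \<and> j $ i < int m}"
  \<comment> \<open>\<open>c j\<close> is the centre of the j-th translate, counted from the corner
    of the large box: its lower faces lie at \<open>- N + (2 * n + 1) * j $ i\<close>.\<close>
  define c :: "int ^ 'd \<Rightarrow> int ^ 'd" where "c j = (\<chi> i. int n - int N + (2 * int n + 1) * j $ i)" for j
  let ?J = "\<lambda>j. (\<lambda>(k, x). (k, x + c j)) ` marks (box_Z n)"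
  have disj: "disjoint_family_on ?J A"
    unfolding disjoint_family_on_def
  proof (intro ballI impI)
    fix j j' :: "int ^ 'd" assume "j \<noteq> j'"
    then obtain i where i: "j $ i \<noteq> j' $ i" by (auto simp: vec_eq_iff)
    have False if "x \<in> box_Z n" "y \<in> box_Z n" "x + c j = y + c j'" for x y
    proof -
      have "\<bar>x $ i\<bar> \<le> int n" "\<bar>y $ i\<bar> \<le> int n" using that by (auto simp: box_Z_def)
      moreover have "x $ i + (2 * int n + 1) * j $ i = y $ i + (2 * int n + 1) * j' $ i"
        using arg_cong[OF that(3), of "\<lambda>v. v $ i"] by (simp add: c_def)
      ultimately have "\<bar>(2 * int n + 1) * (j $ i - j' $ i)\<bar> < 2 * int n + 1" by (simp add: algebra_simps abs_if split: if_splits)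
      moreover have "\<bar>(2 * int n + 1) * (j $ i - j' $ i)\<bar> \<ge> (2 * int n + 1) * 1"
        unfolding abs_mult using i by (intro mult_mono) auto
      ultimately show False by simp
    qed
    then show "?J j \<inter> ?J j' = {}" by auto
  qed
  have sub: "?J j \<subseteq> marks (box_Z N)" if "j \<in> A" for j
  proof -
    have "x + c j \<in> box_Z N" if x: "x \<in> box_Z n" for x
      unfolding box_Z_def
    proof (clarsimp)
      fix i
      have j: "0 \<le> j $ i" "j $ i \<le> int m - 1" using \<open>j \<in> A\<close> by (auto simp: A_def)
      have "int (m * (2 * n + 1)) \<le> int (2 * N + 1)" using m by (simp only: of_nat_le_iff)
      then have "int m * (2 * int n + 1) \<le> 2 * int N + 1"
        by (simp only: of_nat_mult of_nat_add of_nat_numeral of_nat_1)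
      moreover have "(2 * int n + 1) * j $ i \<le> (2 * int n + 1) * (int m - 1)" using j by (intro mult_left_mono) auto
      moreover have "0 \<le> (2 * int n + 1) * j $ i" using j by simp
      moreover have "\<bar>x $ i\<bar> \<le> int n" using x by (simp add: box_Z_def)
      ultimately show "\<bar>x $ i + c j $ i\<bar> \<le> int N" by (simp add: c_def algebra_simps abs_le_iff)
    qed
    then show ?thesis by auto
  qed
  have "of_nat (m ^ CARD('d)) * hent q P (marks (box_Z n)) = (\<Sum>j\<in>A. hent q P (marks (box_Z n)))"
    using card_cube(2)[of 0 "int m", where 'd='d] by (simp add: A_def)
  also have "\<dots> \<le> (\<Sum>j\<in>A. hent q P (?J j))"
    by (intro sum_mono hent_shift[OF P]) auto
  also have "\<dots> \<le> hent q P (\<Union>j\<in>A. ?J j)"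
    using card_cube(1)[of 0 "int m", where 'd='d]
    by (intro hent_superadd_sum[OF cinvD(1,2,3)[OF P] _ disj]) (auto simp: A_def)
  also have "\<dots> \<le> hent q P (marks (box_Z N))" using sub by (intro hent_mono) blast
  finally show ?thesis .
qed

text \<open>Fekete's argument: all values stay below the supremum, and a box whose value exceeds a
  hands it on to every large box, up to the fraction of volume that its disjoint translates
  cover.\<close>

lemma hent_tendsto_dens:
  fixes P :: "'d::finite config measure"
  assumes P: "cinv I P"
  shows "(\<lambda>n. hent q P (marks (box_Z n)) / of_nat (card (box_Z n :: (int ^ 'd) set))) \<longlonglongrightarrow> dens q P"
    (is "?h \<longlonglongrightarrow> _")
proof (rule order_tendstoI)
  fix a assume "dens q P < a"
  moreover have "?h n \<le> dens q P" for n unfolding dens_def by (rule SUP_upper) simp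
  ultimately show "\<forall>\<^sub>F n in sequentially. ?h n < a"
    by (intro always_eventually allI) (rule le_less_trans)
next
  fix a assume "a < dens q P"
  then obtain n where n: "a < ?h n" unfolding dens_def by (auto simp: less_SUP_iff)
  define m where "m N = (2 * N + 1) div (2 * n + 1)" for N
  \<comment> \<open>The covered fraction of the volume of the box of radius N; it tends to
    1.\<close>
  define t where "t N = (real (m N) * real (2 * n + 1) / real (2 * N + 1)) ^ CARD('d)" for N
  have le: "ennreal (t N) * ?h n \<le> ?h N" for N
  proof -
    let ?d = "CARD('d)"
    have "of_nat (m N ^ ?d) * hent q P (marks (box_Z n)) \<le> hent q P (marks (box_Z N))"
      unfolding m_def by (rule hent_box_packing[OF P], rule div_times_less_eq_dividend)
    then have *: "of_nat (m N ^ ?d) * hent q P (marks (box_Z n)) / of_nat ((2 * N + 1) ^ ?d) \<le> ?h N"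
      unfolding card_box_Z by (rule divide_right_mono_ennreal)
    have e: "(of_nat k :: ennreal) = ennreal (real k)" for k by (simp add: ennreal_of_nat_eq_real_of_nat)
    have pos: "real ((2 * n + 1) ^ ?d) > 0" "real ((2 * N + 1) ^ ?d) > 0" by simp_all
    have "ennreal (t N) * ?h n = ennreal (t N) * (inverse (of_nat ((2 * n + 1) ^ ?d)) * hent q P (marks (box_Z n)))"
      by (simp add: card_box_Z divide_ennreal_def mult.commute)
    also have "\<dots> = ennreal (t N * inverse (real ((2 * n + 1) ^ ?d))) * hent q P (marks (box_Z n))"
      unfolding e using pos by (simp add: inverse_ennreal ennreal_mult' t_def mult.assoc del: of_nat_power)
    also have "t N * inverse (real ((2 * n + 1) ^ ?d)) = real (m N ^ ?d) * inverse (real ((2 * N + 1) ^ ?d))"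
    proof -
      have "(a * c / b) ^ k * inverse (c ^ k) = a ^ k * inverse (b ^ k)" if "c \<noteq> 0" "b \<noteq> 0" for a b c :: real and k
        using that by (simp add: power_mult_distrib power_divide field_simps)
      from this[of "real (2 * n + 1)" "real (2 * N + 1)"] show ?thesis
        unfolding t_def of_nat_power by simp
    qed
    also have "ennreal \<dots> * hent q P (marks (box_Z n)) = of_nat (m N ^ ?d) * hent q P (marks (box_Z n)) / of_nat ((2 * N + 1) ^ ?d)"
      unfolding e divide_ennreal_def using pos by (simp add: inverse_ennreal ennreal_mult' mult_ac del: of_nat_power)
    finally show ?thesis using * by simp
  qed
  have "t \<longlonglongrightarrow> 1 ^ CARD('d)"
    unfolding t_def
  proof (rule tendsto_power)
    let ?c = "real (2 * n + 1)"
    show "(\<lambda>N. real (m N) * ?c / real (2 * N + 1)) \<longlonglongrightarrow> 1"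
    proof (rule tendsto_sandwich)
      have "real (2 * N + 1) - ?c \<le> real (m N) * ?c \<and> real (m N) * ?c \<le> real (2 * N + 1)" for N
      proof -
        have "(2 * N + 1) = m N * (2 * n + 1) + (2 * N + 1) mod (2 * n + 1)" unfolding m_def by (rule div_mult_mod_eq[symmetric])
        moreover have "(2 * N + 1) mod (2 * n + 1) < 2 * n + 1" by simp
        ultimately have "2 * N + 1 \<le> m N * (2 * n + 1) + (2 * n + 1)" "m N * (2 * n + 1) \<le> 2 * N + 1" by linarith+
        then have "real (2 * N + 1) \<le> real (m N * (2 * n + 1) + (2 * n + 1))" "real (m N * (2 * n + 1)) \<le> real (2 * N + 1)"
          unfolding of_nat_le_iff .
        moreover have "real (a * c + c) = real a * real c + real c" "real (a * c) = real a * real c" for a c by simp_all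
        ultimately show ?thesis by (simp only: diff_le_eq)
      qed
      then show "\<forall>\<^sub>F N in sequentially. (real (2 * N + 1) - ?c) / real (2 * N + 1) \<le> real (m N) * ?c / real (2 * N + 1)"
        "\<forall>\<^sub>F N in sequentially. real (m N) * ?c / real (2 * N + 1) \<le> 1"
        by (auto intro!: always_eventually divide_right_mono simp del: of_nat_mult of_nat_add of_nat_Suc)
      have "(\<lambda>N. 1 - ?c * inverse (real (2 * N + 1))) \<longlonglongrightarrow> 1 - ?c * 0"
        by (intro tendsto_intros filterlim_compose[OF tendsto_inverse_0_at_top] filterlim_compose[OF filterlim_real_sequentially])
           (auto intro!: filterlim_subseq strict_monoI)
      moreover have "1 - ?c * inverse (real (2 * N + 1)) = (real (2 * N + 1) - ?c) / real (2 * N + 1)" for N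
        by (simp add: field_simps)
      ultimately show "(\<lambda>N. (real (2 * N + 1) - ?c) / real (2 * N + 1)) \<longlonglongrightarrow> 1" by simp
    qed simp
  qed
  then have "(\<lambda>N. ennreal (t N) * ?h n) \<longlonglongrightarrow> ennreal 1 * ?h n"
    by (intro tendsto_mult_ennreal tendsto_ennrealI tendsto_const) auto
  then have "\<forall>\<^sub>F N in sequentially. a < ennreal (t N) * ?h n"
    using n by (intro order_tendstoD) auto
  then show "\<forall>\<^sub>F N in sequentially. a < ?h N"
    by eventually_elim (rule less_le_trans[OF _ le])
qed

lemma entropy_dens_eq_dens:
  fixes P :: "'d::finite config measure"
  assumes "P \<in> shift_invariant_probs"
  shows "entropy_dens q P = dens q P"
proof -
  have c: "cinv (marks UNIV) P" using assms by (rule shift_invariant_imp_cinv)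
  show ?thesis
    unfolding entropy_dens_def rel_entropy_law_on[OF cinvD(1,2)[OF c]]
    by (rule limI[OF hent_tendsto_dens[OF c]])
qed

lemma hent_le_dens:
  fixes P :: "'d::finite config measure"
  shows "hent q P (marks (box_Z n)) \<le> of_nat (card (box_Z n :: (int ^ 'd) set)) * dens q P"
proof -
  have "hent q P (marks (box_Z n)) / of_nat (card (box_Z n :: (int ^ 'd) set)) \<le> dens q P"
    unfolding dens_def by (rule SUP_upper) simp
  then have "hent q P (marks (box_Z n)) / of_nat (card (box_Z n :: (int ^ 'd) set)) * of_nat (card (box_Z n :: (int ^ 'd) set))
      \<le> dens q P * of_nat (card (box_Z n :: (int ^ 'd) set))"
    by (rule mult_right_mono) simp
  then show ?thesis using card_box_pos[of n, where 'd='d]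
    by (simp only: ennreal_divide_mult_cancel of_nat_less_top) (simp only: mult.commute)
qed

text \<open>A supremum of continuous functionals: one box and one test already witness
  \<open>c < dens q P\<close>, and the integral of that test converges.\<close>

lemma dens_lower_semicontinuous:
  fixes P :: "'d::finite config measure"
  assumes conv: "\<And>f. cyl (marks UNIV) f \<Longrightarrow> (\<lambda>n. \<integral>\<omega>. f \<omega> \<partial>\<mu> n) \<longlonglongrightarrow> (\<integral>\<omega>. f \<omega> \<partial>P)"
    and c: "c < dens q P"
  shows "\<forall>\<^sub>F n in sequentially. c < dens q (\<mu> n)"
proof -
  from c obtain k where k: "c < hent q P (marks (box_Z k)) / of_nat (card (box_Z k :: (int ^ 'd) set))"
    unfolding dens_def by (auto simp: less_SUP_iff)
  let ?b = "of_nat (card (box_Z k :: (int ^ 'd) set)) :: ennreal"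
  have b: "?b > 0" "?b < top" by (rule card_box_pos, rule of_nat_less_top)
  have less: "c < x / ?b \<longleftrightarrow> c * ?b < x" for x
    using ennreal_mult_strict_right_mono[of c "x / ?b" ?b] mult_right_mono[of "x / ?b" c ?b] b
    by (metis ennreal_divide_mult_cancel leD leI zero_le)
  from k obtain f where f: "cyl (marks (box_Z k)) f" "(\<integral>\<omega>. exp (f \<omega>) \<partial>(reference q)) \<le> 1" "c * ?b < ennreal (\<integral>\<omega>. f \<omega> \<partial>P)"
    unfolding less hent_def by (auto simp: less_SUP_iff)
  have "cyl (marks UNIV) f" using f(1) by (rule cyl_mono) auto
  then have "(\<lambda>n. ennreal (\<integral>\<omega>. f \<omega> \<partial>\<mu> n)) \<longlonglongrightarrow> ennreal (\<integral>\<omega>. f \<omega> \<partial>P)"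
    by (intro tendsto_ennrealI conv)
  then have "\<forall>\<^sub>F n in sequentially. c * ?b < ennreal (\<integral>\<omega>. f \<omega> \<partial>\<mu> n)"
    using f(3) by (rule order_tendstoD)
  then show ?thesis
  proof eventually_elim
    case (elim n)
    then have "c * ?b < hent q (\<mu> n) (marks (box_Z k))" using hent_upper[OF f(1,2)] by (rule less_le_trans)
    then have "c < hent q (\<mu> n) (marks (box_Z k)) / ?b" by (simp add: less)
    also have "\<dots> \<le> dens q (\<mu> n)" unfolding dens_def by (rule SUP_upper) simp
    finally show ?case .
  qed
qed

section \<open>Mixtures\<close>

definition mix :: "'b pmf \<Rightarrow> ('b \<Rightarrow> 'a measure) \<Rightarrow> 'a measure" where
  "mix \<psi> P = measure_pmf \<psi> \<bind> P"

context
  fixes P :: "'b \<Rightarrow> 'a measure" and N :: "'a measure" and \<psi> :: "'b pmf"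
  assumes prob: "\<And>a. prob_space (P a)" and sets_P: "\<And>a. sets (P a) = sets N"
begin

lemma mix_kernel: "P \<in> measurable (measure_pmf \<psi>) (subprob_algebra N)"
proof -
  have "P a \<in> space (subprob_algebra N)" for a
    using prob[of a] sets_P by (simp add: space_subprob_algebra prob_space_imp_subprob_space)
  then show ?thesis by simp
qed

lemma sets_mix: "sets (mix \<psi> P) = sets N"
  unfolding mix_def using sets_P by (intro sets_bind) auto

lemma prob_mix: "prob_space (mix \<psi> P)"
  unfolding mix_def
  by (rule prob_space.prob_space_bind[OF measure_pmf.prob_space_axioms _ mix_kernel]) (simp add: prob)

lemma nn_integral_mix:
  "f \<in> borel_measurable N \<Longrightarrow> (\<integral>\<^sup>+x. f x \<partial>mix \<psi> P) = (\<integral>\<^sup>+a. (\<integral>\<^sup>+x. f x \<partial>P a) \<partial>measure_pmf \<psi>)"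
  unfolding mix_def by (rule nn_integral_bind[OF _ mix_kernel])

lemma integral_mix:
  fixes f :: "'a \<Rightarrow> real"
  assumes "f \<in> borel_measurable N" "\<And>x. \<bar>f x\<bar> \<le> B"
  shows "(\<integral>x. f x \<partial>mix \<psi> P) = (\<integral>a. (\<integral>x. f x \<partial>P a) \<partial>measure_pmf \<psi>)"
  unfolding mix_def
proof (rule integral_bind[OF assms(1) _ mix_kernel, of B 1])
  show "finite_measure (measure_pmf \<psi>)" by (rule measure_pmf.finite_measure_axioms)
  show "AE a in measure_pmf \<psi>. emeasure (P a) (space (P a)) \<le> ennreal 1"
    by (intro AE_I2) (simp add: prob_space.emeasure_space_1[OF prob])
qed (rule assms(2))

end

lemma nn_integral_pmf_countable:
  fixes f :: "'b::countable \<Rightarrow> ennreal"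
  shows "(\<integral>\<^sup>+a. f a \<partial>measure_pmf \<psi>) = infsum (\<lambda>a. ennreal (pmf \<psi> a) * f a) UNIV"
  by (subst infsum_ennreal_eq_nn_integral) (auto simp: nn_integral_measure_pmf)

lemma ennreal_add_le: "ennreal (a + b) \<le> ennreal a + ennreal b"
proof (cases "a < 0 \<or> b < 0")
  case True
  then show ?thesis
    by (auto simp: ennreal_neg intro!: ennreal_leI)
qed simp

lemma ennreal_integral_le_nn_integral:
  fixes f :: "'a \<Rightarrow> real"
  assumes "integrable M f"
  shows "ennreal (\<integral>x. f x \<partial>M) \<le> (\<integral>\<^sup>+x. ennreal (f x) \<partial>M)"
proof -
  have "(\<integral>x. f x \<partial>M) \<le> (\<integral>x. max 0 (f x) \<partial>M)"
    using assms by (intro integral_mono) auto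
  then have "ennreal (\<integral>x. f x \<partial>M) \<le> ennreal (\<integral>x. max 0 (f x) \<partial>M)" by (rule ennreal_leI)
  also have "\<dots> = (\<integral>\<^sup>+x. ennreal (max 0 (f x)) \<partial>M)"
    using assms by (intro nn_integral_eq_integral[symmetric]) auto
  also have "\<dots> = (\<integral>\<^sup>+x. ennreal (f x) \<partial>M)" by (intro nn_integral_cong) (auto simp: max_def ennreal_neg)
  finally show ?thesis .
qed

text \<open>For a fixed test the integral is linear in the law, so the supremum over tests is
  convex.\<close>

lemma hent_mix_le:
  fixes P :: "'b \<Rightarrow> 'd::finite config measure"
  assumes prob: "\<And>a. prob_space (P a)" and sets_P: "\<And>a. sets (P a) = sets (conf I)" and J: "J \<subseteq> I"
  shows "hent q (mix \<psi> P) J \<le> (\<integral>\<^sup>+a. hent q (P a) J \<partial>measure_pmf \<psi>)"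
  unfolding hent_def[of q "mix \<psi> P"]
proof (rule SUP_least)
  fix f :: "'d config \<Rightarrow> real" assume "f \<in> {f. cyl J f \<and> (\<integral>\<omega>. exp (f \<omega>) \<partial>(reference q)) \<le> 1}"
  then have f: "cyl J f" "(\<integral>\<omega>. exp (f \<omega>) \<partial>(reference q)) \<le> 1" by auto
  from cylE[OF f(1)] obtain B where B: "\<And>\<omega>. \<bar>f \<omega>\<bar> \<le> B" by metis
  have m: "f \<in> borel_measurable (conf I)" using f(1) J by (rule cyl_measurable) simp
  have "\<bar>\<integral>\<omega>. f \<omega> \<partial>P a\<bar> \<le> B" for a
  proof -
    interpret prob_space "P a" by (rule prob)
    have i: "integrable (P a) f" by (rule cyl_integrable[OF f(1) J sets_P prob])
    have "\<bar>\<integral>\<omega>. f \<omega> \<partial>P a\<bar> \<le> (\<integral>\<omega>. \<bar>f \<omega>\<bar> \<partial>P a)" by (rule integral_abs_bound)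
    also have "\<dots> \<le> (\<integral>\<omega>. B \<partial>P a)" using i B by (intro integral_mono) auto
    finally show ?thesis using prob_space by simp
  qed
  then have "integrable (measure_pmf \<psi>) (\<lambda>a. \<integral>\<omega>. f \<omega> \<partial>P a)"
    by (intro measure_pmf.integrable_const_bound[where B=B]) auto
  then have "ennreal (\<integral>\<omega>. f \<omega> \<partial>mix \<psi> P) \<le> (\<integral>\<^sup>+a. ennreal (\<integral>\<omega>. f \<omega> \<partial>P a) \<partial>measure_pmf \<psi>)"
    unfolding integral_mix[OF prob sets_P m B] by (rule ennreal_integral_le_nn_integral)
  also have "\<dots> \<le> (\<integral>\<^sup>+a. hent q (P a) J \<partial>measure_pmf \<psi>)"
    by (intro nn_integral_mono hent_upper f)
  finally show "ennreal (\<integral>\<omega>. f \<omega> \<partial>mix \<psi> P) \<le> (\<integral>\<^sup>+a. hent q (P a) J \<partial>measure_pmf \<psi>)" .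
qed

lemma dens_mix_le:
  fixes P :: "'b \<Rightarrow> 'd::finite config measure"
  assumes prob: "\<And>a. prob_space (P a)" and sets_P: "\<And>a. sets (P a) = sets (conf I)" and I: "marks UNIV \<subseteq> I"
  shows "dens q (mix \<psi> P) \<le> (\<integral>\<^sup>+a. dens q (P a) \<partial>measure_pmf \<psi>)"
  unfolding dens_def[of q "mix \<psi> P"]
proof (rule SUP_least)
  fix n :: nat
  let ?b = "of_nat (card (box_Z n :: (int ^ 'd) set)) :: ennreal"
  have "hent q (mix \<psi> P) (marks (box_Z n)) / ?b \<le> (\<integral>\<^sup>+a. hent q (P a) (marks (box_Z n)) \<partial>measure_pmf \<psi>) / ?b"
    using I by (intro divide_right_mono_ennreal hent_mix_le[OF prob sets_P]) auto
  also have "\<dots> = (\<integral>\<^sup>+a. hent q (P a) (marks (box_Z n)) / ?b \<partial>measure_pmf \<psi>)"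
    by (rule nn_integral_divide[symmetric]) simp
  also have "\<dots> \<le> (\<integral>\<^sup>+a. dens q (P a) \<partial>measure_pmf \<psi>)"
    unfolding dens_def by (intro nn_integral_mono SUP_upper) simp
  finally show "hent q (mix \<psi> P) (marks (box_Z n)) / ?b \<le> (\<integral>\<^sup>+a. dens q (P a) \<partial>measure_pmf \<psi>)" .
qed

lemma mix_cinv:
  fixes P :: "'b \<Rightarrow> 'd::finite config measure"
  assumes "\<And>a. cinv I (P a)"
  shows "cinv I (mix \<psi> P)"
  unfolding cinv_def
proof (intro conjI allI impI)
  note P = cinvD[OF assms]
  show "prob_space (mix \<psi> P)" by (rule prob_mix[OF P(1,2)])
  show "sets (mix \<psi> P) = sets (conf I)" by (rule sets_mix[OF P(1,2)])
  show "\<exists>K. I = K \<times> UNIV \<and> {1..} \<subseteq> K" using assms unfolding cinv_def by blast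
  fix z :: "int ^ 'd" and f :: "'d config \<Rightarrow> real" assume f: "cyl I f"
  from cylE[OF f] obtain F B where F: "finite F" "F \<subseteq> I" "depends_on F f" and B: "\<And>\<omega>. \<bar>f \<omega>\<bar> \<le> B" by metis
  have m: "f \<in> borel_measurable (conf I)" using f by (rule cyl_measurable) simp_all
  have m': "(\<lambda>\<omega>. f (tshift z \<omega>)) \<in> borel_measurable (conf I)"
    using cinv_shift_cyl[OF assms f] by (rule cyl_measurable) simp_all
  show "(\<integral>\<omega>. f (tshift z \<omega>) \<partial>mix \<psi> P) = (\<integral>\<omega>. f \<omega> \<partial>mix \<psi> P)"
    unfolding integral_mix[OF P(1,2) m B] integral_mix[OF P(1,2) m' B] P(4)[OF f] ..
qed

section \<open>Concavity of the entropy up to a constant\<close>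

text \<open>Reduces a sum of suprema to arbitrary selections of one element per summand. The slack y
  takes up the summand split off in the induction.\<close>

lemma sum_SUP_le:
  fixes g :: "'b \<Rightarrow> 'c \<Rightarrow> ennreal"
  assumes "finite F" "T \<noteq> {}" "\<And>\<phi>. (\<And>a. \<phi> a \<in> T) \<Longrightarrow> (\<Sum>a\<in>F. g a (\<phi> a)) + y \<le> R"
  shows "(\<Sum>a\<in>F. SUP f\<in>T. g a f) + y \<le> R"
  using assms(1,3)
proof (induction F arbitrary: y rule: finite_induct)
  case empty
  from assms(2) obtain t where "t \<in> T" by blast
  with empty[of "\<lambda>_. t"] show ?case by simp
next
  case (insert a F)
  have "(\<Sum>b\<in>F. SUP f\<in>T. g b f) + (g a f + y) \<le> R" if f: "f \<in> T" for f
  proof (rule insert.IH)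
    fix \<phi> :: "'b \<Rightarrow> 'c" assume "\<And>b. \<phi> b \<in> T"
    with f insert.prems[of "\<phi>(a := f)"] insert.hyps
    have "(\<Sum>b\<in>insert a F. g b ((\<phi>(a := f)) b)) + y \<le> R" by auto
    moreover have "(\<Sum>b\<in>F. g b ((\<phi>(a := f)) b)) = (\<Sum>b\<in>F. g b (\<phi> b))"
      using insert.hyps by (intro sum.cong) auto
    ultimately show "(\<Sum>b\<in>F. g b (\<phi> b)) + (g a f + y) \<le> R" using insert.hyps by (simp add: ac_simps)
  qed
  then have "(SUP f\<in>T. g a f + ((\<Sum>b\<in>F. SUP f\<in>T. g b f) + y)) \<le> R"
    by (intro SUP_least) (simp add: ac_simps)
  then have "(SUP f\<in>T. g a f) + ((\<Sum>b\<in>F. SUP f\<in>T. g b f) + y) \<le> R"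
    unfolding ennreal_SUP_add_left[OF assms(2)] .
  then show ?case using insert.hyps by (simp add: add.assoc)
qed

lemma cyl_sum_exp:
  assumes "finite F" "\<And>a. a \<in> F \<Longrightarrow> cyl J (\<phi> a)"
  shows "cyl J (\<lambda>\<omega>. \<Sum>a\<in>F. exp (\<phi> a \<omega>))"
  using assms
proof (induction F rule: finite_induct)
  case empty
  show ?case by (simp add: cyl_const)
next
  case (insert a F)
  then have "cyl J (\<lambda>\<omega>. exp (\<phi> a \<omega>) + (\<Sum>a\<in>F. exp (\<phi> a \<omega>)))" by (intro cyl_add cyl_exp) auto
  with insert.hyps show ?case by simp
qed

text \<open>Soft maximum: the logarithm of 1 plus the sum of the exponentials dominates all chosen
  tests at once, and its exponential moment is at most \<open>card F + 1\<close>. The loss is thus a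
  constant that does not depend on J. The summand 1 makes the function nonnegative, as
  \<open>dom\<close> demands.\<close>

lemma hent_concave:
  fixes P :: "'d::finite config measure" and Q :: "'b \<Rightarrow> 'd config measure"
  assumes F: "finite F" and P: "prob_space P" "sets P = sets (conf I)"
    and Q: "\<And>a. a \<in> F \<Longrightarrow> prob_space (Q a)" "\<And>a. a \<in> F \<Longrightarrow> sets (Q a) = sets (conf (I' a))" "\<And>a. a \<in> F \<Longrightarrow> J \<subseteq> I' a"
    and J: "J \<subseteq> I" "J \<subseteq> marks UNIV"
    and w: "\<And>a. 0 \<le> w a"
    and dom: "\<And>h. cyl J h \<Longrightarrow> (\<And>\<omega>. 0 \<le> h \<omega>) \<Longrightarrow> (\<Sum>a\<in>F. w a * (\<integral>\<omega>. h \<omega> \<partial>Q a)) \<le> (\<integral>\<omega>. h \<omega> \<partial>P)"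
  shows "(\<Sum>a\<in>F. ennreal (w a) * hent q (Q a) J) \<le> hent q P J + ennreal (ln (real (card F) + 1))"
proof -
  let ?T = "{f. cyl J f \<and> (\<integral>\<omega>. exp (f \<omega>) \<partial>(reference q)) \<le> 1}"
  let ?c = "real (card F) + 1"
  interpret P: prob_space P by fact
  interpret R: prob_space "reference q" by (rule prob_reference)
  have main: "(\<Sum>a\<in>F. ennreal (w a) * ennreal (\<integral>\<omega>. \<phi> a \<omega> \<partial>Q a)) \<le> hent q P J + ennreal (ln ?c)"
    if \<phi>: "\<And>a. \<phi> a \<in> ?T" for \<phi>
  proof -
    define h where "h \<omega> = ln (1 + (\<Sum>a\<in>F. exp (\<phi> a \<omega>)))" for \<omega>
    have s0: "0 \<le> (\<Sum>a\<in>F. exp (\<phi> a \<omega>))" for \<omega> by (intro sum_nonneg) simp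
    have cs: "cyl J (\<lambda>\<omega>. 1 + (\<Sum>a\<in>F. exp (\<phi> a \<omega>)))"
      using \<phi> by (intro cyl_add cyl_const cyl_sum_exp F) auto
    have h0: "0 \<le> h \<omega>" for \<omega> using s0[of \<omega>] unfolding h_def by (intro ln_ge_zero) simp
    have hge: "\<phi> a \<omega> \<le> h \<omega>" if "a \<in> F" for a \<omega>
    proof -
      have "exp (\<phi> a \<omega>) \<le> (\<Sum>a\<in>F. exp (\<phi> a \<omega>))" using F that by (intro member_le_sum) auto
      then have "exp (\<phi> a \<omega>) \<le> exp (h \<omega>)" using s0[of \<omega>] by (simp add: h_def)
      then show ?thesis by simp
    qed
    have ch: "cyl J h"
    proof -
      from cylE[OF cs] obtain F' B where 1: "finite F'" "F' \<subseteq> J" "depends_on F' (\<lambda>\<omega>. 1 + (\<Sum>a\<in>F. exp (\<phi> a \<omega>)))"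
        "\<And>\<omega>. \<bar>1 + (\<Sum>a\<in>F. exp (\<phi> a \<omega>))\<bar> \<le> B" "B > 0" by metis
      have "depends_on F' h" unfolding h_def using depends_on_comp[OF 1(3), of ln] .
      moreover have "\<bar>h \<omega>\<bar> \<le> ln B" for \<omega>
        using h0[of \<omega>] 1(4)[of \<omega>] s0[of \<omega>] 1(5) unfolding h_def by simp
      ultimately show ?thesis using 1(1,2) by (intro cylI[of F'])
    qed
    have exph: "exp (h \<omega> + - ln ?c) = (1 + (\<Sum>a\<in>F. exp (\<phi> a \<omega>))) / ?c" for \<omega>
      using s0[of \<omega>] by (simp add: h_def exp_diff add_pos_nonneg)
    have ie: "integrable (reference q) (\<lambda>\<omega>. exp (\<phi> a \<omega>))" for a
      using \<phi>[of a] J(2) by (intro cyl_integrable[OF _ _ sets_reference prob_reference, of J] cyl_exp) auto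
    have "(\<integral>\<omega>. exp (h \<omega> + - ln ?c) \<partial>(reference q)) = (1 + (\<Sum>a\<in>F. \<integral>\<omega>. exp (\<phi> a \<omega>) \<partial>(reference q))) / ?c"
      unfolding exph using ie R.prob_space by simp
    also have "\<dots> \<le> (1 + (\<Sum>a\<in>F. 1)) / ?c"
      using \<phi> by (intro divide_right_mono add_left_mono sum_mono) auto
    also have "\<dots> = 1" by (simp add: add.commute)
    finally have up: "ennreal (\<integral>\<omega>. h \<omega> + - ln ?c \<partial>P) \<le> hent q P J"
      using ch by (intro hent_upper cyl_add cyl_const)
    have ih: "integrable P h" by (rule cyl_integrable[OF ch J(1) P(2,1)])
    have wle: "w a * max 0 (\<integral>\<omega>. \<phi> a \<omega> \<partial>Q a) \<le> w a * (\<integral>\<omega>. h \<omega> \<partial>Q a)" if a: "a \<in> F" for a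
    proof (rule mult_left_mono[OF _ w])
      have i: "integrable (Q a) h" "integrable (Q a) (\<phi> a)"
        using ch \<phi>[of a] Q[OF a] by (auto intro: cyl_integrable[of J _ "I' a"])
      have "(\<integral>\<omega>. \<phi> a \<omega> \<partial>Q a) \<le> (\<integral>\<omega>. h \<omega> \<partial>Q a)" by (rule integral_mono[OF i(2,1) hge[OF a]])
      moreover have "0 \<le> (\<integral>\<omega>. h \<omega> \<partial>Q a)" using h0 by simp
      ultimately show "max 0 (\<integral>\<omega>. \<phi> a \<omega> \<partial>Q a) \<le> (\<integral>\<omega>. h \<omega> \<partial>Q a)" by simp
    qed
    have "(\<Sum>a\<in>F. ennreal (w a) * ennreal (\<integral>\<omega>. \<phi> a \<omega> \<partial>Q a)) = ennreal (\<Sum>a\<in>F. w a * max 0 (\<integral>\<omega>. \<phi> a \<omega> \<partial>Q a))"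
      using w by (auto simp: sum_ennreal[symmetric] ennreal_mult ennreal_neg max_def intro!: sum.cong)
    also have "\<dots> \<le> ennreal (\<integral>\<omega>. h \<omega> \<partial>P)"
      by (intro ennreal_leI order.trans[OF sum_mono[OF wle] dom[OF ch h0]])
    also have "(\<integral>\<omega>. h \<omega> \<partial>P) = (\<integral>\<omega>. h \<omega> + - ln ?c \<partial>P) + ln ?c"
      using ih P.prob_space by simp
    also have "ennreal \<dots> \<le> ennreal (\<integral>\<omega>. h \<omega> + - ln ?c \<partial>P) + ennreal (ln ?c)" by (rule ennreal_add_le)
    also have "\<dots> \<le> hent q P J + ennreal (ln ?c)" using up by (rule add_right_mono)
    finally show ?thesis .
  qed
  have "(\<Sum>a\<in>F. ennreal (w a) * hent q (Q a) J) = (\<Sum>a\<in>F. SUP f\<in>?T. ennreal (w a) * ennreal (\<integral>\<omega>. f \<omega> \<partial>Q a))"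
    unfolding hent_def by (intro sum.cong SUP_mult_left_ennreal refl)
  also have "\<dots> + 0 \<le> hent q P J + ennreal (ln ?c)"
    using main by (intro sum_SUP_le F hent_tests_nonempty) simp
  finally show ?thesis by simp
qed

lemma card_box_tendsto: "(\<lambda>n. ennreal c / of_nat (card (box_Z n :: (int ^ 'd::finite) set))) \<longlonglongrightarrow> 0"
proof -
  let ?b = "\<lambda>n. card (box_Z n :: (int ^ 'd) set)"
  have ge: "real n \<le> real (?b n)" for n
  proof -
    have "n \<le> 2 * n + 1" by simp
    also have "\<dots> \<le> (2 * n + 1) ^ CARD('d)" by (rule self_le_power) auto
    finally show ?thesis unfolding card_box_Z of_nat_le_iff .
  qed
  have "filterlim (\<lambda>n. real (?b n)) at_top sequentially"
    using ge by (rule filterlim_at_top_mono[OF filterlim_real_sequentially always_eventually[OF allI]])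
  then have "(\<lambda>n. \<bar>c\<bar> / real (?b n)) \<longlonglongrightarrow> 0" by (rule real_tendsto_divide_at_top[OF tendsto_const])
  then have lim: "(\<lambda>n. ennreal (\<bar>c\<bar> / real (?b n))) \<longlonglongrightarrow> ennreal 0" by (rule tendsto_ennrealI)
  have "ennreal c / of_nat (?b n) \<le> ennreal (\<bar>c\<bar> / real (?b n))" for n
  proof -
    have "real (?b n) > 0" by (simp add: card_box_Z)
    then have "ennreal (\<bar>c\<bar> / real (?b n)) = ennreal \<bar>c\<bar> / of_nat (?b n)"
      by (simp add: divide_ennreal[symmetric] ennreal_of_nat_eq_real_of_nat)
    then show ?thesis by (simp add: divide_right_mono_ennreal ennreal_leI)
  qed
  note le = this
  show ?thesis
  proof (rule tendsto_sandwich[OF _ _ tendsto_const])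
    show "(\<lambda>n. ennreal (\<bar>c\<bar> / real (?b n))) \<longlonglongrightarrow> 0" using lim by simp
  qed (use le in simp_all)
qed

text \<open>The constant lost in \<open>hent_concave\<close> disappears after division by the
  volume. Strictly positive weights exclude a product of 0 and \<infinity> in the limit. Together
  with \<open>dens_mix_le\<close> this is affinity of the entropy density.\<close>

lemma dens_concave:
  fixes P :: "'d::finite config measure" and Q :: "'b \<Rightarrow> 'd config measure"
  assumes F: "finite F" and P: "cinv I P" and Q: "\<And>a. a \<in> F \<Longrightarrow> cinv (I' a) (Q a)"
    and w: "\<And>a. 0 < w a"
    and dom: "\<And>h. cyl (marks UNIV) h \<Longrightarrow> (\<And>\<omega>. 0 \<le> h \<omega>) \<Longrightarrow> (\<Sum>a\<in>F. w a * (\<integral>\<omega>. h \<omega> \<partial>Q a)) \<le> (\<integral>\<omega>. h \<omega> \<partial>P)"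
  shows "(\<Sum>a\<in>F. ennreal (w a) * dens q (Q a)) \<le> dens q P"
proof -
  let ?b = "\<lambda>n. of_nat (card (box_Z n :: (int ^ 'd) set)) :: ennreal"
  let ?c = "ln (real (card F) + 1)"
  have "(\<lambda>n. \<Sum>a\<in>F. ennreal (w a) * (hent q (Q a) (marks (box_Z n)) / ?b n)) \<longlonglongrightarrow> (\<Sum>a\<in>F. ennreal (w a) * dens q (Q a))"
  proof (rule tendsto_sum, rule tendsto_mult_ennreal[OF tendsto_const])
    fix a assume "a \<in> F"
    then show "(\<lambda>n. hent q (Q a) (marks (box_Z n)) / ?b n) \<longlonglongrightarrow> dens q (Q a)"
      by (rule hent_tendsto_dens[OF Q])
    show "\<not> (ennreal (w a) = 0 \<and> dens q (Q a) = \<infinity> \<or> ennreal (w a) = \<infinity> \<and> dens q (Q a) = 0)"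
      using w[of a] by auto
  qed
  moreover have "(\<lambda>n. hent q P (marks (box_Z n)) / ?b n + ennreal ?c / ?b n) \<longlonglongrightarrow> dens q P + 0"
    by (intro tendsto_add hent_tendsto_dens[OF P] card_box_tendsto)
  moreover have "(\<Sum>a\<in>F. ennreal (w a) * (hent q (Q a) (marks (box_Z n)) / ?b n)) \<le> hent q P (marks (box_Z n)) / ?b n + ennreal ?c / ?b n" for n
  proof -
    have sub: "marks (box_Z n) \<subseteq> marks UNIV" by auto
    have subI: "marks (box_Z n) \<subseteq> I" using sub cinvD(3)[OF P] by (rule order.trans)
    have subI': "marks (box_Z n) \<subseteq> I' a" if "a \<in> F" for a using sub cinvD(3)[OF Q[OF that]] by (rule order.trans)
    have "(\<Sum>a\<in>F. ennreal (w a) * (hent q (Q a) (marks (box_Z n)) / ?b n)) = (\<Sum>a\<in>F. ennreal (w a) * hent q (Q a) (marks (box_Z n))) / ?b n"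
      by (simp add: divide_ennreal_def sum_distrib_right mult.assoc)
    also have "\<dots> \<le> (hent q P (marks (box_Z n)) + ennreal ?c) / ?b n"
    proof (intro divide_right_mono_ennreal hent_concave[OF F cinvD(1,2)[OF P] cinvD(1,2)[OF Q]])
      show "(\<Sum>a\<in>F. w a * (\<integral>\<omega>. h \<omega> \<partial>Q a)) \<le> (\<integral>\<omega>. h \<omega> \<partial>P)" if "cyl (marks (box_Z n)) h" "\<And>\<omega>. 0 \<le> h \<omega>" for h
        using that by (intro dom cyl_mono[OF _ sub])
    qed (rule sub subI subI' less_imp_le[OF w] | assumption)+
    also have "\<dots> = hent q P (marks (box_Z n)) / ?b n + ennreal ?c / ?b n"
      by (simp add: divide_ennreal_def distrib_right)
    finally show ?thesis .
  qed
  ultimately show ?thesis by (intro LIMSEQ_le[of _ _ _ "dens q P"]) auto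
qed

section \<open>Uniform integrability from bounded entropy\<close>

lemma poisson_exp_integrable:
  assumes r: "r > 0"
  shows "integrable (measure_pmf (poisson_pmf r)) (\<lambda>n. exp (l * real n))"
proof -
  have e: "r ^ n / fact n * exp (- r) * exp (l * real n) = exp (- r) * ((r * exp l) ^ n /\<^sub>R fact n)" for n
    by (simp add: power_mult_distrib exp_of_nat_mult[symmetric] mult.commute divide_inverse mult_ac)
  have "summable (\<lambda>n. exp (- r) * ((r * exp l) ^ n /\<^sub>R fact n))"
    by (intro summable_mult summable_exp_generic)
  then have "integrable (count_space UNIV) (\<lambda>n. r ^ n / fact n * exp (- r) * exp (l * real n))"
    unfolding integrable_count_space_nat_iff e using r by (simp add: abs_mult)
  then show ?thesis
    unfolding measure_pmf_eq_density using r by (subst integrable_density) auto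
qed

text \<open>\<open>n - M\<close> is truncated subtraction, the excess of n over M, so the integrand
  equals 1 as soon as M reaches n.\<close>

lemma poisson_exp_tail:
  assumes r: "r > 0" and l: "l \<ge> 0"
  shows "(\<lambda>M. \<integral>n. exp (l * real (n - M)) \<partial>measure_pmf (poisson_pmf r)) \<longlonglongrightarrow> 1"
proof -
  have "(\<lambda>M. \<integral>n. exp (l * real (n - M)) \<partial>measure_pmf (poisson_pmf r)) \<longlonglongrightarrow> (\<integral>n. 1 \<partial>measure_pmf (poisson_pmf r))"
  proof (rule integral_dominated_convergence[OF _ _ poisson_exp_integrable[OF r, of l]])
    show "AE n in measure_pmf (poisson_pmf r). (\<lambda>M. exp (l * real (n - M))) \<longlonglongrightarrow> 1"
    proof (intro AE_I2 tendsto_eventually)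
      fix n show "\<forall>\<^sub>F M in sequentially. exp (l * real (n - M)) = 1"
        using eventually_ge_at_top[of n] by eventually_elim simp
    qed
    show "AE n in measure_pmf (poisson_pmf r). norm (exp (l * real (n - M))) \<le> exp (l * real n)" for M
      using l by (intro AE_I2) (simp add: mult_left_mono)
  qed simp_all
  then show ?thesis by simp
qed

lemma integral_reference_coordinate:
  fixes g :: "nat \<Rightarrow> real"
  assumes "k \<ge> 1"
  shows "(\<integral>\<omega>. g (\<omega> (k, x)) \<partial>(reference q)) = (\<integral>n. g n \<partial>measure_pmf (poisson_pmf (q k)))"
proof -
  let ?M = "\<lambda>(k, x). measure_pmf (poisson_pmf (q k)) :: nat measure"
  have p: "prob_space (?M i)" for i by (cases i) (simp add: measure_pmf.prob_space_axioms)
  have "distr (PiM (marks UNIV) ?M) (?M (k, x)) (\<lambda>\<omega>. \<omega> (k, x)) = ?M (k, x)"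
    using assms by (intro distr_PiM_component p) auto
  then have "(\<integral>n. g n \<partial>measure_pmf (poisson_pmf (q k))) = (\<integral>n. g n \<partial>distr (reference q) (?M (k, x)) (\<lambda>\<omega>. \<omega> (k, x)))"
    unfolding reference_def by simp
  also have "\<dots> = (\<integral>\<omega>. g (\<omega> (k, x)) \<partial>(reference q))"
  proof (rule integral_distr)
    show "(\<lambda>\<omega>. \<omega> (k, x)) \<in> measurable (reference q) (?M (k, x))"
      unfolding reference_def using assms by (intro measurable_component_singleton) auto
  qed simp
  finally show ?thesis ..
qed

lemma depends_on_coordinate: "depends_on {i} (\<lambda>\<omega>. h (\<omega> i))"
  by (intro depends_onI arg_cong[where f=h]) simp

text \<open>Entropy inequality for the excess over M. The cutoff N only makes the test bounded and
  does not enter the estimate; \<open>- ln E\<close> normalises the exponential moment.\<close>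

lemma mean_tail:
  assumes P: "prob_space P" "sets P = sets (conf I)" and k: "k \<ge> 1" "(k, x) \<in> I" and q: "q k > 0"
    and C: "hent q P {(k, x)} \<le> ennreal C" "0 \<le> C" and l: "l > 0"
  shows "l * (\<integral>\<omega>. real (min (\<omega> (k, x) - M) N) \<partial>P)
    \<le> C + ln (\<integral>n. exp (l * real (n - M)) \<partial>measure_pmf (poisson_pmf (q k)))"
proof -
  let ?p = "measure_pmf (poisson_pmf (q k))"
  interpret P: prob_space P by fact
  define E where "E = (\<integral>n. exp (l * real (n - M)) \<partial>?p)"
  have int: "integrable ?p (\<lambda>n. exp (l * real (n - M)))"
    by (rule Bochner_Integration.integrable_bound[OF poisson_exp_integrable[OF q, of l]]) (use l in \<open>auto simp: mult_left_mono\<close>)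
  have "(\<integral>n. 1 \<partial>?p) \<le> E" unfolding E_def using l by (intro integral_mono int) auto
  then have E: "E \<ge> 1" by simp
  define f where "f \<omega> = l * real (min (\<omega> (k, x) - M) N) + - ln E" for \<omega> :: "'a config"
  have c0: "cyl {(k, x)} (\<lambda>\<omega>. l * real (min (\<omega> (k, x) - M) N))"
    using l by (intro cylI[of "{(k, x)}" _ _ "l * real N"] depends_on_coordinate) (auto simp: abs_mult mult_left_mono)
  then have c: "cyl {(k, x)} f" unfolding f_def by (intro cyl_add cyl_const)
  have "(\<integral>\<omega>. exp (f \<omega>) \<partial>(reference q)) = (\<integral>n. exp (l * real (min (n - M) N) + - ln E) \<partial>?p)"
    unfolding f_def by (rule integral_reference_coordinate[OF k(1)])
  also have "\<dots> \<le> (\<integral>n. exp (l * real (n - M)) / E \<partial>?p)"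
  proof (rule integral_mono)
    show "integrable ?p (\<lambda>n. exp (l * real (min (n - M) N) + - ln E))"
      by (rule measure_pmf.integrable_const_bound[where B="exp (l * real N + - ln E)"]) (use l in \<open>auto simp: mult_left_mono\<close>)
    show "exp (l * real (min (n - M) N) + - ln E) \<le> exp (l * real (n - M)) / E" for n
      using E l by (simp add: exp_diff divide_right_mono mult_left_mono)
  qed (use int in simp)
  also have "\<dots> = 1" using E unfolding E_def[symmetric] by (simp add: E_def[symmetric])
  finally have "ennreal (\<integral>\<omega>. f \<omega> \<partial>P) \<le> ennreal C" by (intro order.trans[OF hent_upper C(1)] c)
  then have "(\<integral>\<omega>. f \<omega> \<partial>P) \<le> C" using C(2) by (simp add: ennreal_le_iff)
  moreover have "integrable P (\<lambda>\<omega>. l * real (min (\<omega> (k, x) - M) N))"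
    using k by (intro cyl_integrable[OF c0 _ P(2,1)]) auto
  ultimately show ?thesis unfolding f_def E_def[symmetric] using P.prob_space l by simp
qed

lemma nn_integral_nat_SUP:
  fixes g :: "'a \<Rightarrow> nat"
  assumes "g \<in> measurable P (count_space UNIV)"
  shows "(\<integral>\<^sup>+x. of_nat (g x) \<partial>P) = (SUP N. \<integral>\<^sup>+x. of_nat (min (g x) N) \<partial>P)"
proof -
  have "(SUP N. of_nat (min (g x) N) :: ennreal) = of_nat (g x)" for x
    by (intro antisym SUP_least SUP_upper2[of "g x"]) auto
  then have "(\<integral>\<^sup>+x. of_nat (g x) \<partial>P) = (\<integral>\<^sup>+x. (SUP N. of_nat (min (g x) N)) \<partial>P)" by simp
  also have "\<dots> = (SUP N. \<integral>\<^sup>+x. of_nat (min (g x) N) \<partial>P)"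
    using assms by (intro nn_integral_monotone_convergence_SUP) (auto simp: incseq_def le_fun_def)
  finally show ?thesis .
qed

lemma nn_integral_min_nat:
  fixes g :: "'a \<Rightarrow> nat"
  assumes "prob_space P" "g \<in> measurable P (count_space UNIV)"
  shows "(\<integral>\<^sup>+x. of_nat (min (g x) N) \<partial>P) = ennreal (\<integral>x. real (min (g x) N) \<partial>P)"
proof -
  interpret prob_space P by fact
  note [measurable] = assms(2)
  have "integrable P (\<lambda>x. real (min (g x) N))"
    by (rule integrable_const_bound[where B="real N"]) auto
  then show ?thesis by (simp add: nn_integral_eq_integral[symmetric] ennreal_of_nat_eq_real_of_nat)
qed

lemma measurable_coordinate: "i \<in> I \<Longrightarrow> sets P = sets (conf I) \<Longrightarrow> (\<lambda>\<omega>. \<omega> i) \<in> measurable P (count_space UNIV)"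
  by (subst measurable_cong_sets[of P "conf I" _ "count_space UNIV"]) (auto intro: measurable_component_singleton)

text \<open>Local convergence handles the means truncated at M. The tails are at most
  \<open>(C + ln (E l M)) / l\<close> uniformly in n: letting M grow sends \<open>E l M\<close> to
  1, and letting l grow then removes C.\<close>

lemma mean_limit:
  fixes \<mu> :: "nat \<Rightarrow> 'd::finite config measure"
  assumes mu: "\<And>n. prob_space (\<mu> n)" "\<And>n. sets (\<mu> n) = sets (conf UNIV)"
    and nu: "prob_space \<nu>" "sets \<nu> = sets (conf UNIV)"
    and conv: "\<And>f. cyl UNIV f \<Longrightarrow> (\<lambda>n. \<integral>\<omega>. f \<omega> \<partial>\<mu> n) \<longlonglongrightarrow> (\<integral>\<omega>. f \<omega> \<partial>\<nu>)"
    and k: "k \<ge> 1" and q: "q k > 0" and C: "\<And>n. hent q (\<mu> n) {(k, x)} \<le> ennreal C" "0 \<le> C"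
    and mean: "\<And>n. (\<integral>\<^sup>+\<omega>. of_nat (\<omega> (k, x)) \<partial>\<mu> n) = ennreal (m n)" "\<And>n. 0 \<le> m n" "m \<longlonglongrightarrow> m'"
  shows "(\<integral>\<^sup>+\<omega>. of_nat (\<omega> (k, x)) \<partial>\<nu>) = ennreal m'"
proof -
  define E where "E l M = (\<integral>n. exp (l * real (n - M)) \<partial>measure_pmf (poisson_pmf (q k)))" for l M
  define e where "e P M = (\<integral>\<omega>. real (min (\<omega> (k, x)) M) \<partial>P)" for P :: "'d config measure" and M
  have m': "0 \<le> m'" using mean(3) by (rule LIMSEQ_le_const) (use mean(2) in auto)
  have coord: "(\<lambda>\<omega>. \<omega> (k, x)) \<in> measurable P (count_space UNIV)" if "sets P = sets (conf UNIV)" for P :: "'d config measure"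
    using that by (intro measurable_coordinate) auto
  have ecyl: "cyl UNIV (\<lambda>\<omega>. real (min (\<omega> (k, x)) M))" for M
    by (intro cylI[of "{(k, x)}" _ _ "real M"] depends_on_coordinate) auto
  have elim: "(\<lambda>n. e (\<mu> n) M) \<longlonglongrightarrow> e \<nu> M" for M unfolding e_def by (intro conv ecyl)
  have emean: "e (\<mu> n) M \<le> m n" for n M
  proof -
    have "ennreal (e (\<mu> n) M) = (\<integral>\<^sup>+\<omega>. of_nat (min (\<omega> (k, x)) M) \<partial>\<mu> n)"
      unfolding e_def by (rule nn_integral_min_nat[OF mu(1) coord[OF mu(2)], symmetric])
    also have "\<dots> \<le> (\<integral>\<^sup>+\<omega>. of_nat (\<omega> (k, x)) \<partial>\<mu> n)" by (intro nn_integral_mono) simp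
    finally show ?thesis using mean(1,2) by (simp add: ennreal_le_iff)
  qed
  have tail: "m n \<le> e (\<mu> n) M + (C + ln (E l M)) / l" if l: "l > 0" for n M l
  proof -
    have mm: "(\<lambda>\<omega>. \<omega> (k, x) - M) \<in> measurable (\<mu> n) (count_space UNIV)"
      using coord[OF mu(2)] by (rule measurable_compose) simp
    have "(\<integral>\<^sup>+\<omega>. of_nat (\<omega> (k, x) - M) \<partial>\<mu> n) \<le> ennreal ((C + ln (E l M)) / l)"
      unfolding nn_integral_nat_SUP[OF mm]
    proof (rule SUP_least)
      fix N
      have "l * (\<integral>\<omega>. real (min (\<omega> (k, x) - M) N) \<partial>\<mu> n) \<le> C + ln (E l M)"
        unfolding E_def by (rule mean_tail[where I=UNIV]) (use mu k q C l in auto)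
      then have "(\<integral>\<omega>. real (min (\<omega> (k, x) - M) N) \<partial>\<mu> n) \<le> (C + ln (E l M)) / l"
        using l by (simp add: pos_le_divide_eq mult.commute)
      then show "(\<integral>\<^sup>+\<omega>. of_nat (min (\<omega> (k, x) - M) N) \<partial>\<mu> n) \<le> ennreal ((C + ln (E l M)) / l)"
        unfolding nn_integral_min_nat[OF mu(1) mm] by (rule ennreal_leI)
    qed
    moreover have "(\<integral>\<^sup>+\<omega>. of_nat (\<omega> (k, x)) \<partial>\<mu> n) = (\<integral>\<^sup>+\<omega>. of_nat (min (\<omega> (k, x)) M) \<partial>\<mu> n) + (\<integral>\<^sup>+\<omega>. of_nat (\<omega> (k, x) - M) \<partial>\<mu> n)"
    proof -
      have split: "(of_nat a :: ennreal) = of_nat (min a M) + of_nat (a - M)" for a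
        by (simp add: of_nat_add[symmetric] min_def del: of_nat_add)
      have m1: "(\<lambda>\<omega>. of_nat (min (\<omega> (k, x)) M) :: ennreal) \<in> borel_measurable (\<mu> n)"
        using coord[OF mu(2)] by (rule measurable_compose) simp
      have m2: "(\<lambda>\<omega>. of_nat (\<omega> (k, x) - M) :: ennreal) \<in> borel_measurable (\<mu> n)"
        using mm by (rule measurable_compose) simp
      have "(\<integral>\<^sup>+\<omega>. of_nat (\<omega> (k, x)) \<partial>\<mu> n) = (\<integral>\<^sup>+\<omega>. of_nat (min (\<omega> (k, x)) M) + of_nat (\<omega> (k, x) - M) \<partial>\<mu> n)"
        by (rule nn_integral_cong) (rule split)
      also have "\<dots> = (\<integral>\<^sup>+\<omega>. of_nat (min (\<omega> (k, x)) M) \<partial>\<mu> n) + (\<integral>\<^sup>+\<omega>. of_nat (\<omega> (k, x) - M) \<partial>\<mu> n)"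
        by (rule nn_integral_add[OF m1 m2])
      finally show ?thesis .
    qed
    moreover have "(\<integral>\<^sup>+\<omega>. of_nat (min (\<omega> (k, x)) M) \<partial>\<mu> n) = ennreal (e (\<mu> n) M)"
      unfolding e_def by (rule nn_integral_min_nat[OF mu(1) coord[OF mu(2)]])
    ultimately have "ennreal (m n) \<le> ennreal (e (\<mu> n) M) + ennreal ((C + ln (E l M)) / l)"
      using mean(1) by (simp add: add_left_mono)
    moreover have "0 \<le> e (\<mu> n) M" unfolding e_def by (intro integral_nonneg_AE) auto
    moreover have "0 \<le> (C + ln (E l M)) / l"
    proof -
      have "l * 0 \<le> l * (\<integral>\<omega>. real (min (\<omega> (k, x) - M) 0) \<partial>\<mu> n)" by simp
      also have "\<dots> \<le> C + ln (E l M)"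
        unfolding E_def by (rule mean_tail[where I=UNIV]) (use mu k q C l in auto)
      finally show ?thesis using l by simp
    qed
    ultimately show ?thesis by (simp add: ennreal_plus[symmetric] del: ennreal_plus)
  qed
  have low: "e \<nu> M \<le> m'" for M
    using elim mean(3) by (rule LIMSEQ_le) (use emean in auto)
  have up: "m' \<le> e \<nu> M + (C + ln (E l M)) / l" if "l > 0" for M l
    using mean(3) tendsto_add[OF elim tendsto_const] by (rule LIMSEQ_le) (use tail[OF that] in auto)
  have eq: "(\<integral>\<^sup>+\<omega>. of_nat (\<omega> (k, x)) \<partial>\<nu>) = (SUP M. ennreal (e \<nu> M))"
    unfolding nn_integral_nat_SUP[OF coord[OF nu(2)]] nn_integral_min_nat[OF nu(1) coord[OF nu(2)]] e_def ..
  then have le: "(\<integral>\<^sup>+\<omega>. of_nat (\<omega> (k, x)) \<partial>\<nu>) \<le> ennreal m'"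
    using low by (auto intro!: SUP_least ennreal_leI)
  then obtain t where t: "(\<integral>\<^sup>+\<omega>. of_nat (\<omega> (k, x)) \<partial>\<nu>) = ennreal t" "0 \<le> t" "t \<le> m'"
    using m' by (cases "\<integral>\<^sup>+\<omega>. of_nat (\<omega> (k, x)) \<partial>\<nu>") (auto simp: top_unique)
  have et: "e \<nu> M \<le> t" for M
  proof -
    have "ennreal (e \<nu> M) \<le> ennreal t" unfolding t(1)[symmetric] eq by (rule SUP_upper) simp
    then show ?thesis using t(2) by (simp add: ennreal_le_iff)
  qed
  have "m' \<le> t + C / l" if l: "l > 0" for l
  proof (rule LIMSEQ_le[OF tendsto_const])
    have "(\<lambda>M. t + (C + ln (E l M)) / l) \<longlonglongrightarrow> t + (C + ln 1) / l"
      unfolding E_def using l q by (intro tendsto_intros poisson_exp_tail) auto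
    then show "(\<lambda>M. t + (C + ln (E l M)) / l) \<longlonglongrightarrow> t + C / l" by simp
    show "\<exists>N. \<forall>M\<ge>N. m' \<le> t + (C + ln (E l M)) / l"
      using up[OF l] et by (meson add_right_mono order.trans)
  qed
  from this[of "real (Suc n)" for n] have b: "m' \<le> t + C / real (Suc n)" for n by simp
  have "(\<lambda>n. t + C / real (Suc n)) \<longlonglongrightarrow> t + 0"
    by (intro tendsto_add tendsto_const LIMSEQ_Suc[OF lim_const_over_n])
  then have "m' \<le> t + 0" by (rule LIMSEQ_le_const) (use b in auto)
  with t show ?thesis by simp
qed

section \<open>Adding deterministic points\<close>

definition bump :: "nat \<Rightarrow> 'i set \<Rightarrow> ('i \<Rightarrow> nat) \<Rightarrow> 'i \<Rightarrow> nat" where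
  "bump a S \<omega> = (\<lambda>i. \<omega> i + (if i \<in> S then a else 0))"

lemma bump_measurable:
  assumes S: "S \<subseteq> I" and P: "sets P = sets (conf I)"
  shows "bump a S \<in> measurable P (conf I)"
proof -
  have "(\<lambda>\<omega> i. \<omega> i + (if i \<in> S then a else 0)) \<in> measurable (conf I) (conf I)"
  proof (rule measurable_PiM_single')
    fix i assume "i \<in> I"
    then have "(\<lambda>\<omega>. \<omega> i) \<in> measurable (conf I) (count_space UNIV)" by (rule measurable_component_singleton)
    then show "(\<lambda>\<omega>. \<omega> i + (if i \<in> S then a else 0)) \<in> measurable (conf I) (count_space UNIV)"
      by (rule measurable_compose) simp
  qed (use S in \<open>auto simp: space_PiM PiE_def extensional_def\<close>)
  then show ?thesis using P by (simp add: bump_def[abs_def] cong: measurable_cong_sets)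
qed

text \<open>Crude comparison of the weights at y and y + a: the quotient of the factorials is at
  most \<open>(y + a) ^ a\<close>, hence at most \<open>exp (a * (y + a))\<close>, and
  \<open>r ^ a\<close> is at least \<open>exp (- a * |ln r|)\<close>. The exponent is affine in y,
  so later only the mean of the coordinate matters.\<close>

lemma poisson_ratio:
  assumes r: "r > 0"
  shows "pmf (poisson_pmf r) y * exp (- (real a * real (y + a)) - real a * \<bar>ln r\<bar>) \<le> pmf (poisson_pmf r) (y + a)"
proof -
  have f: "(fact (y + b) :: real) \<le> fact y * real (y + a) ^ b" if "b \<le> a" for b
    using that
  proof (induction b)
    case (Suc b)
    have "(fact (y + Suc b) :: real) = real (y + Suc b) * fact (y + b)" by simp
    also have "\<dots> \<le> real (y + a) * (fact y * real (y + a) ^ b)"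
      using Suc by (intro mult_mono) auto
    finally show ?case by (simp add: mult_ac)
  qed simp
  have "real (y + a) \<le> exp (real (y + a))"
    using exp_ge_add_one_self[of "real (y + a)"] by linarith
  then have "real (y + a) ^ a \<le> exp (real (y + a)) ^ a"
    by (rule power_mono) simp
  also have "\<dots> = exp (real a * real (y + a))" by (simp add: exp_of_nat_mult)
  finally have f1: "fact (y + a) \<le> fact y * exp (real a * real (y + a))"
    using f[of a] by (meson fact_ge_zero mult_left_mono order.trans order_refl)
  have "exp (- (real a * \<bar>ln r\<bar>)) \<le> exp (real a * ln r)"
    using mult_left_mono[of "- ln r" "\<bar>ln r\<bar>" "real a"] by (simp add: abs_ge_minus_self)
  also have "\<dots> = r ^ a" using r by (simp add: exp_of_nat_mult)
  finally have f2: "exp (- (real a * \<bar>ln r\<bar>)) \<le> r ^ a" .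
  have f3: "inverse (fact y) * exp (- (real a * real (y + a))) \<le> inverse (fact (y + a))"
    using le_imp_inverse_le[OF f1] by (simp add: exp_minus)
  have "pmf (poisson_pmf r) y * exp (- (real a * real (y + a)) - real a * \<bar>ln r\<bar>)
      = r ^ y * exp (- r) * ((inverse (fact y) * exp (- (real a * real (y + a)))) * exp (- (real a * \<bar>ln r\<bar>)))"
    using r by (simp add: exp_diff exp_minus exp_add field_simps)
  also have "\<dots> \<le> r ^ y * exp (- r) * (inverse (fact (y + a)) * r ^ a)"
    using f2 f3 r by (intro mult_left_mono mult_mono) auto
  also have "\<dots> = pmf (poisson_pmf r) (y + a)" using r by (simp add: power_add field_simps)
  finally show ?thesis .
qed

text \<open>Substitution of y + a for y; the values below a are discarded, which only helps.\<close>

lemma poisson_shift: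
  assumes r: "r > 0"
  shows "(\<integral>\<^sup>+y. ennreal (exp (- (real a * real (y + a)) - real a * \<bar>ln r\<bar>)) * \<phi> (y + a) \<partial>measure_pmf (poisson_pmf r))
    \<le> (\<integral>\<^sup>+y. \<phi> y \<partial>measure_pmf (poisson_pmf r))"
proof -
  let ?p = "\<lambda>y. ennreal (pmf (poisson_pmf r) y)"
  have "(\<integral>\<^sup>+y. ennreal (exp (- (real a * real (y + a)) - real a * \<bar>ln r\<bar>)) * \<phi> (y + a) \<partial>measure_pmf (poisson_pmf r))
      = (\<integral>\<^sup>+y. ennreal (pmf (poisson_pmf r) y * exp (- (real a * real (y + a)) - real a * \<bar>ln r\<bar>)) * \<phi> (y + a) \<partial>count_space UNIV)"
    by (subst nn_integral_measure_pmf) (simp add: ennreal_mult' mult.assoc)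
  also have "\<dots> \<le> (\<integral>\<^sup>+y. ?p (y + a) * \<phi> (y + a) \<partial>count_space UNIV)"
    by (intro nn_integral_mono mult_right_mono ennreal_leI poisson_ratio r) simp
  also have "\<dots> = (\<integral>\<^sup>+y. ?p y * \<phi> y \<partial>count_space {a..})"
    by (rule nn_integral_bij_count_space[of "\<lambda>y. y + a" UNIV "{a..}" "\<lambda>y. ?p y * \<phi> y"])
       (auto intro!: bij_betwI[of _ _ _ "\<lambda>y. y - a"])
  also have "\<dots> = (\<integral>\<^sup>+y. ?p y * \<phi> y * indicator {a..} y \<partial>count_space UNIV)"
    by (simp add: nn_integral_count_space_indicator)
  also have "\<dots> \<le> (\<integral>\<^sup>+y. ?p y * \<phi> y \<partial>count_space UNIV)"
    by (intro nn_integral_mono) (auto simp: indicator_def)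
  also have "\<dots> = (\<integral>\<^sup>+y. \<phi> y \<partial>measure_pmf (poisson_pmf r))"
    by (rule nn_integral_measure_pmf[symmetric])
  finally show ?thesis .
qed

lemma nn_integral_distr_restrict:
  assumes "depends_on F h" "finite F" "F \<subseteq> K" "K \<subseteq> I" "sets M = sets (conf I)"
  shows "(\<integral>\<^sup>+\<omega>. h \<omega> \<partial>distr M (conf K) (\<lambda>\<omega>. restrict \<omega> K)) = (\<integral>\<^sup>+\<omega>. h \<omega> \<partial>M)"
proof -
  have "(\<lambda>\<omega>. restrict \<omega> K) \<in> measurable (conf I) (conf K)"
    using assms(4) by (rule measurable_restrict_subset)
  then have "(\<lambda>\<omega>. restrict \<omega> K) \<in> measurable M (conf K)"
    using assms(5) by (simp cong: measurable_cong_sets)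
  then have "(\<integral>\<^sup>+\<omega>. h \<omega> \<partial>distr M (conf K) (\<lambda>\<omega>. restrict \<omega> K)) = (\<integral>\<^sup>+\<omega>. h (restrict \<omega> K) \<partial>M)"
    by (rule nn_integral_distr) (use assms in \<open>simp add: measurable_depends_on\<close>)
  moreover have "h (restrict \<omega> K) = h \<omega>" for \<omega>
    using assms(1) by (rule depends_onD) (use assms(3) in auto)
  ultimately show ?thesis by simp
qed

text \<open>The factor of \<open>poisson_ratio\<close> pays for raising coordinate i by a; Fubini's
  theorem isolates this coordinate from the others that f depends on.\<close>

lemma reference_bump_le:
  fixes f :: "'d::finite config \<Rightarrow> real"
  assumes f: "depends_on F f" "finite F" "F \<subseteq> marks UNIV" and k: "fst i \<ge> 1" and q: "q (fst i) > 0"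
  shows "(\<integral>\<^sup>+\<omega>. ennreal (exp (f (bump a {i} \<omega>) - real a * real (\<omega> i + a) - real a * \<bar>ln (q (fst i))\<bar>)) \<partial>(reference q))
    \<le> (\<integral>\<^sup>+\<omega>. ennreal (exp (f \<omega>)) \<partial>(reference q))"
proof -
  let ?M = "\<lambda>(k, x). measure_pmf (poisson_pmf (q k)) :: nat measure"
  define F' where "F' = F - {i}"
  have F': "finite F'" "i \<notin> F'" "insert i F' \<subseteq> marks UNIV" "F \<subseteq> insert i F'" using f k by (cases i, auto simp: F'_def)+
  have "prob_space (?M j)" for j by (cases j) (simp add: measure_pmf.prob_space_axioms)
  then interpret product_prob_space ?M "marks UNIV" by (rule product_prob_spaceI)
  have setsM: "sets (PiM K ?M) = sets (conf K)" for K by (intro sets_PiM_cong) auto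
  have int: "(\<integral>\<^sup>+\<omega>. h \<omega> \<partial>(reference q)) = (\<integral>\<^sup>+\<omega>. (\<integral>\<^sup>+y. h (fun_upd \<omega> i y) \<partial>measure_pmf (poisson_pmf (q (fst i)))) \<partial>PiM F' ?M)"
    if h: "depends_on (insert i F') h" for h
  proof -
    have "PiM (insert i F') ?M = distr (PiM (marks UNIV) ?M) (PiM (insert i F') ?M) (\<lambda>\<omega>. restrict \<omega> (insert i F'))"
      using F' by (intro distr_PiM_restrict_finite[symmetric]) auto
    also have "\<dots> = distr (reference q) (conf (insert i F')) (\<lambda>\<omega>. restrict \<omega> (insert i F'))"
      unfolding reference_def by (rule distr_cong) (simp_all add: setsM)
    finally have "(\<integral>\<^sup>+\<omega>. h \<omega> \<partial>(reference q)) = (\<integral>\<^sup>+\<omega>. h \<omega> \<partial>PiM (insert i F') ?M)"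
      using nn_integral_distr_restrict[OF h _ subset_refl F'(3) sets_reference] F'(1) by simp
    also have "\<dots> = (\<integral>\<^sup>+\<omega>. (\<integral>\<^sup>+y. h (fun_upd \<omega> i y) \<partial>?M i) \<partial>PiM F' ?M)"
    proof (rule product_nn_integral_insert[OF F'(1,2)])
      have "h \<in> borel_measurable (conf (insert i F'))"
        using F'(1) h by (intro measurable_depends_on) auto
      then show "h \<in> borel_measurable (PiM (insert i F') ?M)" by (simp add: setsM cong: measurable_cong_sets)
    qed
    finally show ?thesis by (simp add: case_prod_beta)
  qed
  let ?g = "\<lambda>\<omega>. ennreal (exp (f (bump a {i} \<omega>) - real a * real (\<omega> i + a) - real a * \<bar>ln (q (fst i))\<bar>))"
  have df: "depends_on (insert i F') f" using f(1) F'(4) by (rule depends_on_mono)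
  have dg: "depends_on (insert i F') ?g"
  proof (rule depends_onI)
    fix \<omega> \<omega>' :: "'d config" assume h: "\<And>j. j \<in> insert i F' \<Longrightarrow> \<omega> j = \<omega>' j"
    have "f (bump a {i} \<omega>) = f (bump a {i} \<omega>')" using df by (rule depends_onD) (use h in \<open>auto simp: bump_def\<close>)
    moreover have "\<omega> i = \<omega>' i" using h by simp
    ultimately show "?g \<omega> = ?g \<omega>'" by simp
  qed
  have de: "depends_on (insert i F') (\<lambda>\<omega>. ennreal (exp (f \<omega>)))"
    using depends_on_comp[OF df, of "\<lambda>t. ennreal (exp t)"] .
  show ?thesis
    unfolding int[OF dg] int[OF de]
  proof (rule nn_integral_mono)
    fix \<omega> :: "'d config"
    have b: "bump a {i} (fun_upd \<omega> i y) = fun_upd \<omega> i (y + a)" for y by (auto simp: bump_def fun_eq_iff)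
    have "(\<integral>\<^sup>+y. ?g (fun_upd \<omega> i y) \<partial>measure_pmf (poisson_pmf (q (fst i))))
      = (\<integral>\<^sup>+y. ennreal (exp (- (real a * real (y + a)) - real a * \<bar>ln (q (fst i))\<bar>)) * ennreal (exp (f (fun_upd \<omega> i (y + a)))) \<partial>measure_pmf (poisson_pmf (q (fst i))))"
      unfolding b by (intro nn_integral_cong) (simp add: ennreal_mult[symmetric] exp_add[symmetric] algebra_simps)
    also have "\<dots> \<le> (\<integral>\<^sup>+y. ennreal (exp (f (fun_upd \<omega> i y))) \<partial>measure_pmf (poisson_pmf (q (fst i))))"
      by (rule poisson_shift[OF q])
    finally show "(\<integral>\<^sup>+y. ?g (fun_upd \<omega> i y) \<partial>measure_pmf (poisson_pmf (q (fst i))))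
      \<le> (\<integral>\<^sup>+y. ennreal (exp (f (fun_upd \<omega> i y))) \<partial>measure_pmf (poisson_pmf (q (fst i))))" .
  qed
qed

lemma cyl_bump: "cyl J f \<Longrightarrow> cyl J (\<lambda>\<omega>. f (bump a S \<omega>))"
proof -
  assume "cyl J f"
  from cylE[OF this] obtain F B where F: "finite F" "F \<subseteq> J" "depends_on F f" "\<And>\<omega>. \<bar>f \<omega>\<bar> \<le> B" by metis
  have "depends_on F (\<lambda>\<omega>. f (bump a S \<omega>))"
    by (rule depends_onI, rule depends_onD[OF F(3)]) (simp add: bump_def)
  then show ?thesis by (rule cylI[where B=B, OF F(1,2)]) (rule F(4))
qed

lemma integral_bump:
  fixes f :: "('i \<Rightarrow> nat) \<Rightarrow> real"
  assumes "S \<subseteq> I" "sets P = sets (conf I)" "cyl J f" "J \<subseteq> I"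
  shows "(\<integral>\<omega>. f \<omega> \<partial>distr P (conf I) (bump a S)) = (\<integral>\<omega>. f (bump a S \<omega>) \<partial>P)"
  by (rule integral_distr[OF bump_measurable[OF assms(1,2)] cyl_measurable[OF assms(3,4) refl]])

lemma integrable_nat_of_nn:
  fixes g :: "'a \<Rightarrow> nat"
  assumes "g \<in> measurable P (count_space UNIV)" "(\<integral>\<^sup>+\<omega>. of_nat (g \<omega>) \<partial>P) \<le> ennreal m" "0 \<le> m"
  shows "integrable P (\<lambda>\<omega>. real (g \<omega>))" "(\<integral>\<omega>. real (g \<omega>) \<partial>P) \<le> m"
proof -
  note [measurable] = assms(1)
  show i: "integrable P (\<lambda>\<omega>. real (g \<omega>))"
    using assms(2) by (intro integrableI_nonneg) (auto simp: ennreal_of_nat_eq_real_of_nat intro: le_less_trans)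
  have "ennreal (\<integral>\<omega>. real (g \<omega>) \<partial>P) \<le> ennreal m"
    using assms(2) nn_integral_eq_integral[OF i] by (simp add: ennreal_of_nat_eq_real_of_nat)
  then show "(\<integral>\<omega>. real (g \<omega>) \<partial>P) \<le> m" using assms(3) by (simp add: ennreal_le_iff)
qed

text \<open>A test pulled back along \<open>bump\<close>, minus the cost c, has exponential moment
  at most 1 by \<open>reference_bump_le\<close>. As c is unbounded this is not yet a test: it is cut
  off below at \<open>- real T\<close>, at the price \<open>ln (1 + exp (- real T))\<close>, and T
  tends to infinity.\<close>

lemma hent_bump1:
  fixes P :: "'d::finite config measure"
  assumes P: "prob_space P" "sets P = sets (conf I)" and J: "J \<subseteq> I" "J \<subseteq> marks UNIV"
    and i: "i \<in> J" and q: "q (fst i) > 0"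
    and m: "(\<integral>\<^sup>+\<omega>. of_nat (\<omega> i) \<partial>P) \<le> ennreal m" "0 \<le> m"
  shows "hent q (distr P (conf I) (bump a {i})) J \<le> hent q P J + ennreal (real a * (m + real a) + real a * \<bar>ln (q (fst i))\<bar>)"
    (is "_ \<le> _ + ennreal ?b")
proof (cases "hent q P J = \<infinity>")
  case False
  then obtain H where H: "hent q P J = ennreal H" "0 \<le> H" by (cases "hent q P J") auto
  interpret P: prob_space P by fact
  have iI: "{i} \<subseteq> I" "fst i \<ge> 1" using i J by auto
  note im = integrable_nat_of_nn[OF measurable_coordinate[OF _ P(2)] m]
  have im: "integrable P (\<lambda>\<omega>. real (\<omega> i))" "(\<integral>\<omega>. real (\<omega> i) \<partial>P) \<le> m" using im iI by auto
  have b0: "0 \<le> ?b" using m(2) by simp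
  have "ennreal (\<integral>\<omega>. f \<omega> \<partial>distr P (conf I) (bump a {i})) \<le> ennreal (H + ?b)"
    if f: "cyl J f" "(\<integral>\<omega>. exp (f \<omega>) \<partial>(reference q)) \<le> 1" for f
  proof -
    define c where "c \<omega> = real a * real (\<omega> i + a) + real a * \<bar>ln (q (fst i))\<bar>" for \<omega> :: "'d config"
    define g where "g \<omega> = f (bump a {i} \<omega>) - c \<omega>" for \<omega>
    have cb: "cyl J (\<lambda>\<omega>. f (bump a {i} \<omega>))" by (rule cyl_bump[OF f(1)])
    from cylE[OF f(1)] obtain F where F: "finite F" "F \<subseteq> J" "depends_on F f" by metis
    from cylE[OF cb] obtain F' B where F': "finite F'" "F' \<subseteq> J" "depends_on F' (\<lambda>\<omega>. f (bump a {i} \<omega>))"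
      "\<And>\<omega>. \<bar>f (bump a {i} \<omega>)\<bar> \<le> B" "B > 0" by metis
    have "depends_on {i} c" unfolding c_def by (rule depends_on_coordinate)
    from depends_on_comp2[OF F'(3) this, of "(-)"] have dg: "depends_on (insert i F') g" unfolding g_def by simp
    have c0: "0 \<le> c \<omega>" for \<omega> by (simp add: c_def)
    have ef: "integrable (reference q) (\<lambda>\<omega>. exp (f \<omega>))"
      by (rule cyl_integrable[OF cyl_exp[OF f(1)] J(2) sets_reference prob_reference])
    have gm: "g \<in> borel_measurable (reference q)"
    proof -
      have "g \<in> borel_measurable (conf (marks UNIV))"
        using F'(1,2) i J(2) by (intro measurable_depends_on[OF _ _ dg]) auto
      then show ?thesis by (subst measurable_cong_sets[OF sets_reference refl])
    qed
    have "(\<integral>\<^sup>+\<omega>. ennreal (exp (g \<omega>)) \<partial>(reference q)) \<le> (\<integral>\<^sup>+\<omega>. ennreal (exp (f \<omega>)) \<partial>(reference q))"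
      unfolding g_def c_def diff_diff_eq[symmetric]
      using F J iI(2) q by (intro reference_bump_le[of F]) auto
    also have "\<dots> = ennreal (\<integral>\<omega>. exp (f \<omega>) \<partial>(reference q))" by (intro nn_integral_eq_integral ef) simp
    also have "\<dots> \<le> ennreal 1" using f(2) by (rule ennreal_leI)
    finally have eg1: "(\<integral>\<^sup>+\<omega>. ennreal (exp (g \<omega>)) \<partial>(reference q)) \<le> ennreal 1" .
    then have egi: "integrable (reference q) (\<lambda>\<omega>. exp (g \<omega>))"
      using gm by (intro integrableI_nonneg) (auto intro: le_less_trans)
    have eg: "(\<integral>\<omega>. exp (g \<omega>) \<partial>(reference q)) \<le> 1"
      using eg1 by (subst (asm) nn_integral_eq_integral[OF egi]) auto
    have icb: "integrable P (\<lambda>\<omega>. f (bump a {i} \<omega>))" by (rule cyl_integrable[OF cb J(1) P(2,1)])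
    have ic: "integrable P c" unfolding c_def using im(1) by simp
    have "(\<integral>\<omega>. c \<omega> \<partial>P) = real a * ((\<integral>\<omega>. real (\<omega> i) \<partial>P) + real a) + real a * \<bar>ln (q (fst i))\<bar>"
      unfolding c_def using im(1) P.prob_space by (simp add: algebra_simps)
    also have "\<dots> \<le> ?b" using im(2) by (intro add_right_mono mult_left_mono) auto
    finally have cle: "(\<integral>\<omega>. c \<omega> \<partial>P) \<le> ?b" .
    interpret R: prob_space "reference q :: 'd config measure" by (rule prob_reference)
    have "(\<integral>\<omega>. f (bump a {i} \<omega>) \<partial>P) - ?b \<le> H + ln (1 + exp (- real T))" for T :: nat
    proof -
      define h where "h \<omega> = max (g \<omega>) (- real T)" for \<omega>
      have "depends_on (insert i F') h" unfolding h_def by (rule depends_on_comp[OF dg])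
      moreover have "\<bar>h \<omega>\<bar> \<le> B + real T" for \<omega>
        using F'(4)[of \<omega>] c0[of \<omega>] F'(5) unfolding h_def g_def by auto
      ultimately have ch: "cyl J h" using F'(1,2) i by (intro cylI[of "insert i F'"]) auto
      have "(\<integral>\<omega>. exp (h \<omega>) \<partial>(reference q)) \<le> (\<integral>\<omega>. exp (g \<omega>) + exp (- real T) \<partial>(reference q))"
        using egi cyl_integrable[OF cyl_exp[OF ch] J(2) sets_reference prob_reference]
        by (intro integral_mono) (auto simp: h_def max_def add_increasing add_increasing2)
      also have "\<dots> \<le> 1 + exp (- real T)" using egi eg R.prob_space by simp
      finally have eh: "(\<integral>\<omega>. exp (h \<omega>) \<partial>(reference q)) \<le> 1 + exp (- real T)" .
      have pos: "0 < 1 + exp (- real T)" by (simp add: add_pos_pos)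
      have "(\<integral>\<omega>. exp (h \<omega> + - ln (1 + exp (- real T))) \<partial>(reference q)) = (\<integral>\<omega>. exp (h \<omega>) \<partial>(reference q)) / (1 + exp (- real T))"
        using pos by (simp add: exp_diff)
      then have "(\<integral>\<omega>. exp (h \<omega> + - ln (1 + exp (- real T))) \<partial>(reference q)) \<le> 1" using eh pos by simp
      then have "ennreal (\<integral>\<omega>. h \<omega> + - ln (1 + exp (- real T)) \<partial>P) \<le> ennreal H"
        unfolding H(1)[symmetric] using ch by (intro hent_upper cyl_add cyl_const)
      then have "(\<integral>\<omega>. h \<omega> + - ln (1 + exp (- real T)) \<partial>P) \<le> H" using H(2) by (simp add: ennreal_le_iff)
      moreover have ih: "integrable P h" by (rule cyl_integrable[OF ch J(1) P(2,1)])
      moreover have "(\<integral>\<omega>. g \<omega> \<partial>P) \<le> (\<integral>\<omega>. h \<omega> \<partial>P)"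
        using icb ic ih unfolding g_def by (intro integral_mono) (auto simp: h_def g_def)
      moreover have "(\<integral>\<omega>. g \<omega> \<partial>P) = (\<integral>\<omega>. f (bump a {i} \<omega>) \<partial>P) - (\<integral>\<omega>. c \<omega> \<partial>P)"
        unfolding g_def using icb ic by simp
      ultimately show ?thesis using cle P.prob_space by simp
    qed
    moreover have "(\<lambda>T. H + ln (1 + exp (- real T))) \<longlonglongrightarrow> H + ln (1 + 0)"
      by (intro tendsto_intros filterlim_compose[OF exp_at_bot]
          filterlim_compose[OF filterlim_uminus_at_bot_at_top] filterlim_real_sequentially) auto
    ultimately have "(\<integral>\<omega>. f (bump a {i} \<omega>) \<partial>P) - ?b \<le> H + ln (1 + 0)"
      by (intro LIMSEQ_le_const) auto
    then show ?thesis
      unfolding integral_bump[OF iI(1) P(2) f(1) J(1)] by (intro ennreal_leI) simp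
  qed
  then have "hent q (distr P (conf I) (bump a {i})) J \<le> ennreal (H + ?b)"
    unfolding hent_def by (intro SUP_least) auto
  also have "\<dots> = hent q P J + ennreal ?b" using H b0 by simp
  finally show ?thesis .
qed simp

lemma prob_bump: "prob_space P \<Longrightarrow> S \<subseteq> I \<Longrightarrow> sets P = sets (conf I) \<Longrightarrow> prob_space (distr P (conf I) (bump a S))"
  by (rule prob_space.prob_space_distr[OF _ bump_measurable])

text \<open>Points are added one coordinate at a time. A coordinate not yet raised still has its
  mean under P, so each step costs at most b.\<close>

lemma hent_bump:
  fixes P :: "'d::finite config measure"
  assumes P: "prob_space P" "sets P = sets (conf I)" and J: "J \<subseteq> I" "J \<subseteq> marks UNIV"
    and S: "finite S" "S \<subseteq> J" and q: "\<And>i. i \<in> S \<Longrightarrow> q (fst i) > 0"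
    and m: "\<And>i. i \<in> S \<Longrightarrow> (\<integral>\<^sup>+\<omega>. of_nat (\<omega> i) \<partial>P) \<le> ennreal m" "0 \<le> m"
    and b: "\<And>i. i \<in> S \<Longrightarrow> real a * (m + real a) + real a * \<bar>ln (q (fst i))\<bar> \<le> b"
  shows "hent q (distr P (conf I) (bump a S)) J \<le> hent q P J + of_nat (card S) * ennreal b"
  using S q m(1) b
proof (induction S rule: finite_induct)
  case empty
  have "distr P (conf I) (bump a {}) = distr P P (\<lambda>\<omega>. \<omega>)"
    using P(2) by (intro distr_cong) (auto simp: bump_def)
  then show ?case by simp
next
  case (insert i S)
  let ?P = "distr P (conf I) (bump a S)"
  have SI: "S \<subseteq> I" "{i} \<subseteq> I" using insert.prems(1) J by auto
  have "bump a (insert i S) = bump a {i} \<circ> bump a S"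
    using insert.hyps by (auto simp: bump_def fun_eq_iff)
  then have eq: "distr P (conf I) (bump a (insert i S)) = distr ?P (conf I) (bump a {i})"
    using SI by (subst distr_distr[OF bump_measurable[OF SI(2) refl] bump_measurable[OF SI(1) P(2)]]) simp
  have mi: "(\<integral>\<^sup>+\<omega>. of_nat (\<omega> i) \<partial>?P) \<le> ennreal m"
  proof -
    have "(\<lambda>\<omega>. of_nat (\<omega> i) :: ennreal) \<in> borel_measurable (conf I)"
      using SI(2) by (intro measurable_compose[OF measurable_coordinate[of i I "conf I"] borel_measurable_count_space]) auto
    then have "(\<integral>\<^sup>+\<omega>. of_nat (\<omega> i) \<partial>?P) = (\<integral>\<^sup>+\<omega>. of_nat (bump a S \<omega> i) \<partial>P)"
      by (intro nn_integral_distr[OF bump_measurable[OF SI(1) P(2)]]) simp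
    also have "\<dots> = (\<integral>\<^sup>+\<omega>. of_nat (\<omega> i) \<partial>P)" using insert.hyps by (simp add: bump_def)
    finally show ?thesis using insert.prems(3)[of i] by simp
  qed
  have "hent q (distr ?P (conf I) (bump a {i})) J \<le> hent q ?P J + ennreal (real a * (m + real a) + real a * \<bar>ln (q (fst i))\<bar>)"
    using insert.prems(1,2) mi m(2) J
    by (intro hent_bump1[OF prob_bump[OF P(1) SI(1) P(2)] sets_distr]) auto
  also have "\<dots> \<le> (hent q P J + of_nat (card S) * ennreal b) + ennreal b"
    using insert by (intro add_mono[OF insert.IH ennreal_leI]) auto
  also have "\<dots> = hent q P J + of_nat (card (insert i S)) * ennreal b"
    using insert.hyps by (simp add: distrib_left distrib_right ac_simps)
  finally show ?case unfolding eq .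
qed

section \<open>Equality of measures and shift invariance\<close>

lemma cyl_indicator: "finite F \<Longrightarrow> F \<subseteq> J \<Longrightarrow> depends_on F C \<Longrightarrow> cyl J (\<lambda>\<omega>. if C \<omega> then 1 else 0)"
  by (rule cylI[of F _ _ 1]) (auto intro: depends_on_comp[of F C "\<lambda>b. if b then 1 else 0"])

lemma measure_eqI_cyl:
  assumes P: "prob_space P" "sets P = sets (conf I)" and Q: "prob_space Q" "sets Q = sets (conf I)"
    and eq: "\<And>f. cyl I f \<Longrightarrow> (\<integral>\<omega>. f \<omega> \<partial>P) = (\<integral>\<omega>. f \<omega> \<partial>Q)"
  shows "P = Q"
proof (rule measure_eqI_PiM_infinite[OF P(2) Q(2)])
  interpret P: prob_space P by fact
  interpret Q: prob_space Q by fact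
  show "finite_measure P" by (rule P.finite_measure_axioms)
  fix A :: "'a \<Rightarrow> nat set" and J assume J: "finite J" "J \<subseteq> I"
  define C where "C \<omega> \<longleftrightarrow> (\<forall>i\<in>J. \<omega> i \<in> A i)" for \<omega> :: "'a \<Rightarrow> nat"
  have dC: "depends_on J C" unfolding C_def by (rule depends_onI) simp
  let ?B = "prod_emb I (\<lambda>_. count_space UNIV) J (PiE J A)"
  have B: "?B = {\<omega> \<in> space (conf I). C \<omega>}"
    using J by (auto simp: prod_emb_def space_PiM C_def PiE_def Pi_def)
  have "?B \<in> sets (conf I)" using J by (intro sets_PiM_I) auto
  then have m: "?B \<in> sets P" "?B \<in> sets Q" using P(2) Q(2) by auto
  have int: "(\<integral>\<omega>. (if C \<omega> then 1 else 0 :: real) \<partial>M) = measure M ?B" if "sets M = sets (conf I)" "?B \<in> sets M" for M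
  proof -
    have "(\<integral>\<omega>. (if C \<omega> then 1 else 0 :: real) \<partial>M) = (\<integral>\<omega>. indicator ?B \<omega> \<partial>M)"
      using sets_eq_imp_space_eq[OF that(1)] by (intro Bochner_Integration.integral_cong refl) (auto simp: B)
    then show ?thesis using that(2) sets.sets_into_space[OF that(2)] by (simp add: Int_absorb2)
  qed
  have "measure P ?B = measure Q ?B"
    using eq[OF cyl_indicator[OF J dC]] int[OF P(2) m(1)] int[OF Q(2) m(2)] by simp
  then show "emeasure P ?B = emeasure Q ?B" by (simp add: P.emeasure_eq_measure Q.emeasure_eq_measure)
qed

lemma cinv_imp_shift_invariant:
  assumes "cinv (marks UNIV) P" shows "P \<in> shift_invariant_probs"
proof -
  note P = cinvD[OF assms]
  have m: "translate z \<in> measurable P (conf (marks UNIV))" for z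
    using translate_measurable P(2) by (simp cong: measurable_cong_sets)
  have "distr P (conf (marks UNIV)) (translate z) = P" for z
  proof (rule measure_eqI_cyl[OF _ _ P(1,2)])
    show "prob_space (distr P (conf (marks UNIV)) (translate z))"
      by (rule prob_space.prob_space_distr[OF P(1) m])
    fix f :: "'a config \<Rightarrow> real" assume f: "cyl (marks UNIV) f"
    have "(\<integral>\<omega>. f \<omega> \<partial>distr P (conf (marks UNIV)) (translate z)) = (\<integral>\<omega>. f (translate z \<omega>) \<partial>P)"
      by (rule integral_distr[OF m cyl_measurable[OF f subset_refl refl]])
    also have "\<dots> = (\<integral>\<omega>. f (tshift z \<omega>) \<partial>P)"
      using restrict_cyl[OF f subset_refl] by (simp add: translate_eq_tshift)
    finally show "(\<integral>\<omega>. f \<omega> \<partial>distr P (conf (marks UNIV)) (translate z)) = (\<integral>\<omega>. f \<omega> \<partial>P)"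
      using P(4)[OF f] by simp
  qed simp
  then show ?thesis using P(1,2) by (simp add: shift_invariant_probs_def config_space_def)
qed

lemma shift_invariant_iff_cinv: "P \<in> shift_invariant_probs \<longleftrightarrow> cinv (marks UNIV) P"
  using cinv_imp_shift_invariant shift_invariant_imp_cinv by blast

lemma tshift_measurable:
  assumes "I = K \<times> UNIV" "sets P = sets (conf I)"
  shows "(\<lambda>\<omega>. restrict (tshift z \<omega>) I) \<in> measurable P (conf I)"
proof -
  have "(\<lambda>\<omega>. \<lambda>i\<in>I. tshift z \<omega> i) \<in> measurable (conf I) (conf I)"
    unfolding tshift_def by (rule measurable_restrict) (auto simp: assms(1) split: prod.split intro!: measurable_component_singleton)
  then show ?thesis using assms(2) by (simp cong: measurable_cong_sets)
qed

text \<open>Local functions determine the law, so invariance tested on them is invariance of the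
  whole measure, and unbounded functionals become accessible.\<close>

lemma cinv_distr_tshift:
  assumes "cinv I P" shows "distr P (conf I) (\<lambda>\<omega>. restrict (tshift z \<omega>) I) = P"
proof -
  note P = cinvD[OF assms]
  from assms obtain K where K: "I = K \<times> UNIV" unfolding cinv_def by blast
  note m = tshift_measurable[OF K P(2), of z]
  show ?thesis
  proof (rule measure_eqI_cyl[OF _ _ P(1,2)])
    show "prob_space (distr P (conf I) (\<lambda>\<omega>. restrict (tshift z \<omega>) I))"
      by (rule prob_space.prob_space_distr[OF P(1) m])
    fix f :: "'a config \<Rightarrow> real" assume f: "cyl I f"
    have "(\<integral>\<omega>. f \<omega> \<partial>distr P (conf I) (\<lambda>\<omega>. restrict (tshift z \<omega>) I)) = (\<integral>\<omega>. f (restrict (tshift z \<omega>) I) \<partial>P)"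
      by (rule integral_distr[OF m cyl_measurable[OF f subset_refl refl]])
    then show "(\<integral>\<omega>. f \<omega> \<partial>distr P (conf I) (\<lambda>\<omega>. restrict (tshift z \<omega>) I)) = (\<integral>\<omega>. f \<omega> \<partial>P)"
      using restrict_cyl[OF f subset_refl] P(4)[OF f] by simp
  qed simp
qed

lemma nn_integral_tshift:
  assumes "cinv I P" and f: "f \<in> borel_measurable (conf I)" and dep: "depends_on I f"
  shows "(\<integral>\<^sup>+\<omega>. f (tshift z \<omega>) \<partial>P) = (\<integral>\<^sup>+\<omega>. f \<omega> \<partial>P)"
proof -
  note P = cinvD[OF assms(1)]
  from assms obtain K where K: "I = K \<times> UNIV" unfolding cinv_def by blast
  have "(\<integral>\<^sup>+\<omega>. f \<omega> \<partial>P) = (\<integral>\<^sup>+\<omega>. f \<omega> \<partial>distr P (conf I) (\<lambda>\<omega>. restrict (tshift z \<omega>) I))"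
    by (simp add: cinv_distr_tshift[OF assms(1)])
  also have "\<dots> = (\<integral>\<^sup>+\<omega>. f (restrict (tshift z \<omega>) I) \<partial>P)"
    by (rule nn_integral_distr[OF tshift_measurable[OF K P(2)]]) (simp add: f)
  also have "\<dots> = (\<integral>\<^sup>+\<omega>. f (tshift z \<omega>) \<partial>P)"
    by (intro nn_integral_cong depends_onD[OF dep]) simp
  finally show ?thesis ..
qed

declare One_nat_def [simp del]

section \<open>The occupation field and the interaction\<close>

lemma nn_integral_count_space_Times:
  assumes "countable A" "countable B"
  shows "(\<integral>\<^sup>+p. f p \<partial>count_space (A \<times> B)) = (\<integral>\<^sup>+x. (\<integral>\<^sup>+y. f (x, y) \<partial>count_space B) \<partial>count_space A)"
proof -
  have "(\<integral>\<^sup>+p. f p \<partial>count_space (A \<times> B)) = (\<integral>\<^sup>+p. f p * indicator (A \<times> B) p \<partial>count_space UNIV)"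
  proof -
    have "(\<integral>\<^sup>+p. f p \<partial>count_space (A \<times> B)) = (\<integral>\<^sup>+p. f p * indicator (A \<times> B) p \<partial>count_space (A \<times> B))"
      by (intro nn_integral_cong) auto
    also have "\<dots> = (\<integral>\<^sup>+p. f p * indicator (A \<times> B) p \<partial>count_space UNIV)"
      by (rule nn_integral_count_space_eq) auto
    finally show ?thesis .
  qed
  also have "\<dots> = (\<integral>\<^sup>+x. (\<integral>\<^sup>+y. f (x, y) * indicator (A \<times> B) (x, y) \<partial>count_space UNIV) \<partial>count_space UNIV)"
    by (rule nn_integral_fst_count_space[symmetric])
  also have "\<dots> = (\<integral>\<^sup>+x. (\<integral>\<^sup>+y. f (x, y) * indicator (A \<times> B) (x, y) \<partial>count_space B) \<partial>count_space UNIV)"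
    by (intro nn_integral_cong nn_integral_count_space_eq) auto
  also have "\<dots> = (\<integral>\<^sup>+x. (\<integral>\<^sup>+y. f (x, y) * indicator (A \<times> B) (x, y) \<partial>count_space B) \<partial>count_space A)"
    by (rule nn_integral_count_space_eq) (auto simp: nn_integral_0_iff_AE)
  also have "\<dots> = (\<integral>\<^sup>+x. (\<integral>\<^sup>+y. f (x, y) \<partial>count_space B) \<partial>count_space A)"
    by (intro nn_integral_cong) auto
  finally show ?thesis .
qed

text \<open>A mark \<open>G k\<close> rooted at x covers i exactly when \<open>i - x\<close> lies in
  \<open>G k\<close>. So this counts the points with mark size in A whose mark covers i.\<close>

definition occ :: "(nat \<Rightarrow> (int ^ 'd::finite) set) \<Rightarrow> nat set \<Rightarrow> 'd config \<Rightarrow> int ^ 'd \<Rightarrow> ennreal" where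
  "occ G A \<omega> i = (\<integral>\<^sup>+k. (\<Sum>y\<in>G k. of_nat (\<omega> (k, i - y))) \<partial>count_space A)"

text \<open>Energy attributed to site 0: the pair interaction as a quadratic form in an occupation
  field d.\<close>

definition inter :: "(int ^ 'd::finite \<Rightarrow> real) \<Rightarrow> (int ^ 'd \<Rightarrow> ennreal) \<Rightarrow> ennreal" where
  "inter v d = (\<Sum>u | v u \<noteq> 0. ennreal (v u) * (d 0 * d u))"

lemma occ_measurable:
  assumes I: "A \<times> UNIV \<subseteq> I" and P: "sets P = sets (conf I)"
  shows "(\<lambda>\<omega>. occ G A \<omega> i) \<in> borel_measurable P"
proof -
  have "(\<lambda>\<omega>. of_nat (\<omega> (k, i - y)) * indicator A k :: ennreal) \<in> borel_measurable P" for k y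
  proof (cases "k \<in> A")
    case True
    then have [measurable]: "(\<lambda>\<omega>. \<omega> (k, i - y)) \<in> measurable P (count_space UNIV)"
      using I P by (intro measurable_coordinate) auto
    show ?thesis by measurable
  qed simp
  note [measurable] = this
  have "(\<lambda>\<omega>. \<Sum>k. \<Sum>y\<in>G k. of_nat (\<omega> (k, i - y)) * indicator A k :: ennreal) \<in> borel_measurable P"
    by measurable
  moreover have "occ G A \<omega> i = (\<Sum>k. \<Sum>y\<in>G k. of_nat (\<omega> (k, i - y)) * indicator A k)" for \<omega>
  proof -
    have "occ G A \<omega> i = (\<integral>\<^sup>+k. (\<Sum>y\<in>G k. of_nat (\<omega> (k, i - y)) * indicator A k) \<partial>count_space A)"
      unfolding occ_def by (intro nn_integral_cong) auto
    also have "\<dots> = (\<integral>\<^sup>+k. (\<Sum>y\<in>G k. of_nat (\<omega> (k, i - y)) * indicator A k) \<partial>count_space UNIV)"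
      by (rule nn_integral_count_space_eq) auto
    finally show ?thesis by (simp add: nn_integral_count_space_nat)
  qed
  ultimately show ?thesis by simp
qed

lemma inter_measurable:
  assumes "\<And>i. (\<lambda>\<omega>. d \<omega> i) \<in> borel_measurable P"
  shows "(\<lambda>\<omega>. inter v (d \<omega>)) \<in> borel_measurable P"
  unfolding inter_def by (intro borel_measurable_sum borel_measurable_times_ennreal borel_measurable_const assms)

lemma inter_mono: "(\<And>i. d i \<le> d' i) \<Longrightarrow> inter v d \<le> inter v d'"
  unfolding inter_def by (intro sum_mono mult_left_mono mult_mono) auto

lemma depends_on_occ: "depends_on (A \<times> UNIV) (\<lambda>\<omega>. occ G A \<omega> i)"
proof (rule depends_onI)
  fix \<omega> \<omega>' :: "nat \<times> (int ^ 'a) \<Rightarrow> nat" assume h: "\<And>j. j \<in> A \<times> UNIV \<Longrightarrow> \<omega> j = \<omega>' j"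
  show "occ G A \<omega> i = occ G A \<omega>' i"
    unfolding occ_def by (intro nn_integral_cong sum.cong refl arg_cong[where f=of_nat] h) auto
qed

section \<open>Moments under shift invariance\<close>

lemma nn_integral_coordinate_shift:
  assumes P: "cinv I P" and k: "(k, x) \<in> I"
  shows "(\<integral>\<^sup>+\<omega>. of_nat (\<omega> (k, x)) \<partial>P) = (\<integral>\<^sup>+\<omega>. of_nat (\<omega> (k, 0)) \<partial>P)"
proof -
  from P obtain K where K: "I = K \<times> UNIV" unfolding cinv_def by blast
  have i: "(k, 0) \<in> I" using k K by auto
  have [measurable]: "(\<lambda>\<omega>. \<omega> (k, 0)) \<in> measurable (conf I) (count_space UNIV)"
    using i by (rule measurable_component_singleton)
  have "(\<integral>\<^sup>+\<omega>. of_nat (tshift x \<omega> (k, 0)) \<partial>P) = (\<integral>\<^sup>+\<omega>. of_nat (\<omega> (k, 0)) \<partial>P)"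
  proof (rule nn_integral_tshift[OF P])
    show "depends_on I (\<lambda>\<omega>. of_nat (\<omega> (k, 0)) :: ennreal)"
      using i by (intro depends_onI arg_cong[where f=of_nat]) auto
  qed measurable
  then show ?thesis by (simp add: tshift_def)
qed

lemma nn_integral_pair_shift:
  assumes P: "cinv I P" and k: "(k, x) \<in> I" "(l, y) \<in> I"
  shows "(\<integral>\<^sup>+\<omega>. of_nat (\<omega> (k, x)) * of_nat (\<omega> (l, y)) \<partial>P) = (\<integral>\<^sup>+\<omega>. of_nat (\<omega> (k, 0)) * of_nat (\<omega> (l, y - x)) \<partial>P)"
proof -
  from P obtain K where K: "I = K \<times> UNIV" unfolding cinv_def by blast
  have i: "(k, 0) \<in> I" "(l, y - x) \<in> I" using k K by auto
  have [measurable]: "(\<lambda>\<omega>. \<omega> (k, 0)) \<in> measurable (conf I) (count_space UNIV)" "(\<lambda>\<omega>. \<omega> (l, y - x)) \<in> measurable (conf I) (count_space UNIV)"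
    using i by (auto intro: measurable_component_singleton)
  have "(\<integral>\<^sup>+\<omega>. of_nat (tshift x \<omega> (k, 0)) * of_nat (tshift x \<omega> (l, y - x)) \<partial>P) = (\<integral>\<^sup>+\<omega>. of_nat (\<omega> (k, 0)) * of_nat (\<omega> (l, y - x)) \<partial>P)"
  proof (rule nn_integral_tshift[OF P])
    show "depends_on I (\<lambda>\<omega>. of_nat (\<omega> (k, 0)) * of_nat (\<omega> (l, y - x)) :: ennreal)"
      using i by (intro depends_onI arg_cong2[where f="(*)"] arg_cong[where f=of_nat]) auto
  qed measurable
  then show ?thesis by (simp add: tshift_def)
qed

locale interaction =
  fixes G :: "nat \<Rightarrow> (int ^ 'd::finite) set" and v :: "int ^ 'd \<Rightarrow> real"
  assumes G_card: "\<And>k. k \<ge> 1 \<Longrightarrow> card (G k) = k"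
    and G_box: "\<And>k. k \<ge> 1 \<Longrightarrow> \<exists>L. box_Z L \<subseteq> G k \<and> G k \<subseteq> box_Z (L + 1)"
    and v_nonneg: "\<And>x. v x \<ge> 0"
    and v_sym: "\<And>x. v (- x) = v x"
    and v_supp: "finite {x. v x \<noteq> 0}"
begin

lemma finite_G: "k \<ge> 1 \<Longrightarrow> finite (G k)"
  using G_card[of k] by (metis card.infinite not_one_le_zero)

lemma v_bar_eq: "ennreal (v_bar v) = (\<Sum>u | v u \<noteq> 0. ennreal (v u))"
proof -
  have "v_bar v = infsum v {u. v u \<noteq> 0}" unfolding v_bar_def by (rule infsum_cong_neutral) auto
  also have "\<dots> = (\<Sum>u | v u \<noteq> 0. v u)" using v_supp by simp
  finally show ?thesis using v_nonneg by (simp add: sum_ennreal)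
qed

lemma nn_integral_occ:
  assumes P: "cinv I P" and A: "A \<subseteq> {1..}"
  shows "(\<integral>\<^sup>+\<omega>. occ G A \<omega> i \<partial>P) = (\<integral>\<^sup>+k. of_nat k * (\<integral>\<^sup>+\<omega>. of_nat (\<omega> (k, 0)) \<partial>P) \<partial>count_space A)"
proof -
  note P' = cinvD[OF P]
  have c: "(k, x) \<in> I" if "k \<in> A" for k x using that A P'(3) by auto
  have m: "(\<lambda>\<omega>. of_nat (\<omega> (k, x)) :: ennreal) \<in> borel_measurable P" if "k \<in> A" for k x
    using measurable_coordinate[OF c[OF that] P'(2)] by measurable
  have "(\<integral>\<^sup>+\<omega>. occ G A \<omega> i \<partial>P) = (\<integral>\<^sup>+k. (\<integral>\<^sup>+\<omega>. (\<Sum>y\<in>G k. of_nat (\<omega> (k, i - y))) \<partial>P) \<partial>count_space A)"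
    unfolding occ_def by (rule nn_integral_count_space_nn_integral) (auto intro!: borel_measurable_sum m)
  also have "\<dots> = (\<integral>\<^sup>+k. of_nat k * (\<integral>\<^sup>+\<omega>. of_nat (\<omega> (k, 0)) \<partial>P) \<partial>count_space A)"
  proof (rule nn_integral_cong)
    fix k assume "k \<in> space (count_space A)"
    then have k: "k \<in> A" "k \<ge> 1" using A by auto
    have "(\<integral>\<^sup>+\<omega>. (\<Sum>y\<in>G k. of_nat (\<omega> (k, i - y))) \<partial>P) = (\<Sum>y\<in>G k. \<integral>\<^sup>+\<omega>. of_nat (\<omega> (k, i - y)) \<partial>P)"
      by (rule nn_integral_sum) (rule m[OF k(1)])
    also have "\<dots> = (\<Sum>y\<in>G k. \<integral>\<^sup>+\<omega>. of_nat (\<omega> (k, 0)) \<partial>P)"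
      by (intro sum.cong refl nn_integral_coordinate_shift[OF P c[OF k(1)]])
    finally show "(\<integral>\<^sup>+\<omega>. (\<Sum>y\<in>G k. of_nat (\<omega> (k, i - y))) \<partial>P) = of_nat k * (\<integral>\<^sup>+\<omega>. of_nat (\<omega> (k, 0)) \<partial>P)"
      using G_card[OF k(2)] by simp
  qed
  finally show ?thesis .
qed

text \<open>By stationarity the total length of the marks rooted at a site has the mean of the
  number of marks covering a site: a mark of size k is counted k times either way.\<close>

lemma nn_integral_N_len:
  assumes P: "cinv I P"
  shows "(\<integral>\<^sup>+\<omega>. N_len {0} \<omega> \<partial>P) = (\<integral>\<^sup>+\<omega>. occ G {1..} \<omega> i \<partial>P)"
proof -
  note P' = cinvD[OF P]
  have m: "(\<lambda>\<omega>. of_nat (\<omega> (k, x)) :: ennreal) \<in> borel_measurable P" if "k \<in> {1..}" for k x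
  proof -
    have "(k, x) \<in> I" using P'(3) that by auto
    from measurable_coordinate[OF this P'(2)] show ?thesis by measurable
  qed
  have "(\<integral>\<^sup>+\<omega>. N_len {0} \<omega> \<partial>P) = (\<integral>\<^sup>+\<omega>. (\<integral>\<^sup>+k. of_nat k * of_nat (\<omega> (k, 0)) \<partial>count_space {1..}) \<partial>P)"
    unfolding N_len_def N_mark_def by (simp add: infsum_ennreal_eq_nn_integral)
  also have "\<dots> = (\<integral>\<^sup>+k. (\<integral>\<^sup>+\<omega>. of_nat k * of_nat (\<omega> (k, 0)) \<partial>P) \<partial>count_space {1..})"
    by (rule nn_integral_count_space_nn_integral) (auto intro!: borel_measurable_times_ennreal m)
  also have "\<dots> = (\<integral>\<^sup>+k. of_nat k * (\<integral>\<^sup>+\<omega>. of_nat (\<omega> (k, 0)) \<partial>P) \<partial>count_space {1..})"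
    by (intro nn_integral_cong nn_integral_cmult m) auto
  finally show ?thesis using nn_integral_occ[OF P, of "{1..}"] by simp
qed

text \<open>Mass transport: in \<open>Phi\<close> the first mark of a pair is rooted at 0, in
  \<open>inter\<close> it covers 0. Under a shift-invariant law both expectations reduce to the same
  sums over the pair correlations \<open>M\<close>.\<close>

lemma nn_integral_Phi:
  assumes P: "cinv I P"
  shows "(\<integral>\<^sup>+\<omega>. Phi G v {0} UNIV \<omega> \<partial>P) = (\<integral>\<^sup>+\<omega>. inter v (occ G {1..} \<omega>) \<partial>P)"
proof -
  note P' = cinvD[OF P]
  have c: "(k, x) \<in> I" if "k \<in> {1..}" for k x using that P'(3) by auto
  have m: "(\<lambda>\<omega>. of_nat (\<omega> (k, x)) :: ennreal) \<in> borel_measurable P" if "k \<in> {1..}" for k x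
    using measurable_coordinate[OF c[OF that] P'(2)] by measurable
  have m2: "(\<lambda>\<omega>. of_nat (\<omega> (k, x)) * of_nat (\<omega> (l, y)) :: ennreal) \<in> borel_measurable P" if "k \<in> {1..}" "l \<in> {1..}" for k x l y
    by (intro borel_measurable_times_ennreal m that)
  define M where "M k l y = (\<integral>\<^sup>+\<omega>. of_nat (\<omega> (k, 0)) * of_nat (\<omega> (l, y)) \<partial>P)" for k l y
  define T where "T k l y = (\<Sum>i\<in>G k. \<Sum>j\<in>G l. ennreal (v (i - y - j)))" for k l :: nat and y
  let ?N = "count_space {1..} :: nat measure"
  have fub: "(\<integral>\<^sup>+\<omega>. (\<integral>\<^sup>+k. (\<integral>\<^sup>+l. f k l \<omega> \<partial>?N) \<partial>?N) \<partial>P) = (\<integral>\<^sup>+k. (\<integral>\<^sup>+l. (\<integral>\<^sup>+\<omega>. f k l \<omega> \<partial>P) \<partial>?N) \<partial>?N)"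
    if "\<And>k l. k \<in> {1..} \<Longrightarrow> l \<in> {1..} \<Longrightarrow> f k l \<in> borel_measurable P" for f :: "nat \<Rightarrow> nat \<Rightarrow> 'd config \<Rightarrow> ennreal"
  proof -
    have p: "(\<integral>\<^sup>+k. (\<integral>\<^sup>+l. g k l \<partial>?N) \<partial>?N) = (\<integral>\<^sup>+p. g (fst p) (snd p) \<partial>count_space ({1..} \<times> {1..}))" for g :: "nat \<Rightarrow> nat \<Rightarrow> ennreal"
      by (subst nn_integral_count_space_Times) auto
    show ?thesis unfolding p by (rule nn_integral_count_space_nn_integral) (auto intro: that)
  qed
  have "(\<integral>\<^sup>+\<omega>. Phi G v {0} UNIV \<omega> \<partial>P) = (\<integral>\<^sup>+\<omega>. (\<integral>\<^sup>+y. (\<integral>\<^sup>+k. (\<integral>\<^sup>+l. of_nat (\<omega> (k, 0)) * of_nat (\<omega> (l, y)) * T k l y \<partial>?N) \<partial>?N) \<partial>count_space UNIV) \<partial>P)"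
  proof (rule nn_integral_cong)
    fix \<omega> :: "'d config"
    have t: "ennreal (T_int v 0 y (G k) (G l)) = T k l y" for k l y
      unfolding T_int_def T_def using v_nonneg by (simp add: sum_ennreal sum_nonneg)
    show "Phi G v {0} UNIV \<omega> = (\<integral>\<^sup>+y. (\<integral>\<^sup>+k. (\<integral>\<^sup>+l. of_nat (\<omega> (k, 0)) * of_nat (\<omega> (l, y)) * T k l y \<partial>?N) \<partial>?N) \<partial>count_space UNIV)"
      unfolding Phi_def
      by (simp add: infsum_ennreal_eq_nn_integral nn_integral_count_space_Times t nn_integral_count_space_finite case_prod_beta)
  qed
  also have "\<dots> = (\<integral>\<^sup>+y. (\<integral>\<^sup>+\<omega>. (\<integral>\<^sup>+k. (\<integral>\<^sup>+l. of_nat (\<omega> (k, 0)) * of_nat (\<omega> (l, y)) * T k l y \<partial>?N) \<partial>?N) \<partial>P) \<partial>count_space UNIV)"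
  proof (rule nn_integral_count_space_nn_integral)
    fix y :: "int ^ 'd"
    have "(\<lambda>\<omega>. of_nat (\<omega> (k, 0)) * of_nat (\<omega> (l, y)) * T k l y * indicator ({1..} \<times> {1..}) (k, l)) \<in> borel_measurable P" for k l
    proof (cases "k \<in> {1..} \<and> l \<in> {1..}")
      case True
      then show ?thesis by (intro borel_measurable_times_ennreal borel_measurable_const m) auto
    qed (auto simp: indicator_def)
    note [measurable] = this
    have "(\<lambda>\<omega>. \<Sum>k. \<Sum>l. of_nat (\<omega> (k, 0)) * of_nat (\<omega> (l, y)) * T k l y * indicator ({1..} \<times> {1..}) (k, l)) \<in> borel_measurable P"
      by measurable
    moreover have "(\<integral>\<^sup>+k. (\<integral>\<^sup>+l. of_nat (\<omega> (k, 0)) * of_nat (\<omega> (l, y)) * T k l y \<partial>?N) \<partial>?N)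
      = (\<Sum>k. \<Sum>l. of_nat (\<omega> (k, 0)) * of_nat (\<omega> (l, y)) * T k l y * indicator ({1..} \<times> {1..}) (k, l))" (is "?l = ?r") for \<omega>
    proof -
      have "?r = (\<integral>\<^sup>+k. (\<integral>\<^sup>+l. of_nat (\<omega> (k, 0)) * of_nat (\<omega> (l, y)) * T k l y * indicator ({1..} \<times> {1..}) (k, l) \<partial>count_space UNIV) \<partial>count_space UNIV)"
        by (simp add: nn_integral_count_space_nat)
      also have "\<dots> = (\<integral>\<^sup>+p. of_nat (\<omega> (fst p, 0)) * of_nat (\<omega> (snd p, y)) * T (fst p) (snd p) y * indicator ({1..} \<times> {1..}) p \<partial>count_space UNIV)"
        using nn_integral_fst_count_space[of "\<lambda>p. of_nat (\<omega> (fst p, 0)) * of_nat (\<omega> (snd p, y)) * T (fst p) (snd p) y * indicator ({1..} \<times> {1..}) p"] by simp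
      also have "\<dots> = (\<integral>\<^sup>+p. of_nat (\<omega> (fst p, 0)) * of_nat (\<omega> (snd p, y)) * T (fst p) (snd p) y * indicator ({1..} \<times> {1..}) p \<partial>count_space ({1..} \<times> {1..}))"
        by (rule nn_integral_count_space_eq) auto
      also have "\<dots> = (\<integral>\<^sup>+p. of_nat (\<omega> (fst p, 0)) * of_nat (\<omega> (snd p, y)) * T (fst p) (snd p) y \<partial>count_space ({1..} \<times> {1..}))"
        by (intro nn_integral_cong) auto
      also have "\<dots> = ?l" by (subst nn_integral_count_space_Times) auto
      finally show ?thesis ..
    qed
    ultimately show "(\<lambda>\<omega>. \<integral>\<^sup>+k. (\<integral>\<^sup>+l. of_nat (\<omega> (k, 0)) * of_nat (\<omega> (l, y)) * T k l y \<partial>?N) \<partial>?N) \<in> borel_measurable P"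
      by simp
  qed simp
  also have "\<dots> = (\<integral>\<^sup>+y. (\<integral>\<^sup>+k. (\<integral>\<^sup>+l. M k l y * T k l y \<partial>?N) \<partial>?N) \<partial>count_space UNIV)"
    unfolding M_def
    by (intro nn_integral_cong) (subst fub, (intro borel_measurable_times_ennreal borel_measurable_const m; simp),
        intro nn_integral_cong nn_integral_multc m2, auto)
  also have "\<dots> = (\<integral>\<^sup>+k. (\<integral>\<^sup>+l. (\<integral>\<^sup>+y. M k l y * T k l y \<partial>count_space UNIV) \<partial>?N) \<partial>?N)"
    by (subst nn_integral_count_space_nn_integral[of "{1..}" _ "count_space UNIV"], simp, simp, intro nn_integral_cong)
       (subst nn_integral_count_space_nn_integral[of "{1..}" _ "count_space UNIV"], auto)
  finally have 1: "(\<integral>\<^sup>+\<omega>. Phi G v {0} UNIV \<omega> \<partial>P) = (\<integral>\<^sup>+k. (\<integral>\<^sup>+l. (\<integral>\<^sup>+y. M k l y * T k l y \<partial>count_space UNIV) \<partial>?N) \<partial>?N)" .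
  \<comment> \<open>Substituting \<open>y = u - j + i\<close> turns \<open>i - y - j\<close> into
    \<open>- u\<close>; the symmetry of v gives \<open>v u\<close>, and the sum over all y becomes
    one over the finite support.\<close>
  have MT: "(\<integral>\<^sup>+y. M k l y * T k l y \<partial>count_space UNIV)
      = (\<Sum>u | v u \<noteq> 0. ennreal (v u) * (\<Sum>i\<in>G k. \<Sum>j\<in>G l. M k l (u - j + i)))" if "k \<in> {1..}" "l \<in> {1..}" for k l
  proof -
    have "(\<integral>\<^sup>+y. M k l y * T k l y \<partial>count_space UNIV) = (\<Sum>i\<in>G k. \<Sum>j\<in>G l. \<integral>\<^sup>+y. M k l y * ennreal (v (i - y - j)) \<partial>count_space UNIV)"
      unfolding T_def by (simp add: sum_distrib_left nn_integral_sum)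
    also have "\<dots> = (\<Sum>i\<in>G k. \<Sum>j\<in>G l. \<Sum>u | v u \<noteq> 0. M k l (u - j + i) * ennreal (v u))"
    proof (intro sum.cong refl)
      fix i j :: "int ^ 'd"
      have "(\<integral>\<^sup>+y. M k l y * ennreal (v (i - y - j)) \<partial>count_space UNIV) = (\<integral>\<^sup>+u. M k l (u - j + i) * ennreal (v (i - (u - j + i) - j)) \<partial>count_space UNIV)"
        by (rule nn_integral_bij_count_space[symmetric, where g="\<lambda>u. u - j + i" and A=UNIV])
           (auto intro!: bij_betwI[of _ _ _ "\<lambda>y. y + j - i"])
      also have "\<dots> = (\<integral>\<^sup>+u. M k l (u - j + i) * ennreal (v u) \<partial>count_space UNIV)"
        using v_sym by (intro nn_integral_cong) (simp add: algebra_simps)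
      also have "\<dots> = (\<Sum>u | v u \<noteq> 0. M k l (u - j + i) * ennreal (v u))"
        using v_supp by (intro nn_integral_count_space') auto
      finally show "(\<integral>\<^sup>+y. M k l y * ennreal (v (i - y - j)) \<partial>count_space UNIV) = (\<Sum>u | v u \<noteq> 0. M k l (u - j + i) * ennreal (v u))" .
    qed
    also have "\<dots> = (\<Sum>i\<in>G k. \<Sum>u | v u \<noteq> 0. \<Sum>j\<in>G l. M k l (u - j + i) * ennreal (v u))"
      by (intro sum.cong refl sum.swap)
    also have "\<dots> = (\<Sum>u | v u \<noteq> 0. \<Sum>i\<in>G k. \<Sum>j\<in>G l. M k l (u - j + i) * ennreal (v u))"
      by (rule sum.swap)
    finally show ?thesis by (simp add: sum_distrib_left mult.commute)
  qed
  have "(\<integral>\<^sup>+\<omega>. inter v (occ G {1..} \<omega>) \<partial>P) = (\<Sum>u | v u \<noteq> 0. ennreal (v u) * (\<integral>\<^sup>+\<omega>. occ G {1..} \<omega> 0 * occ G {1..} \<omega> u \<partial>P))"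
    unfolding inter_def using P'(2,3)
    by (simp add: nn_integral_sum nn_integral_cmult occ_measurable borel_measurable_times_ennreal)
  also have "\<dots> = (\<Sum>u | v u \<noteq> 0. ennreal (v u) * (\<integral>\<^sup>+k. (\<integral>\<^sup>+l. (\<Sum>i\<in>G k. \<Sum>j\<in>G l. M k l (u - j + i)) \<partial>?N) \<partial>?N))"
  proof (intro sum.cong refl arg_cong2[where f="(*)"])
    fix u :: "int ^ 'd"
    have "(\<integral>\<^sup>+\<omega>. occ G {1..} \<omega> 0 * occ G {1..} \<omega> u \<partial>P) = (\<integral>\<^sup>+\<omega>. (\<integral>\<^sup>+k. (\<integral>\<^sup>+l. (\<Sum>i\<in>G k. \<Sum>j\<in>G l. of_nat (\<omega> (k, 0 - i)) * of_nat (\<omega> (l, u - j))) \<partial>?N) \<partial>?N) \<partial>P)"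
    proof (rule nn_integral_cong)
      fix \<omega> :: "'d config"
      let ?a = "\<lambda>k. \<Sum>i\<in>G k. of_nat (\<omega> (k, 0 - i)) :: ennreal" and ?b = "\<lambda>l. \<Sum>j\<in>G l. of_nat (\<omega> (l, u - j)) :: ennreal"
      have "occ G {1..} \<omega> 0 * occ G {1..} \<omega> u = (\<integral>\<^sup>+k. ?a k * (\<integral>\<^sup>+l. ?b l \<partial>?N) \<partial>?N)"
        unfolding occ_def by (rule nn_integral_multc[symmetric]) simp
      also have "\<dots> = (\<integral>\<^sup>+k. (\<integral>\<^sup>+l. ?a k * ?b l \<partial>?N) \<partial>?N)"
        by (intro nn_integral_cong nn_integral_cmult[symmetric]) simp
      finally show "occ G {1..} \<omega> 0 * occ G {1..} \<omega> u
        = (\<integral>\<^sup>+k. (\<integral>\<^sup>+l. (\<Sum>i\<in>G k. \<Sum>j\<in>G l. of_nat (\<omega> (k, 0 - i)) * of_nat (\<omega> (l, u - j))) \<partial>?N) \<partial>?N)"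
        by (simp only: sum_product)
    qed
    also have "\<dots> = (\<integral>\<^sup>+k. (\<integral>\<^sup>+l. (\<integral>\<^sup>+\<omega>. (\<Sum>i\<in>G k. \<Sum>j\<in>G l. of_nat (\<omega> (k, 0 - i)) * of_nat (\<omega> (l, u - j))) \<partial>P) \<partial>?N) \<partial>?N)"
      by (rule fub) (intro borel_measurable_sum m2)
    also have "\<dots> = (\<integral>\<^sup>+k. (\<integral>\<^sup>+l. (\<Sum>i\<in>G k. \<Sum>j\<in>G l. M k l (u - j + i)) \<partial>?N) \<partial>?N)"
    proof (intro nn_integral_cong)
      fix k l assume kl: "k \<in> space ?N" "l \<in> space ?N"
      then have kl': "k \<in> {1..}" "l \<in> {1..}" by auto
      have "(\<integral>\<^sup>+\<omega>. (\<Sum>i\<in>G k. \<Sum>j\<in>G l. of_nat (\<omega> (k, 0 - i)) * of_nat (\<omega> (l, u - j))) \<partial>P)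
        = (\<Sum>i\<in>G k. \<Sum>j\<in>G l. \<integral>\<^sup>+\<omega>. of_nat (\<omega> (k, 0 - i)) * of_nat (\<omega> (l, u - j)) \<partial>P)"
        by (subst nn_integral_sum) (auto intro!: borel_measurable_sum m2 sum.cong nn_integral_sum kl' simp del: diff_0)
      \<comment> \<open>Shift invariance moves the root of the first mark from \<open>- i\<close> to
        0.\<close>
      also have "\<dots> = (\<Sum>i\<in>G k. \<Sum>j\<in>G l. M k l (u - j + i))"
        unfolding M_def by (intro sum.cong refl, subst nn_integral_pair_shift[OF P c[OF kl'(1)] c[OF kl'(2)]]) simp
      finally show "(\<integral>\<^sup>+\<omega>. (\<Sum>i\<in>G k. \<Sum>j\<in>G l. of_nat (\<omega> (k, 0 - i)) * of_nat (\<omega> (l, u - j))) \<partial>P)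
        = (\<Sum>i\<in>G k. \<Sum>j\<in>G l. M k l (u - j + i))" .
    qed
    finally show "(\<integral>\<^sup>+\<omega>. occ G {1..} \<omega> 0 * occ G {1..} \<omega> u \<partial>P) = (\<integral>\<^sup>+k. (\<integral>\<^sup>+l. (\<Sum>i\<in>G k. \<Sum>j\<in>G l. M k l (u - j + i)) \<partial>?N) \<partial>?N)" .
  qed
  also have "\<dots> = (\<integral>\<^sup>+k. (\<integral>\<^sup>+l. (\<Sum>u | v u \<noteq> 0. ennreal (v u) * (\<Sum>i\<in>G k. \<Sum>j\<in>G l. M k l (u - j + i))) \<partial>?N) \<partial>?N)"
    by (simp add: nn_integral_sum nn_integral_cmult)
  also have "\<dots> = (\<integral>\<^sup>+k. (\<integral>\<^sup>+l. (\<integral>\<^sup>+y. M k l y * T k l y \<partial>count_space UNIV) \<partial>?N) \<partial>?N)"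
    by (intro nn_integral_cong MT[symmetric]) auto
  finally show ?thesis using 1 by simp
qed

text \<open>Cost of a single level a: the terms linear and quadratic in a are the cross terms and
  the square that arise when the constant a is added to the occupation field.\<close>

definition ecost :: "(nat \<Rightarrow> real) \<Rightarrow> nat \<Rightarrow> 'd config measure \<Rightarrow> ennreal" where
  "ecost q a P = dens q P + (\<integral>\<^sup>+\<omega>. inter v (\<lambda>i. occ G {1..} \<omega> i + of_nat a) \<partial>P)"

lemma ecost_eq:
  assumes P: "P \<in> shift_invariant_probs"
  shows "entropy_dens q P + (\<integral>\<^sup>+\<omega>. Phi G v {0} UNIV \<omega> \<partial>P)
        + 2 * ennreal (v_bar v) * of_nat a * (\<integral>\<^sup>+\<omega>. N_len {0} \<omega> \<partial>P)
        + ennreal (v_bar v) * (of_nat a)\<^sup>2 = ecost q a P"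
proof -
  have c: "cinv (marks UNIV) P" by (rule shift_invariant_imp_cinv[OF P])
  note P' = cinvD[OF c]
  interpret prob_space P by (rule P')
  have [measurable]: "(\<lambda>\<omega>. occ G {1..} \<omega> i) \<in> borel_measurable P" for i
    using P' by (intro occ_measurable) auto
  define m where "m = (\<integral>\<^sup>+\<omega>. N_len {0} \<omega> \<partial>P)"
  have m: "(\<integral>\<^sup>+\<omega>. occ G {1..} \<omega> i \<partial>P) = m" for i unfolding m_def by (rule nn_integral_N_len[OF c, symmetric])
  have "(\<integral>\<^sup>+\<omega>. inter v (\<lambda>i. occ G {1..} \<omega> i + of_nat a) \<partial>P)
    = (\<Sum>u | v u \<noteq> 0. ennreal (v u) * (\<integral>\<^sup>+\<omega>. (occ G {1..} \<omega> 0 + of_nat a) * (occ G {1..} \<omega> u + of_nat a) \<partial>P))"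
    unfolding inter_def by (simp add: nn_integral_sum nn_integral_cmult)
  also have "\<dots> = (\<Sum>u | v u \<noteq> 0. ennreal (v u) * ((\<integral>\<^sup>+\<omega>. occ G {1..} \<omega> 0 * occ G {1..} \<omega> u \<partial>P) + (2 * of_nat a * m + (of_nat a)\<^sup>2)))"
  proof (intro sum.cong refl arg_cong2[where f="(*)"])
    fix u :: "int ^ 'd"
    have "(\<integral>\<^sup>+\<omega>. (occ G {1..} \<omega> 0 + of_nat a) * (occ G {1..} \<omega> u + of_nat a) \<partial>P)
      = (\<integral>\<^sup>+\<omega>. occ G {1..} \<omega> 0 * occ G {1..} \<omega> u + (of_nat a * occ G {1..} \<omega> 0 + (of_nat a * occ G {1..} \<omega> u + of_nat a * of_nat a)) \<partial>P)"
      by (intro nn_integral_cong) (simp add: distrib_left distrib_right ac_simps)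
    also have "\<dots> = (\<integral>\<^sup>+\<omega>. occ G {1..} \<omega> 0 * occ G {1..} \<omega> u \<partial>P) + (of_nat a * m + (of_nat a * m + of_nat a * of_nat a))"
      by (simp add: nn_integral_add nn_integral_cmult m emeasure_space_1)
    also have "of_nat a * m + (of_nat a * m + of_nat a * of_nat a) = 2 * of_nat a * m + (of_nat a)\<^sup>2"
      by (simp only: power2_eq_square mult_2 distrib_right add.assoc)
    finally show "(\<integral>\<^sup>+\<omega>. (occ G {1..} \<omega> 0 + of_nat a) * (occ G {1..} \<omega> u + of_nat a) \<partial>P)
      = (\<integral>\<^sup>+\<omega>. occ G {1..} \<omega> 0 * occ G {1..} \<omega> u \<partial>P) + (2 * of_nat a * m + (of_nat a)\<^sup>2)" .
  qed
  also have "\<dots> = (\<Sum>u | v u \<noteq> 0. ennreal (v u) * (\<integral>\<^sup>+\<omega>. occ G {1..} \<omega> 0 * occ G {1..} \<omega> u \<partial>P)) + (\<Sum>u | v u \<noteq> 0. ennreal (v u)) * (2 * of_nat a * m + (of_nat a)\<^sup>2)"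
    by (simp add: distrib_left sum.distrib sum_distrib_right)
  also have "(\<Sum>u | v u \<noteq> 0. ennreal (v u) * (\<integral>\<^sup>+\<omega>. occ G {1..} \<omega> 0 * occ G {1..} \<omega> u \<partial>P)) = (\<integral>\<^sup>+\<omega>. inter v (occ G {1..} \<omega>) \<partial>P)"
    unfolding inter_def by (simp add: nn_integral_sum nn_integral_cmult)
  finally have "ecost q a P = dens q P + ((\<integral>\<^sup>+\<omega>. inter v (occ G {1..} \<omega>) \<partial>P) + ennreal (v_bar v) * (2 * of_nat a * m + (of_nat a)\<^sup>2))"
    unfolding ecost_def v_bar_eq by simp
  then show ?thesis
    unfolding entropy_dens_eq_dens[OF P] nn_integral_Phi[OF c] m_def[symmetric]
    by (simp add: distrib_left ac_simps)
qed

lemma cost_eq: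
  assumes "\<And>a. P a \<in> shift_invariant_probs"
  shows "cost q G v \<psi> P = (\<integral>\<^sup>+a. ecost q a (P a) \<partial>measure_pmf \<psi>)"
  unfolding cost_def nn_integral_pmf_countable ecost_eq[OF assms] ..

end

section \<open>Tiling with large cubes\<close>

definition lattice :: "nat \<Rightarrow> int ^ 'd::finite \<Rightarrow> (int ^ 'd) set" where
  "lattice L z = {x. \<forall>i. (2 * int L + 1) dvd (x $ i - z $ i)}"

text \<open>The balanced residue modulo the side length \<open>2 * L + 1\<close> in each coordinate.
  It is the one offset z in \<open>box_Z L\<close> whose lattice contains x.\<close>

definition cube_rep :: "nat \<Rightarrow> int ^ 'd::finite \<Rightarrow> int ^ 'd" where
  "cube_rep L x = (\<chi> i. (x $ i + int L) mod (2 * int L + 1) - int L)"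

lemma cube_rep_box: "cube_rep L x \<in> box_Z L"
  unfolding box_Z_def cube_rep_def
proof (clarsimp)
  fix i
  have "0 \<le> (x $ i + int L) mod (2 * int L + 1)" "(x $ i + int L) mod (2 * int L + 1) < 2 * int L + 1"
    by (rule pos_mod_sign, simp, rule pos_mod_bound, simp)
  then show "\<bar>(x $ i + int L) mod (2 * int L + 1) - int L\<bar> \<le> int L" by linarith
qed

lemma lattice_iff_rep:
  assumes "z \<in> box_Z L" shows "x \<in> lattice L z \<longleftrightarrow> z = cube_rep L x"
proof -
  have "(2 * int L + 1) dvd (x $ i - z $ i) \<longleftrightarrow> z $ i = (x $ i + int L) mod (2 * int L + 1) - int L" for i
  proof -
    have "\<bar>z $ i\<bar> \<le> int L" using assms by (simp add: box_Z_def)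
    then have "(z $ i + int L) mod (2 * int L + 1) = z $ i + int L" by (intro mod_pos_pos_trivial) linarith+
    moreover have "(2 * int L + 1) dvd (x $ i - z $ i) \<longleftrightarrow> (x $ i + int L) mod (2 * int L + 1) = (z $ i + int L) mod (2 * int L + 1)"
      by (simp add: mod_eq_dvd_iff)
    ultimately show ?thesis by linarith
  qed
  then show ?thesis by (simp add: lattice_def cube_rep_def vec_eq_iff)
qed

lemma lattice_cong: "w \<in> lattice L z \<Longrightarrow> lattice L w = lattice L z"
  unfolding lattice_def
proof (intro set_eqI, simp, intro iffI allI)
  fix x :: "int ^ 'a" and i
  assume w: "\<forall>i. 2 * int L + 1 dvd w $ i - z $ i"
  show "2 * int L + 1 dvd x $ i - z $ i" if "\<forall>i. 2 * int L + 1 dvd x $ i - w $ i"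
    using dvd_add[OF that[rule_format, of i] w[rule_format, of i]] by simp
  show "2 * int L + 1 dvd x $ i - w $ i" if "\<forall>i. 2 * int L + 1 dvd x $ i - z $ i"
    using dvd_diff[OF that[rule_format, of i] w[rule_format, of i]] by simp
qed

lemma lattice_shift: "x + u \<in> lattice L z \<longleftrightarrow> x \<in> lattice L (z - u)"
  unfolding lattice_def by (simp add: algebra_simps)

lemma lattice_cube_rep: "lattice L (cube_rep L z) = lattice L z"
  using lattice_cong[of z L "cube_rep L z"] lattice_iff_rep[OF cube_rep_box, of z L z] by simp

lemma cube_rep_eq_iff: "cube_rep L x = cube_rep L y \<longleftrightarrow> x \<in> lattice L y"
proof
  assume "cube_rep L x = cube_rep L y"
  then have "x \<in> lattice L (cube_rep L y)" by (simp add: lattice_iff_rep[OF cube_rep_box])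
  then show "x \<in> lattice L y" by (simp add: lattice_cube_rep)
next
  assume "x \<in> lattice L y"
  then have "x \<in> lattice L (cube_rep L y)" by (simp add: lattice_cube_rep)
  then show "cube_rep L x = cube_rep L y" by (simp add: lattice_iff_rep[OF cube_rep_box])
qed

text \<open>A shift permutes the offsets of the coarse lattice, so the uniform average over offsets
  is shift invariant.\<close>

lemma bij_cube_shift: "bij_betw (\<lambda>z. cube_rep L (z - u)) (box_Z L) (box_Z L)"
proof -
  have "inj_on (\<lambda>z. cube_rep L (z - u)) (box_Z L)"
  proof (rule inj_onI)
    fix z w :: "int ^ 'a" assume zw: "z \<in> box_Z L" "w \<in> box_Z L" "cube_rep L (z - u) = cube_rep L (w - u)"
    then have "z - u \<in> lattice L (w - u)" by (simp add: cube_rep_eq_iff)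
    then have "z \<in> lattice L w" using lattice_shift[of "z - u" u L w] by simp
    then have "w = cube_rep L z" using zw by (simp add: lattice_iff_rep)
    moreover have "z = cube_rep L z" using zw(1) by (subst lattice_iff_rep[symmetric]) (auto simp: lattice_def)
    ultimately show "z = w" by simp
  qed
  then show ?thesis
    using finite_box_Z cube_rep_box by (intro bij_betw_imageI endo_inj_surj) auto
qed

text \<open>Each site lies on the lattice of exactly one offset. Averaged over the offsets, B
  therefore receives \<open>card B\<close> divided by the volume of a cube.\<close>

lemma sum_lattice_count:
  fixes B :: "(int ^ 'd::finite) set"
  assumes "finite B"
  shows "(\<Sum>z\<in>box_Z L. card (lattice L z \<inter> B)) = card B"
proof -
  have "(\<Sum>z\<in>box_Z L. card (lattice L z \<inter> B)) = (\<Sum>z\<in>box_Z L. \<Sum>x\<in>B. of_bool (x \<in> lattice L z))"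
    using assms by (intro sum.cong refl) (simp add: Int_commute Int_def)
  also have "\<dots> = (\<Sum>x\<in>B. \<Sum>z\<in>box_Z L. of_bool (x \<in> lattice L z))" by (rule sum.swap)
  also have "\<dots> = (\<Sum>x\<in>B. 1)"
  proof (intro sum.cong refl)
    fix x
    have "(\<Sum>z\<in>box_Z L. of_bool (x \<in> lattice L z)) = (\<Sum>z\<in>box_Z L. if z = cube_rep L x then 1 else 0 :: nat)"
      by (intro sum.cong refl) (simp add: lattice_iff_rep)
    also have "\<dots> = 1" by (simp add: finite_box_Z cube_rep_box)
    finally show "(\<Sum>z\<in>box_Z L. of_bool (x \<in> lattice L z)) = (1 :: nat)" .
  qed
  finally show ?thesis by simp
qed

lemma tshift_bump: "tshift u (bump a ({k} \<times> lattice L z) \<omega>) = bump a ({k} \<times> lattice L (z - u)) (tshift u \<omega>)"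
  by (auto simp: tshift_def bump_def fun_eq_iff lattice_shift)

lemma box_Z_nonempty: "box_Z L \<noteq> {}"
  using cube_rep_box by blast

text \<open>For \<open>k = (2 * L + 1)\<^sup>d\<close> the mark \<open>G k\<close> is the box of radius \<open>L\<close>, so \<open>a\<close> such marks on each point of the lattice
  raise the occupation field by exactly \<open>a\<close>.\<close>

definition tile :: "nat \<Rightarrow> nat \<Rightarrow> 'd::finite config measure \<Rightarrow> 'd config measure" where
  "tile a L P = mix (pmf_of_set (box_Z L)) (\<lambda>z. distr P (conf (marks UNIV)) (bump a ({(2 * L + 1) ^ CARD('d)} \<times> lattice L z)))"

lemma tile_subset: "{(2 * L + 1) ^ CARD('d)} \<times> lattice L z \<subseteq> marks (UNIV :: (int ^ 'd::finite) set)"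
  by (auto simp: Suc_le_eq One_nat_def)

context
  fixes P :: "'d::finite config measure"
  assumes P: "cinv (marks UNIV) P"
begin

lemma tile_parts:
  "prob_space (distr P (conf (marks UNIV)) (bump a ({(2 * L + 1) ^ CARD('d)} \<times> lattice L z)))"
  "sets (distr P (conf (marks UNIV)) (bump a ({(2 * L + 1) ^ CARD('d)} \<times> lattice L z))) = sets (conf (marks UNIV))"
  by (rule prob_bump[OF cinvD(1)[OF P] tile_subset cinvD(2)[OF P]]) simp

text \<open>Shifting commutes with adding the lattice points up to a change of offset, and the
  average over offsets absorbs that change.\<close>

lemma tile_cinv: "cinv (marks UNIV) (tile a L P)"
  unfolding cinv_def
proof (intro conjI allI impI)
  show "prob_space (tile a L P)" "sets (tile a L P) = sets (conf (marks UNIV))"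
    unfolding tile_def by (rule prob_mix[OF tile_parts], rule sets_mix[OF tile_parts])
  show "\<exists>K. marks UNIV = K \<times> (UNIV :: (int ^ 'd) set) \<and> {1..} \<subseteq> K" by (intro exI[of _ "{1..}"]) simp
  fix u :: "int ^ 'd" and f :: "'d config \<Rightarrow> real" assume f: "cyl (marks UNIV) f"
  let ?S = "\<lambda>z. {(2 * L + 1) ^ CARD('d)} \<times> lattice L z :: (nat \<times> (int ^ 'd)) set"
  have int: "(\<integral>\<omega>. g \<omega> \<partial>tile a L P) = (\<Sum>z\<in>box_Z L. \<integral>\<omega>. g (bump a (?S z) \<omega>) \<partial>P) / real (card (box_Z L :: (int ^ 'd) set))"
    if g: "cyl (marks UNIV) g" for g
  proof -
    from cylE[OF g] obtain B where B: "\<And>\<omega>. \<bar>g \<omega>\<bar> \<le> B" by metis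
    have "(\<integral>\<omega>. g \<omega> \<partial>tile a L P) = (\<integral>z. (\<integral>\<omega>. g (bump a (?S z) \<omega>) \<partial>P) \<partial>measure_pmf (pmf_of_set (box_Z L)))"
      unfolding tile_def
      by (simp only: integral_mix[OF tile_parts cyl_measurable[OF g subset_refl refl] B]
          integral_bump[OF tile_subset cinvD(2)[OF P] g subset_refl])
    then show ?thesis by (simp add: integral_pmf_of_set[OF box_Z_nonempty finite_box_Z])
  qed
  have "(\<Sum>z\<in>box_Z L. \<integral>\<omega>. f (tshift u (bump a (?S z) \<omega>)) \<partial>P) = (\<Sum>z\<in>box_Z L. \<integral>\<omega>. f (bump a (?S (cube_rep L (z - u))) (tshift u \<omega>)) \<partial>P)"
    by (simp only: tshift_bump lattice_cube_rep)
  also have "\<dots> = (\<Sum>z\<in>box_Z L. \<integral>\<omega>. f (bump a (?S (cube_rep L (z - u))) \<omega>) \<partial>P)"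
    by (intro sum.cong refl cinvD(4)[OF P] cyl_bump f)
  also have "\<dots> = (\<Sum>z\<in>box_Z L. \<integral>\<omega>. f (bump a (?S z) \<omega>) \<partial>P)"
    by (rule sum.reindex_bij_betw[OF bij_cube_shift])
  finally show "(\<integral>\<omega>. f (tshift u \<omega>) \<partial>tile a L P) = (\<integral>\<omega>. f \<omega> \<partial>tile a L P)"
    by (simp only: int[OF f] int[OF cinv_shift_cyl[OF P f]])
qed

text \<open>Each added point costs at most b by \<open>hent_bump\<close>. Convexity of the entropy
  lets the offsets be averaged, and the mean number of points in a box is its volume divided by that
  of a cube.\<close>

lemma tile_dens:
  assumes q: "q ((2 * L + 1) ^ CARD('d)) > 0"
    and m: "(\<integral>\<^sup>+\<omega>. of_nat (\<omega> ((2 * L + 1) ^ CARD('d), 0)) \<partial>P) \<le> ennreal m" "0 \<le> m"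
  shows "dens q (tile a L P) \<le> dens q P + ennreal ((real a * (m + real a) + real a * \<bar>ln (q ((2 * L + 1) ^ CARD('d)))\<bar>) / real ((2 * L + 1) ^ CARD('d)))"
proof -
  define k where "k = (2 * L + 1) ^ CARD('d)"
  define b where "b = real a * (m + real a) + real a * \<bar>ln (q k)\<bar>"
  have b0: "0 \<le> b" using m(2) by (simp add: b_def)
  have k1: "k \<ge> 1" by (simp add: k_def Suc_le_eq One_nat_def)
  note P' = cinvD[OF P]
  have "dens q (tile a L P) \<le> dens q P + ennreal (b / real k)"
    unfolding dens_def[of q "tile a L P"]
  proof (rule SUP_least)
    fix n :: nat
    let ?B = "box_Z n :: (int ^ 'd) set" and ?J = "marks (box_Z n) :: (nat \<times> (int ^ 'd)) set"
    have sub: "?J \<subseteq> marks UNIV" by auto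
    have one: "hent q (distr P (conf (marks UNIV)) (bump a ({k} \<times> lattice L z))) ?J \<le> hent q P ?J + of_nat (card (lattice L z \<inter> ?B)) * ennreal b" for z :: "int ^ 'd"
    proof -
      let ?S = "{k} \<times> (lattice L z \<inter> ?B)"
      have SJ: "?S \<subseteq> ?J" "?S \<subseteq> marks UNIV" using k1 by auto
      \<comment> \<open>Tests on the box see only the lattice points inside it; these are finitely
        many, as \<open>hent_bump\<close> requires.\<close>
      have "hent q (distr P (conf (marks UNIV)) (bump a ({k} \<times> lattice L z))) ?J = hent q (distr P (conf (marks UNIV)) (bump a ?S)) ?J"
        unfolding hent_def
      proof (intro SUP_cong refl)
        fix f :: "'d config \<Rightarrow> real" assume "f \<in> {f. cyl ?J f \<and> (\<integral>\<omega>. exp (f \<omega>) \<partial>(reference q)) \<le> 1}"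
        then have f: "cyl ?J f" by simp
        from cylE[OF f] obtain F where F: "F \<subseteq> ?J" "depends_on F f" by metis
        have "f (bump a ({k} \<times> lattice L z) \<omega>) = f (bump a ?S \<omega>)" for \<omega>
          using F(2) by (rule depends_onD) (use F(1) in \<open>auto simp: bump_def\<close>)
        then show "ennreal (\<integral>\<omega>. f \<omega> \<partial>distr P (conf (marks UNIV)) (bump a ({k} \<times> lattice L z))) = ennreal (\<integral>\<omega>. f \<omega> \<partial>distr P (conf (marks UNIV)) (bump a ?S))"
          by (simp only: integral_bump[OF tile_subset[of L z, folded k_def] P'(2) f sub] integral_bump[OF SJ(2) P'(2) f sub])
      qed
      also have "\<dots> \<le> hent q P ?J + of_nat (card ?S) * ennreal b"
      proof (rule hent_bump[OF P'(1,2) sub sub _ SJ(1)])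
        show "finite ?S" using finite_box_Z by auto
        show "(\<integral>\<^sup>+\<omega>. of_nat (\<omega> i) \<partial>P) \<le> ennreal m" if "i \<in> ?S" for i
        proof -
          from that obtain x where i: "i = (k, x)" by auto
          show ?thesis unfolding i using m(1) k1 by (subst nn_integral_coordinate_shift[OF P]) (auto simp: k_def)
        qed
      qed (use q m(2) in \<open>auto simp: b_def k_def\<close>)
      also have "card ?S = card (lattice L z \<inter> ?B)" by (simp add: card_cartesian_product_singleton)
      finally show ?thesis .
    qed
    let ?bn = "of_nat (card ?B) :: ennreal"
    have kB: "card (box_Z L :: (int ^ 'd) set) = k" by (simp add: card_box_Z k_def)
    have k0: "(0::ennreal) < of_nat k" using k1 by (simp add: of_nat_0_less_iff One_nat_def)
    have "hent q (tile a L P) ?J \<le> (\<integral>\<^sup>+z. hent q (distr P (conf (marks UNIV)) (bump a ({k} \<times> lattice L z))) ?J \<partial>measure_pmf (pmf_of_set (box_Z L)))"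
      unfolding tile_def k_def by (rule hent_mix_le[OF tile_parts sub])
    also have "\<dots> \<le> (\<integral>\<^sup>+z. hent q P ?J + of_nat (card (lattice L z \<inter> ?B)) * ennreal b \<partial>measure_pmf (pmf_of_set (box_Z L)))"
      by (intro nn_integral_mono one)
    also have "\<dots> = (\<Sum>z\<in>box_Z L. hent q P ?J + of_nat (card (lattice L z \<inter> ?B)) * ennreal b) / of_nat k"
      by (simp add: nn_integral_pmf_of_set[OF box_Z_nonempty finite_box_Z] kB)
    also have "(\<Sum>z\<in>box_Z L. hent q P ?J + of_nat (card (lattice L z \<inter> ?B)) * ennreal b) = hent q P ?J * of_nat k + ?bn * ennreal b"
    proof -
      have "(\<Sum>z\<in>box_Z L. of_nat (card (lattice L z \<inter> ?B)) :: ennreal) = ?bn"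
        using sum_lattice_count[OF finite_box_Z[of n], of L] by (metis of_nat_sum)
      then have "(\<Sum>z\<in>box_Z L. of_nat (card (lattice L z \<inter> ?B)) * ennreal b) = ?bn * ennreal b"
        by (simp only: sum_distrib_right[symmetric])
      then show ?thesis by (simp only: sum.distrib sum_constant kB mult.commute)
    qed
    also have "(hent q P ?J * of_nat k + ?bn * ennreal b) / of_nat k = hent q P ?J + ?bn * ennreal (b / real k)"
    proof -
      have "hent q P ?J * of_nat k / of_nat k = hent q P ?J"
        using ennreal_divide_mult_cancel[OF k0 of_nat_less_top, of "hent q P ?J"] by (simp add: divide_ennreal_def mult_ac)
      moreover have "ennreal b / of_nat k = ennreal (b / real k)"
        using k1 b0 by (simp add: divide_ennreal ennreal_of_nat_eq_real_of_nat One_nat_def)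
      ultimately show ?thesis by (simp add: divide_ennreal_def distrib_right mult.assoc)
    qed
    finally have "hent q (tile a L P) ?J / ?bn \<le> (hent q P ?J + ?bn * ennreal (b / real k)) / ?bn"
      by (rule divide_right_mono_ennreal)
    also have "\<dots> = hent q P ?J / ?bn + ennreal (b / real k)"
    proof -
      have "?bn * ennreal (b / real k) / ?bn = ennreal (b / real k)"
        using ennreal_divide_mult_cancel[OF card_box_pos[of n, where 'd='d] of_nat_less_top, of "ennreal (b / real k)"]
        by (simp add: divide_ennreal_def mult_ac)
      then show ?thesis by (simp add: divide_ennreal_def distrib_right)
    qed
    also have "\<dots> \<le> dens q P + ennreal (b / real k)"
      unfolding dens_def by (intro add_right_mono SUP_upper) simp
    finally show "hent q (tile a L P) ?J / ?bn \<le> dens q P + ennreal (b / real k)" .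
  qed
  then show ?thesis unfolding b_def k_def .
qed

lemma nn_integral_tile:
  assumes f: "f \<in> borel_measurable (conf (marks UNIV))"
    and g: "\<And>z \<omega>. f (bump a ({(2 * L + 1) ^ CARD('d)} \<times> lattice L z) \<omega>) = g \<omega>"
  shows "(\<integral>\<^sup>+\<omega>. f \<omega> \<partial>tile a L P) = (\<integral>\<^sup>+\<omega>. g \<omega> \<partial>P)"
proof -
  have "(\<integral>\<^sup>+\<omega>. f \<omega> \<partial>tile a L P) = (\<integral>\<^sup>+z. (\<integral>\<^sup>+\<omega>. g \<omega> \<partial>P) \<partial>measure_pmf (pmf_of_set (box_Z L :: (int ^ 'd) set)))"
    unfolding tile_def nn_integral_mix[OF tile_parts f]
    by (intro nn_integral_cong, subst nn_integral_distr[OF bump_measurable[OF tile_subset cinvD(2)[OF P]]]) (simp_all add: f g)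
  then show ?thesis by simp
qed

end

context interaction
begin

text \<open>Forced by cardinality: two consecutive boxes bracket a set with as many points as
  \<open>box_Z L\<close>, so L is the radius of one of them and the inclusion concerned is an
  equality.\<close>

lemma G_cube: "G ((2 * L + 1) ^ CARD('d)) = box_Z L"
proof -
  let ?k = "(2 * L + 1) ^ CARD('d)"
  have k: "?k \<ge> 1" by (simp add: Suc_le_eq One_nat_def)
  obtain L' where L': "box_Z L' \<subseteq> G ?k" "G ?k \<subseteq> box_Z (L' + 1)" using G_box[OF k] by blast
  have "card (box_Z L' :: (int ^ 'd) set) \<le> ?k" using card_mono[OF finite_G[OF k] L'(1)] G_card[OF k] by simp
  then have le: "L' \<le> L" unfolding card_box_Z by (simp add: power_mono_iff)
  have "?k \<le> card (box_Z (L' + 1) :: (int ^ 'd) set)" using card_mono[OF finite_box_Z L'(2)] G_card[OF k] by simp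
  then have ge: "L \<le> L' + 1" unfolding card_box_Z by (simp add: power_mono_iff One_nat_def)
  show ?thesis
  proof (cases "L = L'")
    case True
    have "box_Z L = G ?k"
      by (rule card_subset_eq[OF finite_G[OF k] L'(1)[folded True]]) (simp only: card_box_Z G_card[OF k])
    then show ?thesis ..
  next
    case False
    then have "L = L' + 1" using le ge by linarith
    show ?thesis
      by (rule card_subset_eq[OF finite_box_Z L'(2)[folded \<open>L = L' + 1\<close>]]) (simp only: card_box_Z G_card[OF k])
  qed
qed

text \<open>The cubes of radius L around the points of the lattice partition the space, so every
  site is covered by exactly one of them.\<close>

lemma occ_bump: "occ G {1..} (bump a ({(2 * L + 1) ^ CARD('d)} \<times> lattice L z) \<omega>) i = occ G {1..} \<omega> i + of_nat a"
proof -
  let ?k = "(2 * L + 1) ^ CARD('d)"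
  let ?h = "\<lambda>k. \<Sum>y\<in>G k. if k = ?k \<and> i - y \<in> lattice L z then of_nat a else 0 :: ennreal"
  have k: "?k \<in> {1..}" by (simp add: Suc_le_eq One_nat_def)
  have "occ G {1..} (bump a ({?k} \<times> lattice L z) \<omega>) i = (\<integral>\<^sup>+k. (\<Sum>y\<in>G k. of_nat (\<omega> (k, i - y))) + ?h k \<partial>count_space {1..})"
    unfolding occ_def bump_def by (intro nn_integral_cong) (auto simp: sum.distrib[symmetric] intro!: sum.cong)
  also have "\<dots> = occ G {1..} \<omega> i + (\<integral>\<^sup>+k. ?h k \<partial>count_space {1..})"
    unfolding occ_def by (rule nn_integral_add) auto
  also have "(\<integral>\<^sup>+k. ?h k \<partial>count_space {1..}) = (\<Sum>k\<in>{?k}. ?h k)"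
    using k by (intro nn_integral_count_space') auto
  also have "\<dots> = (\<Sum>y\<in>box_Z L. if y = cube_rep L (i - z) then of_nat a else 0)"
  proof -
    have "i - y \<in> lattice L z \<longleftrightarrow> y = cube_rep L (i - z)" if "y \<in> box_Z L" for y
    proof -
      have "i - y \<in> lattice L z \<longleftrightarrow> i - z \<in> lattice L y" by (simp add: lattice_def algebra_simps)
      then show ?thesis using lattice_iff_rep[OF that] by simp
    qed
    then show ?thesis by (simp add: G_cube cong: sum.cong)
  qed
  also have "\<dots> = of_nat a" by (simp add: finite_box_Z cube_rep_box)
  finally show ?thesis .
qed

lemma tile_ecost:
  assumes P: "cinv (marks UNIV) P" and q: "q ((2 * L + 1) ^ CARD('d)) > 0"
    and r: "(\<integral>\<^sup>+\<omega>. occ G {1..} \<omega> 0 \<partial>P) \<le> ennreal r" "0 \<le> r"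
  shows "ecost q 0 (tile a L P) \<le> ecost q a P + ennreal ((real a * (r + real a) + real a * \<bar>ln (q ((2 * L + 1) ^ CARD('d)))\<bar>) / real ((2 * L + 1) ^ CARD('d)))"
    "(\<integral>\<^sup>+\<omega>. occ G {1..} \<omega> 0 \<partial>tile a L P) = (\<integral>\<^sup>+\<omega>. occ G {1..} \<omega> 0 \<partial>P) + of_nat a"
proof -
  let ?k = "(2 * L + 1) ^ CARD('d)"
  have k: "?k \<in> {1..}" by (simp add: Suc_le_eq One_nat_def)
  have om: "(\<lambda>\<omega>. occ G {1..} \<omega> i) \<in> borel_measurable (conf (marks UNIV))" for i
    by (intro occ_measurable) auto
  \<comment> \<open>Marks of size \<open>?k\<close> contribute \<open>?k \<ge> 1\<close> times their
    mean to the total density, so r also bounds the mean needed in \<open>tile_dens\<close>.\<close>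
  have "(\<integral>\<^sup>+\<omega>. of_nat (\<omega> (?k, 0)) \<partial>P) \<le> of_nat ?k * (\<integral>\<^sup>+\<omega>. of_nat (\<omega> (?k, 0)) \<partial>P)"
    using mult_right_mono[of 1 "of_nat ?k" "\<integral>\<^sup>+\<omega>. of_nat (\<omega> (?k, 0)) \<partial>P"] k by (simp del: of_nat_power)
  also have "\<dots> = (\<Sum>k\<in>{?k}. of_nat k * (\<integral>\<^sup>+\<omega>. of_nat (\<omega> (k, 0)) \<partial>P))" by simp
  also have "\<dots> \<le> (\<integral>\<^sup>+k. of_nat k * (\<integral>\<^sup>+\<omega>. of_nat (\<omega> (k, 0)) \<partial>P) \<partial>count_space {1..})"
    unfolding nn_integral_count_space_eq_SUP[OF countableI_type] using k by (intro SUP_upper) auto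
  also have "\<dots> \<le> ennreal r" using r(1) nn_integral_occ[OF P subset_refl, of 0] by simp
  finally have m: "(\<integral>\<^sup>+\<omega>. of_nat (\<omega> (?k, 0)) \<partial>P) \<le> ennreal r" .
  have "(\<integral>\<^sup>+\<omega>. inter v (\<lambda>i. occ G {1..} \<omega> i + of_nat 0) \<partial>tile a L P) = (\<integral>\<^sup>+\<omega>. inter v (\<lambda>i. occ G {1..} \<omega> i + of_nat a) \<partial>P)"
    by (rule nn_integral_tile[OF P]) (auto simp: occ_bump intro!: inter_measurable om)
  then show "ecost q 0 (tile a L P) \<le> ecost q a P + ennreal ((real a * (r + real a) + real a * \<bar>ln (q ?k)\<bar>) / real ?k)"
    unfolding ecost_def using tile_dens[where L=L and q=q and m=r and a=a, OF P q m r(2)] by (simp add: add_right_mono ac_simps)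
  have "(\<integral>\<^sup>+\<omega>. occ G {1..} \<omega> 0 \<partial>tile a L P) = (\<integral>\<^sup>+\<omega>. occ G {1..} \<omega> 0 + of_nat a \<partial>P)"
    by (rule nn_integral_tile[OF P om occ_bump])
  also have "\<dots> = (\<integral>\<^sup>+\<omega>. occ G {1..} \<omega> 0 \<partial>P) + of_nat a"
    using prob_space.emeasure_space_1[OF cinvD(1)[OF P]]
    by (subst nn_integral_add) (auto intro!: occ_measurable[OF _ cinvD(2)[OF P]])
  finally show "(\<integral>\<^sup>+\<omega>. occ G {1..} \<omega> 0 \<partial>tile a L P) = (\<integral>\<^sup>+\<omega>. occ G {1..} \<omega> 0 \<partial>P) + of_nat a" .
qed

text \<open>The only error is the entropy of the added points. Divided by the cube volume k it is a
  constant over k plus \<open>a * |ln (q k)| / k\<close>, and both vanish for large cubes by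
  subexponentiality of q.\<close>

lemma tile_approx:
  assumes P: "cinv (marks UNIV) P" and q: "\<And>k. k \<ge> 1 \<Longrightarrow> q k > 0" "(\<lambda>k. ln (q k)) \<in> o(\<lambda>k. real k)"
    and r: "(\<integral>\<^sup>+\<omega>. occ G {1..} \<omega> 0 \<partial>P) < \<infinity>" and e: "(\<epsilon> :: real) > 0"
  shows "\<exists>P'. cinv (marks UNIV) P' \<and> ecost q 0 P' \<le> ecost q a P + ennreal \<epsilon>
    \<and> (\<integral>\<^sup>+\<omega>. occ G {1..} \<omega> 0 \<partial>P') = (\<integral>\<^sup>+\<omega>. occ G {1..} \<omega> 0 \<partial>P) + of_nat a"
proof -
  from r obtain r' where r': "(\<integral>\<^sup>+\<omega>. occ G {1..} \<omega> 0 \<partial>P) = ennreal r'" "0 \<le> r'"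
    by (cases "\<integral>\<^sup>+\<omega>. occ G {1..} \<omega> 0 \<partial>P") auto
  define c where "c = real a * (r' + real a)"
  have "(\<lambda>k. ln (q k) / real k) \<longlonglongrightarrow> 0" using smalloD_tendsto[OF q(2)] .
  then have "(\<lambda>k. c / real k + real a * \<bar>ln (q k) / real k\<bar>) \<longlonglongrightarrow> 0 + real a * \<bar>0\<bar>"
    by (intro tendsto_add lim_const_over_n tendsto_mult tendsto_const tendsto_rabs)
  then have lim: "(\<lambda>k. (c + real a * \<bar>ln (q k)\<bar>) / real k) \<longlonglongrightarrow> 0"
    by (simp add: add_divide_distrib abs_divide)
  have sub: "filterlim (\<lambda>L. (2 * L + 1) ^ CARD('d)) at_top sequentially"
  proof (rule filterlim_at_top_mono[OF filterlim_ident])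
    show "\<forall>\<^sub>F L in sequentially. L \<le> (2 * L + 1) ^ CARD('d)"
    proof (intro always_eventually allI)
      fix L :: nat
      have "L \<le> 2 * L + 1" by simp
      also have "\<dots> \<le> (2 * L + 1) ^ CARD('d)" by (rule self_le_power) auto
      finally show "L \<le> (2 * L + 1) ^ CARD('d)" .
    qed
  qed
  have "\<forall>\<^sub>F L in sequentially. (c + real a * \<bar>ln (q ((2 * L + 1) ^ CARD('d)))\<bar>) / real ((2 * L + 1) ^ CARD('d)) < \<epsilon>"
    using order_tendstoD(2)[OF filterlim_compose[OF lim sub] e] .
  then obtain L where L: "(c + real a * \<bar>ln (q ((2 * L + 1) ^ CARD('d)))\<bar>) / real ((2 * L + 1) ^ CARD('d)) < \<epsilon>"
    using eventually_happens'[OF sequentially_bot] by blast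
  have qk: "q ((2 * L + 1) ^ CARD('d)) > 0" by (rule q(1)) (simp add: Suc_le_eq One_nat_def)
  note T = tile_ecost[where L=L and q=q and r=r' and a=a, OF P qk eq_refl[OF r'(1)] r'(2)]
  have "ecost q 0 (tile a L P) \<le> ecost q a P + ennreal \<epsilon>"
    using T(1) L unfolding c_def[symmetric] by (elim order.trans) (intro add_left_mono ennreal_leI less_imp_le)
  then show ?thesis using tile_cinv[OF P] T(2) by blast
qed

end

section \<open>Adjoining a macroscopic field\<close>

text \<open>The coordinates \<open>(0, x)\<close>, which carry no marks, hold the macroscopic field. Mixtures of the
  \<open>P a\<close> with weights \<open>\<psi> a\<close> become single measures whose macroscopic field is almost surely constant.\<close>

definition attach :: "('d::finite config \<Rightarrow> int ^ 'd \<Rightarrow> nat) \<Rightarrow> 'd config \<Rightarrow> 'd config" where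
  "attach A \<omega> = (\<lambda>(k, x). if k = 0 then A \<omega> x else \<omega> (k, x))"

lemma attach_measurable:
  assumes P: "sets P = sets (conf (marks UNIV))" and A: "\<And>x. (\<lambda>\<omega>. A \<omega> x) \<in> measurable P (count_space UNIV)"
  shows "attach A \<in> measurable P (conf UNIV)"
proof -
  have "(\<lambda>\<omega> i. if fst i = 0 then A \<omega> (snd i) else \<omega> i) \<in> measurable P (conf UNIV)"
  proof (rule measurable_PiM_single')
    fix i :: "nat \<times> (int ^ 'a)"
    show "(\<lambda>\<omega>. if fst i = 0 then A \<omega> (snd i) else \<omega> i) \<in> measurable P (count_space UNIV)"
    proof (cases "fst i = 0")
      case False
      then have "i \<in> marks UNIV" by (cases i) auto
      then show ?thesis using False measurable_coordinate[OF _ P] by simp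
    qed (simp add: A)
  qed auto
  moreover have "attach A = (\<lambda>\<omega> i. if fst i = 0 then A \<omega> (snd i) else \<omega> i)"
    by (auto simp: attach_def fun_eq_iff)
  ultimately show ?thesis by simp
qed

lemma depends_on_attach: "depends_on (marks UNIV) f \<Longrightarrow> f (attach A \<omega>) = f \<omega>"
  by (erule depends_onD) (auto simp: attach_def)

lemma cyl_depends_on: "cyl J f \<Longrightarrow> depends_on J f"
  unfolding cyl_def by (auto intro: depends_on_mono)

lemma integral_attach:
  assumes P: "sets P = sets (conf (marks UNIV))" and A: "\<And>x. (\<lambda>\<omega>. A \<omega> x) \<in> measurable P (count_space UNIV)"
    and f: "cyl (marks UNIV) f"
  shows "(\<integral>\<omega>. f \<omega> \<partial>distr P (conf UNIV) (attach A)) = (\<integral>\<omega>. f \<omega> \<partial>P)"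
  using integral_distr[OF attach_measurable[OF P A] cyl_measurable[OF f subset_UNIV refl]]
  by (simp add: depends_on_attach[OF cyl_depends_on[OF f]])

text \<open>The tests in \<open>dens\<close> depend on marks only, so laws with equal integrals of
  such functions have equal density; the coordinates \<open>(0, x)\<close> are invisible.\<close>

lemma dens_cong:
  fixes P Q :: "'d::finite config measure"
  assumes "\<And>f. cyl (marks UNIV) f \<Longrightarrow> (\<integral>\<omega>. f \<omega> \<partial>P) = (\<integral>\<omega>. f \<omega> \<partial>Q)"
  shows "dens q P = dens q Q" "J \<subseteq> marks UNIV \<Longrightarrow> hent q P J = hent q Q J"
proof -
  have e: "hent q P J = hent q Q J" if "J \<subseteq> marks UNIV" for J
    unfolding hent_def
  proof (intro SUP_cong refl)
    fix f :: "'d config \<Rightarrow> real" assume "f \<in> {f. cyl J f \<and> (\<integral>\<omega>. exp (f \<omega>) \<partial>(reference q)) \<le> 1}"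
    then have "cyl (marks UNIV) f" using that by (auto intro: cyl_mono)
    from assms[OF this] show "ennreal (\<integral>\<omega>. f \<omega> \<partial>P) = ennreal (\<integral>\<omega>. f \<omega> \<partial>Q)" by simp
  qed
  show "dens q P = dens q Q" unfolding dens_def by (intro SUP_cong refl arg_cong2[where f="(/)"] e) auto
  show "J \<subseteq> marks UNIV \<Longrightarrow> hent q P J = hent q Q J" by (rule e)
qed

lemma integral_tshift:
  fixes f :: "'d::finite config \<Rightarrow> real"
  assumes "cinv I P" and f: "f \<in> borel_measurable (conf I)" and dep: "depends_on I f"
  shows "(\<integral>\<omega>. f (tshift z \<omega>) \<partial>P) = (\<integral>\<omega>. f \<omega> \<partial>P)"
proof -
  note P = cinvD[OF assms(1)]
  from assms obtain K where K: "I = K \<times> UNIV" unfolding cinv_def by blast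
  have "(\<integral>\<omega>. f \<omega> \<partial>P) = (\<integral>\<omega>. f \<omega> \<partial>distr P (conf I) (\<lambda>\<omega>. restrict (tshift z \<omega>) I))"
    by (simp add: cinv_distr_tshift[OF assms(1)])
  also have "\<dots> = (\<integral>\<omega>. f (restrict (tshift z \<omega>) I) \<partial>P)"
    by (rule integral_distr[OF tshift_measurable[OF K P(2)] f])
  also have "\<dots> = (\<integral>\<omega>. f (tshift z \<omega>) \<partial>P)"
    by (intro Bochner_Integration.integral_cong refl depends_onD[OF dep]) simp
  finally show ?thesis ..
qed

text \<open>The adjoined field is computed equivariantly from the marks, so shifting before or after
  adjoining it gives the same configuration.\<close>

lemma attach_cinv:
  assumes P: "cinv (marks UNIV) P" and A: "\<And>x. (\<lambda>\<omega>. A \<omega> x) \<in> measurable P (count_space UNIV)"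
    and dep: "\<And>x. depends_on (marks UNIV) (\<lambda>\<omega>. A \<omega> x)"
    and shift: "\<And>z \<omega> x. A (tshift z \<omega>) x = A \<omega> (x + z)"
  shows "cinv UNIV (distr P (conf UNIV) (attach A))"
  unfolding cinv_def
proof (intro conjI allI impI)
  note P' = cinvD[OF P]
  note m = attach_measurable[where A=A, OF P'(2) A]
  show "prob_space (distr P (conf UNIV) (attach A))" by (rule prob_space.prob_space_distr[OF P'(1) m])
  show "\<exists>K. (UNIV :: (nat \<times> (int ^ 'a)) set) = K \<times> UNIV \<and> {1..} \<subseteq> K" by (intro exI[of _ UNIV]) simp
  fix z :: "int ^ 'a" and f :: "'a config \<Rightarrow> real" assume f: "cyl UNIV f"
  have comm: "tshift z (attach A \<omega>) = attach A (tshift z \<omega>)" for \<omega>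
  proof (rule ext)
    fix i :: "nat \<times> (int ^ 'a)"
    obtain k x where "i = (k, x)" by (cases i)
    then show "tshift z (attach A \<omega>) i = attach A (tshift z \<omega>) i"
      using shift[of z \<omega> x] by (simp add: attach_def tshift_def)
  qed
  have fm: "(\<lambda>\<omega>. f (attach A \<omega>)) \<in> borel_measurable (conf (marks UNIV))"
    using measurable_compose[OF m cyl_measurable[OF f subset_UNIV refl]] P'(2) by (simp cong: measurable_cong_sets)
  have fd: "depends_on (marks UNIV) (\<lambda>\<omega>. f (attach A \<omega>))"
  proof (rule depends_onI)
    fix \<omega> \<omega>' :: "'a config" assume h: "\<And>i. i \<in> marks UNIV \<Longrightarrow> \<omega> i = \<omega>' i"
    have "A \<omega> x = A \<omega>' x" for x using dep by (rule depends_onD) (rule h)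
    then have "attach A \<omega> = attach A \<omega>'" using h by (auto simp: attach_def fun_eq_iff)
    then show "f (attach A \<omega>) = f (attach A \<omega>')" by simp
  qed
  have tm: "(\<lambda>\<omega>. f (tshift z \<omega>)) \<in> borel_measurable (conf UNIV)"
  proof -
    have "cyl UNIV (\<lambda>\<omega>. f (tshift z \<omega>))" using cyl_tshift[OF f] by (rule cyl_mono) simp
    then show ?thesis by (rule cyl_measurable) simp_all
  qed
  have "(\<integral>\<omega>. f (tshift z \<omega>) \<partial>distr P (conf UNIV) (attach A)) = (\<integral>\<omega>. f (tshift z (attach A \<omega>)) \<partial>P)"
    by (rule integral_distr[OF m tm])
  also have "\<dots> = (\<integral>\<omega>. f (attach A (tshift z \<omega>)) \<partial>P)" by (simp only: comm)
  also have "\<dots> = (\<integral>\<omega>. f (attach A \<omega>) \<partial>P)" by (rule integral_tshift[OF P fm fd])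
  also have "\<dots> = (\<integral>\<omega>. f \<omega> \<partial>distr P (conf UNIV) (attach A))"
    by (rule integral_distr[OF m cyl_measurable[OF f subset_UNIV refl], symmetric])
  finally show "(\<integral>\<omega>. f (tshift z \<omega>) \<partial>distr P (conf UNIV) (attach A)) = (\<integral>\<omega>. f \<omega> \<partial>distr P (conf UNIV) (attach A))" .
qed simp

definition pack :: "nat pmf \<Rightarrow> (nat \<Rightarrow> 'd::finite config measure) \<Rightarrow> 'd config measure" where
  "pack \<psi> P = mix \<psi> (\<lambda>a. distr (P a) (conf UNIV) (attach (\<lambda>_ _. a)))"

context
  fixes P :: "nat \<Rightarrow> 'd::finite config measure" and \<psi> :: "nat pmf"
  assumes P: "\<And>a. cinv (marks UNIV) (P a)"
begin

lemma pack_parts: "cinv UNIV (distr (P a) (conf UNIV) (attach (\<lambda>_ _. a)))"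
  by (rule attach_cinv[OF P]) (auto intro: depends_onI)

lemma pack_cinv: "cinv UNIV (pack \<psi> P)"
  unfolding pack_def by (rule mix_cinv[OF pack_parts])

lemma nn_integral_pack:
  assumes f: "f \<in> borel_measurable (conf UNIV)"
  shows "(\<integral>\<^sup>+\<omega>. f \<omega> \<partial>pack \<psi> P) = (\<integral>\<^sup>+a. (\<integral>\<^sup>+\<omega>. f (attach (\<lambda>_ _. a) \<omega>) \<partial>P a) \<partial>measure_pmf \<psi>)"
  unfolding pack_def nn_integral_mix[OF cinvD(1,2)[OF pack_parts] f]
  by (intro nn_integral_cong, subst nn_integral_distr[OF attach_measurable[OF cinvD(2)[OF P]]]) (simp_all add: f)

lemma dens_pack: "dens q (pack \<psi> P) \<le> (\<integral>\<^sup>+a. dens q (P a) \<partial>measure_pmf \<psi>)"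
proof -
  have "dens q (pack \<psi> P) \<le> (\<integral>\<^sup>+a. dens q (distr (P a) (conf UNIV) (attach (\<lambda>_ _. a))) \<partial>measure_pmf \<psi>)"
    unfolding pack_def by (rule dens_mix_le[OF cinvD(1,2)[OF pack_parts]]) simp
  moreover have "dens q (distr (P a) (conf UNIV) (attach (\<lambda>_ _. a))) = dens q (P a)" for a
    by (rule dens_cong(1), rule integral_attach[OF cinvD(2)[OF P]]) simp_all
  ultimately show ?thesis by simp
qed

end

text \<open>The free predicate C on two sites yields both the law of the level and its constancy in
  space. Both are statements about local events and therefore pass to limits.\<close>

lemma measure_macro_pack:
  assumes P: "\<And>a. cinv (marks UNIV) (P a)"
  shows "emeasure (pack \<psi> P) {\<omega>. C (\<omega> (0, x)) (\<omega> (0, y))} = emeasure (measure_pmf \<psi>) {a. C a a}"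
proof -
  have m: "Measurable.pred (conf UNIV) (\<lambda>\<omega>. C (\<omega> (0, x)) (\<omega> (0, y)))"
    by (intro measurable_depends_on[of "{(0, x), (0, y)}"] depends_onI) auto
  have sP: "sets (pack \<psi> P) = sets (conf UNIV)"
    by (rule cinvD(2)[OF pack_cinv]) (rule P)
  have s: "{\<omega>. C (\<omega> (0, x)) (\<omega> (0, y))} \<in> sets (conf UNIV)" using m by (simp add: pred_def space_PiM)
  have "emeasure (pack \<psi> P) {\<omega>. C (\<omega> (0, x)) (\<omega> (0, y))} = (\<integral>\<^sup>+\<omega>. indicator {\<omega>. C (\<omega> (0, x)) (\<omega> (0, y))} \<omega> \<partial>pack \<psi> P)"
    by (rule nn_integral_indicator[symmetric]) (simp only: sP s)
  also have "\<dots> = (\<integral>\<^sup>+a. (\<integral>\<^sup>+\<omega>. indicator {a. C a a} a \<partial>P a) \<partial>measure_pmf \<psi>)"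
    using s by (subst nn_integral_pack[OF P]) (auto simp: attach_def indicator_def)
  also have "\<dots> = (\<integral>\<^sup>+a. indicator {a. C a a} a \<partial>measure_pmf \<psi>)"
    by (intro nn_integral_cong) (simp add: prob_space.emeasure_space_1[OF cinvD(1)[OF P]])
  finally show ?thesis by simp
qed

context interaction
begin

definition field :: "'d config \<Rightarrow> int ^ 'd \<Rightarrow> ennreal" where
  "field \<omega> i = occ G {1..} \<omega> i + of_nat (\<omega> (0, i))"

text \<open>Counterpart of the averaged \<open>ecost\<close> for a packed law, with the level read
  from the coordinates \<open>(0, i)\<close>. The two are compared by \<open>jcost_pack\<close> in
  one direction and by \<open>ecost_cond\<close> in the other.\<close>

definition jcost :: "(nat \<Rightarrow> real) \<Rightarrow> 'd config measure \<Rightarrow> ennreal" where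
  "jcost q P = dens q P + (\<integral>\<^sup>+\<omega>. inter v (field \<omega>) \<partial>P)"

lemma occ_attach: "A \<subseteq> {1..} \<Longrightarrow> occ G A (attach B \<omega>) i = occ G A \<omega> i"
  using depends_on_attach[OF depends_on_mono[OF depends_on_occ[of A G i], of "marks UNIV"], of B \<omega>] by auto

lemma field_measurable: "sets P = sets (conf UNIV) \<Longrightarrow> (\<lambda>\<omega>. field \<omega> i) \<in> borel_measurable P"
proof -
  assume P: "sets P = sets (conf UNIV)"
  have [measurable]: "(\<lambda>\<omega>. \<omega> (0, i)) \<in> measurable P (count_space UNIV)"
    using P by (intro measurable_coordinate) auto
  have [measurable]: "(\<lambda>\<omega>. occ G {1..} \<omega> i) \<in> borel_measurable P"
    using P by (intro occ_measurable) auto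
  show ?thesis unfolding field_def by measurable
qed

lemma jcost_pack:
  assumes P: "\<And>a. cinv (marks UNIV) (P a)"
  shows "jcost q (pack \<psi> P) \<le> (\<integral>\<^sup>+a. ecost q a (P a) \<partial>measure_pmf \<psi>)"
proof -
  have f: "field (attach (\<lambda>_ _. a) \<omega>) = (\<lambda>i. occ G {1..} \<omega> i + of_nat a)" for a \<omega>
    by (auto simp: field_def occ_attach fun_eq_iff) (simp add: attach_def)
  have "(\<integral>\<^sup>+\<omega>. inter v (field \<omega>) \<partial>pack \<psi> P) = (\<integral>\<^sup>+a. (\<integral>\<^sup>+\<omega>. inter v (\<lambda>i. occ G {1..} \<omega> i + of_nat a) \<partial>P a) \<partial>measure_pmf \<psi>)"
    by (subst nn_integral_pack[OF P]) (auto simp: f intro!: inter_measurable field_measurable)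
  then have "jcost q (pack \<psi> P) \<le> (\<integral>\<^sup>+a. dens q (P a) \<partial>measure_pmf \<psi>) + (\<integral>\<^sup>+a. (\<integral>\<^sup>+\<omega>. inter v (\<lambda>i. occ G {1..} \<omega> i + of_nat a) \<partial>P a) \<partial>measure_pmf \<psi>)"
    unfolding jcost_def by (simp add: add_right_mono dens_pack[OF P])
  also have "\<dots> = (\<integral>\<^sup>+a. ecost q a (P a) \<partial>measure_pmf \<psi>)"
    unfolding ecost_def by (rule nn_integral_add[symmetric]) auto
  finally show ?thesis .
qed

lemma nn_integral_coordinate_pack:
  assumes P: "\<And>a. cinv (marks UNIV) (P a)" and k: "k \<ge> 1"
  shows "(\<integral>\<^sup>+\<omega>. of_nat (\<omega> (k, x)) \<partial>pack \<psi> P) = (\<integral>\<^sup>+a. (\<integral>\<^sup>+\<omega>. of_nat (\<omega> (k, x)) \<partial>P a) \<partial>measure_pmf \<psi>)"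
proof -
  have "(\<lambda>\<omega>. \<omega> (k, x)) \<in> measurable (conf UNIV) (count_space UNIV)" by (rule measurable_component_singleton) simp
  then have "(\<lambda>\<omega>. of_nat (\<omega> (k, x)) :: ennreal) \<in> borel_measurable (conf UNIV)" by (rule measurable_compose) simp
  then show ?thesis using k by (subst nn_integral_pack[OF P]) (auto simp: attach_def)
qed

end

section \<open>Disintegration along the macroscopic field\<close>

locale constant_macro = interaction G v for G :: "nat \<Rightarrow> (int ^ 'd::finite) set" and v +
  fixes P :: "'d config measure" and \<psi> :: "nat pmf" and q :: "nat \<Rightarrow> real"
  assumes P: "cinv UNIV P"
    and const: "\<And>x. emeasure P {\<omega>. \<omega> (0, x) \<noteq> \<omega> (0, 0)} = 0"
    and psi: "\<And>a. pmf \<psi> a = measure P {\<omega>. \<omega> (0, 0) = a}"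
begin

text \<open>Levels of probability 0 receive the reference measure as a default, so that every
  \<open>cond a\<close> is an admissible shift-invariant law.\<close>

definition cond :: "nat \<Rightarrow> 'd config measure" where
  "cond a = (if pmf \<psi> a > 0 then
     distr (uniform_measure P {\<omega>. \<omega> (0, 0) = a}) (conf (marks UNIV)) (\<lambda>\<omega>. restrict \<omega> (marks UNIV)) else reference q)"

lemma space_P: "space P = UNIV"
  using sets_eq_imp_space_eq[OF cinvD(2)[OF P]] by (simp add: space_PiM)

lemma coord [measurable]: "(\<lambda>\<omega>. \<omega> i) \<in> measurable P (count_space UNIV)"
  using cinvD(2)[OF P] by (intro measurable_coordinate) auto

lemma macro_set [measurable]: "{\<omega>. \<omega> (0, 0) = a} \<in> sets P"
proof -
  have "{\<omega> \<in> space P. \<omega> (0, 0) = a} \<in> sets P" by measurable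
  then show ?thesis by (simp add: space_P)
qed

lemma emeasure_macro: "emeasure P {\<omega>. \<omega> (0, 0) = a} = ennreal (pmf \<psi> a)"
  using cinvD(1)[OF P] by (simp add: psi finite_measure.emeasure_eq_measure prob_space.finite_measure)

lemma AE_const: "AE \<omega> in P. \<omega> (0, x) = \<omega> (0, 0)"
proof -
  have "{\<omega> \<in> space P. \<omega> (0, x) \<noteq> \<omega> (0, 0)} \<in> sets P" by measurable
  then show ?thesis using const[of x] by (intro AE_I[of _ _ "{\<omega>. \<omega> (0, x) \<noteq> \<omega> (0, 0)}"]) (auto simp: space_P)
qed

lemma restrict_meas: "(\<lambda>\<omega>. restrict \<omega> (marks UNIV)) \<in> measurable (uniform_measure P S) (conf (marks UNIV))"
proof -
  have "(\<lambda>\<omega>. restrict \<omega> (marks UNIV)) \<in> measurable (conf UNIV) (conf (marks UNIV))"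
    by (rule measurable_restrict_subset) simp
  then show ?thesis using cinvD(2)[OF P] by (simp cong: measurable_cong_sets)
qed

lemma meas_P: "h \<in> borel_measurable (conf (marks UNIV)) \<Longrightarrow> depends_on (marks UNIV) h \<Longrightarrow> h \<in> borel_measurable P"
proof -
  assume h: "h \<in> borel_measurable (conf (marks UNIV))" and dep: "depends_on (marks UNIV) h"
  have "(\<lambda>\<omega>. restrict \<omega> (marks UNIV)) \<in> measurable (conf UNIV) (conf (marks UNIV))"
    by (rule measurable_restrict_subset) simp
  then have "(\<lambda>\<omega>. h (restrict \<omega> (marks UNIV))) \<in> borel_measurable (conf UNIV)" using h by (rule measurable_compose)
  moreover have "h (restrict \<omega> (marks UNIV)) = h \<omega>" for \<omega> using dep by (rule depends_onD) simp
  ultimately show ?thesis using cinvD(2)[OF P] by (simp cong: measurable_cong_sets)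
qed

lemma nn_integral_cond:
  assumes h: "h \<in> borel_measurable (conf (marks UNIV))" and dep: "depends_on (marks UNIV) h"
  shows "ennreal (pmf \<psi> a) * (\<integral>\<^sup>+\<omega>. h \<omega> \<partial>cond a) = (\<integral>\<^sup>+\<omega>. h \<omega> * indicator {\<omega>. \<omega> (0, 0) = a} \<omega> \<partial>P)"
proof (cases "pmf \<psi> a > 0")
  case True
  note hP = meas_P[OF h dep]
  have r: "h (restrict \<omega> (marks UNIV)) = h \<omega>" for \<omega> using dep by (rule depends_onD) simp
  have "(\<integral>\<^sup>+\<omega>. h \<omega> \<partial>cond a) = (\<integral>\<^sup>+\<omega>. h (restrict \<omega> (marks UNIV)) \<partial>uniform_measure P {\<omega>. \<omega> (0, 0) = a})"
    unfolding cond_def using True h by (simp add: nn_integral_distr[OF restrict_meas])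
  also have "\<dots> = (\<integral>\<^sup>+\<omega>. h \<omega> * indicator {\<omega>. \<omega> (0, 0) = a} \<omega> \<partial>P) / ennreal (pmf \<psi> a)"
    using hP by (simp add: r nn_integral_uniform_measure emeasure_macro)
  finally show ?thesis
    using ennreal_divide_mult_cancel[of "ennreal (pmf \<psi> a)" "\<integral>\<^sup>+\<omega>. h \<omega> * indicator {\<omega>. \<omega> (0, 0) = a} \<omega> \<partial>P"] True
    by (simp add: mult.commute)
next
  case False
  then have 0: "pmf \<psi> a = 0" using pmf_nonneg[of \<psi> a] by linarith
  have "{\<omega>. \<omega> (0, 0) = a} \<in> null_sets P" using emeasure_macro[of a] 0 by (intro null_setsI) auto
  then have "AE \<omega> in P. h \<omega> * indicator {\<omega>. \<omega> (0, 0) = a} \<omega> = 0"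
    by (rule AE_I') (auto simp: indicator_def)
  then show ?thesis using 0 by (subst nn_integral_cong_AE[of _ "\<lambda>_. 0"]) auto
qed

lemma prob_cond: "prob_space (cond a)" and sets_cond: "sets (cond a) = sets (conf (marks UNIV))"
proof -
  have "prob_space (uniform_measure P {\<omega>. \<omega> (0, 0) = a})" if "pmf \<psi> a > 0"
    using that by (intro prob_space_uniform_measure) (auto simp: emeasure_macro)
  then show "prob_space (cond a)"
    unfolding cond_def using prob_reference by (auto intro!: prob_space.prob_space_distr restrict_meas)
  show "sets (cond a) = sets (conf (marks UNIV))" unfolding cond_def by (simp add: sets_reference)
qed

lemma integral_cond:
  assumes f: "cyl (marks UNIV) f" and a: "pmf \<psi> a > 0"
  shows "pmf \<psi> a * (\<integral>\<omega>. f \<omega> \<partial>cond a) = (\<integral>\<omega>. f \<omega> * indicator {\<omega>. \<omega> (0, 0) = a} \<omega> \<partial>P)"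
proof -
  have fP: "f \<in> borel_measurable P" using cyl_measurable[OF f subset_UNIV cinvD(2)[OF P]] .
  have "(\<integral>\<omega>. f \<omega> \<partial>cond a) = (\<integral>\<omega>. f (restrict \<omega> (marks UNIV)) \<partial>uniform_measure P {\<omega>. \<omega> (0, 0) = a})"
    unfolding cond_def using a by (simp add: integral_distr[OF restrict_meas cyl_measurable[OF f subset_refl refl]])
  also have "\<dots> = (\<integral>\<omega>. f \<omega> \<partial>uniform_measure P {\<omega>. \<omega> (0, 0) = a})"
    using restrict_cyl[OF f subset_refl] by simp
  also have "\<dots> = (\<integral>\<omega>. (indicator {\<omega>. \<omega> (0, 0) = a} \<omega> / pmf \<psi> a) *\<^sub>R f \<omega> \<partial>P)"
  proof -
    have "uniform_measure P {\<omega>. \<omega> (0, 0) = a} = density P (\<lambda>\<omega>. ennreal (indicator {\<omega>. \<omega> (0, 0) = a} \<omega> / pmf \<psi> a))"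
      unfolding uniform_measure_def emeasure_macro using a
      using divide_ennreal[of 1 "pmf \<psi> a"] by (intro density_cong) (auto simp: indicator_def intro!: AE_I2)
    then show ?thesis using fP a by (simp add: integral_density)
  qed
  also have "\<dots> = (\<integral>\<omega>. f \<omega> * indicator {\<omega>. \<omega> (0, 0) = a} \<omega> / pmf \<psi> a \<partial>P)"
    by (intro Bochner_Integration.integral_cong refl) simp
  finally show ?thesis using a by simp
qed

text \<open>By \<open>AE_const\<close> the conditioning event agrees almost surely with each of its
  shifts, so conditioning preserves invariance.\<close>

lemma cond_cinv: "cinv (marks UNIV) (cond a)"
proof (cases "pmf \<psi> a > 0")
  case True
  show ?thesis
    unfolding cinv_def
  proof (intro conjI allI impI)
    show "prob_space (cond a)" "sets (cond a) = sets (conf (marks UNIV))" by (rule prob_cond, rule sets_cond)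
    show "\<exists>K. marks UNIV = K \<times> (UNIV :: (int ^ 'd) set) \<and> {1..} \<subseteq> K" by (intro exI[of _ "{1..}"]) simp
    fix z :: "int ^ 'd" and f :: "'d config \<Rightarrow> real" assume f: "cyl (marks UNIV) f"
    define g where "g \<omega> = f \<omega> * indicator {\<omega>. \<omega> (0, 0) = a} \<omega>" for \<omega>
    from cylE[OF f] obtain F B where F: "finite F" "depends_on F f" "\<And>\<omega>. \<bar>f \<omega>\<bar> \<le> B" by metis
    have g: "cyl UNIV g"
    proof (rule cylI[where B=B])
      show "finite (insert (0, 0) F)" using F(1) by simp
      show "depends_on (insert (0, 0) F) g"
      proof (rule depends_onI)
        fix \<omega> \<omega>' :: "'d config" assume h: "\<And>i. i \<in> insert (0, 0) F \<Longrightarrow> \<omega> i = \<omega>' i"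
        have "f \<omega> = f \<omega>'" using F(2) by (rule depends_onD) (use h in auto)
        moreover have "\<omega> (0, 0) = \<omega>' (0, 0)" using h by simp
        ultimately show "g \<omega> = g \<omega>'" by (simp add: g_def indicator_def)
      qed
      show "\<bar>g \<omega>\<bar> \<le> B" for \<omega> using F(3)[of \<omega>] by (auto simp: g_def indicator_def)
    qed simp
    have ft: "cyl (marks UNIV) (\<lambda>\<omega>. f (tshift z \<omega>))"
      using cyl_tshift[OF f, of z] by (rule cyl_mono) auto
    have m1: "(\<lambda>\<omega>. f (tshift z \<omega>)) \<in> borel_measurable P" by (rule cyl_measurable[OF ft subset_UNIV cinvD(2)[OF P]])
    have m2: "(\<lambda>\<omega>. g (tshift z \<omega>)) \<in> borel_measurable P"
      by (rule cyl_measurable[OF cinv_shift_cyl[OF P g] subset_refl cinvD(2)[OF P]])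
    have "pmf \<psi> a * (\<integral>\<omega>. f (tshift z \<omega>) \<partial>cond a) = (\<integral>\<omega>. f (tshift z \<omega>) * indicator {\<omega>. \<omega> (0, 0) = a} \<omega> \<partial>P)"
      by (rule integral_cond[OF ft True])
    also have "\<dots> = (\<integral>\<omega>. g (tshift z \<omega>) \<partial>P)"
    proof (rule integral_cong_AE)
      show "AE \<omega> in P. f (tshift z \<omega>) * indicator {\<omega>. \<omega> (0, 0) = a} \<omega> = g (tshift z \<omega>)"
        using AE_const[of z] by eventually_elim (simp add: g_def indicator_def tshift_def)
    qed (use m1 m2 in measurable)
    also have "\<dots> = (\<integral>\<omega>. g \<omega> \<partial>P)" by (rule cinvD(4)[OF P g])
    also have "\<dots> = pmf \<psi> a * (\<integral>\<omega>. f \<omega> \<partial>cond a)" unfolding g_def by (rule integral_cond[OF f True, symmetric])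
    finally show "(\<integral>\<omega>. f (tshift z \<omega>) \<partial>cond a) = (\<integral>\<omega>. f \<omega> \<partial>cond a)" using True by simp
  qed
next
  case False
  then show ?thesis unfolding cond_def by (simp add: reference_cinv)
qed

lemma nn_integral_partition:
  assumes [measurable]: "\<And>a. f a \<in> borel_measurable P"
  shows "(\<integral>\<^sup>+a. (\<integral>\<^sup>+\<omega>. f a \<omega> * indicator {\<omega>. \<omega> (0, 0) = a} \<omega> \<partial>P) \<partial>count_space UNIV) = (\<integral>\<^sup>+\<omega>. f (\<omega> (0, 0)) \<omega> \<partial>P)"
proof -
  have "(\<integral>\<^sup>+a. (\<integral>\<^sup>+\<omega>. f a \<omega> * indicator {\<omega>. \<omega> (0, 0) = a} \<omega> \<partial>P) \<partial>count_space UNIV)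
      = (\<integral>\<^sup>+\<omega>. (\<integral>\<^sup>+a. f a \<omega> * indicator {\<omega>. \<omega> (0, 0) = a} \<omega> \<partial>count_space UNIV) \<partial>P)"
    by (rule nn_integral_count_space_nn_integral[symmetric]) auto
  also have "\<dots> = (\<integral>\<^sup>+\<omega>. f (\<omega> (0, 0)) \<omega> \<partial>P)"
  proof (rule nn_integral_cong)
    fix \<omega> :: "'d config"
    have "(\<integral>\<^sup>+a. f a \<omega> * indicator {\<omega>. \<omega> (0, 0) = a} \<omega> \<partial>count_space UNIV) = (\<Sum>a\<in>{\<omega> (0, 0)}. f a \<omega> * indicator {\<omega>. \<omega> (0, 0) = a} \<omega>)"
      by (rule nn_integral_count_space') auto
    then show "(\<integral>\<^sup>+a. f a \<omega> * indicator {\<omega>. \<omega> (0, 0) = a} \<omega> \<partial>count_space UNIV) = f (\<omega> (0, 0)) \<omega>" by simp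
  qed
  finally show ?thesis .
qed

lemma cond_mean:
  assumes k: "k \<ge> 1"
  shows "(\<integral>\<^sup>+a. (\<integral>\<^sup>+\<omega>. of_nat (\<omega> (k, x)) \<partial>cond a) \<partial>measure_pmf \<psi>) = (\<integral>\<^sup>+\<omega>. of_nat (\<omega> (k, x)) \<partial>P)"
proof -
  have m: "(\<lambda>\<omega>. of_nat (\<omega> (k, x)) :: ennreal) \<in> borel_measurable (conf (marks UNIV))"
  proof -
    have [measurable]: "(\<lambda>\<omega>. \<omega> (k, x)) \<in> measurable (conf (marks UNIV)) (count_space UNIV)"
      using k by (intro measurable_component_singleton) auto
    show ?thesis by measurable
  qed
  have d: "depends_on (marks UNIV) (\<lambda>\<omega>. of_nat (\<omega> (k, x)) :: ennreal)"
    using k by (intro depends_onI) auto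
  have "(\<integral>\<^sup>+a. (\<integral>\<^sup>+\<omega>. of_nat (\<omega> (k, x)) \<partial>cond a) \<partial>measure_pmf \<psi>)
    = (\<integral>\<^sup>+a. (\<integral>\<^sup>+\<omega>. of_nat (\<omega> (k, x)) * indicator {\<omega>. \<omega> (0, 0) = a} \<omega> \<partial>P) \<partial>count_space UNIV)"
    unfolding nn_integral_measure_pmf nn_integral_cond[OF m d] ..
  also have "\<dots> = (\<integral>\<^sup>+\<omega>. of_nat (\<omega> (k, x)) \<partial>P)" by (rule nn_integral_partition) measurable
  finally show ?thesis .
qed

lemma macro_mean: "(\<integral>\<^sup>+a. of_nat a \<partial>measure_pmf \<psi>) = (\<integral>\<^sup>+\<omega>. of_nat (\<omega> (0, 0)) \<partial>P)"
proof -
  have "(\<integral>\<^sup>+a. of_nat a \<partial>measure_pmf \<psi>) = (\<integral>\<^sup>+a. (\<integral>\<^sup>+\<omega>. of_nat a * indicator {\<omega>. \<omega> (0, 0) = a} \<omega> \<partial>P) \<partial>count_space UNIV)"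
    unfolding nn_integral_measure_pmf by (intro nn_integral_cong) (simp add: nn_integral_cmult_indicator emeasure_macro mult.commute)
  also have "\<dots> = (\<integral>\<^sup>+\<omega>. of_nat (\<omega> (0, 0)) \<partial>P)" by (rule nn_integral_partition) simp
  finally show ?thesis .
qed

text \<open>Finitely many conditioned laws, weighted by the probabilities of their levels, are
  dominated by P on nonnegative functions. So \<open>dens_concave\<close> bounds every finite
  partial sum.\<close>

lemma dens_cond: "(\<integral>\<^sup>+a. dens q (cond a) \<partial>measure_pmf \<psi>) \<le> dens q P"
  unfolding nn_integral_measure_pmf nn_integral_count_space_eq_SUP[OF countableI_type]
proof (rule SUP_least)
  fix F :: "nat set" assume "F \<in> {F. finite F \<and> F \<subseteq> UNIV}"
  then have F: "finite F" by simp
  \<comment> \<open>Off the support the weight 1 merely provides the strict positivity asked for by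
    \<open>dens_concave\<close>; the sum runs over \<open>F \<inter> set_pmf \<psi>\<close>.\<close>
  define w where "w a = (if pmf \<psi> a > 0 then pmf \<psi> a else 1)" for a
  let ?F = "F \<inter> set_pmf \<psi>"
  have pos: "pmf \<psi> a > 0" if "a \<in> ?F" for a using that by (simp add: pmf_positive)
  have "(\<Sum>a\<in>F. ennreal (pmf \<psi> a) * dens q (cond a)) = (\<Sum>a\<in>?F. ennreal (w a) * dens q (cond a))"
    using F by (intro sum.mono_neutral_cong_right) (auto simp: w_def set_pmf_iff dest: pmf_positive)
  also have "\<dots> \<le> dens q P"
  proof (rule dens_concave[OF _ P cond_cinv])
    show "finite ?F" using F by simp
    show "0 < w a" for a by (simp add: w_def)
    fix h :: "'d config \<Rightarrow> real" assume h: "cyl (marks UNIV) h" "\<And>\<omega>. 0 \<le> h \<omega>"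
    have hi: "integrable P h" by (rule cyl_integrable[OF h(1) subset_UNIV cinvD(2,1)[OF P]])
    have ii: "integrable P (\<lambda>\<omega>. h \<omega> * indicator {\<omega>. \<omega> (0, 0) = a} \<omega>)" for a
    proof (rule Bochner_Integration.integrable_bound[OF hi])
      note [measurable] = borel_measurable_integrable[OF hi]
      show "(\<lambda>\<omega>. h \<omega> * indicator {\<omega>. \<omega> (0, 0) = a} \<omega>) \<in> borel_measurable P" by measurable
    qed (auto simp: indicator_def)
    have "(\<Sum>a\<in>?F. w a * (\<integral>\<omega>. h \<omega> \<partial>cond a)) = (\<Sum>a\<in>?F. \<integral>\<omega>. h \<omega> * indicator {\<omega>. \<omega> (0, 0) = a} \<omega> \<partial>P)"
      using pos by (intro sum.cong refl) (simp add: w_def integral_cond[OF h(1)])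
    also have "\<dots> = (\<integral>\<omega>. (\<Sum>a\<in>?F. h \<omega> * indicator {\<omega>. \<omega> (0, 0) = a} \<omega>) \<partial>P)"
      by (rule Bochner_Integration.integral_sum[symmetric]) (rule ii)
    also have "\<dots> \<le> (\<integral>\<omega>. h \<omega> \<partial>P)"
    proof (rule integral_mono[OF Bochner_Integration.integrable_sum[OF ii] hi])
      fix \<omega> :: "'d config"
      have "(\<Sum>a\<in>?F. h \<omega> * indicator {\<omega>. \<omega> (0, 0) = a} \<omega>) = (\<Sum>a\<in>?F. if a = \<omega> (0, 0) then h \<omega> else 0)"
        by (intro sum.cong refl) (auto simp: indicator_def)
      then show "(\<Sum>a\<in>?F. h \<omega> * indicator {\<omega>. \<omega> (0, 0) = a} \<omega>) \<le> h \<omega>" using F h(2) by (simp add: sum.delta)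
    qed
    finally show "(\<Sum>a\<in>?F. w a * (\<integral>\<omega>. h \<omega> \<partial>cond a)) \<le> (\<integral>\<omega>. h \<omega> \<partial>P)" .
  qed
  finally show "(\<Sum>a\<in>F. ennreal (pmf \<psi> a) * dens q (cond a)) \<le> dens q P" .
qed

text \<open>The field of P is almost surely the occupation plus a constant level, so the interaction
  terms agree exactly; \<open>dens_cond\<close> takes care of the entropy.\<close>

lemma ecost_cond: "(\<integral>\<^sup>+a. ecost q a (cond a) \<partial>measure_pmf \<psi>) \<le> jcost q P"
proof -
  have om: "(\<lambda>\<omega>. occ G {1..} \<omega> i) \<in> borel_measurable (conf (marks UNIV))" for i
    by (intro occ_measurable) auto
  have m: "(\<lambda>\<omega>. inter v (\<lambda>i. occ G {1..} \<omega> i + of_nat a)) \<in> borel_measurable (conf (marks UNIV))" for a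
    by (intro inter_measurable borel_measurable_add om) simp
  have d: "depends_on (marks UNIV) (\<lambda>\<omega>. inter v (\<lambda>i. occ G {1..} \<omega> i + of_nat a))" for a
  proof (rule depends_onI)
    fix \<omega> \<omega>' :: "'d config" assume "\<And>i. i \<in> marks UNIV \<Longrightarrow> \<omega> i = \<omega>' i"
    then have "occ G {1..} \<omega> i = occ G {1..} \<omega>' i" for i by (rule depends_onD[OF depends_on_occ])
    then show "inter v (\<lambda>i. occ G {1..} \<omega> i + of_nat a) = inter v (\<lambda>i. occ G {1..} \<omega>' i + of_nat a)" by simp
  qed
  have "(\<integral>\<^sup>+a. (\<integral>\<^sup>+\<omega>. inter v (\<lambda>i. occ G {1..} \<omega> i + of_nat a) \<partial>cond a) \<partial>measure_pmf \<psi>)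
    = (\<integral>\<^sup>+a. (\<integral>\<^sup>+\<omega>. inter v (\<lambda>i. occ G {1..} \<omega> i + of_nat a) * indicator {\<omega>. \<omega> (0, 0) = a} \<omega> \<partial>P) \<partial>count_space UNIV)"
    unfolding nn_integral_measure_pmf nn_integral_cond[OF m d] ..
  also have "\<dots> = (\<integral>\<^sup>+\<omega>. inter v (\<lambda>i. occ G {1..} \<omega> i + of_nat (\<omega> (0, 0))) \<partial>P)"
    by (rule nn_integral_partition) (rule meas_P[OF m d])
  also have "\<dots> = (\<integral>\<^sup>+\<omega>. inter v (field \<omega>) \<partial>P)"
  proof (rule nn_integral_cong_AE)
    have "AE \<omega> in P. \<forall>x. \<omega> (0, x) = \<omega> (0, 0)"
      unfolding AE_all_countable using AE_const by blast
    then show "AE \<omega> in P. inter v (\<lambda>i. occ G {1..} \<omega> i + of_nat (\<omega> (0, 0))) = inter v (field \<omega>)"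
    proof eventually_elim
      case (elim \<omega>)
      then have "field \<omega> = (\<lambda>i. occ G {1..} \<omega> i + of_nat (\<omega> (0, 0)))" by (auto simp: field_def fun_eq_iff)
      then show ?case by simp
    qed
  qed
  finally have i: "(\<integral>\<^sup>+a. (\<integral>\<^sup>+\<omega>. inter v (\<lambda>i. occ G {1..} \<omega> i + of_nat a) \<partial>cond a) \<partial>measure_pmf \<psi>) = (\<integral>\<^sup>+\<omega>. inter v (field \<omega>) \<partial>P)" .
  have "(\<integral>\<^sup>+a. ecost q a (cond a) \<partial>measure_pmf \<psi>) = (\<integral>\<^sup>+a. dens q (cond a) \<partial>measure_pmf \<psi>) + (\<integral>\<^sup>+\<omega>. inter v (field \<omega>) \<partial>P)"
    unfolding ecost_def i[symmetric] by (rule nn_integral_add) auto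
  then show ?thesis unfolding jcost_def using dens_cond by (simp add: add_right_mono)
qed

end

section \<open>Lower semicontinuity and compactness\<close>

lemma liminf_add_ennreal:
  fixes X Y :: "nat \<Rightarrow> ennreal"
  shows "liminf X + liminf Y \<le> liminf (\<lambda>n. X n + Y n)"
proof -
  have "liminf X + liminf Y = (SUP n. (INF m\<in>{n..}. X m) + (INF m\<in>{n..}. Y m))"
    unfolding liminf_SUP_INF
    by (rule ennreal_SUP_add[symmetric]) (auto simp: incseq_def intro!: INF_superset_mono)
  also have "\<dots> \<le> (SUP n. INF m\<in>{n..}. X m + Y m)"
    by (intro SUP_mono' INF_greatest add_mono INF_lower)
  finally show ?thesis unfolding liminf_SUP_INF .
qed

lemma SUP_mult_incseq:
  fixes f g :: "nat \<Rightarrow> ennreal"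
  assumes "incseq f" "incseq g"
  shows "(SUP n. f n) * (SUP n. g n) = (SUP n. f n * g n)"
proof (rule antisym)
  have "(SUP n. f n) * (SUP n. g n) = (SUP m. SUP n. f n * g m)"
    unfolding SUP_mult_left_ennreal SUP_mult_right_ennreal ..
  also have "\<dots> \<le> (SUP n. f n * g n)"
  proof (intro SUP_least)
    fix n m
    have "f n * g m \<le> f (max n m) * g (max n m)"
      using assms by (intro mult_mono) (auto simp: incseq_def)
    also have "\<dots> \<le> (SUP n. f n * g n)" by (rule SUP_upper) simp
    finally show "f n * g m \<le> (SUP n. f n * g n)" .
  qed
  finally show "(SUP n. f n) * (SUP n. g n) \<le> (SUP n. f n * g n)" .
  show "(SUP n. f n * g n) \<le> (SUP n. f n) * (SUP n. g n)"
    by (intro SUP_least mult_mono SUP_upper) auto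
qed

lemma measure_le_nn_mean:
  fixes g :: "'a \<Rightarrow> nat"
  assumes P: "prob_space P" and g: "g \<in> measurable P (count_space UNIV)"
    and m: "(\<integral>\<^sup>+\<omega>. of_nat (g \<omega>) \<partial>P) \<le> ennreal m" "0 \<le> m"
  shows "measure P {\<omega> \<in> space P. g \<omega> > M} \<le> m / real (M + 1)"
proof -
  interpret prob_space P by fact
  note [measurable] = g
  have "ennreal (measure P {\<omega> \<in> space P. g \<omega> > M}) * of_nat (M + 1) = (\<integral>\<^sup>+\<omega>. of_nat (M + 1) * indicator {\<omega> \<in> space P. g \<omega> > M} \<omega> \<partial>P)"
    by (simp add: nn_integral_cmult_indicator emeasure_eq_measure mult.commute del: of_nat_add)
  also have "\<dots> \<le> (\<integral>\<^sup>+\<omega>. of_nat (g \<omega>) \<partial>P)"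
    by (intro nn_integral_mono) (auto simp: indicator_def simp del: of_nat_add)
  also have "\<dots> \<le> ennreal m" by (rule m)
  finally have "ennreal (measure P {\<omega> \<in> space P. g \<omega> > M} * real (M + 1)) \<le> ennreal m"
    by (simp add: ennreal_mult ennreal_of_nat_eq_real_of_nat del: of_nat_add)
  then have "measure P {\<omega> \<in> space P. g \<omega> > M} * real (M + 1) \<le> m" using m(2) by (simp add: ennreal_le_iff)
  then show ?thesis by (simp add: pos_le_divide_eq)
qed

lemma cyl_limit_measure:
  assumes mu: "\<And>n. prob_space (\<mu> n)" "\<And>n. sets (\<mu> n) = sets (conf UNIV)"
    and nu: "prob_space \<nu>" "sets \<nu> = sets (conf UNIV)"
    and conv: "\<And>f. cyl UNIV f \<Longrightarrow> (\<lambda>n. \<integral>\<omega>. f \<omega> \<partial>\<mu> n) \<longlonglongrightarrow> (\<integral>\<omega>. f \<omega> \<partial>\<nu>)"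
    and C: "finite F" "depends_on F C"
  shows "(\<lambda>n. measure (\<mu> n) {\<omega>. C \<omega>}) \<longlonglongrightarrow> measure \<nu> {\<omega>. C \<omega>}"
proof -
  have "(\<integral>\<omega>. (if C \<omega> then 1 else 0) \<partial>M) = measure M {\<omega>. C \<omega>}" if "prob_space M" "sets M = sets (conf UNIV)" for M
  proof -
    have sp: "space M = UNIV" using sets_eq_imp_space_eq[OF that(2)] by (simp add: space_PiM)
    have "Measurable.pred (conf UNIV) C" using C by (intro measurable_depends_on) auto
    then have "{\<omega>. C \<omega>} \<in> sets M" unfolding that(2) by (simp add: pred_def space_PiM)
    moreover have "(\<lambda>\<omega>. if C \<omega> then 1 else 0 :: real) = indicator {\<omega>. C \<omega>}" by (auto simp: indicator_def)
    ultimately show ?thesis by (simp add: sp)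
  qed
  then show ?thesis using conv[OF cyl_indicator[OF C(1) subset_UNIV C(2)]] mu nu by simp
qed

lemma cinv_limit:
  fixes \<mu> :: "nat \<Rightarrow> 'd::finite config measure"
  assumes mu: "\<And>n. cinv UNIV (\<mu> n)" and nu: "prob_space \<nu>" "sets \<nu> = sets (conf UNIV)"
    and conv: "\<And>f. cyl UNIV f \<Longrightarrow> (\<lambda>n. \<integral>\<omega>. f \<omega> \<partial>\<mu> n) \<longlonglongrightarrow> (\<integral>\<omega>. f \<omega> \<partial>\<nu>)"
  shows "cinv UNIV \<nu>"
  unfolding cinv_def
proof (intro conjI allI impI nu)
  show "\<exists>K. (UNIV :: (nat \<times> (int ^ 'd)) set) = K \<times> UNIV \<and> {1..} \<subseteq> K" by (intro exI[of _ UNIV]) simp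
  fix z :: "int ^ 'd" and f :: "'d config \<Rightarrow> real" assume f: "cyl UNIV f"
  have "(\<lambda>n. \<integral>\<omega>. f (tshift z \<omega>) \<partial>\<mu> n) \<longlonglongrightarrow> (\<integral>\<omega>. f (tshift z \<omega>) \<partial>\<nu>)"
    using cinv_shift_cyl[OF mu f] by (rule conv)
  moreover have "(\<lambda>n. \<integral>\<omega>. f (tshift z \<omega>) \<partial>\<mu> n) \<longlonglongrightarrow> (\<integral>\<omega>. f \<omega> \<partial>\<nu>)"
    using conv[OF f] cinvD(4)[OF mu f] by simp
  ultimately show "(\<integral>\<omega>. f (tshift z \<omega>) \<partial>\<nu>) = (\<integral>\<omega>. f \<omega> \<partial>\<nu>)" by (rule LIMSEQ_unique)
qed

lemma measure_coordinate_shift: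
  assumes P: "cinv UNIV P"
  shows "measure P {\<omega>. \<omega> (k, x) > M} = measure P {\<omega>. \<omega> (k, 0) > M}"
proof -
  have sp: "space P = UNIV" using sets_eq_imp_space_eq[OF cinvD(2)[OF P]] by (simp add: space_PiM)
  have c: "cyl UNIV (\<lambda>\<omega>. if \<omega> (k, y) > M then 1 else 0)" for y
    by (rule cyl_indicator[of "{(k, y)}"]) (auto intro: depends_on_coordinate)
  have m: "(\<integral>\<omega>. (if \<omega> (k, y) > M then 1 else 0) \<partial>P) = measure P {\<omega>. \<omega> (k, y) > M}" for y
  proof -
    have "(\<lambda>\<omega>. \<omega> (k, y)) \<in> measurable P (count_space UNIV)" using cinvD(2)[OF P] by (intro measurable_coordinate) auto
    then have "{\<omega> \<in> space P. \<omega> (k, y) > M} \<in> sets P" by measurable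
    moreover have "(\<lambda>\<omega>. if \<omega> (k, y) > M then 1 else 0 :: real) = indicator {\<omega>. \<omega> (k, y) > M}" by (auto simp: indicator_def)
    ultimately show ?thesis by (simp add: sp)
  qed
  show ?thesis using cinvD(4)[OF P c[of 0], of x] unfolding m[symmetric] by (simp add: tshift_def)
qed

text \<open>Tightness of the marks comes from Markov's inequality and the convergent means, that of
  the macroscopic coordinates from the hypothesis \<open>macro\<close>. The entropy bound lets the
  means of the marks survive; the conclusion says nothing about the mean of the macroscopic
  field.\<close>

lemma compact_limit:
  fixes \<mu> :: "nat \<Rightarrow> 'd::finite config measure"
  assumes mu: "\<And>n. cinv UNIV (\<mu> n)"
    and q: "\<And>k. k \<ge> 1 \<Longrightarrow> q k > 0"
    and mean: "\<And>n k. k \<ge> 1 \<Longrightarrow> (\<integral>\<^sup>+\<omega>. of_nat (\<omega> (k, 0)) \<partial>\<mu> n) = ennreal (m n k)" "\<And>n k. k \<ge> 1 \<Longrightarrow> 0 \<le> m n k"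
    and lim: "\<And>k. k \<ge> 1 \<Longrightarrow> (\<lambda>n. m n k) \<longlonglongrightarrow> m' k"
    and dens: "\<And>n. dens q (\<mu> n) \<le> ennreal C" "0 \<le> C"
    and macro: "\<And>e. e > 0 \<Longrightarrow> \<exists>M. \<forall>n. measure (\<mu> n) {\<omega>. \<omega> (0, 0) > M} \<le> e"
  obtains r \<nu> where "strict_mono (r :: nat \<Rightarrow> nat)" "cinv UNIV \<nu>"
    "\<And>f. cyl UNIV f \<Longrightarrow> (\<lambda>n. \<integral>\<omega>. f \<omega> \<partial>\<mu> (r n)) \<longlonglongrightarrow> (\<integral>\<omega>. f \<omega> \<partial>\<nu>)"
    "\<And>k. k \<ge> 1 \<Longrightarrow> (\<integral>\<^sup>+\<omega>. of_nat (\<omega> (k, 0)) \<partial>\<nu>) = ennreal (m' k)"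
proof -
  have tight: "\<exists>M. \<forall>n. measure (\<mu> n) {\<omega>. \<omega> i > M} \<le> e" if e: "e > 0" for i e
  proof -
    obtain k x where i: "i = (k, x)" by (cases i)
    have shift: "measure (\<mu> n) {\<omega>. \<omega> (k, x) > M} = measure (\<mu> n) {\<omega>. \<omega> (k, 0) > M}" for n M
      by (rule measure_coordinate_shift[OF mu])
    show ?thesis
    proof (cases "k = 0")
      case True
      then show ?thesis unfolding i shift using macro[OF e] by simp
    next
      case False
      then have k: "k \<ge> 1" by simp
      have "Bseq (\<lambda>n. m n k)" using lim[OF k] by (intro convergent_imp_Bseq convergentI)
      then obtain B where B: "B > 0" "\<And>n. \<bar>m n k\<bar> \<le> B" by (auto simp: Bseq_def)
      obtain M :: nat where M: "B / e < real M" using reals_Archimedean2 by blast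
      have "measure (\<mu> n) {\<omega>. \<omega> (k, 0) > M} \<le> e" for n
      proof -
        have sp: "space (\<mu> n) = UNIV" using sets_eq_imp_space_eq[OF cinvD(2)[OF mu]] by (simp add: space_PiM)
        have "measure (\<mu> n) {\<omega> \<in> space (\<mu> n). \<omega> (k, 0) > M} \<le> B / real (M + 1)"
        proof (rule measure_le_nn_mean[OF cinvD(1)[OF mu]])
          show "(\<lambda>\<omega>. \<omega> (k, 0)) \<in> measurable (\<mu> n) (count_space UNIV)"
            using cinvD(2)[OF mu] by (intro measurable_coordinate) auto
          show "(\<integral>\<^sup>+\<omega>. of_nat (\<omega> (k, 0)) \<partial>\<mu> n) \<le> ennreal B"
            unfolding mean(1)[OF k] using B(2)[of n] by (intro ennreal_leI) simp
        qed (use B in simp)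
        also have "\<dots> \<le> e" using M e by (simp add: field_simps)
        finally show ?thesis by (simp add: sp)
      qed
      then show ?thesis unfolding i shift by blast
    qed
  qed
  obtain r \<nu> where r: "strict_mono (r :: nat \<Rightarrow> nat)" and nu: "prob_space \<nu>" "sets \<nu> = sets (conf UNIV)"
    and conv: "\<And>f. cyl UNIV f \<Longrightarrow> (\<lambda>n. \<integral>\<omega>. f \<omega> \<partial>\<mu> (r n)) \<longlonglongrightarrow> (\<integral>\<omega>. f \<omega> \<partial>\<nu>)"
    by (rule tight_subseq[OF cinvD(1,2)[OF mu] tight], assumption) (rule that)
  have cn: "cinv UNIV \<nu>" by (rule cinv_limit[OF mu nu conv])
  have mn: "(\<integral>\<^sup>+\<omega>. of_nat (\<omega> (k, 0)) \<partial>\<nu>) = ennreal (m' k)" if k: "k \<ge> 1" for k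
  proof (rule mean_limit[where \<mu>="\<lambda>n. \<mu> (r n)" and q=q and C=C and m="\<lambda>n. m (r n) k", OF cinvD(1,2)[OF mu] nu conv k q[OF k]])
    show "hent q (\<mu> (r n)) {(k, 0)} \<le> ennreal C" for n
    proof -
      have "hent q (\<mu> (r n)) {(k, 0)} \<le> hent q (\<mu> (r n)) (marks (box_Z 0))"
        using k by (intro hent_mono) (auto simp: box_Z_def)
      also have "\<dots> \<le> dens q (\<mu> (r n))"
        using hent_le_dens[of q "\<mu> (r n)" 0] by (simp add: card_box_Z)
      finally show ?thesis using dens(1) by (rule order.trans)
    qed
    show "(\<lambda>n. m (r n) k) \<longlonglongrightarrow> m' k" using LIMSEQ_subseq_LIMSEQ[OF lim[OF k] r] by (simp add: o_def)
  qed (use mean k dens in auto)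
  show ?thesis by (rule that[OF r cn conv mn])
qed

section \<open>The interaction along local limits\<close>

context interaction
begin

text \<open>Keeping only marks up to size K makes the interaction a local function. It also
  tolerates laws whose larger marks have been copied into the macroscopic coordinates.\<close>

definition field_to :: "nat \<Rightarrow> 'd config \<Rightarrow> int ^ 'd \<Rightarrow> ennreal" where
  "field_to K \<omega> i = occ G {1..K} \<omega> i + of_nat (\<omega> (0, i))"

lemma occ_finite: "finite A \<Longrightarrow> occ G A \<omega> i = of_nat (\<Sum>k\<in>A. \<Sum>y\<in>G k. \<omega> (k, i - y))"
  unfolding occ_def by (simp add: nn_integral_count_space_finite)

lemma occ_mono: "A \<subseteq> B \<Longrightarrow> occ G A \<omega> i \<le> occ G B \<omega> i"
  unfolding occ_def nn_integral_count_space_eq_SUP[OF countableI_type] by (intro SUP_subset_mono) auto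

lemma occ_SUP: "occ G {1..} \<omega> i = (SUP K. occ G {1..K} \<omega> i)"
proof (rule antisym)
  show "occ G {1..} \<omega> i \<le> (SUP K. occ G {1..K} \<omega> i)"
    unfolding occ_def[of G "{1..}"] nn_integral_count_space_eq_SUP[OF countableI_type]
  proof (rule SUP_least)
    fix F :: "nat set" assume "F \<in> {F. finite F \<and> F \<subseteq> {1..}}"
    then have F: "finite F" "F \<subseteq> {1..Max (insert 0 F)}" by (auto intro: Max_ge)
    have "(\<Sum>k\<in>F. \<Sum>y\<in>G k. of_nat (\<omega> (k, i - y))) = occ G F \<omega> i"
      using F(1) by (simp add: occ_finite)
    also have "\<dots> \<le> occ G {1..Max (insert 0 F)} \<omega> i" by (rule occ_mono[OF F(2)])
    also have "\<dots> \<le> (SUP K. occ G {1..K} \<omega> i)" by (rule SUP_upper) simp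
    finally show "(\<Sum>k\<in>F. \<Sum>y\<in>G k. of_nat (\<omega> (k, i - y))) \<le> (SUP K. occ G {1..K} \<omega> i)" .
  qed
  show "(SUP K. occ G {1..K} \<omega> i) \<le> occ G {1..} \<omega> i" by (intro SUP_least occ_mono) auto
qed

lemma inter_SUP:
  assumes "\<And>i. incseq (\<lambda>K. d K i)"
  shows "inter v (\<lambda>i. SUP K. d K i) = (SUP K. inter v (d K))"
proof -
  have i2: "incseq (\<lambda>K. d K 0 * d K u)" for u
    using assms by (auto simp: incseq_def intro!: mult_mono)
  have "inter v (\<lambda>i. SUP K. d K i) = (\<Sum>u | v u \<noteq> 0. SUP K. ennreal (v u) * (d K 0 * d K u))"
    unfolding inter_def SUP_mult_incseq[OF assms assms] by (simp add: SUP_mult_left_ennreal)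
  also have "\<dots> = (SUP K. \<Sum>u | v u \<noteq> 0. ennreal (v u) * (d K 0 * d K u))"
    using i2 by (intro ennreal_SUP_sum[symmetric]) (auto simp: incseq_def intro!: mult_left_mono)
  finally show ?thesis unfolding inter_def .
qed

lemma incseq_field_to: "incseq (\<lambda>K. field_to K \<omega> i)"
  unfolding field_to_def by (auto simp: incseq_def intro!: add_right_mono occ_mono)

lemma inter_field_SUP: "inter v (field \<omega>) = (SUP K. inter v (field_to K \<omega>))"
proof -
  have "field \<omega> = (\<lambda>i. SUP K. field_to K \<omega> i)"
    unfolding field_def field_to_def occ_SUP by (simp add: ennreal_SUP_add_left)
  then show ?thesis using inter_SUP[OF incseq_field_to] by simp
qed

text \<open>There are finitely many mark sizes, each of finite extent, and finitely many interacting
  displacements.\<close>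

lemma inter_field_to_local: "\<exists>F. finite F \<and> depends_on F (\<lambda>\<omega>. inter v (field_to K \<omega>))"
proof -
  define S where "S i = insert (0, i) (\<Union>k\<in>{1..K}. (\<lambda>y. (k, i - y)) ` G k)" for i :: "int ^ 'd"
  let ?F = "\<Union>u\<in>insert 0 {u. v u \<noteq> 0}. S u"
  have "finite (S i)" for i unfolding S_def using finite_G by auto
  then have "finite ?F" using v_supp by auto
  moreover have "depends_on ?F (\<lambda>\<omega>. inter v (field_to K \<omega>))"
  proof (rule depends_onI)
    fix \<omega> \<omega>' :: "'d config" assume h: "\<And>i. i \<in> ?F \<Longrightarrow> \<omega> i = \<omega>' i"
    have f: "field_to K \<omega> u = field_to K \<omega>' u" if "u \<in> insert 0 {u. v u \<noteq> 0}" for u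
    proof -
      have e: "\<omega> i = \<omega>' i" if "i \<in> S u" for i using that \<open>u \<in> insert 0 {u. v u \<noteq> 0}\<close> by (intro h) blast
      have "(\<Sum>k\<in>{1..K}. \<Sum>y\<in>G k. \<omega> (k, u - y)) = (\<Sum>k\<in>{1..K}. \<Sum>y\<in>G k. \<omega>' (k, u - y))"
        by (intro sum.cong refl e) (auto simp: S_def)
      moreover have "\<omega> (0, u) = \<omega>' (0, u)" by (rule e) (simp add: S_def)
      ultimately show ?thesis unfolding field_to_def by (simp add: occ_finite)
    qed
    then show "inter v (field_to K \<omega>) = inter v (field_to K \<omega>')"
      unfolding inter_def by (intro sum.cong refl) auto
  qed
  ultimately show ?thesis by blast
qed

lemma field_to_measurable: "sets P = sets (conf UNIV) \<Longrightarrow> (\<lambda>\<omega>. inter v (field_to K \<omega>)) \<in> borel_measurable P"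
proof -
  assume P: "sets P = sets (conf UNIV)"
  obtain F where "finite F" "depends_on F (\<lambda>\<omega>. inter v (field_to K \<omega>))" using inter_field_to_local by blast
  then have "(\<lambda>\<omega>. inter v (field_to K \<omega>)) \<in> borel_measurable (conf UNIV)" by (intro measurable_depends_on) auto
  then show ?thesis using P by (simp cong: measurable_cong_sets)
qed

text \<open>The truncated interaction is local but unbounded. Cut off at N it is a cylinder function
  and converges; N is removed by monotone convergence, which leaves only an inequality.\<close>

lemma inter_limit:
  assumes mu: "\<And>n. prob_space (\<mu> n)" "\<And>n. sets (\<mu> n) = sets (conf UNIV)"
    and nu: "prob_space \<nu>" "sets \<nu> = sets (conf UNIV)"
    and conv: "\<And>f. cyl UNIV f \<Longrightarrow> (\<lambda>n. \<integral>\<omega>. f \<omega> \<partial>\<mu> n) \<longlonglongrightarrow> (\<integral>\<omega>. f \<omega> \<partial>\<nu>)"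
  shows "(\<integral>\<^sup>+\<omega>. inter v (field_to K \<omega>) \<partial>\<nu>) \<le> liminf (\<lambda>n. \<integral>\<^sup>+\<omega>. inter v (field_to K \<omega>) \<partial>\<mu> n)"
proof -
  let ?h = "\<lambda>\<omega>. inter v (field_to K \<omega>)"
  obtain F where F: "finite F" "depends_on F ?h" using inter_field_to_local by blast
  have c: "cyl UNIV (\<lambda>\<omega>. enn2real (min (of_nat N) (?h \<omega>)))" for N
  proof (rule cylI[OF F(1) subset_UNIV depends_on_comp[OF F(2), of "\<lambda>t. enn2real (min (of_nat N) t)"]])
    show "\<bar>enn2real (min (of_nat N) (?h \<omega>))\<bar> \<le> real N" for \<omega>
      using enn2real_mono[of "min (of_nat N) (?h \<omega>)" "of_nat N"] by (simp add: of_nat_less_top)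
  qed
  have e: "(\<integral>\<^sup>+\<omega>. min (of_nat N) (?h \<omega>) \<partial>M) = ennreal (\<integral>\<omega>. enn2real (min (of_nat N) (?h \<omega>)) \<partial>M)"
    if M: "prob_space M" "sets M = sets (conf UNIV)" for M N
  proof -
    have "min (of_nat N) (?h \<omega>) = ennreal (enn2real (min (of_nat N) (?h \<omega>)))" for \<omega>
      by (intro ennreal_enn2real[symmetric]) (simp add: min_less_iff_disj of_nat_less_top)
    then have "(\<integral>\<^sup>+\<omega>. min (of_nat N) (?h \<omega>) \<partial>M) = (\<integral>\<^sup>+\<omega>. ennreal (enn2real (min (of_nat N) (?h \<omega>))) \<partial>M)" by simp
    also have "\<dots> = ennreal (\<integral>\<omega>. enn2real (min (of_nat N) (?h \<omega>)) \<partial>M)"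
      by (rule nn_integral_eq_integral[OF cyl_integrable[OF c subset_UNIV M(2,1)]]) simp
    finally show ?thesis .
  qed
  have "(\<integral>\<^sup>+\<omega>. ?h \<omega> \<partial>\<nu>) = (\<integral>\<^sup>+\<omega>. (SUP N. min (of_nat N) (?h \<omega>)) \<partial>\<nu>)"
  proof (rule nn_integral_cong)
    fix \<omega> :: "'d config"
    have "inf (?h \<omega>) (SUP N. of_nat N) = ?h \<omega>"
      unfolding ennreal_SUP_of_nat_eq_top by simp
    moreover have "inf (?h \<omega>) (SUP N. of_nat N) = (SUP N. inf (?h \<omega>) (of_nat N))" by (rule inf_SUP)
    moreover have "(SUP N. inf (?h \<omega>) (of_nat N)) = (SUP N. min (of_nat N) (?h \<omega>))"
      by (simp only: inf_min min.commute)
    ultimately show "?h \<omega> = (SUP N. min (of_nat N) (?h \<omega>))" by simp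
  qed
  also have "\<dots> = (SUP N. \<integral>\<^sup>+\<omega>. min (of_nat N) (?h \<omega>) \<partial>\<nu>)"
  proof (rule nn_integral_monotone_convergence_SUP)
    show "incseq (\<lambda>N \<omega>. min (of_nat N) (?h \<omega>))"
      by (auto simp: incseq_def le_fun_def min_le_iff_disj intro: order.trans[of "of_nat _"])
  qed (use field_to_measurable[OF nu(2)] in measurable)
  also have "\<dots> \<le> liminf (\<lambda>n. \<integral>\<^sup>+\<omega>. ?h \<omega> \<partial>\<mu> n)"
  proof (rule SUP_least)
    fix N
    have "(\<lambda>n. \<integral>\<^sup>+\<omega>. min (of_nat N) (?h \<omega>) \<partial>\<mu> n) \<longlonglongrightarrow> (\<integral>\<^sup>+\<omega>. min (of_nat N) (?h \<omega>) \<partial>\<nu>)"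
      unfolding e[OF mu] e[OF nu] by (intro tendsto_ennrealI conv c)
    then have "(\<integral>\<^sup>+\<omega>. min (of_nat N) (?h \<omega>) \<partial>\<nu>) = liminf (\<lambda>n. \<integral>\<^sup>+\<omega>. min (of_nat N) (?h \<omega>) \<partial>\<mu> n)"
      by (simp add: lim_imp_Liminf)
    also have "\<dots> \<le> liminf (\<lambda>n. \<integral>\<^sup>+\<omega>. ?h \<omega> \<partial>\<mu> n)"
      by (intro Liminf_mono always_eventually allI nn_integral_mono) simp
    finally show "(\<integral>\<^sup>+\<omega>. min (of_nat N) (?h \<omega>) \<partial>\<nu>) \<le> liminf (\<lambda>n. \<integral>\<^sup>+\<omega>. ?h \<omega> \<partial>\<mu> n)" .
  qed
  finally show ?thesis .
qed

text \<open>The bound is demanded for each K separately and only eventually in n. This weak form is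
  tailored to \<open>macro\<close>, where large marks stay in the configuration and are also copied
  into the field: the full \<open>jcost\<close> along the sequence would count them twice.\<close>

lemma jcost_limit:
  assumes mu: "\<And>n. prob_space (\<mu> n)" "\<And>n. sets (\<mu> n) = sets (conf UNIV)"
    and nu: "prob_space \<nu>" "sets \<nu> = sets (conf UNIV)"
    and conv: "\<And>f. cyl UNIV f \<Longrightarrow> (\<lambda>n. \<integral>\<omega>. f \<omega> \<partial>\<mu> n) \<longlonglongrightarrow> (\<integral>\<omega>. f \<omega> \<partial>\<nu>)"
    and bound: "\<And>K. \<forall>\<^sub>F n in sequentially. dens q (\<mu> n) + (\<integral>\<^sup>+\<omega>. inter v (field_to K \<omega>) \<partial>\<mu> n) \<le> c n"
    and c: "c \<longlonglongrightarrow> c'"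
  shows "jcost q \<nu> \<le> c'"
proof -
  have d: "dens q \<nu> \<le> liminf (\<lambda>n. dens q (\<mu> n))"
    unfolding le_Liminf_iff using dens_lower_semicontinuous[of \<mu> \<nu>] conv by (blast intro: cyl_mono)
  have k: "dens q \<nu> + (\<integral>\<^sup>+\<omega>. inter v (field_to K \<omega>) \<partial>\<nu>) \<le> c'" for K
  proof -
    have "dens q \<nu> + (\<integral>\<^sup>+\<omega>. inter v (field_to K \<omega>) \<partial>\<nu>)
        \<le> liminf (\<lambda>n. dens q (\<mu> n)) + liminf (\<lambda>n. \<integral>\<^sup>+\<omega>. inter v (field_to K \<omega>) \<partial>\<mu> n)"
      by (intro add_mono d inter_limit[OF mu nu conv])
    also have "\<dots> \<le> liminf (\<lambda>n. dens q (\<mu> n) + (\<integral>\<^sup>+\<omega>. inter v (field_to K \<omega>) \<partial>\<mu> n))"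
      by (rule liminf_add_ennreal)
    also have "\<dots> \<le> liminf c" by (rule Liminf_mono[OF bound])
    also have "\<dots> = c'" using c by (simp add: lim_imp_Liminf)
    finally show ?thesis .
  qed
  have "(\<integral>\<^sup>+\<omega>. inter v (field \<omega>) \<partial>\<nu>) = (SUP K. \<integral>\<^sup>+\<omega>. inter v (field_to K \<omega>) \<partial>\<nu>)"
    unfolding inter_field_SUP
    by (rule nn_integral_monotone_convergence_SUP)
       (auto simp: incseq_def le_fun_def intro!: inter_mono field_to_measurable[OF nu(2)] incseqD[OF incseq_field_to])
  then have "jcost q \<nu> = (SUP K. dens q \<nu> + (\<integral>\<^sup>+\<omega>. inter v (field_to K \<omega>) \<partial>\<nu>))"
    unfolding jcost_def by (simp add: ennreal_SUP_add_right)
  then show ?thesis using k by (simp add: SUP_least)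
qed

lemma jcost_ge_field_to: "dens q P + (\<integral>\<^sup>+\<omega>. inter v (field_to K \<omega>) \<partial>P) \<le> jcost q P"
  unfolding jcost_def field_def field_to_def
  by (intro add_left_mono nn_integral_mono inter_mono add_right_mono occ_mono) auto

end

section \<open>Existence of minimisers for fixed \<open>(m, \<psi>)\<close>\<close>

text \<open>A two-point law on the integers next to m, with the fractional part as weight.\<close>

lemma ex_pmf_mean:
  assumes "(m :: real) \<ge> 0"
  obtains p :: "nat pmf" where "(\<integral>\<^sup>+n. of_nat n \<partial>measure_pmf p) = ennreal m"
proof -
  define f where "f = nat \<lfloor>m\<rfloor>"
  define p where "p = map_pmf (\<lambda>b. f + of_bool b) (bernoulli_pmf (frac m))"
  have fr: "0 \<le> frac m" "frac m \<le> 1" by (auto simp: frac_lt_1 less_imp_le)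
  have "(\<integral>\<^sup>+n. of_nat n \<partial>measure_pmf p) = (\<integral>\<^sup>+b. ennreal (real f + of_bool b) \<partial>measure_pmf (bernoulli_pmf (frac m)))"
    unfolding p_def by (simp add: ennreal_of_nat_eq_real_of_nat[symmetric] of_bool_def) (rule nn_integral_cong; simp add: ennreal_of_nat_eq_real_of_nat)
  also have "\<dots> = ennreal (frac m) * ennreal (real f + 1) + ennreal (1 - frac m) * ennreal (real f)"
    using fr by (simp add: nn_integral_measure_pmf nn_integral_count_space_finite UNIV_bool)
  also have "\<dots> = ennreal (frac m * (real f + 1) + (1 - frac m) * real f)"
    using fr by (simp add: ennreal_mult ennreal_plus)
  also have "frac m * (real f + 1) + (1 - frac m) * real f = m"
    using assms by (simp add: f_def frac_def algebra_simps)
  finally show ?thesis by (rule that)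
qed

lemma product_law_mean:
  assumes k: "k \<ge> 1"
  shows "(\<integral>\<^sup>+\<omega>. of_nat (\<omega> (k, x)) \<partial>(product_law p :: 'd::finite config measure)) = (\<integral>\<^sup>+n. of_nat n \<partial>measure_pmf (p k))"
proof -
  let ?M = "\<lambda>(k, x). measure_pmf (p k) :: nat measure"
  have pr: "prob_space (?M i)" for i :: "nat \<times> (int ^ 'd)" by (cases i) (simp add: measure_pmf.prob_space_axioms)
  have "distr (PiM (marks UNIV) ?M) (?M (k, x)) (\<lambda>\<omega>. \<omega> (k, x)) = ?M (k, x)"
    using k by (intro distr_PiM_component pr) auto
  then have "(\<integral>\<^sup>+n. of_nat n \<partial>measure_pmf (p k)) = (\<integral>\<^sup>+n. of_nat n \<partial>distr (product_law p) (?M (k, x)) (\<lambda>\<omega>. \<omega> (k, x)))"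
    unfolding product_law_def by simp
  also have "\<dots> = (\<integral>\<^sup>+\<omega>. of_nat (\<omega> (k, x)) \<partial>product_law p)"
  proof (rule nn_integral_distr)
    show "(\<lambda>\<omega>. \<omega> (k, x)) \<in> measurable (product_law p) (?M (k, x))"
      unfolding product_law_def using k by (intro measurable_component_singleton) auto
  qed simp
  finally show ?thesis ..
qed

lemma competitors_iff:
  "P \<in> competitors m \<psi> \<longleftrightarrow> (\<forall>a. cinv (marks UNIV) (P a)) \<and>
    (\<forall>k\<ge>1. (\<integral>\<^sup>+a. (\<integral>\<^sup>+\<omega>. of_nat (\<omega> (k, 0)) \<partial>P a) \<partial>measure_pmf \<psi>) = ennreal (m k))"
  unfolding competitors_def nn_integral_pmf_countable N_mark_def
  by (simp add: shift_invariant_iff_cinv)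

text \<open>Independent counts with the prescribed means compete, the same law for every a. Their
  cost may be infinite, but a minimiser exists even then because the set is nonempty.\<close>

lemma competitors_nonempty:
  assumes "m \<in> {1..} \<rightarrow> {0..}"
  shows "competitors m \<psi> \<noteq> ({} :: (nat \<Rightarrow> 'd::finite config measure) set)"
proof -
  have "\<forall>k. \<exists>p :: nat pmf. k \<ge> 1 \<longrightarrow> (\<integral>\<^sup>+n. of_nat n \<partial>measure_pmf p) = ennreal (m k)"
  proof
    fix k :: nat
    show "\<exists>p :: nat pmf. k \<ge> 1 \<longrightarrow> (\<integral>\<^sup>+n. of_nat n \<partial>measure_pmf p) = ennreal (m k)"
    proof (cases "k \<ge> 1")
      case True
      then have "m k \<ge> 0" using assms by auto
      then show ?thesis using ex_pmf_mean by metis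
    qed simp
  qed
  from choice[OF this] obtain p :: "nat \<Rightarrow> nat pmf" where p: "\<And>k. k \<ge> 1 \<Longrightarrow> (\<integral>\<^sup>+n. of_nat n \<partial>measure_pmf (p k)) = ennreal (m k)"
    by blast
  have "(\<lambda>_. product_law p :: 'd config measure) \<in> competitors m \<psi>"
    unfolding competitors_iff
    using p shift_invariant_imp_cinv[OF product_law_shift_invariant] by (simp add: product_law_mean)
  then show ?thesis by blast
qed

lemma minimising_sequence:
  fixes f :: "'a \<Rightarrow> ennreal"
  assumes "A \<noteq> {}" "(INF x\<in>A. f x) \<noteq> \<infinity>"
  obtains x where "\<And>n :: nat. x n \<in> A" "\<And>n. f (x n) \<le> (INF x\<in>A. f x) + ennreal (1 / real (Suc n))"
proof -
  let ?c = "INF x\<in>A. f x"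
  have "\<exists>x. x \<in> A \<and> f x \<le> ?c + ennreal (1 / real (Suc n))" for n :: nat
  proof -
    have "?c < ?c + ennreal (1 / real (Suc n))"
      using assms(2) by (cases ?c) (auto simp: ennreal_plus[symmetric] ennreal_less_iff simp del: ennreal_plus)
    then show ?thesis by (auto simp: INF_less_iff intro: less_imp_le)
  qed
  then have "\<forall>n. \<exists>x. x \<in> A \<and> f x \<le> ?c + ennreal (1 / real (Suc n))" ..
  from choice[OF this] show ?thesis using that by blast
qed

lemma tendsto_add_inverse: "(\<lambda>n. c + ennreal (1 / real (Suc n))) \<longlonglongrightarrow> c"
proof -
  have "(\<lambda>n. c + ennreal (1 / real (Suc n))) \<longlonglongrightarrow> c + ennreal 0"
    by (intro tendsto_add tendsto_const tendsto_ennrealI LIMSEQ_Suc[OF lim_const_over_n])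
  then show ?thesis by simp
qed

context interaction
begin

lemma competitors_minimiser:
  assumes q: "\<And>k. k \<ge> 1 \<Longrightarrow> q k > 0" and m: "m \<in> {1..} \<rightarrow> {0..}"
  shows "\<exists>P\<in>competitors m \<psi>. \<forall>P'\<in>competitors m \<psi>. cost q G v \<psi> P \<le> cost q G v \<psi> P'"
proof -
  let ?C = "competitors m \<psi> :: (nat \<Rightarrow> 'd config measure) set"
  let ?c = "INF P\<in>?C. cost q G v \<psi> P"
  have ne: "?C \<noteq> {}" by (rule competitors_nonempty[OF m])
  have cost: "cost q G v \<psi> P = (\<integral>\<^sup>+a. ecost q a (P a) \<partial>measure_pmf \<psi>)" if "P \<in> ?C" for P
    using that by (intro cost_eq) (simp add: competitors_iff shift_invariant_iff_cinv)
  have "\<exists>P\<in>?C. cost q G v \<psi> P \<le> ?c"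
  \<comment> \<open>With an infinite infimum every competitor is a minimiser, so compactness is
    needed only for a finite one.\<close>
  proof (cases "?c = \<infinity>")
    case True
    then show ?thesis using ne by auto
  next
    case False
    obtain P where P: "\<And>n :: nat. P n \<in> ?C" "\<And>n. cost q G v \<psi> (P n) \<le> ?c + ennreal (1 / real (Suc n))"
      by (rule minimising_sequence[OF ne False]) (rule that)
    have Pc: "cinv (marks UNIV) (P n a)" for n a using P(1) by (simp add: competitors_iff)
    define \<mu> where "\<mu> n = pack \<psi> (P n)" for n
    have mu: "cinv UNIV (\<mu> n)" for n unfolding \<mu>_def by (rule pack_cinv[OF Pc])
    have mean: "(\<integral>\<^sup>+\<omega>. of_nat (\<omega> (k, 0)) \<partial>\<mu> n) = ennreal (m k)" if "k \<ge> 1" for n k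
      unfolding \<mu>_def using P(1)[of n] that by (simp add: nn_integral_coordinate_pack[OF Pc that] competitors_iff)
    have jle: "jcost q (\<mu> n) \<le> ?c + ennreal (1 / real (Suc n))" for n
      unfolding \<mu>_def using jcost_pack[OF Pc] P(2)[of n] unfolding cost[OF P(1)] by (rule order.trans)
    obtain c where c: "?c = ennreal c" "0 \<le> c" using False by (cases ?c) auto
    have dle: "dens q (\<mu> n) \<le> ennreal (c + 1)" for n
    proof -
      have "dens q (\<mu> n) \<le> jcost q (\<mu> n)" unfolding jcost_def by simp
      also have "\<dots> \<le> ennreal c + ennreal 1"
        using jle[of n] unfolding c(1) by (elim order.trans) (intro add_left_mono ennreal_leI; simp)
      finally show ?thesis using c(2) by simp
    qed
    \<comment> \<open>The joint law of two macroscopic coordinates is the same for all n. Hence no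
      mass of \<open>\<psi>\<close> can escape, and the limit inherits the law of the level together
      with its constancy.\<close>
    have macro: "measure (\<mu> n) {\<omega>. C (\<omega> (0, x)) (\<omega> (0, y))} = measure (measure_pmf \<psi>) {a. C a a}" for n C x y
      unfolding \<mu>_def measure_def by (subst measure_macro_pack[OF Pc]) simp
    have tight: "\<exists>M. \<forall>n. measure (\<mu> n) {\<omega>. \<omega> (0, 0) > M} \<le> e" if e: "e > 0" for e
    proof -
      have "(\<lambda>M. measure (measure_pmf \<psi>) {M<..}) \<longlonglongrightarrow> measure (measure_pmf \<psi>) (\<Inter>M. {M<..})"
        by (intro measure_pmf.finite_Lim_measure_decseq) (auto simp: decseq_def)
      moreover have "(\<Inter>M :: nat. {M<..}) = {}" by auto
      ultimately have "(\<lambda>M. measure (measure_pmf \<psi>) {M<..}) \<longlonglongrightarrow> 0" by simp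
      from order_tendstoD(2)[OF this e] obtain M where "measure (measure_pmf \<psi>) {M<..} < e"
        using eventually_happens'[OF sequentially_bot] by blast
      then show ?thesis using macro[of _ "\<lambda>a _. a > M" 0 0] by (intro exI[of _ M]) (auto simp: greaterThan_def)
    qed
    have mnn: "0 \<le> m k" if "k \<ge> 1" for k using m that by auto
    obtain r \<nu> where r: "strict_mono (r :: nat \<Rightarrow> nat)" and nu: "cinv UNIV \<nu>"
      and conv: "\<And>f. cyl UNIV f \<Longrightarrow> (\<lambda>n. \<integral>\<omega>. f \<omega> \<partial>\<mu> (r n)) \<longlonglongrightarrow> (\<integral>\<omega>. f \<omega> \<partial>\<nu>)"
      and nmean: "\<And>k. k \<ge> 1 \<Longrightarrow> (\<integral>\<^sup>+\<omega>. of_nat (\<omega> (k, 0)) \<partial>\<nu>) = ennreal (m k)"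
      by (rule compact_limit[where \<mu>=\<mu> and q=q and m="\<lambda>_. m" and m'=m and C="c + 1", OF mu q mean mnn tendsto_const dle _ tight])
         (use c(2) in \<open>assumption | simp | rule that\<close>)+
    have jnu: "jcost q \<nu> \<le> ?c"
    proof (rule jcost_limit[where \<mu>="\<lambda>n. \<mu> (r n)", OF cinvD(1,2)[OF mu] cinvD(1,2)[OF nu] conv])
      show "\<forall>\<^sub>F n in sequentially. dens q (\<mu> (r n)) + (\<integral>\<^sup>+\<omega>. inter v (field_to K \<omega>) \<partial>\<mu> (r n)) \<le> ?c + ennreal (1 / real (Suc (r n)))" for K
        by (intro always_eventually allI order.trans[OF jcost_ge_field_to jle])
      show "(\<lambda>n. ?c + ennreal (1 / real (Suc (r n)))) \<longlonglongrightarrow> ?c"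
        using LIMSEQ_subseq_LIMSEQ[OF tendsto_add_inverse r] by (simp add: o_def)
    qed
    have lim: "(\<lambda>n. measure (\<mu> (r n)) {\<omega>. C (\<omega> (0, x)) (\<omega> (0, y))}) \<longlonglongrightarrow> measure \<nu> {\<omega>. C (\<omega> (0, x)) (\<omega> (0, y))}" for C x y
      by (rule cyl_limit_measure[where \<mu>="\<lambda>n. \<mu> (r n)" and F="{(0, x), (0, y)}", OF cinvD(1,2)[OF mu] cinvD(1,2)[OF nu] conv])
         (auto intro: depends_onI)
    have nmacro: "measure \<nu> {\<omega>. C (\<omega> (0, x)) (\<omega> (0, y))} = measure (measure_pmf \<psi>) {a. C a a}" for C x y
      using lim[of C x y] unfolding macro by (simp add: LIMSEQ_const_iff)
    interpret nu: prob_space \<nu> by (rule cinvD(1)[OF nu])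
    interpret cm: constant_macro G v \<nu> \<psi> q
    proof unfold_locales
      show "cinv UNIV \<nu>" by (rule nu)
      show "emeasure \<nu> {\<omega>. \<omega> (0, x) \<noteq> \<omega> (0, 0)} = 0" for x
        using nmacro[of "\<lambda>a b. a \<noteq> b" x 0] by (simp add: nu.emeasure_eq_measure)
      show "pmf \<psi> a = measure \<nu> {\<omega>. \<omega> (0, 0) = a}" for a
        using nmacro[of "\<lambda>b _. b = a" 0 0] by (simp add: pmf.rep_eq)
    qed
    have "cm.cond \<in> ?C"
      unfolding competitors_iff using cm.cond_cinv cm.cond_mean nmean by simp
    moreover have "cost q G v \<psi> cm.cond \<le> ?c"
      unfolding cost[OF \<open>cm.cond \<in> ?C\<close>] by (rule order.trans[OF cm.ecost_cond jnu])
    ultimately show ?thesis by blast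
  qed
  then show ?thesis by (meson INF_lower order.trans)
qed

section \<open>Macroscopic mass is a limit of microscopic mass\<close>

lemma total_density:
  assumes P: "\<And>a. cinv (marks UNIV) (P a)"
    and m: "\<And>k. k \<ge> 1 \<Longrightarrow> (\<integral>\<^sup>+a. (\<integral>\<^sup>+\<omega>. of_nat (\<omega> (k, 0)) \<partial>P a) \<partial>measure_pmf \<psi>) = ennreal (m k)"
  shows "density_mi m + density_ma \<psi> = (\<integral>\<^sup>+a. (\<integral>\<^sup>+\<omega>. occ G {1..} \<omega> 0 \<partial>P a) + of_nat a \<partial>measure_pmf \<psi>)"
proof -
  have "density_mi m = (\<integral>\<^sup>+k. of_nat k * (\<integral>\<^sup>+a. (\<integral>\<^sup>+\<omega>. of_nat (\<omega> (k, 0)) \<partial>P a) \<partial>measure_pmf \<psi>) \<partial>count_space {1..})"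
    unfolding density_mi_def infsum_ennreal_eq_nn_integral[OF countableI_type]
    by (intro nn_integral_cong) (simp add: m)
  also have "\<dots> = (\<integral>\<^sup>+k. (\<integral>\<^sup>+a. of_nat k * (\<integral>\<^sup>+\<omega>. of_nat (\<omega> (k, 0)) \<partial>P a) \<partial>measure_pmf \<psi>) \<partial>count_space {1..})"
    by (intro nn_integral_cong nn_integral_cmult[symmetric]) simp
  also have "\<dots> = (\<integral>\<^sup>+a. (\<integral>\<^sup>+k. of_nat k * (\<integral>\<^sup>+\<omega>. of_nat (\<omega> (k, 0)) \<partial>P a) \<partial>count_space {1..}) \<partial>measure_pmf \<psi>)"
    by (rule nn_integral_count_space_nn_integral[symmetric]) auto
  also have "\<dots> = (\<integral>\<^sup>+a. (\<integral>\<^sup>+\<omega>. occ G {1..} \<omega> 0 \<partial>P a) \<partial>measure_pmf \<psi>)"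
    by (intro nn_integral_cong nn_integral_occ[OF P, symmetric]) simp
  finally have mi: "density_mi m = (\<integral>\<^sup>+a. (\<integral>\<^sup>+\<omega>. occ G {1..} \<omega> 0 \<partial>P a) \<partial>measure_pmf \<psi>)" .
  have "density_ma \<psi> = (\<integral>\<^sup>+a. of_nat a \<partial>measure_pmf \<psi>)"
    unfolding density_ma_def nn_integral_pmf_countable by (simp add: mult.commute)
  then show ?thesis unfolding mi by (simp add: nn_integral_add)
qed

text \<open>The vector m is read off from the family. Each of its entries is finite because a mark
  of size at least 1 counts at least its own mean in the total density.\<close>

lemma ex_marginals:
  assumes P: "\<And>a. cinv (marks UNIV) (P a)"
    and fin: "(\<integral>\<^sup>+a. (\<integral>\<^sup>+\<omega>. occ G {1..} \<omega> 0 \<partial>P a) + of_nat a \<partial>measure_pmf \<psi>) = ennreal \<rho>"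
  obtains m where "P \<in> competitors m \<psi>" "with_density \<rho> (m, \<psi>)"
proof -
  let ?M = "\<lambda>k. \<integral>\<^sup>+a. (\<integral>\<^sup>+\<omega>. of_nat (\<omega> (k, 0)) \<partial>P a) \<partial>measure_pmf \<psi>"
  define m where "m k = enn2real (?M k)" for k
  have mk: "?M k = ennreal (m k)" if k: "k \<ge> 1" for k
  proof -
    have "?M k \<le> (\<integral>\<^sup>+a. (\<integral>\<^sup>+\<omega>. occ G {1..} \<omega> 0 \<partial>P a) + of_nat a \<partial>measure_pmf \<psi>)"
    proof (rule nn_integral_mono)
      fix a
      have "(\<integral>\<^sup>+\<omega>. of_nat (\<omega> (k, 0)) \<partial>P a) \<le> of_nat k * (\<integral>\<^sup>+\<omega>. of_nat (\<omega> (k, 0)) \<partial>P a)"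
        using mult_right_mono[of 1 "of_nat k" "\<integral>\<^sup>+\<omega>. of_nat (\<omega> (k, 0)) \<partial>P a"] k by simp
      also have "\<dots> = (\<Sum>k\<in>{k}. of_nat k * (\<integral>\<^sup>+\<omega>. of_nat (\<omega> (k, 0)) \<partial>P a))" by simp
      also have "\<dots> \<le> (\<integral>\<^sup>+k. of_nat k * (\<integral>\<^sup>+\<omega>. of_nat (\<omega> (k, 0)) \<partial>P a) \<partial>count_space {1..})"
        unfolding nn_integral_count_space_eq_SUP[OF countableI_type] using k by (intro SUP_upper) auto
      also have "\<dots> = (\<integral>\<^sup>+\<omega>. occ G {1..} \<omega> 0 \<partial>P a)" using nn_integral_occ[OF P, of "{1..}"] by simp
      finally show "(\<integral>\<^sup>+\<omega>. of_nat (\<omega> (k, 0)) \<partial>P a) \<le> (\<integral>\<^sup>+\<omega>. occ G {1..} \<omega> 0 \<partial>P a) + of_nat a"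
        by (simp add: add_increasing2)
    qed
    then have "?M k < top" unfolding fin by (simp add: le_less_trans)
    then show ?thesis by (simp add: m_def)
  qed
  have "P \<in> competitors m \<psi>" unfolding competitors_iff using P mk by simp
  moreover have "with_density \<rho> (m, \<psi>)"
  proof -
    have "0 \<le> m k" for k by (simp add: m_def)
    then show ?thesis
      unfolding with_density_def using total_density[where P=P and \<psi>=\<psi> and m=m, OF P mk] fin by (simp add: Pi_def)
  qed
  ultimately show ?thesis by (rule that)
qed

text \<open>The point mass at level 0 turns one law into an admissible pair for
  \<open>chi\<close>.\<close>

lemma chi_le_single:
  assumes Q: "cinv (marks UNIV) Q" and d: "(\<integral>\<^sup>+\<omega>. occ G {1..} \<omega> 0 \<partial>Q) = ennreal \<rho>"
  shows "chi q G v \<rho> \<le> ecost q 0 Q"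
proof -
  have "(\<integral>\<^sup>+a. (\<integral>\<^sup>+\<omega>. occ G {1..} \<omega> 0 \<partial>Q) + of_nat a \<partial>measure_pmf (return_pmf 0)) = ennreal \<rho>" using d by simp
  from ex_marginals[of "\<lambda>_. Q", OF Q this] obtain m where m: "(\<lambda>_. Q) \<in> competitors m (return_pmf 0)" "with_density \<rho> (m, return_pmf 0)" by blast
  have ma: "density_ma (return_pmf 0) = 0"
    unfolding density_ma_def by (intro infsum_0) (auto simp: pmf_return indicator_def split: if_splits)
  have "chi q G v \<rho> \<le> phi q G v m (return_pmf 0)"
    unfolding chi_def chi_mi_ma_def using m(2) ma by (intro INF_lower2[of "(m, return_pmf 0)"]) (auto simp: with_density_def)
  also have "\<dots> \<le> cost q G v (return_pmf 0) (\<lambda>_. Q)" unfolding phi_def by (rule INF_lower[OF m(1)])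
  also have "\<dots> = ecost q 0 Q"
    using m(1) by (subst cost_eq) (auto simp: competitors_iff shift_invariant_iff_cinv)
  finally show ?thesis .
qed

text \<open>Every level a is traded for cubes by \<open>tile_approx\<close> at the expense e.
  Afterwards all laws sit at level 0 and can be mixed into one, convexity of the entropy working in
  the right direction.\<close>

lemma chi_le_cost:
  assumes q: "\<And>k. k \<ge> 1 \<Longrightarrow> q k > 0" "(\<lambda>k. ln (q k)) \<in> o(\<lambda>k. real k)"
    and P: "\<And>a. cinv (marks UNIV) (P a)"
    and d: "(\<integral>\<^sup>+a. (\<integral>\<^sup>+\<omega>. occ G {1..} \<omega> 0 \<partial>P a) + of_nat a \<partial>measure_pmf \<psi>) = ennreal \<rho>"
  shows "chi q G v \<rho> \<le> (\<integral>\<^sup>+a. ecost q a (P a) \<partial>measure_pmf \<psi>)"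
proof (rule ennreal_le_epsilon)
  fix e :: real assume e: "e > 0"
  let ?d = "\<lambda>P. \<integral>\<^sup>+\<omega>. occ G {1..} \<omega> 0 \<partial>P"
  \<comment> \<open>For a law of infinite density the implication is void and \<open>P a\<close>
    itself serves; by \<open>d\<close> this occurs only on a null set of levels.\<close>
  have "\<exists>P'. cinv (marks UNIV) P' \<and> (?d (P a) < \<infinity> \<longrightarrow> ecost q 0 P' \<le> ecost q a (P a) + ennreal e \<and> ?d P' = ?d (P a) + of_nat a)" for a
    using tile_approx[OF P q _ e, of a a] P[of a] by (cases "?d (P a) < \<infinity>") auto
  then have "\<forall>a. \<exists>P'. cinv (marks UNIV) P' \<and> (?d (P a) < \<infinity> \<longrightarrow> ecost q 0 P' \<le> ecost q a (P a) + ennreal e \<and> ?d P' = ?d (P a) + of_nat a)" ..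
  from choice[OF this] obtain P' where P': "\<And>a. cinv (marks UNIV) (P' a)"
    "\<And>a. ?d (P a) < \<infinity> \<Longrightarrow> ecost q 0 (P' a) \<le> ecost q a (P a) + ennreal e \<and> ?d (P' a) = ?d (P a) + of_nat a" by blast
  have ae: "AE a in measure_pmf \<psi>. ?d (P a) < \<infinity>"
  proof -
    have "AE a in measure_pmf \<psi>. ?d (P a) + of_nat a \<noteq> \<infinity>" by (rule nn_integral_PInf_AE) (use d in auto)
    then show ?thesis by eventually_elim (auto simp: top.not_eq_extremum)
  qed
  define Q where "Q = mix \<psi> P'"
  have Qc: "cinv (marks UNIV) Q" unfolding Q_def by (rule mix_cinv[OF P'(1)])
  have om: "(\<lambda>\<omega>. occ G {1..} \<omega> i) \<in> borel_measurable (conf (marks UNIV))" for i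
    by (intro occ_measurable) auto
  have "?d Q = (\<integral>\<^sup>+a. ?d (P' a) \<partial>measure_pmf \<psi>)" unfolding Q_def by (rule nn_integral_mix[OF cinvD(1,2)[OF P'(1)] om])
  also have "\<dots> = (\<integral>\<^sup>+a. ?d (P a) + of_nat a \<partial>measure_pmf \<psi>)"
  proof (rule nn_integral_cong_AE)
    show "AE a in measure_pmf \<psi>. ?d (P' a) = ?d (P a) + of_nat a"
      using ae by eventually_elim (rule conjunct2[OF P'(2)])
  qed
  finally have dQ: "?d Q = ennreal \<rho>" unfolding d .
  have "ecost q 0 Q \<le> (\<integral>\<^sup>+a. dens q (P' a) \<partial>measure_pmf \<psi>) + (\<integral>\<^sup>+a. (\<integral>\<^sup>+\<omega>. inter v (\<lambda>i. occ G {1..} \<omega> i + of_nat 0) \<partial>P' a) \<partial>measure_pmf \<psi>)"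
    unfolding ecost_def Q_def
    by (intro add_mono dens_mix_le[OF cinvD(1,2)[OF P'(1)]] eq_refl nn_integral_mix[OF cinvD(1,2)[OF P'(1)]] inter_measurable)
       (use om in auto)
  also have "\<dots> = (\<integral>\<^sup>+a. ecost q 0 (P' a) \<partial>measure_pmf \<psi>)"
    unfolding ecost_def by (rule nn_integral_add[symmetric]) auto
  also have "\<dots> \<le> (\<integral>\<^sup>+a. ecost q a (P a) + ennreal e \<partial>measure_pmf \<psi>)"
  proof (rule nn_integral_mono_AE)
    show "AE a in measure_pmf \<psi>. ecost q 0 (P' a) \<le> ecost q a (P a) + ennreal e"
      using ae by eventually_elim (rule conjunct1[OF P'(2)])
  qed
  also have "\<dots> = (\<integral>\<^sup>+a. ecost q a (P a) \<partial>measure_pmf \<psi>) + ennreal e"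
    by (simp add: nn_integral_add)
  finally show "chi q G v \<rho> \<le> (\<integral>\<^sup>+a. ecost q a (P a) \<partial>measure_pmf \<psi>) + ennreal e"
    by (rule order.trans[OF chi_le_single[OF Qc dQ]])
qed

lemma chi_le_phi:
  assumes q: "\<And>k. k \<ge> 1 \<Longrightarrow> q k > 0" "(\<lambda>k. ln (q k)) \<in> o(\<lambda>k. real k)"
    and m: "with_density \<rho> (m, \<psi>)"
  shows "chi q G v \<rho> \<le> phi q G v m \<psi>"
  unfolding phi_def
proof (rule INF_greatest)
  fix P :: "nat \<Rightarrow> 'd config measure" assume P: "P \<in> competitors m \<psi>"
  then have Pc: "\<And>a. cinv (marks UNIV) (P a)" by (simp add: competitors_iff)
  have "cost q G v \<psi> P = (\<integral>\<^sup>+a. ecost q a (P a) \<partial>measure_pmf \<psi>)"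
    using Pc by (intro cost_eq) (simp add: shift_invariant_iff_cinv)
  moreover have "(\<integral>\<^sup>+a. (\<integral>\<^sup>+\<omega>. occ G {1..} \<omega> 0 \<partial>P a) + of_nat a \<partial>measure_pmf \<psi>) = ennreal \<rho>"
    using total_density[where P=P and \<psi>=\<psi> and m=m, OF Pc] P m by (simp add: competitors_iff with_density_def)
  ultimately show "chi q G v \<rho> \<le> cost q G v \<psi> P" using chi_le_cost[OF q Pc] by simp
qed

end

context interaction
begin

section \<open>Large marks look macroscopic\<close>

text \<open>Integer-valued version of \<open>occ\<close>, meant for finite A, so that the value can
  be stored in a coordinate of a configuration.\<close>

definition nocc :: "nat set \<Rightarrow> 'd config \<Rightarrow> int ^ 'd \<Rightarrow> nat" where
  "nocc A \<omega> x = (\<Sum>k\<in>A. \<Sum>y\<in>G k. \<omega> (k, x - y))"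

text \<open>A mark rooted at \<open>w - y\<close> covers w if y lies in \<open>G k\<close>, and
  covers \<open>w + x\<close> if \<open>x + y\<close> does. So this counts the marks that cover w
  but not \<open>w + x\<close>.\<close>

definition excess :: "nat set \<Rightarrow> 'd config \<Rightarrow> int ^ 'd \<Rightarrow> int ^ 'd \<Rightarrow> nat" where
  "excess A \<omega> w x = (\<Sum>k\<in>A. \<Sum>y\<in>{y \<in> G k. x + y \<notin> G k}. \<omega> (k, w - y))"

text \<open>The shell between the cubes of radius L + 1 and L - s, relative to the cube of radius L.
  Truncated subtraction is harmless as eventually s \<le> L.\<close>

lemma box_ratio_tendsto:
  "(\<lambda>L. (real ((2 * L + 3) ^ CARD('d)) - real ((2 * (L - s) + 1) ^ CARD('d))) / real ((2 * L + 1) ^ CARD('d))) \<longlonglongrightarrow> 0"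
proof -
  have inv: "(\<lambda>L. inverse (real (2 * L + 1))) \<longlonglongrightarrow> 0"
    by (intro filterlim_compose[OF tendsto_inverse_0_at_top] filterlim_compose[OF filterlim_real_sequentially])
       (auto intro!: filterlim_subseq strict_monoI)
  have "(\<lambda>L. (1 + 2 * inverse (real (2 * L + 1))) ^ CARD('d) - (1 - 2 * real s * inverse (real (2 * L + 1))) ^ CARD('d))
      \<longlonglongrightarrow> (1 + 2 * 0) ^ CARD('d) - (1 - 2 * real s * 0) ^ CARD('d)"
    by (intro tendsto_intros inv)
  then have lim: "(\<lambda>L. (1 + 2 * inverse (real (2 * L + 1))) ^ CARD('d) - (1 - 2 * real s * inverse (real (2 * L + 1))) ^ CARD('d)) \<longlonglongrightarrow> 0"
    by simp
  have "\<forall>\<^sub>F L in sequentially. (1 + 2 * inverse (real (2 * L + 1))) ^ CARD('d) - (1 - 2 * real s * inverse (real (2 * L + 1))) ^ CARD('d)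
      = (real ((2 * L + 3) ^ CARD('d)) - real ((2 * (L - s) + 1) ^ CARD('d))) / real ((2 * L + 1) ^ CARD('d))"
    using eventually_ge_at_top[of s]
  proof eventually_elim
    case (elim L)
    let ?c = "real (2 * L + 1)"
    have c: "?c > 0" by simp
    have "1 + 2 * inverse ?c = real (2 * L + 3) / ?c" using c by (simp add: field_simps)
    moreover have "1 - 2 * real s * inverse ?c = real (2 * (L - s) + 1) / ?c" using c elim by (simp add: field_simps of_nat_diff)
    ultimately show ?case by (simp only: power_divide of_nat_power diff_divide_distrib)
  qed
  with lim show ?thesis by (rule Lim_transform_eventually)
qed

text \<open>A site of \<open>G k\<close> that x moves out of \<open>G k\<close> cannot lie in
  \<open>box_Z (L - s)\<close>, since x would keep it inside \<open>box_Z L\<close>. Only the shell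
  of \<open>box_ratio_tendsto\<close> remains, and the inner box bounds k from below.\<close>

lemma boundary_small:
  assumes e: "(\<epsilon> :: real) > 0"
  shows "\<exists>K. \<forall>k\<ge>K. k \<ge> 1 \<longrightarrow> real (card {y \<in> G k. x + y \<notin> G k}) \<le> \<epsilon> * real k"
proof -
  define s where "s = Max ((\<lambda>i. nat \<bar>x $ i\<bar>) ` UNIV)"
  have s: "\<bar>x $ i\<bar> \<le> int s" for i
  proof -
    have "nat \<bar>x $ i\<bar> \<le> s" unfolding s_def by (intro Max_ge) auto
    then show ?thesis by simp
  qed
  have "\<forall>\<^sub>F L in sequentially. (real ((2 * L + 3) ^ CARD('d)) - real ((2 * (L - s) + 1) ^ CARD('d))) / real ((2 * L + 1) ^ CARD('d)) < \<epsilon>"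
    by (rule order_tendstoD(2)[OF box_ratio_tendsto e])
  then obtain L0 where L0: "\<And>L. L \<ge> L0 \<Longrightarrow> (real ((2 * L + 3) ^ CARD('d)) - real ((2 * (L - s) + 1) ^ CARD('d))) / real ((2 * L + 1) ^ CARD('d)) < \<epsilon>"
    by (auto simp: eventually_sequentially)
  \<comment> \<open>Any larger k, compared with \<open>k \<le> (2 * L + 3) ^ CARD('d)\<close>,
    forces L above both \<open>L0\<close> and s.\<close>
  define K where "K = (2 * (max L0 s) + 3) ^ CARD('d)"
  have "real (card {y \<in> G k. x + y \<notin> G k}) \<le> \<epsilon> * real k" if k: "k \<ge> K + 1" for k
  proof -
    have k1: "k \<ge> 1" using k by simp
    obtain L where L: "box_Z L \<subseteq> G k" "G k \<subseteq> box_Z (L + 1)" using G_box[OF k1] by blast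
    have cL: "card (box_Z (L + 1) :: (int ^ 'd) set) = (2 * L + 3) ^ CARD('d)"
    proof -
      have "2 * (L + 1) + 1 = 2 * L + 3" by simp
      then show ?thesis by (simp only: card_box_Z)
    qed
    have lower: "(2 * L + 1) ^ CARD('d) \<le> k" using card_mono[OF finite_G[OF k1] L(1)] by (simp only: card_box_Z G_card[OF k1])
    have "k \<le> (2 * L + 3) ^ CARD('d)" using card_mono[OF finite_box_Z L(2)] by (simp only: cL G_card[OF k1])
    then have "(2 * max L0 s + 3) ^ CARD('d) < (2 * L + 3) ^ CARD('d)" using k unfolding K_def by linarith
    then have "2 * max L0 s + 3 < 2 * L + 3" by (rule power_less_imp_less_base) simp
    then have Lge: "L0 \<le> L" "s \<le> L" by auto
    have sub: "{y \<in> G k. x + y \<notin> G k} \<subseteq> box_Z (L + 1) - box_Z (L - s)"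
    proof
      fix y assume y: "y \<in> {y \<in> G k. x + y \<notin> G k}"
      have "x + y \<in> box_Z L" if "y \<in> box_Z (L - s)"
        unfolding box_Z_def
      proof (clarsimp)
        fix i
        have "\<bar>y $ i\<bar> \<le> int (L - s)" using that by (simp add: box_Z_def)
        then show "\<bar>x $ i + y $ i\<bar> \<le> int L" using s[of i] Lge(2) by (simp add: of_nat_diff)
      qed
      then show "y \<in> box_Z (L + 1) - box_Z (L - s)" using y L by auto
    qed
    have sub2: "(box_Z (L - s) :: (int ^ 'd) set) \<subseteq> box_Z (L + 1)"
      by (auto simp: box_Z_def intro: order.trans)
    have "card {y \<in> G k. x + y \<notin> G k} \<le> card (box_Z (L + 1) - box_Z (L - s) :: (int ^ 'd) set)"
      using sub finite_box_Z by (intro card_mono) auto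
    also have "\<dots> = (2 * L + 3) ^ CARD('d) - (2 * (L - s) + 1) ^ CARD('d)"
      unfolding card_Diff_subset[OF finite_box_Z sub2] cL by (simp only: card_box_Z)
    finally have "real (card {y \<in> G k. x + y \<notin> G k}) \<le> real ((2 * L + 3) ^ CARD('d) - (2 * (L - s) + 1) ^ CARD('d))"
      by (simp only: of_nat_le_iff)
    also have "\<dots> = real ((2 * L + 3) ^ CARD('d)) - real ((2 * (L - s) + 1) ^ CARD('d))"
      using Lge by (intro of_nat_diff power_mono) auto
    also have "\<dots> \<le> \<epsilon> * real ((2 * L + 1) ^ CARD('d))"
      using L0[OF Lge(1)] by (simp add: pos_divide_less_eq less_imp_le)
    also have "\<dots> \<le> \<epsilon> * real k" using lower e by (intro mult_left_mono) (simp_all only: of_nat_le_iff less_imp_le)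
    finally show ?thesis .
  qed
  then show ?thesis by blast
qed

text \<open>A mark that covers w either covers \<open>w + x\<close> as well or is counted by
  \<open>excess\<close>.\<close>

lemma nocc_le_excess:
  assumes "A \<subseteq> {1..}"
  shows "nocc A \<omega> w \<le> nocc A \<omega> (w + x) + excess A \<omega> w x"
  unfolding nocc_def excess_def sum.distrib[symmetric]
proof (rule sum_mono)
  fix k assume "k \<in> A"
  then have f: "finite (G k)" using assms finite_G by auto
  let ?I = "{y \<in> G k. x + y \<in> G k}" and ?O = "{y \<in> G k. x + y \<notin> G k}"
  have "(\<Sum>y\<in>G k. \<omega> (k, w - y)) = (\<Sum>y\<in>?I \<union> ?O. \<omega> (k, w - y))" by (intro sum.cong) auto
  also have "\<dots> = (\<Sum>y\<in>?I. \<omega> (k, w - y)) + (\<Sum>y\<in>?O. \<omega> (k, w - y))" using f by (intro sum.union_disjoint) auto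
  also have "(\<Sum>y\<in>?I. \<omega> (k, w - y)) = (\<Sum>y\<in>(\<lambda>y. x + y) ` ?I. \<omega> (k, w + x - y))"
    by (subst sum.reindex) (auto simp: inj_on_def algebra_simps)
  also have "\<dots> \<le> (\<Sum>y\<in>G k. \<omega> (k, w + x - y))" using f by (intro sum_mono2) auto
  finally show "(\<Sum>y\<in>G k. \<omega> (k, w - y)) \<le> (\<Sum>y\<in>G k. \<omega> (k, w + x - y)) + (\<Sum>y\<in>?O. \<omega> (k, w - y))" by simp
qed

lemma coordinate_nn_measurable:
  assumes "cinv (marks UNIV) Q" "k \<ge> 1"
  shows "(\<lambda>\<omega>. of_nat (\<omega> (k, x)) :: ennreal) \<in> borel_measurable Q"
proof -
  have [measurable]: "(\<lambda>\<omega>. \<omega> (k, x)) \<in> measurable Q (count_space UNIV)"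
    using assms(2) by (intro measurable_coordinate[OF _ cinvD(2)[OF assms(1)]]) auto
  show ?thesis by measurable
qed

lemma nn_integral_nocc:
  assumes Q: "cinv (marks UNIV) Q" and A: "finite A" "A \<subseteq> {1..}"
  shows "(\<integral>\<^sup>+\<omega>. of_nat (nocc A \<omega> x) \<partial>Q) = (\<Sum>k\<in>A. of_nat k * (\<integral>\<^sup>+\<omega>. of_nat (\<omega> (k, 0)) \<partial>Q))"
  using nn_integral_occ[OF Q A(2), of x] A(1) by (simp add: occ_finite nocc_def nn_integral_count_space_finite)

text \<open>Among the k root positions for which a mark of size k covers w, at most
  \<open>\<epsilon> * k\<close> belong to its boundary, so the mean is at most
  \<open>\<epsilon>\<close> times that of the occupation by A.\<close>

lemma nn_integral_excess:
  assumes Q: "cinv (marks UNIV) Q" and A: "finite A" "A \<subseteq> {1..}"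
    and e: "\<And>k. k \<in> A \<Longrightarrow> real (card {y \<in> G k. x + y \<notin> G k}) \<le> \<epsilon> * real k" "0 \<le> \<epsilon>"
    and r: "(\<integral>\<^sup>+\<omega>. of_nat (nocc A \<omega> 0) \<partial>Q) \<le> ennreal r" "0 \<le> r"
  shows "(\<integral>\<^sup>+\<omega>. of_nat (excess A \<omega> w x) \<partial>Q) \<le> ennreal (\<epsilon> * r)"
proof -
  have k1: "k \<ge> 1" if "k \<in> A" for k using A(2) that by auto
  have "(\<integral>\<^sup>+\<omega>. of_nat (excess A \<omega> w x) \<partial>Q) = (\<Sum>k\<in>A. \<Sum>y\<in>{y \<in> G k. x + y \<notin> G k}. \<integral>\<^sup>+\<omega>. of_nat (\<omega> (k, w - y)) \<partial>Q)"
    unfolding excess_def of_nat_sum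
    by (subst nn_integral_sum, intro borel_measurable_sum coordinate_nn_measurable[OF Q k1], assumption,
        intro sum.cong refl nn_integral_sum coordinate_nn_measurable[OF Q k1])
  also have "\<dots> = (\<Sum>k\<in>A. \<Sum>y\<in>{y \<in> G k. x + y \<notin> G k}. \<integral>\<^sup>+\<omega>. of_nat (\<omega> (k, 0)) \<partial>Q)"
    using k1 by (intro sum.cong refl nn_integral_coordinate_shift[OF Q]) auto
  also have "\<dots> = (\<Sum>k\<in>A. of_nat (card {y \<in> G k. x + y \<notin> G k}) * (\<integral>\<^sup>+\<omega>. of_nat (\<omega> (k, 0)) \<partial>Q))" by simp
  also have "\<dots> \<le> (\<Sum>k\<in>A. ennreal \<epsilon> * (of_nat k * (\<integral>\<^sup>+\<omega>. of_nat (\<omega> (k, 0)) \<partial>Q)))"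
  proof (rule sum_mono)
    fix k assume k: "k \<in> A"
    have "of_nat (card {y \<in> G k. x + y \<notin> G k}) \<le> ennreal \<epsilon> * of_nat k"
      using e(1)[OF k] e(2) by (simp add: ennreal_of_nat_eq_real_of_nat ennreal_mult[symmetric] ennreal_leI)
    from mult_right_mono[OF this, of "\<integral>\<^sup>+\<omega>. of_nat (\<omega> (k, 0)) \<partial>Q"]
    show "of_nat (card {y \<in> G k. x + y \<notin> G k}) * (\<integral>\<^sup>+\<omega>. of_nat (\<omega> (k, 0)) \<partial>Q) \<le> ennreal \<epsilon> * (of_nat k * (\<integral>\<^sup>+\<omega>. of_nat (\<omega> (k, 0)) \<partial>Q))"
      by (simp add: mult.assoc)
  qed
  also have "\<dots> = ennreal \<epsilon> * (\<integral>\<^sup>+\<omega>. of_nat (nocc A \<omega> 0) \<partial>Q)"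
    unfolding nn_integral_nocc[OF Q A] by (simp add: sum_distrib_left)
  also have "\<dots> \<le> ennreal \<epsilon> * ennreal r" using r(1) by (rule mult_left_mono) simp
  finally show ?thesis using e(2) r(2) by (simp add: ennreal_mult)
qed

lemma depends_on_nocc: "A \<subseteq> {1..} \<Longrightarrow> depends_on (marks UNIV) (\<lambda>\<omega>. nocc A \<omega> x)"
  unfolding nocc_def by (rule depends_onI) (auto intro!: sum.cong)

lemma nocc_measurable:
  assumes Q: "cinv (marks UNIV) Q" and A: "A \<subseteq> {1..}"
  shows "(\<lambda>\<omega>. nocc A \<omega> x) \<in> measurable Q (count_space UNIV)"
proof -
  have "(\<lambda>\<omega>. real (nocc A \<omega> x)) \<in> borel_measurable Q"
    unfolding nocc_def of_nat_sum
  proof (intro borel_measurable_sum)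
    fix k y assume "k \<in> A"
    then have [measurable]: "(\<lambda>\<omega>. \<omega> (k, x - y)) \<in> measurable Q (count_space UNIV)"
      using A by (intro measurable_coordinate[OF _ cinvD(2)[OF Q]]) auto
    show "(\<lambda>\<omega>. real (\<omega> (k, x - y))) \<in> borel_measurable Q" by measurable
  qed
  then show ?thesis by (rule measurable_real_imp_nat)
qed

lemma nocc_tshift: "nocc A (tshift z \<omega>) x = nocc A \<omega> (x + z)"
  unfolding nocc_def tshift_def by (simp add: algebra_simps)

text \<open>The marks in \<open>A\<close> are read off into the macroscopic field, but also stay in the configuration:
  in the limit they leave every bounded range of mark sizes.\<close>

definition macro :: "nat set \<Rightarrow> 'd config measure \<Rightarrow> 'd config measure" where
  "macro A Q = distr Q (conf UNIV) (attach (nocc A))"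

context
  fixes Q :: "'d config measure" and A :: "nat set"
  assumes Q: "cinv (marks UNIV) Q" and A: "finite A" "A \<subseteq> {1..}"
begin

lemma macro_map: "attach (nocc A) \<in> measurable Q (conf UNIV)"
  by (rule attach_measurable[OF cinvD(2)[OF Q] nocc_measurable[OF Q A(2)]])

lemma macro_cinv: "cinv UNIV (macro A Q)"
  unfolding macro_def
  by (rule attach_cinv[OF Q nocc_measurable[OF Q A(2)] depends_on_nocc[OF A(2)] nocc_tshift])

lemma dens_macro: "dens q (macro A Q) = dens q Q"
  unfolding macro_def by (rule dens_cong(1), rule integral_attach[OF cinvD(2)[OF Q] nocc_measurable[OF Q A(2)]])

lemma nn_integral_macro:
  "f \<in> borel_measurable (conf UNIV) \<Longrightarrow> (\<integral>\<^sup>+\<omega>. f \<omega> \<partial>macro A Q) = (\<integral>\<^sup>+\<omega>. f (attach (nocc A) \<omega>) \<partial>Q)"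
  unfolding macro_def by (subst nn_integral_distr[OF macro_map]) simp_all

lemma macro_coordinate:
  shows "(\<integral>\<^sup>+\<omega>. of_nat (h (\<omega> (0, x)) (\<omega> (0, y))) \<partial>macro A Q) = (\<integral>\<^sup>+\<omega>. of_nat (h (nocc A \<omega> x) (nocc A \<omega> y)) \<partial>Q)"
proof -
  have "(\<lambda>\<omega>. of_nat (h (\<omega> (0, x)) (\<omega> (0, y))) :: ennreal) \<in> borel_measurable (conf UNIV)"
    by (intro measurable_depends_on[of "{(0, x), (0, y)}"] depends_onI) auto
  then show ?thesis by (subst nn_integral_macro) (auto simp: attach_def)
qed

lemma micro_coordinate:
  assumes "k \<ge> 1"
  shows "(\<integral>\<^sup>+\<omega>. of_nat (\<omega> (k, x)) \<partial>macro A Q) = (\<integral>\<^sup>+\<omega>. of_nat (\<omega> (k, x)) \<partial>Q)"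
proof -
  have "(\<lambda>\<omega>. of_nat (\<omega> (k, x)) :: ennreal) \<in> borel_measurable (conf UNIV)"
    by (intro measurable_depends_on[of "{(k, x)}"] depends_onI) auto
  then show ?thesis using assms by (subst nn_integral_macro) (auto simp: attach_def)
qed

text \<open>As A avoids the sizes up to K, the marks seen by \<open>field_to K\<close> and those
  copied into the macroscopic coordinates are disjoint families of marks of Q. No mark is counted
  twice.\<close>

lemma macro_cost_le:
  assumes K: "A \<inter> {1..K} = {}"
  shows "dens q (macro A Q) + (\<integral>\<^sup>+\<omega>. inter v (field_to K \<omega>) \<partial>macro A Q) \<le> ecost q 0 Q"
proof -
  have f: "field_to K (attach (nocc A) \<omega>) i \<le> occ G {1..} \<omega> i + of_nat 0" for \<omega> i
  proof -
    have "field_to K (attach (nocc A) \<omega>) i = occ G {1..K} \<omega> i + of_nat (nocc A \<omega> i)"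
      unfolding field_to_def by (subst occ_attach) (auto simp: attach_def)
    also have "\<dots> = occ G ({1..K} \<union> A) \<omega> i"
      using A(1) K by (simp add: occ_finite nocc_def sum.union_disjoint Int_commute)
    also have "\<dots> \<le> occ G {1..} \<omega> i" using A(2) by (intro occ_mono) auto
    finally show ?thesis by simp
  qed
  have "(\<integral>\<^sup>+\<omega>. inter v (field_to K \<omega>) \<partial>macro A Q) = (\<integral>\<^sup>+\<omega>. inter v (field_to K (attach (nocc A) \<omega>)) \<partial>Q)"
    by (rule nn_integral_macro[OF field_to_measurable[OF refl]])
  also have "\<dots> \<le> (\<integral>\<^sup>+\<omega>. inter v (\<lambda>i. occ G {1..} \<omega> i + of_nat 0) \<partial>Q)"
    by (intro nn_integral_mono inter_mono f)
  finally show ?thesis unfolding ecost_def dens_macro by (rule add_left_mono)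
qed

lemma macro_difference:
  assumes e: "\<And>k. k \<in> A \<Longrightarrow> real (card {y \<in> G k. x + y \<notin> G k}) \<le> \<epsilon> * real k" "0 \<le> \<epsilon>"
    and r: "(\<integral>\<^sup>+\<omega>. of_nat (nocc A \<omega> 0) \<partial>Q) \<le> ennreal r" "0 \<le> r"
  shows "(\<integral>\<^sup>+\<omega>. of_nat (\<omega> (0, w) - \<omega> (0, w + x)) \<partial>macro A Q) \<le> ennreal (\<epsilon> * r)"
proof -
  have "(\<integral>\<^sup>+\<omega>. of_nat (\<omega> (0, w) - \<omega> (0, w + x)) \<partial>macro A Q) = (\<integral>\<^sup>+\<omega>. of_nat (nocc A \<omega> w - nocc A \<omega> (w + x)) \<partial>Q)"
    by (rule macro_coordinate)
  also have "\<dots> \<le> (\<integral>\<^sup>+\<omega>. of_nat (excess A \<omega> w x) \<partial>Q)"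
    using nocc_le_excess[OF A(2)] by (intro nn_integral_mono) (simp add: le_diff_conv add.commute)
  also have "\<dots> \<le> ennreal (\<epsilon> * r)" by (rule nn_integral_excess[OF Q A e r])
  finally show ?thesis .
qed

end

lemma ex_macro_pmf:
  assumes P: "cinv UNIV (P :: 'd config measure)"
  obtains \<psi> where "\<And>a. pmf \<psi> a = measure P {\<omega>. \<omega> (0, 0) = a}"
proof -
  interpret prob_space P by (rule cinvD(1)[OF P])
  have sp: "space P = UNIV" using sets_eq_imp_space_eq[OF cinvD(2)[OF P]] by (simp add: space_PiM)
  have [measurable]: "(\<lambda>\<omega>. \<omega> (0, 0)) \<in> measurable P (count_space UNIV)"
    using cinvD(2)[OF P] by (intro measurable_coordinate) auto
  have m: "{\<omega>. \<omega> (0, 0) = a} \<in> sets P" for a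
  proof -
    have "{\<omega> \<in> space P. \<omega> (0, 0) = a} \<in> sets P" by measurable
    then show ?thesis by (simp add: sp)
  qed
  have "(\<integral>\<^sup>+a. ennreal (measure P {\<omega>. \<omega> (0, 0) = a}) \<partial>count_space UNIV) = (\<integral>\<^sup>+a. (\<integral>\<^sup>+\<omega>. indicator {\<omega>. \<omega> (0, 0) = a} \<omega> \<partial>P) \<partial>count_space UNIV)"
    using m by (intro nn_integral_cong) (simp add: emeasure_eq_measure)
  also have "\<dots> = (\<integral>\<^sup>+\<omega>. (\<integral>\<^sup>+a. indicator {\<omega>. \<omega> (0, 0) = a} \<omega> \<partial>count_space UNIV) \<partial>P)"
    using m by (intro nn_integral_count_space_nn_integral[symmetric]) auto
  also have "\<dots> = (\<integral>\<^sup>+\<omega>. 1 \<partial>P)"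
  proof (rule nn_integral_cong)
    fix \<omega> :: "'d config"
    have "(\<integral>\<^sup>+a. indicator {\<omega>. \<omega> (0, 0) = a} \<omega> \<partial>count_space UNIV) = (\<Sum>a\<in>{\<omega> (0, 0)}. indicator {\<omega>. \<omega> (0, 0) = a} \<omega> :: ennreal)"
      by (rule nn_integral_count_space') auto
    then show "(\<integral>\<^sup>+a. indicator {\<omega>. \<omega> (0, 0) = a} \<omega> \<partial>count_space UNIV) = (1 :: ennreal)" by simp
  qed
  also have "\<dots> = 1" by (simp add: emeasure_space_1)
  finally have "pmf (embed_pmf (\<lambda>a. measure P {\<omega>. \<omega> (0, 0) = a})) a = measure P {\<omega>. \<omega> (0, 0) = a}" for a
    by (intro pmf_embed_pmf) auto
  then show ?thesis by (rule that)
qed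

text \<open>Macroscopic density 0 makes level 0 almost sure, so \<open>chi\<close> is an infimum
  over single laws. Since \<open>phi\<close> is attained for each pair, only the error from the
  choice of the pair remains.\<close>

lemma chi_sequence:
  assumes q: "\<And>k. k \<ge> 1 \<Longrightarrow> q k > 0" and fin: "chi q G v \<rho> \<noteq> \<infinity>"
  obtains Q where "\<And>n :: nat. cinv (marks UNIV) (Q n)" "\<And>n. (\<integral>\<^sup>+\<omega>. occ G {1..} \<omega> 0 \<partial>Q n) = ennreal \<rho>"
    "\<And>n. ecost q 0 (Q n) \<le> chi q G v \<rho> + ennreal (1 / real (Suc n))"
proof -
  let ?S = "{(m, \<psi>). m \<in> {1..} \<rightarrow> {0..} \<and> density_mi m = ennreal \<rho> \<and> density_ma \<psi> = ennreal 0}"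
  let ?f = "\<lambda>(m, \<psi>). phi q G v m \<psi>"
  have c: "chi q G v \<rho> = (INF p\<in>?S. ?f p)" unfolding chi_def chi_mi_ma_def ..
  have "?S \<noteq> {}"
  proof
    assume e: "?S = {}"
    show False using fin unfolding c e by (simp add: infinity_ennreal_def)
  qed
  then obtain p where p: "\<And>n :: nat. p n \<in> ?S" "\<And>n. ?f (p n) \<le> (INF p\<in>?S. ?f p) + ennreal (1 / real (Suc n))"
    by (rule minimising_sequence[OF _ fin[unfolded c]]) (rule that)
  have "\<exists>Q. cinv (marks UNIV) Q \<and> (\<integral>\<^sup>+\<omega>. occ G {1..} \<omega> 0 \<partial>Q) = ennreal \<rho> \<and> ecost q 0 Q \<le> chi q G v \<rho> + ennreal (1 / real (Suc n))" for n
  proof -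
    obtain m \<psi> where mp: "p n = (m, \<psi>)" by (cases "p n")
    have S: "m \<in> {1..} \<rightarrow> {0..}" "density_mi m = ennreal \<rho>" "density_ma \<psi> = 0" using p(1)[of n] mp by auto
    obtain P :: "nat \<Rightarrow> 'd config measure" where P: "P \<in> competitors m \<psi>" "\<forall>P'\<in>competitors m \<psi>. cost q G v \<psi> P \<le> cost q G v \<psi> P'"
      using competitors_minimiser[of q m \<psi>, OF q S(1)] by blast
    have Pc: "\<And>a. cinv (marks UNIV) (P a)" using P(1) by (simp add: competitors_iff)
    have "cost q G v \<psi> P \<le> phi q G v m \<psi>" unfolding phi_def using P(2) by (intro INF_greatest) auto
    also have "\<dots> \<le> chi q G v \<rho> + ennreal (1 / real (Suc n))" using p(2)[of n] by (simp add: mp c)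
    finally have cost: "cost q G v \<psi> P \<le> chi q G v \<rho> + ennreal (1 / real (Suc n))" .
    have "(\<integral>\<^sup>+a. of_nat a \<partial>measure_pmf \<psi>) = 0"
      using S(3) unfolding density_ma_def nn_integral_pmf_countable by (simp add: mult.commute)
    then have ae: "AE a in measure_pmf \<psi>. a = 0" by (subst (asm) nn_integral_0_iff_AE) auto
    have "cost q G v \<psi> P = (\<integral>\<^sup>+a. ecost q a (P a) \<partial>measure_pmf \<psi>)"
      using Pc by (intro cost_eq) (simp add: shift_invariant_iff_cinv)
    also have "\<dots> = (\<integral>\<^sup>+a. ecost q 0 (P 0) \<partial>measure_pmf \<psi>)"
      using ae by (intro nn_integral_cong_AE) (auto elim!: eventually_mono)
    finally have c1: "cost q G v \<psi> P = ecost q 0 (P 0)" by simp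
    have "ennreal \<rho> = (\<integral>\<^sup>+a. (\<integral>\<^sup>+\<omega>. occ G {1..} \<omega> 0 \<partial>P a) + of_nat a \<partial>measure_pmf \<psi>)"
      using total_density[where P=P and m=m and \<psi>=\<psi>, OF Pc] P(1) S by (simp add: competitors_iff)
    also have "\<dots> = (\<integral>\<^sup>+a. (\<integral>\<^sup>+\<omega>. occ G {1..} \<omega> 0 \<partial>P 0) \<partial>measure_pmf \<psi>)"
      using ae by (intro nn_integral_cong_AE) (auto elim!: eventually_mono)
    finally have "(\<integral>\<^sup>+\<omega>. occ G {1..} \<omega> 0 \<partial>P 0) = ennreal \<rho>" by simp
    then show ?thesis using Pc cost c1 by auto
  qed
  then have "\<forall>n. \<exists>Q. cinv (marks UNIV) Q \<and> (\<integral>\<^sup>+\<omega>. occ G {1..} \<omega> 0 \<partial>Q) = ennreal \<rho> \<and> ecost q 0 Q \<le> chi q G v \<rho> + ennreal (1 / real (Suc n))" ..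
  from choice[OF this] obtain Q where Q: "\<forall>n. cinv (marks UNIV) (Q n) \<and> (\<integral>\<^sup>+\<omega>. occ G {1..} \<omega> 0 \<partial>Q n) = ennreal \<rho> \<and> ecost q 0 (Q n) \<le> chi q G v \<rho> + ennreal (1 / real (Suc n))" by blast
  show ?thesis by (rule that[of Q]) (use Q in auto)
qed

end

section \<open>Escape of mass to large marks\<close>

lemma ennreal_tendsto_0I:
  fixes f :: "'a \<Rightarrow> ennreal"
  assumes "\<And>e. e > 0 \<Longrightarrow> \<forall>\<^sub>F x in F. f x \<le> ennreal e"
  shows "(f \<longlongrightarrow> 0) F"
proof (rule order_tendstoI)
  fix a :: ennreal assume "0 < a"
  then obtain b where b: "0 < b" "b < a" using dense by blast
  then obtain e where e: "b = ennreal e" "0 < e" by (cases b) auto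
  from assms[OF e(2)] show "\<forall>\<^sub>F x in F. f x < a"
    by eventually_elim (use b(2) in \<open>simp add: e(1) le_less_trans\<close>)
qed simp

text \<open>At stage K a late row is chosen whose mass up to index K is close to that of the limit,
  and then a finite window beyond K that carries nearly all the rest of this row. The windows thus
  collect exactly the mass that l misses.\<close>

lemma mass_escape:
  fixes u :: "nat \<Rightarrow> nat \<Rightarrow> real"
  assumes u: "\<And>n k. 0 \<le> u n k" "\<And>n. u n sums \<rho>"
  obtains s l A where "\<And>K. K \<le> s K" "\<And>k. (\<lambda>K. u (s K) k) \<longlonglongrightarrow> l k" "\<And>k. 0 \<le> l k"
    "summable l" "suminf l \<le> \<rho>" "\<And>K. finite (A K)" "\<And>K. A K \<subseteq> {K<..}"
    "(\<lambda>K. sum (u (s K)) (A K)) \<longlonglongrightarrow> \<rho> - suminf l"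
proof -
  have le: "sum (u n) F \<le> \<rho>" if "finite F" for n F
    using sum_le_suminf[OF sums_summable[OF u(2)] that] u by (auto simp: sums_unique[OF u(2), symmetric])
  have r0: "0 \<le> \<rho>" using le[of "{}" 0] by simp
  \<comment> \<open>Scaling into [0, 1] for \<open>convergent_subseq_countable\<close>; the
    \<open>+ 1\<close> avoids a division by 0.\<close>
  define a where "a n k = u n k / (\<rho> + 1)" for n k
  have "a n k \<in> {0..1}" for n k
    using le[of "{k}" n] u(1)[of n k] r0 by (auto simp: a_def divide_le_eq)
  then obtain r l0 where r: "strict_mono (r :: nat \<Rightarrow> nat)" and l0: "\<And>k. (\<lambda>n. a (r n) k) \<longlonglongrightarrow> l0 k"
    using convergent_subseq_countable[of a] by metis
  define l where "l k = (\<rho> + 1) * l0 k" for k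
  have l: "(\<lambda>n. u (r n) k) \<longlonglongrightarrow> l k" for k
    using tendsto_mult[OF tendsto_const[of "\<rho> + 1"] l0[of k]] r0 by (simp add: a_def l_def)
  have lpos: "0 \<le> l k" for k using l by (rule LIMSEQ_le_const) (use u in auto)
  have S: "(\<lambda>n. sum (u (r n)) F) \<longlonglongrightarrow> sum l F" for F by (intro tendsto_sum l)
  have Sle: "sum l F \<le> \<rho>" if "finite F" for F using S by (rule LIMSEQ_le_const2) (use le[OF that] in auto)
  have sl: "summable l" by (rule summableI_nonneg_bounded[where x=\<rho>]) (use lpos Sle in auto)
  have ls: "suminf l \<le> \<rho>" using sl by (rule suminf_le_const) (use Sle in auto)
  have "\<exists>p. K \<le> fst p \<and> K \<le> snd p \<and> \<bar>sum (u (r (fst p))) {..K} - sum l {..K}\<bar> \<le> 1 / real (Suc K)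
      \<and> \<rho> - 1 / real (Suc K) \<le> sum (u (r (fst p))) {..snd p}" for K
  proof -
    have e: "0 < 1 / real (Suc K)" by simp
    have "\<forall>\<^sub>F n in sequentially. dist (sum (u (r n)) {..K}) (sum l {..K}) < 1 / real (Suc K) \<and> K \<le> n"
      by (intro eventually_conj tendstoD[OF S e] eventually_ge_at_top)
    then obtain n where n: "dist (sum (u (r n)) {..K}) (sum l {..K}) < 1 / real (Suc K)" "K \<le> n"
      using eventually_happens'[OF sequentially_bot] by blast
    have "(\<lambda>T. sum (u (r n)) {..T}) \<longlonglongrightarrow> \<rho>" using u(2) by (simp add: sums_def_le)
    then have "\<forall>\<^sub>F T in sequentially. dist (sum (u (r n)) {..T}) \<rho> < 1 / real (Suc K) \<and> K \<le> T"
      by (intro eventually_conj tendstoD[OF _ e] eventually_ge_at_top)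
    then obtain T where T: "dist (sum (u (r n)) {..T}) \<rho> < 1 / real (Suc K)" "K \<le> T"
      using eventually_happens'[OF sequentially_bot] by blast
    have "K \<le> fst (n, T) \<and> K \<le> snd (n, T) \<and> \<bar>sum (u (r (fst (n, T)))) {..K} - sum l {..K}\<bar> \<le> 1 / real (Suc K)
      \<and> \<rho> - 1 / real (Suc K) \<le> sum (u (r (fst (n, T)))) {..snd (n, T)}"
      using n T unfolding dist_real_def fst_conv snd_conv by linarith
    then show ?thesis by blast
  qed
  then have "\<forall>K. \<exists>p. K \<le> fst p \<and> K \<le> snd p \<and> \<bar>sum (u (r (fst p))) {..K} - sum l {..K}\<bar> \<le> 1 / real (Suc K)
      \<and> \<rho> - 1 / real (Suc K) \<le> sum (u (r (fst p))) {..snd p}" ..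
  from choice[OF this] obtain p where p: "\<And>K. K \<le> fst (p K)" "\<And>K. K \<le> snd (p K)"
    "\<And>K. \<bar>sum (u (r (fst (p K)))) {..K} - sum l {..K}\<bar> \<le> 1 / real (Suc K)"
    "\<And>K. \<rho> - 1 / real (Suc K) \<le> sum (u (r (fst (p K)))) {..snd (p K)}" by blast
  define s where "s K = r (fst (p K))" for K
  define A where "A K = {K<..snd (p K)}" for K
  have split: "sum (u (s K)) (A K) = sum (u (s K)) {..snd (p K)} - sum (u (s K)) {..K}" for K
  proof -
    have "{..snd (p K)} = {..K} \<union> A K" using p(2)[of K] by (auto simp: A_def)
    then have "sum (u (s K)) {..snd (p K)} = sum (u (s K)) {..K} + sum (u (s K)) (A K)"
      by (simp only:) (intro sum.union_disjoint; auto simp: A_def)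
    then show ?thesis by simp
  qed
  have inv: "(\<lambda>K. 1 / real (Suc K)) \<longlonglongrightarrow> 0" by (rule LIMSEQ_Suc[OF lim_const_over_n])
  have lim: "(\<lambda>K. sum l {..K}) \<longlonglongrightarrow> suminf l" using summable_sums[OF sl] by (simp add: sums_def_le)
  show ?thesis
  proof (rule that[of s l A])
    show "K \<le> s K" for K using p(1)[of K] seq_suble[OF r, of "fst (p K)"] by (simp add: s_def)
    have "filterlim (\<lambda>K. fst (p K)) at_top sequentially"
      by (rule filterlim_at_top_mono[OF filterlim_ident]) (use p(1) in auto)
    then show "(\<lambda>K. u (s K) k) \<longlonglongrightarrow> l k" for k unfolding s_def by (rule filterlim_compose[OF l])
    show "finite (A K)" "A K \<subseteq> {K<..}" for K by (auto simp: A_def)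
    show "(\<lambda>K. sum (u (s K)) (A K)) \<longlonglongrightarrow> \<rho> - suminf l"
    proof (rule tendsto_sandwich)
      show "\<forall>\<^sub>F K in sequentially. \<rho> - 1 / real (Suc K) - (sum l {..K} + 1 / real (Suc K)) \<le> sum (u (s K)) (A K)"
      proof (intro always_eventually allI)
        fix K show "\<rho> - 1 / real (Suc K) - (sum l {..K} + 1 / real (Suc K)) \<le> sum (u (s K)) (A K)"
          using p(3)[of K] p(4)[of K] unfolding split unfolding s_def by linarith
      qed
      show "\<forall>\<^sub>F K in sequentially. sum (u (s K)) (A K) \<le> \<rho> - (sum l {..K} - 1 / real (Suc K))"
      proof (intro always_eventually allI)
        fix K show "sum (u (s K)) (A K) \<le> \<rho> - (sum l {..K} - 1 / real (Suc K))"
          using p(3)[of K] le[of "{..snd (p K)}" "s K"] unfolding split unfolding s_def by simp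
      qed
      have "(\<lambda>K. \<rho> - 1 / real (Suc K) - (sum l {..K} + 1 / real (Suc K))) \<longlonglongrightarrow> \<rho> - 0 - (suminf l + 0)"
        by (intro tendsto_intros inv lim)
      then show "(\<lambda>K. \<rho> - 1 / real (Suc K) - (sum l {..K} + 1 / real (Suc K))) \<longlonglongrightarrow> \<rho> - suminf l" by simp
      have "(\<lambda>K. \<rho> - (sum l {..K} - 1 / real (Suc K))) \<longlonglongrightarrow> \<rho> - (suminf l - 0)"
        by (intro tendsto_intros inv lim)
      then show "(\<lambda>K. \<rho> - (sum l {..K} - 1 / real (Suc K))) \<longlonglongrightarrow> \<rho> - suminf l" by simp
    qed
  qed (use lpos sl ls in auto)
qed

section \<open>Limits of nearly constant macroscopic fields\<close>

context
  fixes \<mu> :: "nat \<Rightarrow> 'd::finite config measure" and \<nu> :: "'d config measure"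
  assumes mu: "\<And>n. cinv UNIV (\<mu> n)" and nu: "cinv UNIV \<nu>"
    and conv: "\<And>f. cyl UNIV f \<Longrightarrow> (\<lambda>n. \<integral>\<omega>. f \<omega> \<partial>\<mu> n) \<longlonglongrightarrow> (\<integral>\<omega>. f \<omega> \<partial>\<nu>)"
    and diff: "\<And>w x. (\<lambda>n. \<integral>\<^sup>+\<omega>. of_nat (\<omega> (0, w) - \<omega> (0, w + x)) \<partial>\<mu> n) \<longlonglongrightarrow> 0"
begin

text \<open>Truncated subtraction sees only one sign, so the probability that two values differ is
  bounded by the sum of both differences, from 0 to x and back.\<close>

lemma macro_constant_limit: "emeasure \<nu> {\<omega>. \<omega> (0, x) \<noteq> \<omega> (0, 0)} = 0"
proof -
  interpret nu: prob_space \<nu> by (rule cinvD(1)[OF nu])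
  have lim: "(\<lambda>n. measure (\<mu> n) {\<omega>. \<omega> (0, x) \<noteq> \<omega> (0, 0)}) \<longlonglongrightarrow> measure \<nu> {\<omega>. \<omega> (0, x) \<noteq> \<omega> (0, 0)}"
    by (rule cyl_limit_measure[where F="{(0, x), (0, 0)}", OF cinvD(1,2)[OF mu] cinvD(1,2)[OF nu] conv])
       (assumption, simp, rule depends_onI, simp)
  have le: "ennreal (measure (\<mu> n) {\<omega>. \<omega> (0, x) \<noteq> \<omega> (0, 0)}) \<le>
     (\<integral>\<^sup>+\<omega>. of_nat (\<omega> (0, 0) - \<omega> (0, 0 + x)) \<partial>\<mu> n) + (\<integral>\<^sup>+\<omega>. of_nat (\<omega> (0, x) - \<omega> (0, x + (- x))) \<partial>\<mu> n)" for n
  proof -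
    interpret prob_space "\<mu> n" by (rule cinvD(1)[OF mu])
    have sp: "space (\<mu> n) = UNIV" using sets_eq_imp_space_eq[OF cinvD(2)[OF mu]] by (simp add: space_PiM)
    have [measurable]: "(\<lambda>\<omega>. \<omega> i) \<in> measurable (\<mu> n) (count_space UNIV)" for i
      by (rule measurable_coordinate[OF UNIV_I cinvD(2)[OF mu]])
    have "{\<omega> \<in> space (\<mu> n). \<omega> (0, x) \<noteq> \<omega> (0, 0)} \<in> sets (\<mu> n)" by measurable
    then have s: "{\<omega>. \<omega> (0, x) \<noteq> \<omega> (0, 0)} \<in> sets (\<mu> n)" by (simp add: sp)
    have "ennreal (measure (\<mu> n) {\<omega>. \<omega> (0, x) \<noteq> \<omega> (0, 0)}) = (\<integral>\<^sup>+\<omega>. indicator {\<omega>. \<omega> (0, x) \<noteq> \<omega> (0, 0)} \<omega> \<partial>\<mu> n)"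
      using s by (simp add: emeasure_eq_measure)
    also have "\<dots> \<le> (\<integral>\<^sup>+\<omega>. of_nat (\<omega> (0, 0) - \<omega> (0, 0 + x)) + of_nat (\<omega> (0, x) - \<omega> (0, x + (- x))) \<partial>\<mu> n)"
    proof (rule nn_integral_mono)
      fix \<omega> :: "'d config"
      have "(of_bool (\<omega> (0, x) \<noteq> \<omega> (0, 0)) :: nat) \<le> (\<omega> (0, 0) - \<omega> (0, x)) + (\<omega> (0, x) - \<omega> (0, 0))" by auto
      then have "(of_nat (of_bool (\<omega> (0, x) \<noteq> \<omega> (0, 0))) :: ennreal) \<le> of_nat ((\<omega> (0, 0) - \<omega> (0, x)) + (\<omega> (0, x) - \<omega> (0, 0)))"
        by (simp only: of_nat_le_iff)
      then show "(indicator {\<omega>. \<omega> (0, x) \<noteq> \<omega> (0, 0)} \<omega> :: ennreal) \<le> of_nat (\<omega> (0, 0) - \<omega> (0, 0 + x)) + of_nat (\<omega> (0, x) - \<omega> (0, x + (- x)))"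
        by (simp add: indicator_def)
    qed
    also have "\<dots> = (\<integral>\<^sup>+\<omega>. of_nat (\<omega> (0, 0) - \<omega> (0, 0 + x)) \<partial>\<mu> n) + (\<integral>\<^sup>+\<omega>. of_nat (\<omega> (0, x) - \<omega> (0, x + (- x))) \<partial>\<mu> n)"
      by (rule nn_integral_add) measurable
    finally show ?thesis .
  qed
  have "ennreal (measure \<nu> {\<omega>. \<omega> (0, x) \<noteq> \<omega> (0, 0)}) \<le> 0 + 0"
    by (rule LIMSEQ_le[OF tendsto_ennrealI[OF lim] tendsto_add[OF diff[of 0 x] diff[of x "- x"]]]) (use le in blast)
  then show ?thesis by (simp add: nu.emeasure_eq_measure)
qed

text \<open>The interaction controls products of the field at 0 and at some displacement j, while
  \<open>v 0\<close> may vanish. Near-constancy, in the form of \<open>diff\<close>, makes up for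
  the missing second moment at a single site.\<close>

lemma macro_mean_limit:
  assumes mean: "\<And>n. (\<integral>\<^sup>+\<omega>. of_nat (\<omega> (0, 0)) \<partial>\<mu> n) = ennreal (m n)" "m \<longlonglongrightarrow> \<sigma>"
    and pair: "\<And>n. (\<integral>\<^sup>+\<omega>. of_nat (\<omega> (0, 0)) * of_nat (\<omega> (0, j)) \<partial>\<mu> n) \<le> ennreal C" "0 \<le> C"
  shows "(\<integral>\<^sup>+\<omega>. of_nat (\<omega> (0, 0)) \<partial>\<nu>) = ennreal \<sigma>"
proof -
  define g where "g M = (\<integral>\<omega>. real (min (\<omega> (0, 0)) M) \<partial>\<nu>)" for M
  have meas [measurable]: "(\<lambda>\<omega>. \<omega> i) \<in> measurable P (count_space UNIV)" if "cinv UNIV P" for P :: "'d config measure" and i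
    by (rule measurable_coordinate[OF UNIV_I cinvD(2)[OF that]])
  have lim: "(\<lambda>n. \<integral>\<^sup>+\<omega>. of_nat (min (\<omega> (0, 0)) M) \<partial>\<mu> n) \<longlonglongrightarrow> ennreal (g M)" for M
  proof -
    have "cyl UNIV (\<lambda>\<omega> :: 'd config. real (min (\<omega> (0, 0)) M))"
      by (rule cylI[where F="{(0, 0)}" and B="real M"]) (auto intro: depends_onI)
    from tendsto_ennrealI[OF conv[OF this]] show ?thesis
      unfolding g_def by (simp only: nn_integral_min_nat[OF cinvD(1)[OF mu] meas[OF mu]])
  qed
  have sup: "(\<integral>\<^sup>+\<omega>. of_nat (\<omega> (0, 0)) \<partial>\<nu>) = (SUP M. ennreal (g M))"
    unfolding g_def nn_integral_nat_SUP[OF meas[OF nu]] nn_integral_min_nat[OF cinvD(1)[OF nu] meas[OF nu]] ..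
  have mlim: "(\<lambda>n. \<integral>\<^sup>+\<omega>. of_nat (\<omega> (0, 0)) \<partial>\<mu> n) \<longlonglongrightarrow> ennreal \<sigma>"
    unfolding mean(1) by (rule tendsto_ennrealI[OF mean(2)])
  have up: "ennreal (g M) \<le> ennreal \<sigma>" for M
    by (rule LIMSEQ_le[OF lim[of M] mlim]) (auto intro!: exI[of _ 0] nn_integral_mono simp: of_nat_le_iff simp del: of_nat_min)
  have low: "ennreal \<sigma> \<le> ennreal (g M) + (ennreal (C / real M) + 0)" if M: "M \<ge> 1" for M
  proof (rule LIMSEQ_le[OF mlim tendsto_add[OF lim[of M] tendsto_add[OF tendsto_const diff[of 0 j]]]], intro exI[of _ 0] allI impI)
    fix n
    note [measurable] = meas[OF mu[of n]]
    have "(\<integral>\<^sup>+\<omega>. of_nat (\<omega> (0, 0)) \<partial>\<mu> n) \<le> (\<integral>\<^sup>+\<omega>. of_nat (min (\<omega> (0, 0)) M) + (ennreal (1 / real M) * (of_nat (\<omega> (0, 0)) * of_nat (\<omega> (0, j))) + of_nat (\<omega> (0, 0) - \<omega> (0, 0 + j))) \<partial>\<mu> n)"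
    proof (rule nn_integral_mono)
      fix \<omega> :: "'d config"
      define a b where "a = \<omega> (0, 0)" and "b = \<omega> (0, j)"
      \<comment> \<open>If a exceeds M, then either b is at least M and
        \<open>a \<le> a * b / M\<close>, or b is below M and \<open>a - b\<close> covers the part
        of a above M.\<close>
      have "real a \<le> real (min a M) + (1 / real M * (real a * real b) + real (a - b))"
      proof (cases "a \<le> M")
        case True
        then show ?thesis by simp
      next
        case aM: False
        show ?thesis
        proof (cases "b \<ge> M")
          case True
          then have "real a * real M \<le> real a * real b" by (intro mult_left_mono) auto
          then have "real a \<le> 1 / real M * (real a * real b)" using M by (simp add: pos_le_divide_eq)
          then show ?thesis using aM by simp
        next
          case False
          have "0 \<le> 1 / real M * (real a * real b)" by simp
          moreover have "real (a - b) = real a - real b" using aM False by (intro of_nat_diff) simp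
          moreover have "real (min a M) = real M" using aM by simp
          ultimately show ?thesis using False by linarith
        qed
      qed
      then have "ennreal (real a) \<le> ennreal (real (min a M) + (1 / real M * (real a * real b) + real (a - b)))" by (rule ennreal_leI)
      also have "\<dots> = ennreal (real (min a M)) + (ennreal (1 / real M) * (ennreal (real a) * ennreal (real b)) + ennreal (real (a - b)))"
        by (simp only: ennreal_plus ennreal_mult of_nat_0_le_iff zero_le_divide_1_iff mult_nonneg_nonneg add_nonneg_nonneg)
      finally show "of_nat (\<omega> (0, 0)) \<le> of_nat (min (\<omega> (0, 0)) M) + (ennreal (1 / real M) * (of_nat (\<omega> (0, 0)) * of_nat (\<omega> (0, j))) + (of_nat (\<omega> (0, 0) - \<omega> (0, 0 + j)) :: ennreal))"
        by (simp only: ennreal_of_nat_eq_real_of_nat a_def b_def add_0)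
    qed
    also have "\<dots> = (\<integral>\<^sup>+\<omega>. of_nat (min (\<omega> (0, 0)) M) \<partial>\<mu> n) + (ennreal (1 / real M) * (\<integral>\<^sup>+\<omega>. of_nat (\<omega> (0, 0)) * of_nat (\<omega> (0, j)) \<partial>\<mu> n) + (\<integral>\<^sup>+\<omega>. of_nat (\<omega> (0, 0) - \<omega> (0, 0 + j)) \<partial>\<mu> n))"
      by (subst nn_integral_add, measurable, subst nn_integral_add, measurable, subst nn_integral_cmult, measurable)
    also have "\<dots> \<le> (\<integral>\<^sup>+\<omega>. of_nat (min (\<omega> (0, 0)) M) \<partial>\<mu> n) + (ennreal (1 / real M) * ennreal C + (\<integral>\<^sup>+\<omega>. of_nat (\<omega> (0, 0) - \<omega> (0, 0 + j)) \<partial>\<mu> n))"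
      by (intro add_left_mono add_right_mono mult_left_mono pair) simp
    also have "ennreal (1 / real M) * ennreal C = ennreal (C / real M)"
      using pair(2) by (simp add: ennreal_mult[symmetric])
    finally show "(\<integral>\<^sup>+\<omega>. of_nat (\<omega> (0, 0)) \<partial>\<mu> n) \<le> (\<integral>\<^sup>+\<omega>. of_nat (min (\<omega> (0, 0)) M) \<partial>\<mu> n) + (ennreal (C / real M) + (\<integral>\<^sup>+\<omega>. of_nat (\<omega> (0, 0) - \<omega> (0, 0 + j)) \<partial>\<mu> n))" .
  qed
  show ?thesis
  proof (rule antisym)
    show "(\<integral>\<^sup>+\<omega>. of_nat (\<omega> (0, 0)) \<partial>\<nu>) \<le> ennreal \<sigma>" unfolding sup using up by (rule SUP_least)
    have "(\<lambda>M. (\<integral>\<^sup>+\<omega>. of_nat (\<omega> (0, 0)) \<partial>\<nu>) + ennreal (C / real M)) \<longlonglongrightarrow> (\<integral>\<^sup>+\<omega>. of_nat (\<omega> (0, 0)) \<partial>\<nu>) + ennreal 0"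
      by (intro tendsto_add tendsto_const tendsto_ennrealI lim_const_over_n)
    then have "(\<lambda>M. (\<integral>\<^sup>+\<omega>. of_nat (\<omega> (0, 0)) \<partial>\<nu>) + ennreal (C / real M)) \<longlonglongrightarrow> (\<integral>\<^sup>+\<omega>. of_nat (\<omega> (0, 0)) \<partial>\<nu>)" by simp
    then show "ennreal \<sigma> \<le> (\<integral>\<^sup>+\<omega>. of_nat (\<omega> (0, 0)) \<partial>\<nu>)"
    proof (rule LIMSEQ_le_const, intro exI[of _ 1] allI impI)
      fix M :: nat assume M: "1 \<le> M"
      have "ennreal (g M) \<le> (\<integral>\<^sup>+\<omega>. of_nat (\<omega> (0, 0)) \<partial>\<nu>)" unfolding sup by (rule SUP_upper) simp
      then show "ennreal \<sigma> \<le> (\<integral>\<^sup>+\<omega>. of_nat (\<omega> (0, 0)) \<partial>\<nu>) + ennreal (C / real M)"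
        using low[OF M] by (simp add: order.trans add_right_mono)
    qed
  qed
qed

end

lemma nn_integral_marks_sums:
  fixes f :: "nat \<Rightarrow> real"
  assumes f: "\<And>k. 0 \<le> f k" "f 0 = 0"
  shows "(\<integral>\<^sup>+k. ennreal (f k) \<partial>count_space {1..}) = (\<Sum>k. ennreal (f k))"
proof -
  have "(\<integral>\<^sup>+k. ennreal (f k) \<partial>count_space {1..}) = (\<integral>\<^sup>+k. ennreal (f k) \<partial>count_space UNIV)"
    using f(2) by (intro nn_integral_count_space_eq) (auto simp: not_less_eq_eq Suc_le_eq intro: gr0I)
  then show ?thesis by (simp add: nn_integral_count_space_nat)
qed

section \<open>The limit of a minimising sequence for \<open>chi\<close>\<close>

context interaction
begin

text \<open>\<open>\<sigma>\<close> is the density that the marks of the limit miss. Identifying it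
  with the mean of the macroscopic field takes an interaction: otherwise the field might lose mass
  in the limit once more.\<close>

lemma chi_limit:
  assumes q: "\<And>k. k \<ge> 1 \<Longrightarrow> q k > 0" and rho: "0 \<le> \<rho>" and fin: "chi q G v \<rho> \<noteq> \<infinity>"
  obtains \<nu> \<sigma> where "cinv UNIV \<nu>" "0 \<le> \<sigma>" "jcost q \<nu> \<le> chi q G v \<rho>"
    "\<And>x. emeasure \<nu> {\<omega>. \<omega> (0, x) \<noteq> \<omega> (0, 0)} = 0"
    "(\<integral>\<^sup>+k. of_nat k * (\<integral>\<^sup>+\<omega>. of_nat (\<omega> (k, 0)) \<partial>\<nu>) \<partial>count_space {1..}) + ennreal \<sigma> = ennreal \<rho>"
    "{u. v u \<noteq> 0} \<noteq> {} \<Longrightarrow> (\<integral>\<^sup>+\<omega>. of_nat (\<omega> (0, 0)) \<partial>\<nu>) = ennreal \<sigma>"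
proof -
  obtain Q where Q: "\<And>n :: nat. cinv (marks UNIV) (Q n)" and Qd: "\<And>n. (\<integral>\<^sup>+\<omega>. occ G {1..} \<omega> 0 \<partial>Q n) = ennreal \<rho>"
    and Qe: "\<And>n. ecost q 0 (Q n) \<le> chi q G v \<rho> + ennreal (1 / real (Suc n))"
    by (rule chi_sequence[OF q fin]) (assumption | rule that)+
  obtain c where c: "chi q G v \<rho> = ennreal c" "0 \<le> c" using fin by (cases "chi q G v \<rho>") auto
  have Qle: "ecost q 0 (Q n) \<le> ennreal (c + 1)" for n
  proof -
    have "ecost q 0 (Q n) \<le> ennreal c + ennreal 1"
      using Qe[of n] unfolding c(1) by (elim order.trans) (intro add_left_mono ennreal_leI; simp)
    then show ?thesis using c(2) by simp
  qed
  let ?M = "\<lambda>n k. \<integral>\<^sup>+\<omega>. of_nat (\<omega> (k, 0)) \<partial>Q n"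
  \<comment> \<open>The density carried by marks of size k, so that every row of u sums to
    \<open>\<rho>\<close>.\<close>
  define u where "u n k = real k * enn2real (?M n k)" for n k
  have tot: "(\<integral>\<^sup>+k. of_nat k * ?M n k \<partial>count_space {1..}) = ennreal \<rho>" for n
    using Qd[of n] nn_integral_occ[OF Q, of "{1..}"] by simp
  have M: "?M n k = ennreal (enn2real (?M n k))" if k: "k \<ge> 1" for n k
  proof -
    have "?M n k \<le> of_nat k * ?M n k"
      using mult_right_mono[of 1 "of_nat k" "?M n k"] k by simp
    also have "\<dots> = (\<Sum>k\<in>{k}. of_nat k * ?M n k)" by simp
    also have "\<dots> \<le> (\<integral>\<^sup>+k. of_nat k * ?M n k \<partial>count_space {1..})"
      unfolding nn_integral_count_space_eq_SUP[OF countableI_type] using k by (intro SUP_upper) auto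
    finally have "?M n k < top" unfolding tot by (simp add: le_less_trans)
    then show ?thesis by simp
  qed
  have uM: "of_nat k * ?M n k = ennreal (u n k)" if "k \<ge> 1" for n k
    unfolding u_def by (subst M[OF that]) (simp add: ennreal_of_nat_eq_real_of_nat ennreal_mult)
  have u0: "0 \<le> u n k" "u n 0 = 0" for n k by (auto simp: u_def)
  have us: "u n sums \<rho>" for n
  proof -
    have "(\<integral>\<^sup>+k. ennreal (u n k) \<partial>count_space {1..}) = (\<integral>\<^sup>+k. of_nat k * ?M n k \<partial>count_space {1..})"
      by (intro nn_integral_cong) (simp add: uM)
    then have s: "(\<Sum>k. ennreal (u n k)) = ennreal \<rho>" unfolding tot by (simp add: nn_integral_marks_sums u0)
    have sm: "summable (u n)" by (rule summable_suminf_not_top) (use u0 s in auto)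
    have "ennreal (suminf (u n)) = ennreal \<rho>" using suminf_ennreal[of "u n"] u0 s by simp
    then have "suminf (u n) = \<rho>" using rho suminf_nonneg[OF sm] u0 by simp
    then show ?thesis using summable_sums[OF sm] by simp
  qed
  obtain s l A where s: "\<And>K. K \<le> s K" and l: "\<And>k. (\<lambda>K. u (s K) k) \<longlonglongrightarrow> l k" "\<And>k. 0 \<le> l k"
    "summable l" "suminf l \<le> \<rho>" and A: "\<And>K. finite (A K)" "\<And>K. A K \<subseteq> {K<..}"
    and As: "(\<lambda>K. sum (u (s K)) (A K)) \<longlonglongrightarrow> \<rho> - suminf l"
    by (rule mass_escape[of u \<rho>, OF u0(1) us]) (rule that)
  have A1: "A K \<subseteq> {1..}" for K using A(2)[of K] by (auto simp: subset_eq)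
  have l0: "l 0 = 0" using l(1)[of 0] by (simp add: u0 LIMSEQ_const_iff)
  \<comment> \<open>The window of escaping sizes is copied into the macroscopic field. It lies
    beyond K, so the originals drop out of every fixed range of mark sizes.\<close>
  define \<mu> where "\<mu> K = macro (A K) (Q (s K))" for K
  have mu: "cinv UNIV (\<mu> K)" for K unfolding \<mu>_def by (rule macro_cinv[OF Q A(1) A1])
  have micro: "(\<integral>\<^sup>+\<omega>. of_nat (\<omega> (k, 0)) \<partial>\<mu> K) = ennreal (u (s K) k / real k)" if k: "k \<ge> 1" for k K
  proof -
    have "u (s K) k / real k = enn2real (?M (s K) k)" using k by (simp add: u_def)
    then show ?thesis unfolding \<mu>_def micro_coordinate[OF Q A(1) A1 k] using M[OF k] by simp
  qed
  have nocc: "(\<integral>\<^sup>+\<omega>. of_nat (nocc (A K) \<omega> 0) \<partial>Q (s K)) = ennreal (sum (u (s K)) (A K))" for K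
  proof -
    have "(\<integral>\<^sup>+\<omega>. of_nat (nocc (A K) \<omega> 0) \<partial>Q (s K)) = (\<Sum>k\<in>A K. ennreal (u (s K) k))"
      unfolding nn_integral_nocc[OF Q A(1) A1] using A1 by (intro sum.cong refl uM) auto
    then show ?thesis by (simp add: u0 sum_ennreal)
  qed
  have sumle: "sum (u (s K)) (A K) \<le> \<rho>" for K
    using sum_le_suminf[OF sums_summable[OF us] A(1)] u0 by (auto simp: sums_unique[OF us, symmetric])
  have mean: "(\<integral>\<^sup>+\<omega>. of_nat (\<omega> (0, 0)) \<partial>\<mu> K) = ennreal (sum (u (s K)) (A K))" for K
    unfolding \<mu>_def nocc[symmetric] by (rule macro_coordinate[OF Q A(1) A1, where h="\<lambda>a _. a" and x=0 and y=0])
  have cost: "dens q (\<mu> n) + (\<integral>\<^sup>+\<omega>. inter v (field_to K \<omega>) \<partial>\<mu> n) \<le> ecost q 0 (Q (s n))" if "K \<le> n" for K n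
  proof -
    have "A n \<inter> {1..K} = {}" using A(2)[of n] that by fastforce
    then show ?thesis unfolding \<mu>_def by (rule macro_cost_le[OF Q A(1) A1])
  qed
  have dle: "dens q (\<mu> n) \<le> ennreal (c + 1)" for n
    using order.trans[OF cost[OF order.refl] Qle, of n] by (elim order.trans[rotated]) simp
  have tight: "\<exists>M. \<forall>n. measure (\<mu> n) {\<omega>. \<omega> (0, 0) > M} \<le> e" if e: "e > 0" for e
  proof -
    obtain M where M: "\<rho> / e < real M" using reals_Archimedean2 by blast
    have "measure (\<mu> n) {\<omega>. \<omega> (0, 0) > M} \<le> e" for n
    proof -
      have sp: "space (\<mu> n) = UNIV" using sets_eq_imp_space_eq[OF cinvD(2)[OF mu]] by (simp add: space_PiM)
      have "measure (\<mu> n) {\<omega> \<in> space (\<mu> n). \<omega> (0, 0) > M} \<le> \<rho> / real (M + 1)"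
        by (rule measure_le_nn_mean[OF cinvD(1)[OF mu] measurable_coordinate[OF UNIV_I cinvD(2)[OF mu]] _ rho])
           (simp add: mean ennreal_leI sumle)
      also have "\<dots> \<le> e" using M e by (simp add: field_simps)
      finally show ?thesis by (simp add: sp)
    qed
    then show ?thesis by blast
  qed
  have diff: "(\<lambda>n. \<integral>\<^sup>+\<omega>. of_nat (\<omega> (0, w) - \<omega> (0, w + x)) \<partial>\<mu> n) \<longlonglongrightarrow> 0" for w x
  proof (rule ennreal_tendsto_0I)
    fix e :: real assume e: "e > 0"
    define \<epsilon> where "\<epsilon> = e / (\<rho> + 1)"
    have eps: "\<epsilon> > 0" "\<epsilon> * \<rho> \<le> e" using e rho by (auto simp: \<epsilon>_def field_simps)
    obtain K where K: "\<And>k. k \<ge> K \<Longrightarrow> k \<ge> 1 \<Longrightarrow> real (card {y \<in> G k. x + y \<notin> G k}) \<le> \<epsilon> * real k"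
      using boundary_small[OF eps(1), of x] by blast
    show "\<forall>\<^sub>F n in sequentially. (\<integral>\<^sup>+\<omega>. of_nat (\<omega> (0, w) - \<omega> (0, w + x)) \<partial>\<mu> n) \<le> ennreal e"
      using eventually_ge_at_top[of K]
    proof eventually_elim
      case (elim n)
      have "(\<integral>\<^sup>+\<omega>. of_nat (\<omega> (0, w) - \<omega> (0, w + x)) \<partial>\<mu> n) \<le> ennreal (\<epsilon> * \<rho>)"
        unfolding \<mu>_def
      proof (rule macro_difference[OF Q A(1) A1 _ less_imp_le[OF eps(1)] _ rho])
        fix k assume "k \<in> A n"
        then have "k > n" using A(2)[of n] by auto
        then show "real (card {y \<in> G k. x + y \<notin> G k}) \<le> \<epsilon> * real k" using elim by (intro K) auto
      qed (simp add: nocc ennreal_leI sumle)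
      also have "\<dots> \<le> ennreal e" using eps(2) by (rule ennreal_leI)
      finally show ?case .
    qed
  qed
  have mlim: "(\<lambda>n. u (s n) k / real k) \<longlonglongrightarrow> l k / real k" if "k \<ge> 1" for k
    using that by (intro tendsto_divide l tendsto_const) auto
  have mpos: "0 \<le> u (s n) k / real k" for n k using u0 by simp
  have c1: "0 \<le> c + 1" using c(2) by simp
  obtain r \<nu> where r: "strict_mono (r :: nat \<Rightarrow> nat)" and nu: "cinv UNIV \<nu>"
    and conv: "\<And>f. cyl UNIV f \<Longrightarrow> (\<lambda>n. \<integral>\<omega>. f \<omega> \<partial>\<mu> (r n)) \<longlonglongrightarrow> (\<integral>\<omega>. f \<omega> \<partial>\<nu>)"
    and nmean: "\<And>k. k \<ge> 1 \<Longrightarrow> (\<integral>\<^sup>+\<omega>. of_nat (\<omega> (k, 0)) \<partial>\<nu>) = ennreal (l k / real k)"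
    by (rule compact_limit[where \<mu>=\<mu> and q=q and m="\<lambda>n k. u (s n) k / real k" and m'="\<lambda>k. l k / real k" and C="c + 1",
          OF mu q micro mpos mlim dle c1 tight])
       (assumption | rule that)+
  define \<sigma> where "\<sigma> = \<rho> - suminf l"
  have mur: "cinv UNIV (\<mu> (r n))" for n by (rule mu)
  have diffr: "(\<lambda>n. \<integral>\<^sup>+\<omega>. of_nat (\<omega> (0, w) - \<omega> (0, w + x)) \<partial>\<mu> (r n)) \<longlonglongrightarrow> 0" for w x
    using LIMSEQ_subseq_LIMSEQ[OF diff r, of w x] by (simp add: o_def)
  show ?thesis
  proof (rule that[of \<nu> \<sigma>, OF nu])
    show "0 \<le> \<sigma>" using l(4) by (simp add: \<sigma>_def)
    show "jcost q \<nu> \<le> chi q G v \<rho>"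
    proof (rule jcost_limit[where \<mu>="\<lambda>n. \<mu> (r n)", OF cinvD(1,2)[OF mu] cinvD(1,2)[OF nu] conv])
      show "\<forall>\<^sub>F n in sequentially. dens q (\<mu> (r n)) + (\<integral>\<^sup>+\<omega>. inter v (field_to K \<omega>) \<partial>\<mu> (r n)) \<le> chi q G v \<rho> + ennreal (1 / real (Suc n))" for K
        using eventually_ge_at_top[of K]
      proof eventually_elim
        case (elim n)
        have rn: "n \<le> r n" "n \<le> s (r n)" using seq_suble[OF r, of n] s[of "r n"] by auto
        have "dens q (\<mu> (r n)) + (\<integral>\<^sup>+\<omega>. inter v (field_to K \<omega>) \<partial>\<mu> (r n)) \<le> chi q G v \<rho> + ennreal (1 / real (Suc (s (r n))))"
          using cost[of K "r n"] Qe[of "s (r n)"] elim rn by (auto intro: order.trans)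
        also have "\<dots> \<le> chi q G v \<rho> + ennreal (1 / real (Suc n))"
          using rn(2) by (intro add_left_mono ennreal_leI divide_left_mono) auto
        finally show ?case .
      qed
    qed (assumption, rule tendsto_add_inverse)
    show "emeasure \<nu> {\<omega>. \<omega> (0, x) \<noteq> \<omega> (0, 0)} = 0" for x
      by (rule macro_constant_limit[OF mur nu conv diffr])
    have "(\<integral>\<^sup>+k. of_nat k * (\<integral>\<^sup>+\<omega>. of_nat (\<omega> (k, 0)) \<partial>\<nu>) \<partial>count_space {1..}) = (\<integral>\<^sup>+k. ennreal (l k) \<partial>count_space {1..})"
    proof (rule nn_integral_cong)
      fix k :: nat assume "k \<in> space (count_space {1..})"
      then have k: "k \<ge> 1" by simp
      show "of_nat k * (\<integral>\<^sup>+\<omega>. of_nat (\<omega> (k, 0)) \<partial>\<nu>) = ennreal (l k)"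
        unfolding nmean[OF k] using k l(2)[of k] by (simp add: ennreal_of_nat_eq_real_of_nat ennreal_mult[symmetric])
    qed
    also have "\<dots> = ennreal (suminf l)"
      unfolding nn_integral_marks_sums[of l, OF l(2) l0] using l by (intro suminf_ennreal2) auto
    finally show "(\<integral>\<^sup>+k. of_nat k * (\<integral>\<^sup>+\<omega>. of_nat (\<omega> (k, 0)) \<partial>\<nu>) \<partial>count_space {1..}) + ennreal \<sigma> = ennreal \<rho>"
      using suminf_nonneg[OF l(3)] l(2,4) by (simp add: \<sigma>_def ennreal_plus[symmetric] del: ennreal_plus)
    show "(\<integral>\<^sup>+\<omega>. of_nat (\<omega> (0, 0)) \<partial>\<nu>) = ennreal \<sigma>" if ne: "{u. v u \<noteq> 0} \<noteq> {}"
    proof -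
      \<comment> \<open>Any interacting displacement will do: its term of the energy bounds the mean
        product of the field at 0 and j by \<open>(c + 1) / v j\<close>.\<close>
      obtain j where j: "v j \<noteq> 0" using ne by blast
      then have vj: "v j > 0" using v_nonneg[of j] by simp
      have pair: "(\<integral>\<^sup>+\<omega>. of_nat (\<omega> (0, 0)) * of_nat (\<omega> (0, j)) \<partial>\<mu> n) \<le> ennreal ((c + 1) / v j)" for n
      proof -
        have [measurable]: "(\<lambda>\<omega>. \<omega> i) \<in> measurable (\<mu> n) (count_space UNIV)" for i
          by (rule measurable_coordinate[OF UNIV_I cinvD(2)[OF mu]])
        have "ennreal (v j) * (\<integral>\<^sup>+\<omega>. of_nat (\<omega> (0, 0)) * of_nat (\<omega> (0, j)) \<partial>\<mu> n)
            = (\<integral>\<^sup>+\<omega>. ennreal (v j) * (of_nat (\<omega> (0, 0)) * of_nat (\<omega> (0, j))) \<partial>\<mu> n)"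
          by (rule nn_integral_cmult[symmetric]) measurable
        also have "\<dots> \<le> (\<integral>\<^sup>+\<omega>. inter v (field_to n \<omega>) \<partial>\<mu> n)"
        proof (rule nn_integral_mono)
          fix \<omega> :: "'d config"
          have "ennreal (v j) * (of_nat (\<omega> (0, 0)) * of_nat (\<omega> (0, j))) \<le> ennreal (v j) * (field_to n \<omega> 0 * field_to n \<omega> j)"
            unfolding field_to_def by (intro mult_left_mono mult_mono) (auto intro: add_increasing)
          also have "\<dots> \<le> inter v (field_to n \<omega>)"
            unfolding inter_def using j v_supp
            by (intro member_le_sum[where f="\<lambda>u. ennreal (v u) * (field_to n \<omega> 0 * field_to n \<omega> u)"]) auto
          finally show "ennreal (v j) * (of_nat (\<omega> (0, 0)) * of_nat (\<omega> (0, j))) \<le> inter v (field_to n \<omega>)" .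
        qed
        also have "\<dots> \<le> ennreal (c + 1)"
          using order.trans[OF cost[OF order.refl] Qle, of n] by (elim order.trans[rotated]) simp
        also have "\<dots> = ennreal (v j) * ennreal ((c + 1) / v j)"
          using vj c1 by (simp add: ennreal_mult[symmetric])
        finally show ?thesis using vj by (simp add: ennreal_mult_le_mult_iff)
      qed
      have limr: "(\<lambda>n. sum (u (s (r n))) (A (r n))) \<longlonglongrightarrow> \<sigma>"
        using LIMSEQ_subseq_LIMSEQ[OF As r] by (simp add: o_def \<sigma>_def)
      have C: "0 \<le> (c + 1) / v j" using vj c1 by simp
      show ?thesis by (rule macro_mean_limit[OF mur nu conv diffr mean limr pair C])
    qed
  qed
qed

lemma limit_minimiser:
  assumes q: "\<And>k. k \<ge> 1 \<Longrightarrow> q k > 0" and rho: "0 \<le> \<rho>" and fin: "chi q G v \<rho> \<noteq> \<infinity>"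
  obtains \<psi> P where "\<And>a. cinv (marks UNIV) (P a)"
    "(\<integral>\<^sup>+a. (\<integral>\<^sup>+\<omega>. occ G {1..} \<omega> 0 \<partial>P a) + of_nat a \<partial>measure_pmf \<psi>) = ennreal \<rho>"
    "(\<integral>\<^sup>+a. ecost q a (P a) \<partial>measure_pmf \<psi>) \<le> chi q G v \<rho>"
proof -
  obtain \<nu> \<sigma> where nu: "cinv UNIV \<nu>" and s: "0 \<le> \<sigma>" and j: "jcost q \<nu> \<le> chi q G v \<rho>"
    and const: "\<And>x. emeasure \<nu> {\<omega>. \<omega> (0, x) \<noteq> \<omega> (0, 0)} = 0"
    and tot: "(\<integral>\<^sup>+k. of_nat k * (\<integral>\<^sup>+\<omega>. of_nat (\<omega> (k, 0)) \<partial>\<nu>) \<partial>count_space {1..}) + ennreal \<sigma> = ennreal \<rho>"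
    and ma: "{u. v u \<noteq> 0} \<noteq> {} \<Longrightarrow> (\<integral>\<^sup>+\<omega>. of_nat (\<omega> (0, 0)) \<partial>\<nu>) = ennreal \<sigma>"
    by (rule chi_limit[OF q rho fin]) (assumption | rule that)+
  obtain \<psi> where psi: "\<And>a. pmf \<psi> a = measure \<nu> {\<omega>. \<omega> (0, 0) = a}" by (rule ex_macro_pmf[OF nu]) (rule that)
  interpret cm: constant_macro G v \<nu> \<psi> q by unfold_locales (fact nu const psi)+
  have om: "(\<lambda>\<omega>. occ G {1..} \<omega> i) \<in> borel_measurable (conf (marks UNIV))" for i
    by (intro occ_measurable) auto
  have mi: "(\<integral>\<^sup>+a. (\<integral>\<^sup>+\<omega>. occ G {1..} \<omega> 0 \<partial>cm.cond a) \<partial>measure_pmf \<psi>)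
      = (\<integral>\<^sup>+k. of_nat k * (\<integral>\<^sup>+\<omega>. of_nat (\<omega> (k, 0)) \<partial>\<nu>) \<partial>count_space {1..})"
  proof -
    have "(\<integral>\<^sup>+a. (\<integral>\<^sup>+\<omega>. occ G {1..} \<omega> 0 \<partial>cm.cond a) \<partial>measure_pmf \<psi>)
        = (\<integral>\<^sup>+a. (\<integral>\<^sup>+k. of_nat k * (\<integral>\<^sup>+\<omega>. of_nat (\<omega> (k, 0)) \<partial>cm.cond a) \<partial>count_space {1..}) \<partial>measure_pmf \<psi>)"
      by (intro nn_integral_cong nn_integral_occ[OF cm.cond_cinv]) simp
    also have "\<dots> = (\<integral>\<^sup>+k. (\<integral>\<^sup>+a. of_nat k * (\<integral>\<^sup>+\<omega>. of_nat (\<omega> (k, 0)) \<partial>cm.cond a) \<partial>measure_pmf \<psi>) \<partial>count_space {1..})"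
      by (rule nn_integral_count_space_nn_integral) auto
    also have "\<dots> = (\<integral>\<^sup>+k. of_nat k * (\<integral>\<^sup>+\<omega>. of_nat (\<omega> (k, 0)) \<partial>\<nu>) \<partial>count_space {1..})"
      by (intro nn_integral_cong) (simp add: nn_integral_cmult cm.cond_mean)
    finally show ?thesis .
  qed
  show ?thesis
  proof (cases "{u. v u \<noteq> 0} = {}")
    case False
    show ?thesis
    proof (rule that[of cm.cond \<psi>, OF cm.cond_cinv])
      show "(\<integral>\<^sup>+a. (\<integral>\<^sup>+\<omega>. occ G {1..} \<omega> 0 \<partial>cm.cond a) + of_nat a \<partial>measure_pmf \<psi>) = ennreal \<rho>"
        using tot by (simp add: nn_integral_add mi cm.macro_mean ma[OF False])
      show "(\<integral>\<^sup>+a. ecost q a (cm.cond a) \<partial>measure_pmf \<psi>) \<le> chi q G v \<rho>"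
        by (rule order.trans[OF cm.ecost_cond j])
    qed
  next
    case True
    \<comment> \<open>Without interaction a level costs nothing: any law of mean
      \<open>\<sigma>\<close> on the levels restores the missing density, with the same
      configuration law at each level.\<close>
    obtain \<psi>' :: "nat pmf" where p: "(\<integral>\<^sup>+n. of_nat n \<partial>measure_pmf \<psi>') = ennreal \<sigma>" by (rule ex_pmf_mean[OF s]) (rule that)
    define P where "P = mix \<psi> cm.cond"
    have P: "cinv (marks UNIV) P" unfolding P_def by (rule mix_cinv[OF cm.cond_cinv])
    show ?thesis
    proof (rule that[of "\<lambda>_. P" \<psi>', OF P])
      have "(\<integral>\<^sup>+\<omega>. occ G {1..} \<omega> 0 \<partial>P) + ennreal \<sigma> = ennreal \<rho>"
        unfolding P_def nn_integral_mix[OF cinvD(1,2)[OF cm.cond_cinv] om] mi tot ..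
      then show "(\<integral>\<^sup>+a. (\<integral>\<^sup>+\<omega>. occ G {1..} \<omega> 0 \<partial>P) + of_nat a \<partial>measure_pmf \<psi>') = ennreal \<rho>"
        by (simp add: nn_integral_add p)
      have "dens q P \<le> (\<integral>\<^sup>+a. dens q (cm.cond a) \<partial>measure_pmf \<psi>)"
        unfolding P_def by (rule dens_mix_le[OF cinvD(1,2)[OF cm.cond_cinv]]) simp
      also have "\<dots> \<le> jcost q \<nu>"
        unfolding jcost_def by (rule order.trans[OF cm.dens_cond]) simp
      finally have "dens q P \<le> chi q G v \<rho>" using j by (rule order.trans)
      then show "(\<integral>\<^sup>+a. ecost q a P \<partial>measure_pmf \<psi>') \<le> chi q G v \<rho>"
        using True by (simp add: ecost_def inter_def)
    qed
  qed
qed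

end

section \<open>Two atoms suffice\<close>

text \<open>If no segment between two points \<open>(X a, Y a)\<close>, \<open>(X b, Y b)\<close> meets \<open>{0} \<times> {..0}\<close>, then all these
  points lie above a line through the origin, and not all of them on it.\<close>

lemma two_point_mean:
  fixes X Y :: "'a \<Rightarrow> real" and \<psi> :: "'a pmf"
  assumes X: "integrable (measure_pmf \<psi>) X" "(\<integral>a. X a \<partial>measure_pmf \<psi>) = 0"
    and Y: "integrable (measure_pmf \<psi>) Y" "(\<integral>a. Y a \<partial>measure_pmf \<psi>) \<le> 0"
  shows "\<exists>a\<in>set_pmf \<psi>. \<exists>b\<in>set_pmf \<psi>. \<exists>t. 0 \<le> t \<and> t \<le> 1 \<and> (1 - t) * X a + t * X b = 0 \<and> (1 - t) * Y a + t * Y b \<le> 0"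
proof (rule ccontr)
  assume H: "\<not> ?thesis"
  let ?S = "set_pmf \<psi>"
  have H0: "Y a > 0" if a: "a \<in> ?S" "X a = 0" for a
  proof (rule ccontr)
    assume "\<not> Y a > 0"
    then have "0 \<le> (0 :: real) \<and> (0 :: real) \<le> 1 \<and> (1 - 0) * X a + 0 * X a = 0 \<and> (1 - 0) * Y a + 0 * Y a \<le> 0" using a by simp
    then show False using H a(1) by blast
  qed
  have H1: "Y a / X a < Y b / X b" if a: "a \<in> ?S" "X a < 0" and b: "b \<in> ?S" "X b > 0" for a b
  proof (rule ccontr)
    assume "\<not> Y a / X a < Y b / X b"
    then have le: "Y b * X a \<ge> Y a * X b" using a b by (simp add: not_less field_simps)
    \<comment> \<open>The weight at which the segment between the two points crosses the axis X =
      0.\<close>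
    define t where "t = - X a / (X b - X a)"
    have d: "X b - X a > 0" using a b by simp
    have t1: "1 - t = X b / (X b - X a)" using d by (simp add: t_def field_simps)
    have "(1 - t) * X a + t * X b = 0" unfolding t1 unfolding t_def by simp
    moreover have "(1 - t) * Y a + t * Y b = (Y a * X b - Y b * X a) / (X b - X a)"
      unfolding t1 unfolding t_def by (simp add: diff_divide_distrib mult.commute)
    then have "(1 - t) * Y a + t * Y b \<le> 0" using le d by (simp add: divide_le_0_iff)
    moreover have "0 \<le> t" "t \<le> 1" using a b d by (auto simp: t_def divide_le_0_iff le_divide_eq)
    ultimately show False using H a b by blast
  qed
  have zero: "(\<integral>a. Z a \<partial>measure_pmf \<psi>) > 0" if "integrable (measure_pmf \<psi>) Z" "\<And>a. a \<in> ?S \<Longrightarrow> Z a \<ge> 0" "b \<in> ?S" "Z b \<noteq> 0" for Z :: "'a \<Rightarrow> real" and b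
  proof -
    have ae: "AE a in measure_pmf \<psi>. 0 \<le> Z a" using that(2) by (simp add: AE_measure_pmf_iff)
    have "\<not> (AE a in measure_pmf \<psi>. Z a = 0)" using that(3,4) by (auto simp: AE_measure_pmf_iff)
    then have "(\<integral>a. Z a \<partial>measure_pmf \<psi>) \<noteq> 0" using integral_nonneg_eq_0_iff_AE[OF that(1) ae] by simp
    then show ?thesis using integral_nonneg_AE[OF ae] by linarith
  qed
  \<comment> \<open>Without a negative value, mean 0 makes X' vanish on the support, and
    \<open>H0\<close> makes Y positive there. The general X' covers both X and
    \<open>- X\<close>.\<close>
  have ex: "\<exists>a\<in>?S. X' a < 0" if "integrable (measure_pmf \<psi>) X'" "(\<integral>a. X' a \<partial>measure_pmf \<psi>) = 0" "\<And>a. a \<in> ?S \<Longrightarrow> X' a = 0 \<Longrightarrow> X a = 0" for X' :: "'a \<Rightarrow> real"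
  proof (rule ccontr)
    assume "\<not> (\<exists>a\<in>?S. X' a < 0)"
    then have nn: "\<And>a. a \<in> ?S \<Longrightarrow> 0 \<le> X' a" by force
    then have "X' a = 0" if "a \<in> ?S" for a using zero[of X' a] \<open>integrable _ X'\<close> \<open>integral\<^sup>L _ X' = 0\<close> that by fastforce
    then have p: "\<And>a. a \<in> ?S \<Longrightarrow> Y a > 0" using H0 that(3) by blast
    obtain b where b: "b \<in> ?S" using set_pmf_not_empty[of \<psi>] by blast
    have "(\<integral>a. Y a \<partial>measure_pmf \<psi>) > 0" using p p[OF b] by (intro zero[OF Y(1) _ b]) (auto intro: less_imp_le)
    then show False using Y(2) by simp
  qed
  obtain a where a: "a \<in> ?S" "X a < 0" using ex[of X] X by auto
  obtain b where b: "b \<in> ?S" "X b > 0" using ex[of "\<lambda>a. - X a"] X by auto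
  \<comment> \<open>Slope of the supporting line: by \<open>H1\<close> the quotients on the left of
    the axis lie below those on the right, and this supremum separates them.\<close>
  define s where "s = (SUP a\<in>{a \<in> ?S. X a < 0}. Y a / X a)"
  have bdd: "bdd_above ((\<lambda>a. Y a / X a) ` {a \<in> ?S. X a < 0})"
    by (rule bdd_aboveI2[where M="Y b / X b"]) (use H1[OF _ _ b] in \<open>auto intro: less_imp_le\<close>)
  have lo: "Y c / X c \<le> s" if "c \<in> ?S" "X c < 0" for c
    unfolding s_def using that by (intro cSUP_upper bdd) auto
  have hi: "s \<le> Y c / X c" if "c \<in> ?S" "X c > 0" for c
    unfolding s_def using a H1[OF _ _ that] by (intro cSUP_least) (auto intro: less_imp_le)
  have Z: "Y c - s * X c \<ge> 0" if c: "c \<in> ?S" for c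
  proof -
    consider "X c = 0" | "X c < 0" | "X c > 0" by linarith
    then show ?thesis
    proof cases
      case 1 then show ?thesis using H0[OF c] by simp
    next
      case 2 then show ?thesis using lo[OF c 2] by (simp add: divide_le_eq)
    next
      case 3 then show ?thesis using hi[OF c 3] by (simp add: le_divide_eq)
    qed
  qed
  \<comment> \<open>The strict inequality in \<open>H1\<close> keeps a and b from both lying on the
    line, so the mean of \<open>Y - s * X\<close> is strictly positive, against the
    hypotheses.\<close>
  have "Y a - s * X a \<noteq> 0 \<or> Y b - s * X b \<noteq> 0"
    using H1[OF a b] a(2) b(2) by (auto simp: field_simps)
  then obtain c where c: "c \<in> ?S" "Y c - s * X c \<noteq> 0" using a(1) b(1) by blast
  have "(\<integral>a. Y a - s * X a \<partial>measure_pmf \<psi>) > 0" using X Y Z c by (intro zero[of _ c]) auto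
  then show False using X Y by simp
qed

text \<open>Both integrals are linear in the weights. \<open>two_point_mean\<close>, applied to the
  deviations of r from \<open>\<rho>\<close> and of e from c, selects the two atoms, and a Bernoulli
  variable mixes them.\<close>

lemma ex_two_atom_pmf:
  fixes r e :: "'a \<Rightarrow> ennreal"
  assumes r: "(\<integral>\<^sup>+a. r a \<partial>measure_pmf \<psi>) = ennreal \<rho>" "0 \<le> \<rho>"
    and e: "(\<integral>\<^sup>+a. e a \<partial>measure_pmf \<psi>) \<le> ennreal c" "0 \<le> c"
  obtains \<psi>' where "finite (set_pmf \<psi>')" "card (set_pmf \<psi>') \<le> 2"
    "(\<integral>\<^sup>+a. r a \<partial>measure_pmf \<psi>') = ennreal \<rho>" "(\<integral>\<^sup>+a. e a \<partial>measure_pmf \<psi>') \<le> ennreal c"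
proof -
  have real: "\<exists>x \<ge> 0. (\<integral>\<^sup>+a. f a \<partial>measure_pmf \<psi>) = ennreal x \<and> (\<forall>a\<in>set_pmf \<psi>. f a = ennreal (enn2real (f a))) \<and>
      integrable (measure_pmf \<psi>) (\<lambda>a. enn2real (f a)) \<and> (\<integral>a. enn2real (f a) \<partial>measure_pmf \<psi>) = x"
    if fin: "(\<integral>\<^sup>+a. f a \<partial>measure_pmf \<psi>) \<noteq> \<infinity>" for f :: "'a \<Rightarrow> ennreal"
  proof -
    obtain x where x: "(\<integral>\<^sup>+a. f a \<partial>measure_pmf \<psi>) = ennreal x" "0 \<le> x"
      using fin by (cases "\<integral>\<^sup>+a. f a \<partial>measure_pmf \<psi>") auto
    have "AE a in measure_pmf \<psi>. f a \<noteq> \<infinity>" by (rule nn_integral_PInf_AE) (use fin in auto)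
    then have f: "f a = ennreal (enn2real (f a))" if "a \<in> set_pmf \<psi>" for a
      using that by (auto simp: AE_measure_pmf_iff less_top)
    have "(\<integral>\<^sup>+a. ennreal (enn2real (f a)) \<partial>measure_pmf \<psi>) = (\<integral>\<^sup>+a. f a \<partial>measure_pmf \<psi>)"
      by (rule nn_integral_cong_AE) (use f in \<open>simp add: AE_measure_pmf_iff\<close>)
    then have "has_bochner_integral (measure_pmf \<psi>) (\<lambda>a. enn2real (f a)) x"
      using x by (intro has_bochner_integral_nn_integral) auto
    then show ?thesis using x f by (auto simp: has_bochner_integral_iff)
  qed
  have rf: "(\<integral>\<^sup>+a. r a \<partial>measure_pmf \<psi>) \<noteq> \<infinity>" using r by simp
  have ef: "(\<integral>\<^sup>+a. e a \<partial>measure_pmf \<psi>) \<noteq> \<infinity>" using e by (auto simp: top_unique)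
  from real[OF rf] obtain x where x: "x \<ge> 0" "(\<integral>\<^sup>+a. r a \<partial>measure_pmf \<psi>) = ennreal x"
    "\<And>a. a \<in> set_pmf \<psi> \<Longrightarrow> r a = ennreal (enn2real (r a))" "integrable (measure_pmf \<psi>) (\<lambda>a. enn2real (r a))"
    "(\<integral>a. enn2real (r a) \<partial>measure_pmf \<psi>) = x" by blast
  from real[OF ef] obtain y where y: "y \<ge> 0" "(\<integral>\<^sup>+a. e a \<partial>measure_pmf \<psi>) = ennreal y"
    "\<And>a. a \<in> set_pmf \<psi> \<Longrightarrow> e a = ennreal (enn2real (e a))" "integrable (measure_pmf \<psi>) (\<lambda>a. enn2real (e a))"
    "(\<integral>a. enn2real (e a) \<partial>measure_pmf \<psi>) = y" by blast
  have xr: "x = \<rho>" using x r by simp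
  have yc: "y \<le> c" using y e by simp
  have "\<exists>a\<in>set_pmf \<psi>. \<exists>b\<in>set_pmf \<psi>. \<exists>t. 0 \<le> t \<and> t \<le> 1 \<and>
      (1 - t) * (enn2real (r a) - \<rho>) + t * (enn2real (r b) - \<rho>) = 0 \<and>
      (1 - t) * (enn2real (e a) - c) + t * (enn2real (e b) - c) \<le> 0"
    by (rule two_point_mean) (use x y xr yc in auto)
  then obtain a b t where ab: "a \<in> set_pmf \<psi>" "b \<in> set_pmf \<psi>" and t: "0 \<le> t" "t \<le> 1"
    and R: "(1 - t) * (enn2real (r a) - \<rho>) + t * (enn2real (r b) - \<rho>) = 0"
    and E: "(1 - t) * (enn2real (e a) - c) + t * (enn2real (e b) - c) \<le> 0" by blast
  define \<psi>' where "\<psi>' = map_pmf (\<lambda>z. if z then b else a) (bernoulli_pmf t)"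
  have sub: "set_pmf \<psi>' \<subseteq> {a, b}" by (auto simp: \<psi>'_def)
  have int: "(\<integral>\<^sup>+z. f z \<partial>measure_pmf \<psi>') = ennreal ((1 - t) * enn2real (f a) + t * enn2real (f b))"
    if "f a = ennreal (enn2real (f a))" "f b = ennreal (enn2real (f b))" for f
  proof -
    have "(\<integral>\<^sup>+z. f z \<partial>measure_pmf \<psi>') = ennreal t * f b + ennreal (1 - t) * f a"
      unfolding \<psi>'_def nn_integral_map_pmf using t by (simp add: nn_integral_measure_pmf nn_integral_count_space_finite UNIV_bool)
    also have "\<dots> = ennreal t * ennreal (enn2real (f b)) + ennreal (1 - t) * ennreal (enn2real (f a))"
      using that by simp
    finally show ?thesis using t by (simp add: ennreal_mult[symmetric] ennreal_plus[symmetric] add.commute del: ennreal_plus)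
  qed
  show ?thesis
  proof (rule that[of \<psi>'])
    show "finite (set_pmf \<psi>')" using sub by (rule finite_subset) simp
    have "card (set_pmf \<psi>') \<le> card {a, b}" using sub by (intro card_mono) auto
    also have "\<dots> \<le> 2" by (cases "a = b") simp_all
    finally show "card (set_pmf \<psi>') \<le> 2" .
    have "(1 - t) * enn2real (r a) + t * enn2real (r b) = \<rho>" using R by (simp add: algebra_simps)
    then show "(\<integral>\<^sup>+a. r a \<partial>measure_pmf \<psi>') = ennreal \<rho>" by (simp add: int[OF x(3)[OF ab(1)] x(3)[OF ab(2)]])
    have "(1 - t) * enn2real (e a) + t * enn2real (e b) \<le> c" using E by (simp add: algebra_simps)
    then show "(\<integral>\<^sup>+a. e a \<partial>measure_pmf \<psi>') \<le> ennreal c" by (simp add: int[OF y(3)[OF ab(1)] y(3)[OF ab(2)]] ennreal_leI)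
  qed
qed

context interaction
begin

lemma ex_two_atom_minimiser:
  assumes q: "\<And>k. k \<ge> 1 \<Longrightarrow> q k > 0" and rho: "0 \<le> \<rho>"
  obtains m \<psi> where "with_density \<rho> (m, \<psi>)" "phi q G v m \<psi> \<le> chi q G v \<rho>" "finite (set_pmf \<psi>)" "card (set_pmf \<psi>) \<le> 2"
proof (cases "chi q G v \<rho> = \<infinity>")
  case True
  \<comment> \<open>If \<open>chi\<close> is infinite the bound on \<open>phi\<close> is void and
    any pair of density \<open>\<rho>\<close> serves; here all mass is put on marks of size
    1.\<close>
  define m :: "nat \<Rightarrow> real" where "m k = (if k = 1 then \<rho> else 0)" for k
  have "density_mi m = infsum (\<lambda>k. of_nat k * ennreal (m k)) {1}"
    unfolding density_mi_def by (rule infsum_cong_neutral) (auto simp: m_def)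
  then have mi: "density_mi m = ennreal \<rho>" by (simp add: m_def)
  have ma: "density_ma (return_pmf 0) = 0"
    unfolding density_ma_def by (intro infsum_0) (auto simp: pmf_return indicator_def split: if_splits)
  have "with_density \<rho> (m, return_pmf 0)"
    using rho by (simp add: with_density_def mi ma Pi_def) (simp add: m_def)
  then show ?thesis by (rule that) (use True in auto)
next
  case False
  obtain c where c: "chi q G v \<rho> = ennreal c" "0 \<le> c" using False by (cases "chi q G v \<rho>") auto
  obtain \<psi>0 P where P: "\<And>a. cinv (marks UNIV) (P a)"
    and d: "(\<integral>\<^sup>+a. (\<integral>\<^sup>+\<omega>. occ G {1..} \<omega> 0 \<partial>P a) + of_nat a \<partial>measure_pmf \<psi>0) = ennreal \<rho>"
    and e: "(\<integral>\<^sup>+a. ecost q a (P a) \<partial>measure_pmf \<psi>0) \<le> chi q G v \<rho>"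
    by (rule limit_minimiser[OF q rho False]) (assumption | rule that)+
  obtain \<psi> where f: "finite (set_pmf \<psi>)" "card (set_pmf \<psi>) \<le> 2"
    and d': "(\<integral>\<^sup>+a. (\<integral>\<^sup>+\<omega>. occ G {1..} \<omega> 0 \<partial>P a) + of_nat a \<partial>measure_pmf \<psi>) = ennreal \<rho>"
    and e': "(\<integral>\<^sup>+a. ecost q a (P a) \<partial>measure_pmf \<psi>) \<le> ennreal c"
    by (rule ex_two_atom_pmf[OF d rho e[unfolded c(1)] c(2)]) (rule that)
  \<comment> \<open>The laws \<open>P a\<close> are kept and only the weights of the levels have
    changed, so m is read off anew.\<close>
  obtain m where m: "P \<in> competitors m \<psi>" "with_density \<rho> (m, \<psi>)"
    by (rule ex_marginals[OF P d']) (rule that)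
  have "phi q G v m \<psi> \<le> cost q G v \<psi> P" unfolding phi_def by (rule INF_lower[OF m(1)])
  also have "\<dots> = (\<integral>\<^sup>+a. ecost q a (P a) \<partial>measure_pmf \<psi>)"
    using P by (intro cost_eq) (simp add: shift_invariant_iff_cinv)
  finally have "phi q G v m \<psi> \<le> chi q G v \<rho>" using e' c(1) by simp
  with m(2) show ?thesis using f by (rule that)
qed

end

theorem lemma2p4:
  fixes q :: "nat \<Rightarrow> real"
    and G :: "nat \<Rightarrow> (int ^ 'd::finite) set"
    and v :: "int ^ 'd \<Rightarrow> real"
  assumes q_pos: "\<And>k. k \<ge> 1 \<Longrightarrow> q k > 0"
    and q_summable: "q summable_on {1..}"
    and q_subexp: "(\<lambda>k. ln (q k)) \<in> o(\<lambda>k. real k)"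
    and G_card: "\<And>k. k \<ge> 1 \<Longrightarrow> card (G k) = k"
    and G_box: "\<And>k. k \<ge> 1 \<Longrightarrow> \<exists>L. box_Z L \<subseteq> G k \<and> G k \<subseteq> box_Z (L + 1)"
    and v_nonneg: "\<And>x. v x \<ge> 0"
    and v_sym: "\<And>x. v (- x) = v x"
    and v_supp: "finite {x. v x \<noteq> 0}"
  shows "(\<forall>\<rho>\<ge>0.
            (\<exists>m \<psi>. is_arg_min (\<lambda>(m, \<psi>). phi q G v m \<psi>) (with_density \<rho>) (m, \<psi>)
                   \<and> chi q G v \<rho> = phi q G v m \<psi>)
          \<and> (\<exists>m \<psi>. is_arg_min (\<lambda>(m, \<psi>). phi q G v m \<psi>) (with_density \<rho>) (m, \<psi>)
                   \<and> finite (set_pmf \<psi>) \<and> card (set_pmf \<psi>) \<le> 2))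
       \<and> (\<forall>m \<psi>. m \<in> {1..} \<rightarrow> {0..} \<longrightarrow>
            (\<exists>P. is_arg_min (cost q G v \<psi>) (\<lambda>P. P \<in> competitors m \<psi>) P))"
proof -
  interpret interaction G v by unfold_locales (fact G_card G_box v_nonneg v_sym v_supp)+
  \<comment> \<open>A single pair with at most two atoms settles both claims about
    \<open>\<rho>\<close>: it attains \<open>chi\<close>, which by \<open>chi_le_phi\<close> bounds
    \<open>phi\<close> from below over all pairs of this density.\<close>
  have "\<exists>m \<psi>. is_arg_min (\<lambda>(m, \<psi>). phi q G v m \<psi>) (with_density \<rho>) (m, \<psi>)
      \<and> chi q G v \<rho> = phi q G v m \<psi> \<and> finite (set_pmf \<psi>) \<and> card (set_pmf \<psi>) \<le> 2" if rho: "\<rho> \<ge> 0" for \<rho>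
  proof -
    obtain m \<psi> where w: "with_density \<rho> (m, \<psi>)" and le: "phi q G v m \<psi> \<le> chi q G v \<rho>"
      and f: "finite (set_pmf \<psi>)" "card (set_pmf \<psi>) \<le> 2"
      by (rule ex_two_atom_minimiser[OF q_pos rho]) (assumption | rule that)+
    have ge: "chi q G v \<rho> \<le> phi q G v m' \<psi>'" if "with_density \<rho> (m', \<psi>')" for m' \<psi>'
      by (rule chi_le_phi[OF q_pos q_subexp that])
    have eq: "chi q G v \<rho> = phi q G v m \<psi>" using le ge[OF w] by (rule antisym[rotated])
    have "is_arg_min (\<lambda>(m, \<psi>). phi q G v m \<psi>) (with_density \<rho>) (m, \<psi>)"
      unfolding is_arg_min_def using w ge by (auto simp: not_less eq)
    then show ?thesis using eq f by blast
  qed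
  moreover have "\<exists>P. is_arg_min (cost q G v \<psi>) (\<lambda>P. P \<in> competitors m \<psi>) P" if m: "m \<in> {1..} \<rightarrow> {0..}" for m \<psi>
  proof -
    obtain P where "P \<in> competitors m \<psi>" "\<forall>P'\<in>competitors m \<psi>. cost q G v \<psi> P \<le> cost q G v \<psi> P'"
      using competitors_minimiser[of q m \<psi>, OF q_pos m] by blast
    then have "is_arg_min (cost q G v \<psi>) (\<lambda>P. P \<in> competitors m \<psi>) P"
      unfolding is_arg_min_def by (auto simp: not_less)
    then show ?thesis by blast
  qed
  ultimately show ?thesis by blast
qed

end
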